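(* Suppose that Assumptions 1 and 2 (stated in the context) hold for some $\kappa\ge4$ and that $2\rho>\lambda$. Then for all $f\in\mathcal B(V)$ there exists $\sigma_{f,s}>0$ such that for every $x\in\mathcal X$, under $\mathbb P_x$, $$e^{-\lambda t/2}\bigl(Z_t(f)-e^{\lambda t}\gamma(f)W\bigr)\longrightarrow\sigma_{f,s}\sqrt W\,\mathcal Z$$ in distribution as $t\to+\infty$, where $\mathcal Z$ is a standard Gaussian random variable independent of $W$. Moreover, for all $f\in\mathcal B(V)$ there exists $K>0$ such that for all $t>0$ and all $x\in\mathcal X$, under $\mathbb P_x$, $$\mathbf d\Bigl(e^{-\lambda t/2}\bigl(Z_t(f)-e^{\lambda t}\gamma(f)W\bigr),\ \sigma_{f,s}\sqrt W\,\mathcal Z\Bigr)\le K\exp\Bigl(\frac{\lambda(\lambda-2\rho)}{2(\lambda+2\rho)}\,t\Bigr)\,\mathbb E_x\bigl(Z_0(V^* )\bigr),$$ where $V^*(x)=\max\{\sqrt{V(x)},V^3(x)\}$.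
   Context: **Process.** $(Z_t)_{t\ge0}$ is a branching Markov process on a measurable space $\mathcal X$: $Z_t=\sum_{u\in\mathcal N_t}\delta_{X_t^u}$ is a point measure, where $\mathcal N_t$ is the (at most countable) random set of individuals alive at time $t$ and $X_t^u\in\mathcal X$ is the trait of $u$. Branching property: for all $t,s\ge0$, $Z_{t+s}=\sum_{u\in\mathcal N_t}Z^u_{t,t+s}$, where $Z^u_{t,t+s}$ is the point measure of the traits at time $t+s$ of the descendants of $u$ (itself included) and, conditionally on $\mathcal F_t=\sigma(Z_r,\,r\le t)$, the processes $(Z^u_{t,t+s})_{s\ge0}$, $u\in\mathcal N_t$, are independent, each distributed as the process started from a single particle at $X_t^u$. $\mathbb P_x,\mathbb E_x$ denote law and expectation when $Z_0=\delta_x$. Write $Z_t(f)=\sum_{u\in\mathcal N_t}f(X_t^u)$ and $\mu(f)=\int f\,d\mu$. **Weights.** A function $V:\mathcal X\to(0,+\infty)$ is fixed. For an integer $k\ge1$, $\mathcal B(V^k)$ is the set of (measurable) $f:\mathcal X\to\mathbb R$ with $\|f\|_{V^k}:=\sup_x|f(x)|/V^k(x)<\infty$. For $\kappa\ge1$, $\underline V^{(\kappa)}=\min_{1\le k\le\kappa}V^k$ and $\overline V^{(\kappa)}=\max_{1\le k\le\kappa}V^k$. **Assumption 1 (for $\kappa$).** There exist $t^*>0$, $a_1>0$ such that for all $x\in\mathcal X$ and $1\le k\le\kappa$, $\sup_{t\le t^*}\mathbb E_x(Z_t(V)^k)\le a_1V^k(x)$. The mean semigroup is $\mathfrak M_tf(x)=\mathbb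 E_x(Z_t(f))$. **Assumption 2 (for $\kappa$).** There exist a positive measure $\gamma$ with $\gamma(\overline V^{(\kappa)})<\infty$, a non-negative function $h$ with $\sup_x h(x)/\underline V^{(\kappa)}(x)<\infty$, and $\lambda>0$ with $\mathfrak M_th=e^{\lambda t}h$, $\gamma\mathfrak M_t=e^{\lambda t}\gamma$, $\gamma(h)=\|h\|_V=1$, and constants $a_2>0$, $\rho>0$ such that for all $x\in\mathcal X$, $1\le k\le\kappa$, $f\in\mathcal B(V^k)$ and $t>0$, $$|e^{-\lambda t}\mathfrak M_tf(x)-\gamma(f)h(x)|\le a_2e^{-\rho t}\|f\|_{V^k}V^k(x).$$ **Limit $W$.** $W_t:=e^{-\lambda t}Z_t(h)$ is a non-negative martingale and $W$ denotes its limit (almost surely and in $L^4(\mathbb P_x)$) as $t\to\infty$. **Distance.** For real random variables $X,Y$, $\mathbf d(X,Y)=\sup_{F}|\mathbb E(F(X))-\mathbb E(F(Y))|$, the supremum being over $F:\mathbb R\to\mathbb R$ with $\max\{\|F\|_\infty,\|F'\|_\infty,\|F''\|_\infty,\|F'''\|_\infty\}\le1$.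
   Formalization: Strict positivity of σ_{f,s} fails for f = 0; proved instead: σ_{f,s} ≥ 0, with σ_{f,s} > 0 unless for every t ≥ 0 and γ-almost every x the rescaled fluctuation is P_x-almost surely constant. Convergence and rate hold for all f. *)

theory Defs
  imports "HOL-Probability.Probability"
begin

section \<open>Point measures and path space\<close>

text \<open>The sigma-algebra on measures over \<open>E\<close> generated by all evaluations \<open>\<mu> \<mapsto> \<mu>(A)\<close>. This is
  the construction of \<^const>\<open>subprob_algebra\<close> without the bound on the total mass.\<close>

definition measure_algebra :: "'x measure \<Rightarrow> 'x measure measure" where
  "measure_algebra E =
     (SUP A \<in> sets E. vimage_algebra {\<mu>. sets \<mu> = sets E} (\<lambda>\<mu>. emeasure \<mu> A) borel)"

definition path_space :: "'x measure \<Rightarrow> (real \<Rightarrow> 'x measure) measure" where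
  "path_space E = (\<Pi>\<^sub>M s\<in>{0..}. measure_algebra E)"

text \<open>The image of the counting measure on \<open>N\<close> is the sum of the Dirac masses at \<open>X u\<close>, \<open>u \<in> N\<close>.\<close>

definition point_measure_of :: "'x measure \<Rightarrow> 'u set \<Rightarrow> ('u \<Rightarrow> 'x) \<Rightarrow> 'x measure" where
  "point_measure_of E N X = distr (count_space N) E X"

lemma emeasure_point_measure_of:
  assumes "\<And>u. u \<in> N \<Longrightarrow> X u \<in> space E" and "A \<in> sets E"
  shows "emeasure (point_measure_of E N X) A = (\<integral>\<^sup>+ u. emeasure (return E (X u)) A \<partial>count_space N)"
proof -
  have m: "X \<in> count_space N \<rightarrow>\<^sub>M E" using assms(1) by auto
  have "emeasure (point_measure_of E N X) A = (\<integral>\<^sup>+ y. indicator A y \<partial>distr (count_space N) E X)"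
    unfolding point_measure_of_def using assms(2) by simp
  also have "\<dots> = (\<integral>\<^sup>+ u. indicator A (X u) \<partial>count_space N)"
    using m assms(2) by (intro nn_integral_distr) auto
  finally show ?thesis using assms(2) by simp
qed

section \<open>Branching Markov processes\<close>

text \<open>Individuals carry labels in a countable type \<open>'u\<close> (for instance Ulam--Harris words).
  \<open>law x\<close> is the law of the process started from one individual of trait \<open>x\<close>; the coordinate
  functions \<open>alive\<close> and \<open>trait\<close> are common to all starting points.  For \<open>r \<le> s\<close> and \<open>v\<close> alive at
  time \<open>s\<close>, \<open>ancestor r s v \<omega>\<close> is the individual alive at time \<open>r\<close> from which \<open>v\<close> descends
  (\<open>v\<close> itself if it was already alive at time \<open>r\<close>).\<close>

record ('x, 'u, 'w) branching_model =
  trait_space :: "'x measure"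
  sample_space :: "'w measure"
  law :: "'x \<Rightarrow> 'w measure"
  alive :: "real \<Rightarrow> 'w \<Rightarrow> 'u set"
  trait :: "real \<Rightarrow> 'u \<Rightarrow> 'w \<Rightarrow> 'x"
  ancestor :: "real \<Rightarrow> real \<Rightarrow> 'u \<Rightarrow> 'w \<Rightarrow> 'u"

definition population :: "('x, 'u, 'w) branching_model \<Rightarrow> real \<Rightarrow> 'w \<Rightarrow> 'x measure" where
  "population B t \<omega> = point_measure_of (trait_space B) (alive B t \<omega>) (\<lambda>u. trait B t u \<omega>)"

definition progeny :: "('x, 'u, 'w) branching_model \<Rightarrow> real \<Rightarrow> 'u \<Rightarrow> real \<Rightarrow> 'w \<Rightarrow> 'u set" where
  "progeny B t u s \<omega> = {v \<in> alive B (t + s) \<omega>. ancestor B t (t + s) v \<omega> = u}"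

definition subpopulation :: "('x, 'u, 'w) branching_model \<Rightarrow> real \<Rightarrow> 'u \<Rightarrow> real \<Rightarrow> 'w \<Rightarrow> 'x measure" where
  "subpopulation B t u s \<omega> =
     point_measure_of (trait_space B) (progeny B t u s \<omega>) (\<lambda>v. trait B (t + s) v \<omega>)"

definition population_path :: "('x, 'u, 'w) branching_model \<Rightarrow> 'w \<Rightarrow> real \<Rightarrow> 'x measure" where
  "population_path B \<omega> = (\<lambda>s\<in>{0..}. population B s \<omega>)"

definition subpopulation_path ::
    "('x, 'u, 'w) branching_model \<Rightarrow> real \<Rightarrow> 'u \<Rightarrow> 'w \<Rightarrow> real \<Rightarrow> 'x measure" where
  "subpopulation_path B t u \<omega> = (\<lambda>s\<in>{0..}. subpopulation B t u s \<omega>)"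

definition history :: "('x, 'u, 'w) branching_model \<Rightarrow> real \<Rightarrow> 'w set set" where
  "history B t = sigma_sets (space (sample_space B))
     {population B r -` C \<inter> space (sample_space B) | r C.
        0 \<le> r \<and> r \<le> t \<and> C \<in> sets (measure_algebra (trait_space B))}"

definition genealogy :: "('x, 'u, 'w) branching_model \<Rightarrow> bool" where
  "genealogy B \<longleftrightarrow>
     (\<forall>\<omega>\<in>space (sample_space B). \<forall>r s. 0 \<le> r \<and> r \<le> s \<longrightarrow>
        (\<forall>v\<in>alive B s \<omega>.
           ancestor B r s v \<omega> \<in> alive B r \<omega> \<and>
           (v \<in> alive B r \<omega> \<longrightarrow> ancestor B r s v \<omega> = v) \<and>
           (\<forall>q. 0 \<le> q \<and> q \<le> r \<longrightarrow>
              ancestor B q r (ancestor B r s v \<omega>) \<omega> = ancestor B q s v \<omega>)))"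

text \<open>Conditionally on the history up to time \<open>t\<close>, the processes descending from the individuals
  \<open>u\<close> alive at time \<open>t\<close> are independent, each with the law of the process started from the trait
  of \<open>u\<close>.  The conditional expectations given \<open>history B t\<close> are written out by integrating over
  the events \<open>H\<close> of that sigma-algebra.  For distinct labels \<open>u \<in> U\<close> and path events \<open>A u\<close>,
  both sides are restricted to the event that all \<open>u \<in> U\<close> are alive at time \<open>t\<close>.  Because this
  event and the traits appear inside the integral, they need not be determined by the history,
  which only records the unlabelled point measures.\<close>

definition branching_property :: "('x, 'u, 'w) branching_model \<Rightarrow> bool" where
  "branching_property B \<longleftrightarrow>
     (\<forall>x\<in>space (trait_space B). \<forall>t\<ge>0. \<forall>U A H.
        finite U \<and> (\<forall>u\<in>U. A u \<in> sets (path_space (trait_space B))) \<and> H \<in> history B t \<longrightarrow>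
        emeasure (law B x)
          {\<omega> \<in> H. \<forall>u\<in>U. u \<in> alive B t \<omega> \<and> subpopulation_path B t u \<omega> \<in> A u} =
        (\<integral>\<^sup>+ \<omega>. indicator H \<omega> *
           (\<Prod>u\<in>U. indicator (alive B t \<omega>) u *
              emeasure (law B (trait B t u \<omega>))
                {\<omega>' \<in> space (sample_space B). population_path B \<omega>' \<in> A u}) \<partial>law B x))"

definition branching_process :: "('x, 'u::countable, 'w) branching_model \<Rightarrow> bool" where
  "branching_process B \<longleftrightarrow>
     law B \<in> trait_space B \<rightarrow>\<^sub>M prob_algebra (sample_space B) \<and>
     (\<forall>t\<ge>0. \<forall>u. {\<omega> \<in> space (sample_space B). u \<in> alive B t \<omega>} \<in> sets (sample_space B) \<and>
        trait B t u \<in>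
          restrict_space (sample_space B) {\<omega> \<in> space (sample_space B). u \<in> alive B t \<omega>}
            \<rightarrow>\<^sub>M trait_space B) \<and>
     (\<forall>t\<ge>0. \<forall>s\<ge>0. \<forall>u v.
        {\<omega> \<in> space (sample_space B). v \<in> progeny B t u s \<omega>} \<in> sets (sample_space B)) \<and>
     genealogy B \<and>
     (\<forall>x\<in>space (trait_space B). AE \<omega> in law B x. population B 0 \<omega> = return (trait_space B) x) \<and>
     branching_property B"

text \<open>\<open>Z\<^sub>t(f)\<close> and the mean semigroup.\<close>

definition Zint :: "('x, 'u, 'w) branching_model \<Rightarrow> real \<Rightarrow> ('x \<Rightarrow> real) \<Rightarrow> 'w \<Rightarrow> real" where
  "Zint B t f \<omega> = (\<integral>y. f y \<partial>population B t \<omega>)"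

definition mean_semigroup ::
    "('x, 'u, 'w) branching_model \<Rightarrow> real \<Rightarrow> ('x \<Rightarrow> real) \<Rightarrow> 'x \<Rightarrow> real" where
  "mean_semigroup B t f x = (\<integral>\<omega>. Zint B t f \<omega> \<partial>law B x)"

section \<open>Weights and assumptions\<close>

definition wnorm :: "'x measure \<Rightarrow> ('x \<Rightarrow> real) \<Rightarrow> ('x \<Rightarrow> real) \<Rightarrow> real" where
  "wnorm E w f = (SUP x\<in>space E. \<bar>f x\<bar> / w x)"

definition wbounded :: "'x measure \<Rightarrow> ('x \<Rightarrow> real) \<Rightarrow> ('x \<Rightarrow> real) set" where
  "wbounded E w = {f \<in> borel_measurable E. bdd_above ((\<lambda>x. \<bar>f x\<bar> / w x) ` space E)}"

definition Vmin :: "('x \<Rightarrow> real) \<Rightarrow> nat \<Rightarrow> 'x \<Rightarrow> real" where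
  "Vmin V \<kappa> x = Min ((\<lambda>k. V x ^ k) ` {1..\<kappa>})"

definition Vmax :: "('x \<Rightarrow> real) \<Rightarrow> nat \<Rightarrow> 'x \<Rightarrow> real" where
  "Vmax V \<kappa> x = Max ((\<lambda>k. V x ^ k) ` {1..\<kappa>})"

definition Vstar :: "('x \<Rightarrow> real) \<Rightarrow> 'x \<Rightarrow> real" where
  "Vstar V x = max (sqrt (V x)) (V x ^ 3)"

definition assumption_moments ::
    "('x, 'u, 'w) branching_model \<Rightarrow> ('x \<Rightarrow> real) \<Rightarrow> nat \<Rightarrow> bool" where
  "assumption_moments B V \<kappa> \<longleftrightarrow>
     (\<exists>tstar>0. \<exists>a>0. \<forall>x\<in>space (trait_space B). \<forall>k\<in>{1..\<kappa>}.
        (SUP t\<in>{0..tstar}. \<integral>\<^sup>+ \<omega>. (\<integral>\<^sup>+ y. ennreal (V y) \<partial>population B t \<omega>) ^ k \<partial>law B x)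
          \<le> ennreal (a * V x ^ k))"

definition assumption_ergodic ::
    "('x, 'u, 'w) branching_model \<Rightarrow> ('x \<Rightarrow> real) \<Rightarrow> nat \<Rightarrow> 'x measure \<Rightarrow> ('x \<Rightarrow> real) \<Rightarrow>
     real \<Rightarrow> real \<Rightarrow> bool" where
  "assumption_ergodic B V \<kappa> \<gamma> h lam \<rho> \<longleftrightarrow>
     sets \<gamma> = sets (trait_space B) \<and>
     (\<integral>\<^sup>+ x. ennreal (Vmax V \<kappa> x) \<partial>\<gamma>) < \<infinity> \<and>
     h \<in> wbounded (trait_space B) (Vmin V \<kappa>) \<and>
     (\<forall>x\<in>space (trait_space B). 0 \<le> h x) \<and>
     0 < lam \<and> 0 < \<rho> \<and>
     (\<forall>t\<ge>0. \<forall>x\<in>space (trait_space B). mean_semigroup B t h x = exp (lam * t) * h x) \<and>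
     (\<forall>t\<ge>0. \<forall>A\<in>sets (trait_space B).
        (\<integral>\<^sup>+ x. (\<integral>\<^sup>+ \<omega>. emeasure (population B t \<omega>) A \<partial>law B x) \<partial>\<gamma>)
          = ennreal (exp (lam * t)) * emeasure \<gamma> A) \<and>
     (\<integral>x. h x \<partial>\<gamma>) = 1 \<and> wnorm (trait_space B) V h = 1 \<and>
     (\<exists>a>0. \<forall>x\<in>space (trait_space B). \<forall>k\<in>{1..\<kappa>}.
        \<forall>f\<in>wbounded (trait_space B) (\<lambda>y. V y ^ k). \<forall>t>0.
          \<bar>exp (- lam * t) * mean_semigroup B t f x - (\<integral>y. f y \<partial>\<gamma>) * h x\<bar>
            \<le> a * exp (- \<rho> * t) * wnorm (trait_space B) (\<lambda>y. V y ^ k) f * V x ^ k)"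

section \<open>Martingale limit and fluctuations\<close>

text \<open>\<open>W\<close> is the limit of \<open>W\<^sub>t = exp (- lam * t) * Z\<^sub>t(h)\<close> in the fourth mean under every law.  This determines \<open>W\<close>
  up to null sets, so it agrees with the almost sure limit; the latter is not part of the
  definition because no regularity of \<open>t \<mapsto> Z\<^sub>t\<close> is assumed.\<close>

definition martingale_limit ::
    "('x, 'u, 'w) branching_model \<Rightarrow> ('x \<Rightarrow> real) \<Rightarrow> real \<Rightarrow> ('w \<Rightarrow> real) \<Rightarrow> bool" where
  "martingale_limit B h lam W \<longleftrightarrow>
     W \<in> borel_measurable (sample_space B) \<and>
     (\<forall>x\<in>space (trait_space B).
        ((\<lambda>t. \<integral>\<^sup>+ \<omega>. ennreal (\<bar>exp (- lam * t) * Zint B t h \<omega> - W \<omega>\<bar> ^ 4) \<partial>law B x)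
           \<longlongrightarrow> 0) at_top)"

definition fluctuation ::
    "('x, 'u, 'w) branching_model \<Rightarrow> 'x measure \<Rightarrow> real \<Rightarrow> ('w \<Rightarrow> real) \<Rightarrow> ('x \<Rightarrow> real) \<Rightarrow>
     real \<Rightarrow> 'w \<Rightarrow> real" where
  "fluctuation B \<gamma> lam W f t \<omega> =
     exp (- lam * t / 2) * (Zint B t f \<omega> - exp (lam * t) * (\<integral>y. f y \<partial>\<gamma>) * W \<omega>)"

definition fluctuation_law ::
    "('x, 'u, 'w) branching_model \<Rightarrow> 'x measure \<Rightarrow> real \<Rightarrow> ('w \<Rightarrow> real) \<Rightarrow> ('x \<Rightarrow> real) \<Rightarrow>
     'x \<Rightarrow> real \<Rightarrow> real measure" where
  "fluctuation_law B \<gamma> lam W f x t = distr (law B x) borel (fluctuation B \<gamma> lam W f t)"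

text \<open>The law of \<open>\<sigma> \<surd>W G\<close> with \<open>G\<close> standard Gaussian independent of \<open>W\<close>, realised on the product
  of the sample space with a Gaussian line.\<close>

definition mixed_gaussian_law ::
    "('x, 'u, 'w) branching_model \<Rightarrow> ('w \<Rightarrow> real) \<Rightarrow> real \<Rightarrow> 'x \<Rightarrow> real measure" where
  "mixed_gaussian_law B W \<sigma> x =
     distr (law B x \<Otimes>\<^sub>M std_normal_distribution) borel (\<lambda>(\<omega>, g). \<sigma> * sqrt (W \<omega>) * g)"

text \<open>The case where the fluctuations of \<open>f\<close> have no randomness, as for \<open>f = 0\<close>: started from
  \<open>\<gamma>\<close>-almost every trait, the fluctuation at each time is almost surely constant.\<close>

definition degenerate_fluctuation ::
    "('x, 'u, 'w) branching_model \<Rightarrow> 'x measure \<Rightarrow> real \<Rightarrow> ('w \<Rightarrow> real) \<Rightarrow> ('x \<Rightarrow> real) \<Rightarrow> bool" where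
  "degenerate_fluctuation B \<gamma> lam W f \<longleftrightarrow>
     (\<forall>t\<ge>0. AE x in \<gamma>. \<exists>c. AE \<omega> in law B x. fluctuation B \<gamma> lam W f t \<omega> = c)"

text \<open>\<^const>\<open>weak_conv_m\<close> is stated for sequences; a continuous time parameter is treated along
  all sequences of times tending to infinity.\<close>

definition weak_conv_at_top :: "(real \<Rightarrow> real measure) \<Rightarrow> real measure \<Rightarrow> bool" where
  "weak_conv_at_top \<nu> \<mu> \<longleftrightarrow>
     (\<forall>\<tau>. filterlim \<tau> at_top sequentially \<longrightarrow> weak_conv_m (\<lambda>n. \<nu> (\<tau> n)) \<mu>)"

definition smooth_tests :: "(real \<Rightarrow> real) set" where
  "smooth_tests = {F. \<exists>F1 F2 F3. \<forall>y.
     (F has_real_derivative F1 y) (at y) \<and> (F1 has_real_derivative F2 y) (at y) \<and>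
     (F2 has_real_derivative F3 y) (at y) \<and>
     \<bar>F y\<bar> \<le> 1 \<and> \<bar>F1 y\<bar> \<le> 1 \<and> \<bar>F2 y\<bar> \<le> 1 \<and> \<bar>F3 y\<bar> \<le> 1}"

definition smooth_dist :: "real measure \<Rightarrow> real measure \<Rightarrow> real" where
  "smooth_dist \<mu> \<nu> = (SUP F\<in>smooth_tests. \<bar>(\<integral>y. F y \<partial>\<mu>) - (\<integral>y. F y \<partial>\<nu>)\<bar>)"

end

theory Submission
  imports Defs
begin

text \<open>Replace \<open>W\<close> in the fluctuation at time \<open>s\<close> by \<open>W\<^sub>T\<close> with \<open>T \<ge> s\<close>, which makes it a functional of the path
  of \<open>Z\<close>, and let \<open>T\<close> tend to infinity only at the end. Given the population at time \<open>t\<close>, the functional at time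
  \<open>t + s\<close> is a sum of independent terms, one for each individual alive at time \<open>t\<close>; Lindeberg's replacement of
  these terms by Gaussians costs a third moment, that is \<open>exp (- lam * t / 2)\<close> after scaling. The conditional
  means are negligible because \<open>lam < 2 * \<rho>\<close>, and the sum of the conditional variances obeys a law of large
  numbers, with limit \<open>v * W\<close>. The uniform moment bounds come from the branching recursion over a fixed time step,
  which is a contraction up to a constant.

  The variance \<open>v\<close> is the limit of the \<open>\<gamma>\<close>-average \<open>q s\<close> of the variance of the fluctuation at time \<open>s\<close>. The
  same recursion shows that \<open>q\<close> is increasing, hence \<open>v = 0\<close> forces all these variances to vanish.\<close>

text \<open>The branching property concerns finite sets of labels that are all alive, while
  \<open>Z\<close> sums over whatever is alive, possibly infinitely many individuals. Giving a dead
  label the value 0 turns it into a statement about mixtures of product laws; the whole population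
  is reached along an exhaustion of the countable label type. Moments are known beforehand only for
  short times, so this passage is first made by Fatou's lemma for possibly infinite quantities,
  later by domination.

  Fourth moments contract because those of the single branches enter linearly: a step of length
  \<open>T\<close> multiplies the size of the population by about \<open>exp (lam * T)\<close>,
  whereas the fourth power of the scale is \<open>exp (- 2 * lam * T)\<close>. The other terms
  contain squared second moments and fourth powers of means, so second moments come first. For
  centred functions the second moment, relative to \<open>exp (lam * t)\<close>, contracts by
  \<open>exp (- (2 * \<rho> - lam) * T)\<close>. With weight \<open>V^2\<close>, applied to the
  variance functions, this bound is the law of large numbers; it consumes four moments of
  \<open>Z_t(V)\<close>.\<close>

lemma power_abs_le_one_plus_power:
  fixes a :: real
  assumes "j \<le> k"
  shows "\<bar>a\<bar> ^ j \<le> 1 + \<bar>a\<bar> ^ k"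
proof (cases "\<bar>a\<bar> \<le> 1")
  case True
  then have "\<bar>a\<bar> ^ j \<le> 1" by (simp add: power_le_one)
  then show ?thesis by (simp add: add_increasing2)
next
  case False
  then have "\<bar>a\<bar> ^ j \<le> \<bar>a\<bar> ^ k" using assms by (intro power_increasing) auto
  then show ?thesis by simp
qed

lemma (in finite_measure) integrable_power_le:
  fixes f :: "'a \<Rightarrow> real"
  assumes int: "integrable M (\<lambda>x. f x ^ k)" and [measurable]: "f \<in> borel_measurable M" and "j \<le> k"
  shows "integrable M (\<lambda>x. f x ^ j)"
proof (rule Bochner_Integration.integrable_bound)
  show "integrable M (\<lambda>x. 1 + \<bar>f x ^ k\<bar>)" using int by auto
  show "AE x in M. norm (f x ^ j) \<le> norm (1 + \<bar>f x ^ k\<bar>)"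
    using power_abs_le_one_plus_power[OF \<open>j \<le> k\<close>] by (auto simp: power_abs)
qed measurable

lemma power4_sum_le: "(a + b) ^ 4 \<le> 8 * (a ^ 4 + b ^ 4)" for a b :: real
proof -
  have sq: "(x + y)\<^sup>2 \<le> 2 * (x\<^sup>2 + y\<^sup>2)" for x y :: real
    using sum_squares_bound[of x y] by (simp add: power2_sum)
  have "(a + b) ^ 4 = ((a + b)\<^sup>2)\<^sup>2" by (simp flip: power_mult)
  also have "\<dots> \<le> (2 * (a\<^sup>2 + b\<^sup>2))\<^sup>2" by (intro power_mono sq) auto
  also have "\<dots> = 4 * (a\<^sup>2 + b\<^sup>2)\<^sup>2" by (simp only: power_mult_distrib) simp
  also have "\<dots> \<le> 4 * (2 * ((a\<^sup>2)\<^sup>2 + (b\<^sup>2)\<^sup>2))" by (intro mult_left_mono sq) auto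
  finally show ?thesis by (simp flip: power_mult)
qed

lemma power2_sum_le: "(a + b)\<^sup>2 \<le> 2 * (a\<^sup>2 + b\<^sup>2)" for a b :: real
  using sum_squares_bound[of a b] by (simp add: power2_sum)

section \<open>Sums of independent random variables\<close>

lemma integrable_pair_mult:
  fixes f g :: "_ \<Rightarrow> real"
  assumes "prob_space M" "prob_space N" and f: "integrable M f" and g: "integrable N g"
  shows "integrable (M \<Otimes>\<^sub>M N) (\<lambda>z. f (fst z) * g (snd z))"
    and "(LINT z|(M \<Otimes>\<^sub>M N). f (fst z) * g (snd z)) = (LINT x|M. f x) * (LINT y|N. g y)"
proof -
  interpret M: prob_space M by fact
  interpret N: prob_space N by fact
  interpret pair_sigma_finite M N ..
  have [measurable]: "f \<in> borel_measurable M" "g \<in> borel_measurable N" using f g by auto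
  show int: "integrable (M \<Otimes>\<^sub>M N) (\<lambda>z. f (fst z) * g (snd z))"
  proof (rule Fubini_integrable)
    show "integrable M (\<lambda>x. LINT y|N. norm (f (fst (x, y)) * g (snd (x, y))))"
      using f g by (simp add: abs_mult)
  qed (use g in auto)
  show "(LINT z|(M \<Otimes>\<^sub>M N). f (fst z) * g (snd z)) = (LINT x|M. f x) * (LINT y|N. g y)"
    using integral_fst'[OF int] by simp
qed

section \<open>Convolutions and laws of finite independent sums\<close>

lemma real_distribution_convolution:
  assumes "real_distribution M" "real_distribution N"
  shows "real_distribution (M \<star> N)"
proof -
  interpret M: real_distribution M by fact
  interpret N: real_distribution N by fact
  interpret pair_prob_space M N ..
  have "(\<lambda>(x, y). x + y) \<in> M \<Otimes>\<^sub>M N \<rightarrow>\<^sub>M (borel :: real measure)" by measurable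
  from prob_space_distr[OF this] have "prob_space (M \<star> N)"
    by (simp add: convolution_def)
  then show ?thesis
    by (simp add: real_distribution_def real_distribution_axioms_def)
qed

lemma integral_convolution_bounded:
  fixes f :: "real \<Rightarrow> real"
  assumes "real_distribution M" "real_distribution N" and [measurable]: "f \<in> borel_measurable borel"
    and bnd: "\<And>x. \<bar>f x\<bar> \<le> c"
  shows "(LINT z|(M \<star> N). f z) = (LINT x|M. LINT y|N. f (x + y))"
proof -
  interpret M: real_distribution M by fact
  interpret N: real_distribution N by fact
  interpret pair_prob_space M N ..
  have "(LINT z|(M \<star> N). f z) = (LINT z|(M \<Otimes>\<^sub>M N). f (case z of (x, y) \<Rightarrow> x + y))"
    unfolding convolution_def by (rule integral_distr) measurable
  also have "\<dots> = (LINT x|M. LINT y|N. f (x + y))"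
    by (subst integral_fst'[symmetric]) (auto intro!: integrable_const_bound[where B = c] bnd)
  finally show ?thesis .
qed

text \<open>Defined through the product space rather than by iterated convolution, because the
  branching property delivers products of the laws of the branches.\<close>

definition sum_law :: "'i set \<Rightarrow> ('i \<Rightarrow> real measure) \<Rightarrow> real measure" where
  "sum_law I K = distr (\<Pi>\<^sub>M i\<in>I. K i) borel (\<lambda>z. \<Sum>i\<in>I. z i)"

lemma measurable_sum_PiM [measurable]:
  assumes "\<And>i. i \<in> I \<Longrightarrow> sets (K i) = sets borel"
  shows "(\<lambda>z. \<Sum>i\<in>I. z i :: real) \<in> borel_measurable (\<Pi>\<^sub>M i\<in>I. K i)"
proof (rule borel_measurable_sum)
  fix i assume "i \<in> I"
  from measurable_component_singleton[OF this, of K]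
  show "(\<lambda>z. z i) \<in> borel_measurable (\<Pi>\<^sub>M i\<in>I. K i)"
    by (simp cong: measurable_cong_sets add: assms \<open>i \<in> I\<close>)
qed

lemma real_distribution_sum_law:
  assumes "\<And>i. i \<in> I \<Longrightarrow> real_distribution (K i)"
  shows "real_distribution (sum_law I K)"
proof -
  have "prob_space (sum_law I K)"
    unfolding sum_law_def
    using assms
    by (intro prob_space.prob_space_distr prob_space_PiM measurable_sum_PiM)
       (auto simp: real_distribution_def real_distribution_axioms_def)
  then show ?thesis
    by (simp add: real_distribution_def real_distribution_axioms_def sum_law_def)
qed

lemma sum_law_empty: "sum_law {} K = return borel 0"
proof -
  have "(\<Pi>\<^sub>M i\<in>{}. K i) = return (count_space {\<lambda>_. undefined}) (\<lambda>_. undefined)"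
    unfolding PiM_empty
  proof (rule measure_eqI)
    fix A assume "A \<in> sets (count_space {\<lambda>_. undefined :: real})"
    then have "A = {} \<or> A = {\<lambda>_. undefined}" by auto
    then show "emeasure (count_space {\<lambda>_. undefined :: real}) A
        = emeasure (return (count_space {\<lambda>_. undefined}) (\<lambda>_. undefined)) A"
      by (elim disjE) simp_all
  qed simp
  then show ?thesis by (simp add: sum_law_def distr_return)
qed

text \<open>Separates one coordinate of the product, so that every later statement on
  \<open>sum_law\<close> is an induction over a finite set whose step is a single
  convolution.\<close>

lemma sum_law_insert:
  assumes "finite I" "i \<notin> I" and K: "\<And>j. j \<in> insert i I \<Longrightarrow> real_distribution (K j)"
  shows "sum_law (insert i I) K = (K i \<star> sum_law I K)"
proof -
  have P: "prob_space (K j)" and S [measurable_cong]: "sets (K j) = sets borel" if "j \<in> insert i I" for j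
    using K[OF that] by (auto simp: real_distribution_def real_distribution_axioms_def)
  have PI: "prob_space (\<Pi>\<^sub>M j\<in>I. K j)" by (intro prob_space_PiM P) auto
  interpret Ki: prob_space "K i" by (rule P) simp
  interpret Pi: prob_space "\<Pi>\<^sub>M j\<in>I. K j" by fact
  interpret pair_prob_space "K i" "\<Pi>\<^sub>M j\<in>I. K j" ..
  have [measurable]: "(\<lambda>z. \<Sum>i\<in>I. z i :: real) \<in> borel_measurable (\<Pi>\<^sub>M i\<in>I. K i)"
    by (intro measurable_sum_PiM S) simp
  have m1: "(\<lambda>(x, X). X(i := x)) \<in> K i \<Otimes>\<^sub>M (\<Pi>\<^sub>M j\<in>I. K j) \<rightarrow>\<^sub>M (\<Pi>\<^sub>M j\<in>insert i I. K j)"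
    by (auto intro!: measurable_fun_upd[where J = I] simp: split_beta')
  have Si [measurable_cong]: "sets (K i) = sets borel" by (rule S) simp
  have "sum_law (insert i I) K =
      distr (distr (K i \<Otimes>\<^sub>M (\<Pi>\<^sub>M j\<in>I. K j)) (\<Pi>\<^sub>M j\<in>insert i I. K j) (\<lambda>(x, X). X(i := x)))
        borel (\<lambda>z. \<Sum>i\<in>insert i I. z i)"
    unfolding sum_law_def by (subst distr_pair_PiM_eq_PiM) (auto intro: P)
  also have "\<dots> = distr (K i \<Otimes>\<^sub>M (\<Pi>\<^sub>M j\<in>I. K j)) borel (\<lambda>(x, X). x + (\<Sum>i\<in>I. X i))"
    by (subst distr_distr[OF _ m1])
       (auto intro!: measurable_sum_PiM S distr_cong sum.cong simp: assms comp_def split_beta')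
  \<comment> \<open>\<open>K i\<close> is written as its own image under the identity, so that both
    factors are images and the product of the images is the image of the product.\<close>
  also have "\<dots> = distr (distr (K i) borel (\<lambda>x. x) \<Otimes>\<^sub>M distr (\<Pi>\<^sub>M j\<in>I. K j) borel (\<lambda>X. \<Sum>i\<in>I. X i)) borel
      (\<lambda>(x, y). x + y)"
  proof -
    have "sigma_finite_measure (distr (\<Pi>\<^sub>M j\<in>I. K j) borel (\<lambda>X. \<Sum>i\<in>I. X i))"
      by (intro prob_space_imp_sigma_finite Pi.prob_space_distr) measurable
    then show ?thesis
      by (subst pair_measure_distr) (auto simp: distr_distr comp_def split_beta' intro!: distr_cong)
  qed
  also have "distr (K i) borel (\<lambda>x. x) = K i"
    by (rule distr_id2) (simp add: S)
  finally show ?thesis by (simp add: convolution_def sum_law_def)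
qed

section \<open>Central moments up to order four under convolution\<close>

definition mean_of :: "real measure \<Rightarrow> real" where
  "mean_of \<mu> = (LINT z|\<mu>. z)"

definition var_of :: "real measure \<Rightarrow> real" where
  "var_of \<mu> = (LINT z|\<mu>. (z - mean_of \<mu>)\<^sup>2)"

definition fourth_of :: "real measure \<Rightarrow> real" where
  "fourth_of \<mu> = (LINT z|\<mu>. (z - mean_of \<mu>) ^ 4)"

lemma var_of_nonneg: "0 \<le> var_of \<mu>"
  by (simp add: var_of_def)

context real_distribution
begin

lemma integrable_id_of_square:
  assumes "integrable M (\<lambda>z. z\<^sup>2)"
  shows "integrable M (\<lambda>z. z)"
  using integrable_power_le[of "\<lambda>z. z" 2 1] assms by simp

lemma integrable_centred_square:
  assumes "integrable M (\<lambda>z. z\<^sup>2)"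
  shows "integrable M (\<lambda>z. (z - c)\<^sup>2)"
  using assms integrable_id_of_square[OF assms] by (simp add: power2_diff)

lemma integrable_centred_fourth:
  assumes "integrable M (\<lambda>z. z ^ 4)"
  shows "integrable M (\<lambda>z. (z - c) ^ 4)"
proof (rule Bochner_Integration.integrable_bound)
  show "integrable M (\<lambda>z. 8 * (z ^ 4 + (- c) ^ 4))" using assms by simp
  have "(z - c) ^ 4 \<le> 8 * (z ^ 4 + (- c) ^ 4)" for z :: real
    using power4_sum_le[of z "- c"] by simp
  then show "AE x in M. norm ((x - c) ^ 4) \<le> norm (8 * (x ^ 4 + (- c) ^ 4))"
    by (auto simp: abs_of_nonneg)
qed simp

lemma var_of_eq:
  assumes "integrable M (\<lambda>z. z\<^sup>2)"
  shows "var_of M = (LINT z|M. z\<^sup>2) - (mean_of M)\<^sup>2"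
proof -
  note i1 = integrable_id_of_square[OF assms]
  have "var_of M = (LINT z|M. z\<^sup>2 - 2 * mean_of M * z + (mean_of M)\<^sup>2)"
    unfolding var_of_def by (rule Bochner_Integration.integral_cong) (auto simp: power2_diff)
  also have "\<dots> = (LINT z|M. z\<^sup>2) - 2 * mean_of M * (LINT z|M. z) + (mean_of M)\<^sup>2"
    using assms i1 prob_space by simp
  also have "\<dots> = (LINT z|M. z\<^sup>2) - (mean_of M)\<^sup>2"
    by (simp add: mean_of_def power2_eq_square)
  finally show ?thesis .
qed

end

text \<open>The form \<open>has_bochner_integral\<close> carries integrability and value at once, so
  that the binomial expansions below can be added up term by term.\<close>

lemma has_bochner_integral_convolution_power:
  assumes "real_distribution M" "real_distribution N"
    and "integrable M (\<lambda>x. (x - a) ^ j)" "integrable N (\<lambda>y. (y - b) ^ k)"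
  shows "has_bochner_integral (M \<Otimes>\<^sub>M N) (\<lambda>z. (fst z - a) ^ j * (snd z - b) ^ k)
    ((LINT x|M. (x - a) ^ j) * (LINT y|N. (y - b) ^ k))"
  using integrable_pair_mult[OF _ _ assms(3,4)] assms(1,2)
  by (simp add: has_bochner_integral_iff real_distribution_def)

lemma has_bochner_integral_convolution:
  fixes f :: "real \<Rightarrow> real"
  assumes "real_distribution M" "real_distribution N" and [measurable]: "f \<in> borel_measurable borel"
    and f: "has_bochner_integral (M \<Otimes>\<^sub>M N) (\<lambda>z. f (fst z + snd z)) c"
  shows "has_bochner_integral (M \<star> N) f c"
proof -
  interpret M: real_distribution M by fact
  interpret N: real_distribution N by fact
  have p1: "(\<lambda>z. fst z + snd z) \<in> M \<Otimes>\<^sub>M N \<rightarrow>\<^sub>M (borel :: real measure)" by measurable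
  have "has_bochner_integral (distr (M \<Otimes>\<^sub>M N) borel (\<lambda>z. fst z + snd z)) f c"
    using f p1 by (simp add: has_bochner_integral_iff integrable_distr_eq integral_distr)
  then show ?thesis by (simp add: convolution_def split_beta')
qed

lemma (in real_distribution) integral_centred:
  assumes "integrable M (\<lambda>z. z)"
  shows "(LINT z|M. (z - mean_of M) ^ 1) = 0"
  using assms by (simp add: mean_of_def prob_space[simplified])

lemma convolution_moments2:
  assumes "real_distribution M" "real_distribution N"
    and M2: "integrable M (\<lambda>z. z\<^sup>2)" and N2: "integrable N (\<lambda>z. z\<^sup>2)"
  shows "integrable (M \<star> N) (\<lambda>z. z\<^sup>2)"
    and "mean_of (M \<star> N) = mean_of M + mean_of N"
    and "var_of (M \<star> N) = var_of M + var_of N"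
proof -
  interpret M: real_distribution M by fact
  interpret N: real_distribution N by fact
  interpret C: real_distribution "M \<star> N" by (rule real_distribution_convolution) unfold_locales
  note M1 = M.integrable_id_of_square[OF M2] and N1 = N.integrable_id_of_square[OF N2]
  define a b where "a = mean_of M" and "b = mean_of N"
  have ia: "integrable M (\<lambda>x. (x - a) ^ k)" and ib: "integrable N (\<lambda>x. (x - b) ^ k)" if "k \<le> 2" for k
    using M.integrable_power_le[OF M.integrable_centred_square[OF M2, of a], of k]
      N.integrable_power_le[OF N.integrable_centred_square[OF N2, of b], of k] that by auto
  have h: "has_bochner_integral (M \<Otimes>\<^sub>M N) (\<lambda>z. (fst z - a) ^ j * (snd z - b) ^ k)
      ((LINT x|M. (x - a) ^ j) * (LINT y|N. (y - b) ^ k))" if "j \<le> 2" "k \<le> 2" for j k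
    using that by (intro has_bochner_integral_convolution_power assms ia ib)
  have a0: "(LINT x|M. (x - a) ^ 1) = 0" and b0: "(LINT y|N. (y - b) ^ 1) = 0"
    unfolding a_def b_def by (intro M.integral_centred M1 N.integral_centred N1)+
  \<comment> \<open>The exponents 0 and 1 are written out so that each product is an instance of
    \<open>h\<close>; the centred first moments then make the sum vanish.\<close>
  have "has_bochner_integral (M \<Otimes>\<^sub>M N) (\<lambda>z. (fst z - a) ^ 1 * (snd z - b) ^ 0 + (fst z - a) ^ 0 * (snd z - b) ^ 1)
      ((LINT x|M. (x - a) ^ 1) * (LINT y|N. (y - b) ^ 0) + (LINT x|M. (x - a) ^ 0) * (LINT y|N. (y - b) ^ 1))"
    by (intro has_bochner_integral_add h) auto
  then have "has_bochner_integral (M \<Otimes>\<^sub>M N) (\<lambda>z. (fst z + snd z) - (a + b)) 0"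
    unfolding a0 b0 by (simp add: algebra_simps)
  from has_bochner_integral_convolution[OF assms(1,2) _ this]
  have c1: "has_bochner_integral (M \<star> N) (\<lambda>z. z - (a + b)) 0" by simp
  have "integrable (M \<star> N) (\<lambda>z. (z - (a + b)) + (a + b))"
    using c1 by (intro Bochner_Integration.integrable_add) (auto simp: has_bochner_integral_iff)
  then have id: "integrable (M \<star> N) (\<lambda>z. z)" by simp
  show mn: "mean_of (M \<star> N) = mean_of M + mean_of N"
    using c1 id C.prob_space by (simp add: mean_of_def a_def b_def has_bochner_integral_iff)
  have expand: "(x + y - (a + b))\<^sup>2
      = (x - a)\<^sup>2 * (y - b) ^ 0 + 2 * ((x - a) ^ 1 * (y - b) ^ 1) + (x - a) ^ 0 * (y - b)\<^sup>2" for x y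
    by (simp add: power2_eq_square algebra_simps)
  have "has_bochner_integral (M \<Otimes>\<^sub>M N) (\<lambda>z. (fst z + snd z - (a + b))\<^sup>2)
      ((LINT x|M. (x - a)\<^sup>2) * (LINT y|N. (y - b) ^ 0) + 2 * ((LINT x|M. (x - a) ^ 1) * (LINT y|N. (y - b) ^ 1))
        + (LINT x|M. (x - a) ^ 0) * (LINT y|N. (y - b)\<^sup>2))"
    unfolding expand by (intro has_bochner_integral_add has_bochner_integral_mult_right h) auto
  then have "has_bochner_integral (M \<Otimes>\<^sub>M N) (\<lambda>z. (fst z + snd z - (a + b))\<^sup>2) (var_of M + var_of N)"
    unfolding a0 b0 by (simp add: var_of_def a_def b_def M.prob_space[simplified] N.prob_space[simplified])
  from has_bochner_integral_convolution[OF assms(1,2) _ this]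
  have c2: "has_bochner_integral (M \<star> N) (\<lambda>z. (z - (a + b))\<^sup>2) (var_of M + var_of N)" by simp
  then show "var_of (M \<star> N) = var_of M + var_of N"
    by (simp add: var_of_def mn a_def b_def has_bochner_integral_iff)
  have "integrable (M \<star> N) (\<lambda>z. (z - (a + b))\<^sup>2 + (2 * (a + b) * z - (a + b)\<^sup>2))"
    using c2 id by (intro Bochner_Integration.integrable_add Bochner_Integration.integrable_diff integrable_mult_right)
      (auto simp: has_bochner_integral_iff)
  moreover have "(\<lambda>z. (z - (a + b))\<^sup>2 + (2 * (a + b) * z - (a + b)\<^sup>2)) = (\<lambda>z. z\<^sup>2)"
    by (auto simp: power2_eq_square algebra_simps)
  ultimately show "integrable (M \<star> N) (\<lambda>z. z\<^sup>2)" by simp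
qed

text \<open>In the binomial expansion of the centred sum, the terms with exponents 3 and 1 contain a
  centred first moment and vanish. What couples the two laws is the product of the variances
  alone.\<close>

lemma convolution_fourth:
  assumes "real_distribution M" "real_distribution N"
    and M4: "integrable M (\<lambda>z. z ^ 4)" and N4: "integrable N (\<lambda>z. z ^ 4)"
  shows "integrable (M \<star> N) (\<lambda>z. z ^ 4)"
    and "fourth_of (M \<star> N) = fourth_of M + 6 * (var_of M * var_of N) + fourth_of N"
proof -
  interpret M: real_distribution M by fact
  interpret N: real_distribution N by fact
  have M2: "integrable M (\<lambda>z. z\<^sup>2)" and N2: "integrable N (\<lambda>z. z\<^sup>2)"
    using M.integrable_power_le[OF M4, of 2] N.integrable_power_le[OF N4, of 2] by auto
  note M1 = M.integrable_id_of_square[OF M2] and N1 = N.integrable_id_of_square[OF N2]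
  define a b where "a = mean_of M" and "b = mean_of N"
  note mn = convolution_moments2(2)[OF assms(1,2) M2 N2]
  have ia: "integrable M (\<lambda>x. (x - a) ^ k)" and ib: "integrable N (\<lambda>x. (x - b) ^ k)" if "k \<le> 4" for k
    using M.integrable_power_le[OF M.integrable_centred_fourth[OF M4, of a], of k]
      N.integrable_power_le[OF N.integrable_centred_fourth[OF N4, of b], of k] that by auto
  have h: "has_bochner_integral (M \<Otimes>\<^sub>M N) (\<lambda>z. (fst z - a) ^ j * (snd z - b) ^ k)
      ((LINT x|M. (x - a) ^ j) * (LINT y|N. (y - b) ^ k))" if "j \<le> 4" "k \<le> 4" for j k
    using that by (intro has_bochner_integral_convolution_power assms ia ib)
  have a0: "(LINT x|M. (x - a) ^ 1) = 0" and b0: "(LINT y|N. (y - b) ^ 1) = 0"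
    unfolding a_def b_def by (intro M.integral_centred M1 N.integral_centred N1)+
  have binom: "(u + v) ^ 4 = u ^ 4 * v ^ 0 + 4 * (u ^ 3 * v ^ 1)
      + 6 * (u\<^sup>2 * v\<^sup>2) + 4 * (u ^ 1 * v ^ 3) + u ^ 0 * v ^ 4" for u v :: real
    by (simp add: power2_eq_square power4_eq_xxxx power3_eq_cube algebra_simps)
  have expand: "(x + y - (a + b)) ^ 4 = (x - a) ^ 4 * (y - b) ^ 0 + 4 * ((x - a) ^ 3 * (y - b) ^ 1)
      + 6 * ((x - a)\<^sup>2 * (y - b)\<^sup>2) + 4 * ((x - a) ^ 1 * (y - b) ^ 3) + (x - a) ^ 0 * (y - b) ^ 4" for x y
    using binom[of "x - a" "y - b"] by (simp only: add_diff_add)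
  have "has_bochner_integral (M \<Otimes>\<^sub>M N) (\<lambda>z. (fst z + snd z - (a + b)) ^ 4)
      ((LINT x|M. (x - a) ^ 4) * (LINT y|N. (y - b) ^ 0)
        + 4 * ((LINT x|M. (x - a) ^ 3) * (LINT y|N. (y - b) ^ 1))
        + 6 * ((LINT x|M. (x - a)\<^sup>2) * (LINT y|N. (y - b)\<^sup>2))
        + 4 * ((LINT x|M. (x - a) ^ 1) * (LINT y|N. (y - b) ^ 3))
        + (LINT x|M. (x - a) ^ 0) * (LINT y|N. (y - b) ^ 4))"
    unfolding expand by (intro has_bochner_integral_add has_bochner_integral_mult_right h) auto
  then have "has_bochner_integral (M \<Otimes>\<^sub>M N) (\<lambda>z. (fst z + snd z - (a + b)) ^ 4)
      (fourth_of M + 6 * (var_of M * var_of N) + fourth_of N)"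
    unfolding a0 b0 by (simp add: var_of_def fourth_of_def a_def b_def M.prob_space[simplified] N.prob_space[simplified])
  from has_bochner_integral_convolution[OF assms(1,2) _ this]
  have c4: "has_bochner_integral (M \<star> N) (\<lambda>z. (z - (a + b)) ^ 4)
      (fourth_of M + 6 * (var_of M * var_of N) + fourth_of N)" by simp
  then show "fourth_of (M \<star> N) = fourth_of M + 6 * (var_of M * var_of N) + fourth_of N"
    by (simp add: fourth_of_def[of "M \<star> N"] mn a_def b_def has_bochner_integral_iff)
  show "integrable (M \<star> N) (\<lambda>z. z ^ 4)"
  proof (rule Bochner_Integration.integrable_bound)
    interpret C: real_distribution "M \<star> N" by (rule real_distribution_convolution) unfold_locales
    show "integrable (M \<star> N) (\<lambda>z. 8 * ((z - (a + b)) ^ 4 + (a + b) ^ 4))"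
      using c4 by (auto simp: has_bochner_integral_iff)
    have "z ^ 4 \<le> 8 * ((z - (a + b)) ^ 4 + (a + b) ^ 4)" for z :: real
      using power4_sum_le[of "z - (a + b)" "a + b"] by simp
    then show "AE z in M \<star> N. norm (z ^ 4) \<le> norm (8 * ((z - (a + b)) ^ 4 + (a + b) ^ 4))"
      by (auto simp: abs_of_nonneg)
  qed simp
qed

lemma real_distribution_moment2_of_fourth:
  assumes "real_distribution M" "integrable M (\<lambda>z. z ^ 4)"
  shows "integrable M (\<lambda>z. z\<^sup>2)"
proof -
  interpret real_distribution M by fact
  show ?thesis using integrable_power_le[OF assms(2), of 2] by simp
qed

lemma integrable_return:
  fixes f :: "'a \<Rightarrow> real"
  assumes [measurable]: "f \<in> borel_measurable M" and x: "x \<in> space M"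
  shows "integrable (return M x) f"
proof -
  interpret prob_space "return M x" by (rule prob_space_return[OF x])
  show ?thesis
    by (rule integrable_const_bound[where B = "\<bar>f x\<bar>"]) (use x in \<open>auto simp: AE_return\<close>)
qed

lemma sum_law_moments2:
  assumes "finite I" "\<And>i. i \<in> I \<Longrightarrow> real_distribution (K i)" "\<And>i. i \<in> I \<Longrightarrow> integrable (K i) (\<lambda>z. z\<^sup>2)"
  shows "integrable (sum_law I K) (\<lambda>z. z\<^sup>2) \<and> mean_of (sum_law I K) = (\<Sum>i\<in>I. mean_of (K i)) \<and>
    var_of (sum_law I K) = (\<Sum>i\<in>I. var_of (K i))"
  using assms
proof (induction I rule: finite_induct)
  case empty
  then show ?case by (simp add: sum_law_empty integrable_return mean_of_def var_of_def integral_return)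
next
  case (insert i I)
  note R = insert.prems(1)
  have S: "real_distribution (sum_law I K)" using R by (intro real_distribution_sum_law) auto
  have IH: "integrable (sum_law I K) (\<lambda>z. z\<^sup>2)" "mean_of (sum_law I K) = (\<Sum>i\<in>I. mean_of (K i))"
    "var_of (sum_law I K) = (\<Sum>i\<in>I. var_of (K i))"
    using insert by auto
  have ins: "sum_law (insert i I) K = (K i \<star> sum_law I K)" by (rule sum_law_insert[OF insert.hyps R])
  show ?case
    unfolding ins using convolution_moments2[OF R[of i] S insert.prems(2)[of i] IH(1)] IH insert.hyps
    by simp
qed

text \<open>The cross term \<open>6 * (var_of (K i) * S)\<close>, with \<open>S\<close> the sum of
  the other variances, is the mixed term of \<open>3 * (var_of (K i) + S)^2\<close>. This fixes the
  constant 3, the ratio for a Gaussian, and closes the induction after dropping the non-negative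
  \<open>3 * (var_of (K i))^2\<close>.\<close>

lemma sum_law_fourth:
  assumes "finite I" "\<And>i. i \<in> I \<Longrightarrow> real_distribution (K i)" "\<And>i. i \<in> I \<Longrightarrow> integrable (K i) (\<lambda>z. z ^ 4)"
  shows "integrable (sum_law I K) (\<lambda>z. z ^ 4) \<and>
    fourth_of (sum_law I K) \<le> (\<Sum>i\<in>I. fourth_of (K i)) + 3 * (\<Sum>i\<in>I. var_of (K i))\<^sup>2"
  using assms
proof (induction I rule: finite_induct)
  case empty
  then show ?case by (simp add: sum_law_empty integrable_return mean_of_def fourth_of_def integral_return)
next
  case (insert i I)
  note R = insert.prems(1)
  have S: "real_distribution (sum_law I K)" using R by (intro real_distribution_sum_law) auto
  have IH: "integrable (sum_law I K) (\<lambda>z. z ^ 4)"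
    "fourth_of (sum_law I K) \<le> (\<Sum>i\<in>I. fourth_of (K i)) + 3 * (\<Sum>i\<in>I. var_of (K i))\<^sup>2"
    using insert by auto
  have v: "var_of (sum_law I K) = (\<Sum>i\<in>I. var_of (K i))"
    using insert by (intro sum_law_moments2[THEN conjunct2, THEN conjunct2] real_distribution_moment2_of_fourth) auto
  have sq: "0 \<le> (var_of (K i))\<^sup>2" by simp
  have ins: "sum_law (insert i I) K = (K i \<star> sum_law I K)" by (rule sum_law_insert[OF insert.hyps R])
  show ?case
  proof
    note cv = convolution_fourth[OF R[OF insertI1] S insert.prems(2)[OF insertI1] IH(1)]
    show "integrable (sum_law (insert i I) K) (\<lambda>z. z ^ 4)" unfolding ins by (rule cv)
    have "3 * (var_of (K i) + (\<Sum>i\<in>I. var_of (K i)))\<^sup>2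
        = 3 * (var_of (K i))\<^sup>2 + 6 * (var_of (K i) * (\<Sum>i\<in>I. var_of (K i))) + 3 * (\<Sum>i\<in>I. var_of (K i))\<^sup>2"
      by (simp add: power2_sum)
    then show "fourth_of (sum_law (insert i I) K)
        \<le> (\<Sum>i\<in>insert i I. fourth_of (K i)) + 3 * (\<Sum>i\<in>insert i I. var_of (K i))\<^sup>2"
      unfolding ins sum.insert[OF insert.hyps] using cv(2)[unfolded v] IH(2) sq by linarith
  qed
qed

lemma sum_law_second_moment:
  assumes "finite I" "\<And>i. i \<in> I \<Longrightarrow> real_distribution (K i)" "\<And>i. i \<in> I \<Longrightarrow> integrable (K i) (\<lambda>z. z\<^sup>2)"
  shows "(LINT z|sum_law I K. z\<^sup>2) = (\<Sum>i\<in>I. var_of (K i)) + (\<Sum>i\<in>I. mean_of (K i))\<^sup>2"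
  using sum_law_moments2[OF assms] real_distribution.var_of_eq[OF real_distribution_sum_law[of I K]] assms(2)
  by simp

lemma (in real_distribution) fourth_of_le:
  assumes "integrable M (\<lambda>z. z ^ 4)"
  shows "fourth_of M \<le> 8 * ((LINT z|M. z ^ 4) + (mean_of M) ^ 4)"
proof -
  have "fourth_of M \<le> (LINT z|M. 8 * (z ^ 4 + (mean_of M) ^ 4))"
    unfolding fourth_of_def
    using integrable_centred_fourth[OF assms] assms power4_sum_le[of _ "- mean_of M"]
    by (intro integral_mono) (auto simp flip: diff_conv_add_uminus)
  also have "\<dots> = 8 * ((LINT z|M. z ^ 4) + (mean_of M) ^ 4)"
    using assms prob_space by simp
  finally show ?thesis .
qed

lemma (in real_distribution) fourth_moment_le:
  assumes "integrable M (\<lambda>z. z ^ 4)"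
  shows "(LINT z|M. z ^ 4) \<le> 8 * (fourth_of M + (mean_of M) ^ 4)"
proof -
  have "(LINT z|M. z ^ 4) \<le> (LINT z|M. 8 * ((z - mean_of M) ^ 4 + (mean_of M) ^ 4))"
    using integrable_centred_fourth[OF assms] assms power4_sum_le[of "_ - mean_of M" "mean_of M"]
    by (intro integral_mono) auto
  also have "\<dots> = 8 * (fourth_of M + (mean_of M) ^ 4)"
    using integrable_centred_fourth[OF assms] prob_space by (simp add: fourth_of_def)
  finally show ?thesis .
qed

lemma sum_power4_le: 
  fixes a :: "'i \<Rightarrow> real"
  assumes "finite I"
  shows "(\<Sum>i\<in>I. (a i) ^ 4) \<le> (\<Sum>i\<in>I. \<bar>a i\<bar>) ^ 4"
proof -
  have "(\<Sum>i\<in>I. (a i) ^ 4) \<le> (\<Sum>i\<in>I. \<bar>a i\<bar> * (\<Sum>j\<in>I. \<bar>a j\<bar>) ^ 3)"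
  proof (rule sum_mono)
    fix i assume "i \<in> I"
    then have "\<bar>a i\<bar> \<le> (\<Sum>j\<in>I. \<bar>a j\<bar>)" using assms by (intro member_le_sum) auto
    then have "\<bar>a i\<bar> * \<bar>a i\<bar> ^ 3 \<le> \<bar>a i\<bar> * (\<Sum>j\<in>I. \<bar>a j\<bar>) ^ 3"
      by (intro mult_left_mono power_mono) auto
    moreover have "a i ^ 4 = \<bar>a i\<bar> * \<bar>a i\<bar> ^ 3" by (simp add: power4_eq_xxxx power3_eq_cube)
    ultimately show "a i ^ 4 \<le> \<bar>a i\<bar> * (\<Sum>j\<in>I. \<bar>a j\<bar>) ^ 3" by simp
  qed
  also have "\<dots> = (\<Sum>i\<in>I. \<bar>a i\<bar>) ^ 4"
    by (simp add: sum_distrib_right[symmetric] power4_eq_xxxx power3_eq_cube)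
  finally show ?thesis .
qed

text \<open>The source of all recursions for fourth moments: the fourth moments of the summands
  enter linearly. Passing from raw to central moments and back costs a factor 8 each time, whence
  \<open>64 = 8 * 8\<close>, \<open>24 = 8 * 3\<close> and \<open>72 = 8 * (8 + 1)\<close>.\<close>

lemma sum_law_fourth_moment_le:
  assumes I: "finite I" and R: "\<And>i. i \<in> I \<Longrightarrow> real_distribution (K i)"
    and int: "\<And>i. i \<in> I \<Longrightarrow> integrable (K i) (\<lambda>z. z ^ 4)"
  shows "(LINT z|sum_law I K. z ^ 4)
    \<le> 64 * (\<Sum>i\<in>I. LINT z|K i. z ^ 4) + 24 * (\<Sum>i\<in>I. LINT z|K i. z\<^sup>2)\<^sup>2 + 72 * (\<Sum>i\<in>I. \<bar>mean_of (K i)\<bar>) ^ 4"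
proof -
  have S: "real_distribution (sum_law I K)" using R by (intro real_distribution_sum_law) auto
  have int2: "integrable (K i) (\<lambda>z. z\<^sup>2)" if "i \<in> I" for i
    using real_distribution_moment2_of_fourth R int that by blast
  have v: "var_of (K i) \<le> (LINT z|K i. z\<^sup>2)" if "i \<in> I" for i
    using real_distribution.var_of_eq[OF R[OF that] int2[OF that]] by simp
  have m: "mean_of (sum_law I K) = (\<Sum>i\<in>I. mean_of (K i))"
    using sum_law_moments2[OF I R int2] by auto
  have "fourth_of (sum_law I K) \<le> (\<Sum>i\<in>I. fourth_of (K i)) + 3 * (\<Sum>i\<in>I. var_of (K i))\<^sup>2"
    using sum_law_fourth[OF I R int] by auto
  also have "(\<Sum>i\<in>I. fourth_of (K i)) \<le> (\<Sum>i\<in>I. 8 * ((LINT z|K i. z ^ 4) + (mean_of (K i)) ^ 4))"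
    by (intro sum_mono real_distribution.fourth_of_le R int)
  also have "\<dots> = 8 * (\<Sum>i\<in>I. LINT z|K i. z ^ 4) + 8 * (\<Sum>i\<in>I. (mean_of (K i)) ^ 4)"
    by (simp add: sum.distrib sum_distrib_left)
  also have "(\<Sum>i\<in>I. (mean_of (K i)) ^ 4) \<le> (\<Sum>i\<in>I. \<bar>mean_of (K i)\<bar>) ^ 4"
    by (rule sum_power4_le[OF I])
  also have "(\<Sum>i\<in>I. var_of (K i))\<^sup>2 \<le> (\<Sum>i\<in>I. LINT z|K i. z\<^sup>2)\<^sup>2"
    by (intro power_mono sum_mono v sum_nonneg var_of_nonneg)
  finally have f: "fourth_of (sum_law I K) \<le> 8 * (\<Sum>i\<in>I. LINT z|K i. z ^ 4) + 8 * (\<Sum>i\<in>I. \<bar>mean_of (K i)\<bar>) ^ 4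
      + 3 * (\<Sum>i\<in>I. LINT z|K i. z\<^sup>2)\<^sup>2" by simp
  have "\<bar>\<Sum>i\<in>I. mean_of (K i)\<bar> ^ 4 \<le> (\<Sum>i\<in>I. \<bar>mean_of (K i)\<bar>) ^ 4"
    by (intro power_mono sum_abs) auto
  with real_distribution.fourth_moment_le[OF S sum_law_fourth[OF I R int, THEN conjunct1]] f
  show ?thesis by (simp add: m)
qed

section \<open>Gaussian replacement\<close>

text \<open>An image of the standard normal law, with the variance as parameter; variance 0 gives
  the Dirac mass at 0 instead of an undefined density.\<close>

definition centred_gaussian :: "real \<Rightarrow> real measure" where
  "centred_gaussian v = distr std_normal_distribution borel (\<lambda>n. sqrt v * n)"

lemma real_distribution_centred_gaussian: "real_distribution (centred_gaussian v)"
  unfolding centred_gaussian_def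
  using real_dist_normal_dist
  by (auto simp: real_distribution_def real_distribution_axioms_def intro!: prob_space.prob_space_distr)

lemma char_convolution:
  assumes "real_distribution M" "real_distribution N"
  shows "char (M \<star> N) t = char M t * char N t"
proof -
  interpret M: real_distribution M by fact
  interpret N: real_distribution N by fact
  interpret pair_prob_space M N ..
  have p1: "(\<lambda>z. fst z + snd z) \<in> M \<Otimes>\<^sub>M N \<rightarrow>\<^sub>M (borel :: real measure)" by measurable
  have "char (M \<star> N) t = (LINT z|(M \<Otimes>\<^sub>M N). iexp (t * (fst z + snd z)))"
    unfolding char_def convolution_def split_beta' by (rule integral_distr[OF p1]) simp
  also have "\<dots> = (LINT x|M. LINT y|N. iexp (t * x) * iexp (t * y))"
    by (subst integral_fst'[symmetric])
       (auto intro!: integrable_const_bound[where B = 1] simp: exp_add[symmetric] algebra_simps)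
  also have "\<dots> = char M t * char N t"
    unfolding char_def by simp
  finally show ?thesis .
qed

lemma char_centred_gaussian:
  assumes "0 \<le> v"
  shows "char (centred_gaussian v) t = complex_of_real (exp (- v * t\<^sup>2 / 2))"
proof -
  have "char (centred_gaussian v) t = char std_normal_distribution (t * sqrt v)"
    unfolding char_def centred_gaussian_def by (subst integral_distr) (auto simp: ac_simps)
  then show ?thesis
    using assms by (simp add: char_std_normal_distribution power_mult_distrib mult.commute)
qed

text \<open>Characteristic functions treat vanishing variances on the same footing as positive
  ones.\<close>

lemma convolution_centred_gaussian:
  assumes "0 \<le> v" "0 \<le> w"
  shows "(centred_gaussian v \<star> centred_gaussian w) = centred_gaussian (v + w)"
proof (rule Levy_uniqueness)
  show "char (centred_gaussian v \<star> centred_gaussian w) = char (centred_gaussian (v + w))"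
    using assms
    by (auto simp: fun_eq_iff char_convolution real_distribution_centred_gaussian char_centred_gaussian
      exp_add[symmetric] of_real_mult[symmetric] algebra_simps add_divide_distrib simp del: of_real_mult of_real_exp)
qed (intro real_distribution_convolution real_distribution_centred_gaussian)+

lemma centred_gaussian_moments:
  assumes "0 \<le> v"
  shows "integrable (centred_gaussian v) (\<lambda>z. z ^ 4)" and "mean_of (centred_gaussian v) = 0"
    and "var_of (centred_gaussian v) = v" and "(LINT z|centred_gaussian v. \<bar>z\<bar> ^ 3) \<le> 4 * sqrt v ^ 3"
proof -
  interpret real_distribution std_normal_distribution by (rule real_dist_normal_dist)
  note i = integrable_std_normal_distribution_moment
  show "integrable (centred_gaussian v) (\<lambda>z. z ^ 4)"
    unfolding centred_gaussian_def using i[of 4]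
    by (subst integrable_distr_eq) (auto simp: power_mult_distrib)
  show m: "mean_of (centred_gaussian v) = 0"
    unfolding mean_of_def centred_gaussian_def using integral_std_normal_distribution_moment_odd[of 1]
    by (subst integral_distr) auto
  show "var_of (centred_gaussian v) = v"
    unfolding var_of_def m unfolding centred_gaussian_def
    using std_normal_distribution_even_moments(1)[of 1] assms
    by (subst integral_distr) (auto simp: power_mult_distrib fact_numeral)
  \<comment> \<open>\<open>E |n|^3 \<le> 1 + E n^4 = 1 + 3\<close>, the constant 4 of the
    claim.\<close>
  have "(LINT n|std_normal_distribution. \<bar>n\<bar> ^ 3) \<le> (LINT n|std_normal_distribution. 1 + n ^ 4)"
  proof (rule integral_mono_AE')
    show "integrable std_normal_distribution (\<lambda>n. 1 + n ^ 4)" using i by auto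
  qed (use power_abs_le_one_plus_power[of 3 4] in \<open>auto simp: power_even_abs\<close>)
  also have "\<dots> = 4"
    using std_normal_distribution_even_moments[of 2] prob_space by (simp add: fact_numeral i)
  finally have "sqrt v ^ 3 * (LINT n|std_normal_distribution. \<bar>n\<bar> ^ 3) \<le> sqrt v ^ 3 * 4"
    using assms by (intro mult_left_mono) auto
  then show "(LINT z|centred_gaussian v. \<bar>z\<bar> ^ 3) \<le> 4 * sqrt v ^ 3"
    unfolding centred_gaussian_def using assms
    by (subst integral_distr) (auto simp: power_mult_distrib abs_mult)
qed

section \<open>Taylor estimates for the test functions and Lindeberg's replacement\<close>

lemma smooth_testsE:
  assumes "F \<in> smooth_tests"
  obtains F1 F2 F3 where "\<And>y. (F has_real_derivative F1 y) (at y)" "\<And>y. (F1 has_real_derivative F2 y) (at y)"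
    "\<And>y. (F2 has_real_derivative F3 y) (at y)" "\<And>y. \<bar>F y\<bar> \<le> 1" "\<And>y. \<bar>F1 y\<bar> \<le> 1" "\<And>y. \<bar>F2 y\<bar> \<le> 1"
    "\<And>y. \<bar>F3 y\<bar> \<le> 1"
  using assms unfolding smooth_tests_def by blast

lemma smooth_tests_measurable [measurable_dest]:
  assumes "F \<in> smooth_tests" shows "F \<in> borel_measurable borel"
proof -
  from assms obtain F1 F2 F3 where "\<forall>y. (F has_real_derivative F1 y) (at y) \<and> (F1 has_real_derivative F2 y) (at y) \<and>
      (F2 has_real_derivative F3 y) (at y) \<and> \<bar>F y\<bar> \<le> 1 \<and> \<bar>F1 y\<bar> \<le> 1 \<and> \<bar>F2 y\<bar> \<le> 1 \<and> \<bar>F3 y\<bar> \<le> 1"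
    unfolding smooth_tests_def by blast
  then have d: "\<And>y. (F has_real_derivative F1 y) (at y)" "\<And>y. (F1 has_real_derivative F2 y) (at y)"
    "\<And>y. (F2 has_real_derivative F3 y) (at y)" "\<And>y. \<bar>F y\<bar> \<le> 1" "\<And>y. \<bar>F1 y\<bar> \<le> 1" "\<And>y. \<bar>F2 y\<bar> \<le> 1"
    "\<And>y. \<bar>F3 y\<bar> \<le> 1" by auto
  from d(1) have "continuous_on UNIV F"
    by (intro continuous_at_imp_continuous_on) (auto intro: DERIV_isCont)
  then show ?thesis by (rule borel_measurable_continuous_onI)
qed

lemma smooth_tests_bounded: "F \<in> smooth_tests \<Longrightarrow> \<bar>F y\<bar> \<le> 1"
  by (auto elim: smooth_testsE)

lemma smooth_tests_continuous: "F \<in> smooth_tests \<Longrightarrow> isCont F y"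
  by (elim smooth_testsE) (auto intro: DERIV_isCont)

lemma smooth_tests_lipschitz:
  assumes "F \<in> smooth_tests" shows "\<bar>F x - F y\<bar> \<le> \<bar>x - y\<bar>"
proof -
  from assms obtain F1 F2 F3 where "\<forall>y. (F has_real_derivative F1 y) (at y) \<and> (F1 has_real_derivative F2 y) (at y) \<and>
      (F2 has_real_derivative F3 y) (at y) \<and> \<bar>F y\<bar> \<le> 1 \<and> \<bar>F1 y\<bar> \<le> 1 \<and> \<bar>F2 y\<bar> \<le> 1 \<and> \<bar>F3 y\<bar> \<le> 1"
    unfolding smooth_tests_def by blast
  then have d: "\<And>y. (F has_real_derivative F1 y) (at y)" "\<And>y. (F1 has_real_derivative F2 y) (at y)"
    "\<And>y. (F2 has_real_derivative F3 y) (at y)" "\<And>y. \<bar>F y\<bar> \<le> 1" "\<And>y. \<bar>F1 y\<bar> \<le> 1" "\<And>y. \<bar>F2 y\<bar> \<le> 1"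
    "\<And>y. \<bar>F3 y\<bar> \<le> 1" by auto
  have "\<bar>F x - F y\<bar> \<le> 1 * \<bar>x - y\<bar>"
    using field_differentiable_bound[of UNIV F F1 1 x y] d(1,5) by (auto simp: dist_real_def)
  then show ?thesis by simp
qed

lemma integral_convolution_smooth:
  assumes "real_distribution M" "real_distribution N" and F: "F \<in> smooth_tests"
  shows "(LINT z|(M \<star> N). F (c + z)) = (LINT x|M. LINT y|N. F (c + x + y))"
proof -
  note [measurable] = smooth_tests_measurable[OF F]
  show ?thesis
    using integral_convolution_bounded[OF assms(1,2), of "\<lambda>z. F (c + z)" 1] smooth_tests_bounded[OF F]
    by (simp add: add.assoc)
qed

definition third_of :: "real measure \<Rightarrow> real" where
  "third_of \<mu> = (LINT z|\<mu>. \<bar>z - mean_of \<mu>\<bar> ^ 3)"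

lemma (in real_distribution) integrable_third:
  assumes "integrable M (\<lambda>z. z ^ 4)"
  shows "integrable M (\<lambda>z. \<bar>z - c\<bar> ^ 3)"
proof -
  have "integrable M (\<lambda>z. \<bar>z - c\<bar> ^ 4)"
    using integrable_centred_fourth[OF assms] by (simp add: power_even_abs)
  from integrable_power_le[OF this, of 3] show ?thesis by simp
qed

text \<open>The Lagrange form of the remainder is used, since the third derivative is bounded but
  not assumed continuous.\<close>

lemma smooth_tests_taylor3:
  assumes F: "\<And>y. (F has_real_derivative F1 y) (at y)" "\<And>y. (F1 has_real_derivative F2 y) (at y)"
    "\<And>y. (F2 has_real_derivative F3 y) (at y)" "\<And>y. \<bar>F3 y\<bar> \<le> 1"
  shows "\<bar>F (c + w) - (F c + F1 c * w + F2 c * w\<^sup>2 / 2)\<bar> \<le> \<bar>w\<bar> ^ 3 / 6"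
proof (cases "w = 0")
  case False
  define diff where "diff = (\<lambda>n::nat. if n = 0 then F else if n = 1 then F1 else if n = 2 then F2 else F3)"
  have "\<forall>m t. m < 3 \<and> min c (c + w) \<le> t \<and> t \<le> max c (c + w) \<longrightarrow> DERIV (diff m) t :> diff (Suc m) t"
  proof (intro allI impI)
    fix m :: nat and t assume "m < 3 \<and> min c (c + w) \<le> t \<and> t \<le> max c (c + w)"
    then have "m = 0 \<or> m = 1 \<or> m = 2" by auto
    then show "DERIV (diff m) t :> diff (Suc m) t" using F by (auto simp: diff_def)
  qed
  then have "\<exists>t. (if c + w < c then c + w < t \<and> t < c else c < t \<and> t < c + w) \<and>
      F (c + w) = (\<Sum>m<3. diff m c / fact m * (c + w - c) ^ m) + diff 3 t / fact 3 * (c + w - c) ^ 3"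
    using False by (intro Taylor) (auto simp: diff_def)
  then obtain t where "F (c + w) = (\<Sum>m<3. diff m c / fact m * (c + w - c) ^ m) + diff 3 t / fact 3 * (c + w - c) ^ 3"
    by blast
  then have "F (c + w) - (F c + F1 c * w + F2 c * w\<^sup>2 / 2) = F3 t * w ^ 3 / 6"
    by (simp add: diff_def eval_nat_numeral)
  moreover have "\<bar>F3 t * w ^ 3 / 6\<bar> \<le> 1 * \<bar>w\<bar> ^ 3 / 6"
    using F(4)[of t] by (simp add: abs_mult power_abs mult_left_le_one_le)
  ultimately show ?thesis by (simp only: mult_1)
qed simp

text \<open>Expanding around \<open>c + mean_of M\<close> makes the linear term integrate to 0. Two
  laws with equal mean and variance therefore share the expansion, up to their third absolute
  central moments.\<close>

lemma smooth_integral_expansion: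
  assumes F: "F \<in> smooth_tests" "\<And>y. (F has_real_derivative F1 y) (at y)" "\<And>y. (F1 has_real_derivative F2 y) (at y)"
    "\<And>y. (F2 has_real_derivative F3 y) (at y)" "\<And>y. \<bar>F3 y\<bar> \<le> 1"
    and "real_distribution M" and int: "integrable M (\<lambda>z. z ^ 4)"
  shows "\<bar>(LINT z|M. F (c + z)) - (F (c + mean_of M) + F2 (c + mean_of M) * var_of M / 2)\<bar> \<le> third_of M / 6"
proof -
  interpret real_distribution M by fact
  note [measurable] = smooth_tests_measurable[OF F(1)]
  note int2 = real_distribution_moment2_of_fourth[OF \<open>real_distribution M\<close> int]
  define m where "m = mean_of M"
  have i: "integrable M (\<lambda>z. F (c + z))"
    by (rule integrable_const_bound[where B = 1]) (auto simp: smooth_tests_bounded F(1))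
  have ic: "integrable M (\<lambda>z. z - m)" "integrable M (\<lambda>z. (z - m)\<^sup>2)"
    using integrable_centred_square[OF int2] integrable_id_of_square[OF int2] by auto
  let ?G = "\<lambda>z. F (c + m) + F1 (c + m) * (z - m) + F2 (c + m) * (z - m)\<^sup>2 / 2"
  have iG: "integrable M ?G" using ic by auto
  have "(LINT z|M. ?G z) = F (c + m) + F1 (c + m) * (LINT z|M. z - m) + F2 (c + m) * (LINT z|M. (z - m)\<^sup>2) / 2"
    using ic prob_space[simplified] by simp
  also have "(LINT z|M. z - m) = 0"
    using integral_centred[OF integrable_id_of_square[OF int2]] by (simp add: m_def)
  finally have "(LINT z|M. ?G z) = F (c + mean_of M) + F2 (c + mean_of M) * var_of M / 2"
    by (simp add: m_def var_of_def)
  then have "\<bar>(LINT z|M. F (c + z)) - (F (c + mean_of M) + F2 (c + mean_of M) * var_of M / 2)\<bar>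
      = \<bar>LINT z|M. F (c + z) - ?G z\<bar>"
    by (subst Bochner_Integration.integral_diff[OF i iG]) simp
  also have "\<dots> \<le> (LINT z|M. \<bar>F (c + z) - ?G z\<bar>)" by (rule integral_abs_bound)
  also have "\<dots> \<le> (LINT z|M. \<bar>z - m\<bar> ^ 3 / 6)"
  proof (rule integral_mono)
    show "integrable M (\<lambda>z. \<bar>F (c + z) - ?G z\<bar>)" using i iG by auto
    show "integrable M (\<lambda>z. \<bar>z - m\<bar> ^ 3 / 6)" using integrable_third[OF int, of m] by simp
    fix z
    show "\<bar>F (c + z) - ?G z\<bar> \<le> \<bar>z - m\<bar> ^ 3 / 6"
      using smooth_tests_taylor3[OF F(2-5), of "c + m" "z - m"] by simp
  qed
  also have "\<dots> = third_of M / 6" by (simp add: third_of_def m_def)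
  finally show ?thesis .
qed

text \<open>The cost of exchanging one summand for a Gaussian of the same mean and variance; the
  second term dominates the third absolute moment of that Gaussian up to a constant.\<close>

definition lindeberg_error :: "real measure \<Rightarrow> real" where
  "lindeberg_error \<mu> = third_of \<mu> + sqrt (var_of \<mu>) ^ 3"

lemma lindeberg_error_nonneg: "0 \<le> lindeberg_error \<mu>"
  by (simp add: lindeberg_error_def third_of_def var_of_nonneg)

text \<open>Both integrals are compared with the same second-order expansion. The Gaussian has third
  absolute moment at most \<open>4 * sqrt (var_of M) ^ 3\<close>, and each remainder carries a
  factor 1/6, so the total stays below the sum of the two terms of
  \<open>lindeberg_error\<close>.\<close>

lemma smooth_replace_one:
  assumes F: "F \<in> smooth_tests" and M: "real_distribution M" and int: "integrable M (\<lambda>z. z ^ 4)"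
  shows "\<bar>(LINT z|M. F (c + z)) - (LINT z|centred_gaussian (var_of M). F (c + mean_of M + z))\<bar>
    \<le> lindeberg_error M"
proof -
  from F obtain F1 F2 F3 where "\<forall>y. (F has_real_derivative F1 y) (at y) \<and> (F1 has_real_derivative F2 y) (at y) \<and>
      (F2 has_real_derivative F3 y) (at y) \<and> \<bar>F y\<bar> \<le> 1 \<and> \<bar>F1 y\<bar> \<le> 1 \<and> \<bar>F2 y\<bar> \<le> 1 \<and> \<bar>F3 y\<bar> \<le> 1"
    unfolding smooth_tests_def by blast
  then have d: "\<And>y. (F has_real_derivative F1 y) (at y)" "\<And>y. (F1 has_real_derivative F2 y) (at y)"
    "\<And>y. (F2 has_real_derivative F3 y) (at y)" "\<And>y. \<bar>F y\<bar> \<le> 1" "\<And>y. \<bar>F1 y\<bar> \<le> 1" "\<And>y. \<bar>F2 y\<bar> \<le> 1"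
    "\<And>y. \<bar>F3 y\<bar> \<le> 1" by auto
  note d = d(1,2,3,7)
  have v: "0 \<le> var_of M" by (rule var_of_nonneg)
  note g = centred_gaussian_moments[OF v]
  have "third_of (centred_gaussian (var_of M)) \<le> 4 * sqrt (var_of M) ^ 3"
    using g by (simp add: third_of_def)
  then show ?thesis
    using smooth_integral_expansion[OF F d M int, of c]
      smooth_integral_expansion[OF F d real_distribution_centred_gaussian g(1), of "c + mean_of M"] g v
      real_sqrt_ge_zero[OF v]
      zero_le_power[OF real_sqrt_ge_zero[OF v], of 3]
    by (simp add: lindeberg_error_def third_of_def[of M] integral_nonneg_AE zero_le_power)
      (smt (verit, best) integral_nonneg_AE AE_I2 zero_le_power abs_ge_zero)
qed

text \<open>The induction hypothesis, with shift \<open>c + x\<close>, replaces the sum over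
  \<open>I\<close> while \<open>x\<close> is integrated against \<open>K i\<close>. Then the order
  of integration is reversed and \<open>K i\<close> itself is replaced, and the two Gaussians merge
  because variances add. Hence the shift has to be arbitrary in the induction.\<close>

lemma lindeberg_replacement:
  assumes "finite I" and F: "F \<in> smooth_tests"
    and "\<And>i. i \<in> I \<Longrightarrow> real_distribution (K i)" "\<And>i. i \<in> I \<Longrightarrow> integrable (K i) (\<lambda>z. z ^ 4)"
  shows "\<bar>(LINT s|sum_law I K. F (c + s))
      - (LINT s|centred_gaussian (\<Sum>i\<in>I. var_of (K i)). F (c + (\<Sum>i\<in>I. mean_of (K i)) + s))\<bar>
    \<le> (\<Sum>i\<in>I. lindeberg_error (K i))"
  using assms(1,3,4)
proof (induction I arbitrary: c rule: finite_induct)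
  case empty
  \<comment> \<open>Without summands the Gaussian has variance 0 and is the Dirac mass at 0.\<close>
  have "centred_gaussian 0 = return borel 0"
    using real_dist_normal_dist
    by (auto simp: centred_gaussian_def real_distribution_def intro!: prob_space.distr_const)
  then show ?case by (simp add: sum_law_empty)
next
  case (insert i I)
  note [measurable] = smooth_tests_measurable[OF F]
  define m v where "m = (\<Sum>i\<in>I. mean_of (K i))" and "v = (\<Sum>i\<in>I. var_of (K i))"
  have v: "0 \<le> v" by (auto simp: v_def intro: sum_nonneg var_of_nonneg)
  define G where "G = centred_gaussian v"
  note R = insert.prems(1)
  have S: "real_distribution (sum_law I K)" using R by (intro real_distribution_sum_law) auto
  have Ri: "real_distribution (K i)" using R by auto
  have GR: "real_distribution G" unfolding G_def by (rule real_distribution_centred_gaussian)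
  interpret Ki: real_distribution "K i" by fact
  interpret G: real_distribution G by fact
  interpret Sl: real_distribution "sum_law I K" by fact
  interpret H: real_distribution "centred_gaussian (var_of (K i))" by (rule real_distribution_centred_gaussian)
  have bi: "integrable N (\<lambda>x. LINT y|N'. F (f x + y))"
    if "real_distribution N" "real_distribution N'" and [measurable]: "f \<in> borel_measurable borel" for N N' f
  proof -
    interpret N: real_distribution N by fact
    interpret N': real_distribution N' by fact
    show ?thesis
    proof (rule N.integrable_const_bound[where B = 1])
      show "AE x in N. norm (LINT y|N'. F (f x + y)) \<le> 1"
      proof (intro AE_I2)
        fix x
        have "\<bar>LINT y|N'. F (f x + y)\<bar> \<le> (LINT y|N'. \<bar>F (f x + y)\<bar>)" by (rule integral_abs_bound)
        also have "\<dots> \<le> (LINT y|N'. 1)"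
          by (intro integral_mono N'.integrable_const_bound[where B = 1]) (auto simp: smooth_tests_bounded F)
        finally show "norm (LINT y|N'. F (f x + y)) \<le> 1" by (simp add: N'.prob_space[simplified])
      qed
    qed measurable
  qed
  have ins: "sum_law (insert i I) K = (K i \<star> sum_law I K)" by (rule sum_law_insert[OF insert.hyps R])
  have A: "(LINT s|sum_law (insert i I) K. F (c + s)) = (LINT x|K i. LINT s|sum_law I K. F (c + x + s))"
    unfolding ins by (rule integral_convolution_smooth[OF Ri S F])
  have "(LINT x|K i. LINT s|G. F (c + x + m + s)) = (LINT z|(K i \<star> G). F (c + m + z))"
    unfolding integral_convolution_smooth[OF Ri GR F] by (simp add: ac_simps)
  \<comment> \<open>Commuting the convolution makes \<open>K i\<close> the inner law, where it can
    be replaced for each value of the Gaussian variable.\<close>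
  also have "(K i \<star> G) = (G \<star> K i)"
    by (rule convolution_commutative) (unfold_locales, auto)
  also have "(LINT z|(G \<star> K i). F (c + m + z)) = (LINT s|G. LINT x|K i. F (c + m + s + x))"
    by (rule integral_convolution_smooth[OF GR Ri F])
  finally have B: "(LINT x|K i. LINT s|G. F (c + x + m + s)) = (LINT s|G. LINT x|K i. F (c + m + s + x))" .
  have "(LINT s|centred_gaussian (v + var_of (K i)). F (c + (m + mean_of (K i)) + s))
      = (LINT s|(G \<star> centred_gaussian (var_of (K i))). F (c + (m + mean_of (K i)) + s))"
    unfolding G_def by (subst convolution_centred_gaussian[OF v var_of_nonneg]) simp
  also have "\<dots> = (LINT s|G. LINT x|centred_gaussian (var_of (K i)). F (c + (m + mean_of (K i)) + s + x))"
    by (rule integral_convolution_smooth[OF GR real_distribution_centred_gaussian F])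
  finally have C: "(LINT s|centred_gaussian (v + var_of (K i)). F (c + (m + mean_of (K i)) + s))
     = (LINT s|G. LINT x|centred_gaussian (var_of (K i)). F (c + m + s + mean_of (K i) + x))"
    by (simp add: ac_simps)
  have IH: "\<bar>(LINT s|sum_law I K. F (c + x + s)) - (LINT s|G. F (c + x + m + s))\<bar> \<le> (\<Sum>i\<in>I. lindeberg_error (K i))" for x
    unfolding m_def v_def G_def using insert by (intro insert.IH) auto
  have 1: "\<bar>(LINT x|K i. LINT s|sum_law I K. F (c + x + s)) - (LINT x|K i. LINT s|G. F (c + x + m + s))\<bar>
      \<le> (\<Sum>i\<in>I. lindeberg_error (K i))"
  proof -
    have i1: "integrable (K i) (\<lambda>x. LINT s|sum_law I K. F (c + x + s))" by (rule bi[OF Ri S]) simp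
    have i2: "integrable (K i) (\<lambda>x. LINT s|G. F (c + x + m + s))" by (rule bi[OF Ri GR]) simp
    have "\<bar>LINT x|K i. (LINT s|sum_law I K. F (c + x + s)) - (LINT s|G. F (c + x + m + s))\<bar>
        \<le> (LINT x|K i. \<bar>(LINT s|sum_law I K. F (c + x + s)) - (LINT s|G. F (c + x + m + s))\<bar>)"
      by (rule integral_abs_bound)
    also have "\<dots> \<le> (LINT x|K i. (\<Sum>i\<in>I. lindeberg_error (K i)))"
      using i1 i2 IH by (intro integral_mono) auto
    finally show ?thesis
      by (simp add: Bochner_Integration.integral_diff[OF i1 i2] Ki.prob_space[simplified])
  qed
  have 2: "\<bar>(LINT s|G. LINT x|K i. F (c + m + s + x))
      - (LINT s|G. LINT x|centred_gaussian (var_of (K i)). F (c + m + s + mean_of (K i) + x))\<bar> \<le> lindeberg_error (K i)"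
  proof -
    have i1: "integrable G (\<lambda>s. LINT x|K i. F (c + m + s + x))" by (rule bi[OF GR Ri]) simp
    have i2: "integrable G (\<lambda>s. LINT x|centred_gaussian (var_of (K i)). F (c + m + s + mean_of (K i) + x))"
      by (rule bi[OF GR real_distribution_centred_gaussian]) simp
    have "\<bar>LINT s|G. (LINT x|K i. F (c + m + s + x)) - (LINT x|centred_gaussian (var_of (K i)). F (c + m + s + mean_of (K i) + x))\<bar>
        \<le> (LINT s|G. \<bar>(LINT x|K i. F (c + m + s + x)) - (LINT x|centred_gaussian (var_of (K i)). F (c + m + s + mean_of (K i) + x))\<bar>)"
      by (rule integral_abs_bound)
    also have "\<dots> \<le> (LINT s|G. lindeberg_error (K i))"
      using i1 i2 smooth_replace_one[OF F Ri insert.prems(2)[of i]] by (intro integral_mono) auto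
    finally show ?thesis
      by (simp add: Bochner_Integration.integral_diff[OF i1 i2] G.prob_space[simplified])
  qed
  show ?case
    using 1 2 insert.hyps unfolding A B by (simp add: m_def[symmetric] v_def[symmetric] C[unfolded add.commute[of m] add.commute[of v]])
qed

text \<open>The estimate is Lipschitz in the variance although the standard deviation is not
  Lipschitz in it near 0: the larger Gaussian is the smaller one plus an independent Gaussian of
  variance \<open>b - a\<close>, whose first-order effect on \<open>F\<close> averages out. The law
  of large numbers controls variances, so this is the form required.\<close>

lemma centred_gaussian_lipschitz:
  assumes F: "F \<in> smooth_tests" and "0 \<le> a" "0 \<le> b"
  shows "\<bar>(LINT z|centred_gaussian a. F z) - (LINT z|centred_gaussian b. F z)\<bar> \<le> \<bar>a - b\<bar>"
  using assms(2,3)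
proof (induction a b rule: linorder_wlog)
  case (sym a b)
  then show ?case by (simp add: abs_minus_commute)
next
  case (le a b)
  note [measurable] = smooth_tests_measurable[OF F]
  from F obtain F1 F2 F3 where "\<forall>y. (F has_real_derivative F1 y) (at y) \<and> (F1 has_real_derivative F2 y) (at y) \<and>
      (F2 has_real_derivative F3 y) (at y) \<and> \<bar>F y\<bar> \<le> 1 \<and> \<bar>F1 y\<bar> \<le> 1 \<and> \<bar>F2 y\<bar> \<le> 1 \<and> \<bar>F3 y\<bar> \<le> 1"
    unfolding smooth_tests_def by blast
  then have d: "\<And>y. (F has_real_derivative F1 y) (at y)" "\<And>y. (F1 has_real_derivative F2 y) (at y)"
    "\<And>y. (F2 has_real_derivative F3 y) (at y)" "\<And>y. \<bar>F y\<bar> \<le> 1" "\<And>y. \<bar>F1 y\<bar> \<le> 1" "\<And>y. \<bar>F2 y\<bar> \<le> 1"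
    "\<And>y. \<bar>F3 y\<bar> \<le> 1" by auto
  note d = d(1,2,6)
  define G where "G = centred_gaussian a"
  define H where "H = centred_gaussian (b - a)"
  have GR: "real_distribution G" and HR: "real_distribution H"
    unfolding G_def H_def by (rule real_distribution_centred_gaussian)+
  interpret G: real_distribution G by fact
  interpret H: real_distribution H by fact
  have ba: "0 \<le> b - a" using le by simp
  note Hm = centred_gaussian_moments[OF ba, folded H_def]
  note H2 = real_distribution_moment2_of_fourth[OF HR Hm(1)]
  have sq: "\<bar>F (x + w) - (F x + F1 x * w)\<bar> \<le> w\<^sup>2 / 2" for x w
  proof (cases "w = 0")
    case False
    define diff where "diff = (\<lambda>n::nat. if n = 0 then F else if n = 1 then F1 else F2)"
    have "\<forall>m t. m < 2 \<and> min x (x + w) \<le> t \<and> t \<le> max x (x + w) \<longrightarrow> DERIV (diff m) t :> diff (Suc m) t"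
    proof (intro allI impI)
      fix m :: nat and t assume "m < 2 \<and> min x (x + w) \<le> t \<and> t \<le> max x (x + w)"
      then have "m = 0 \<or> m = 1" by auto
      then show "DERIV (diff m) t :> diff (Suc m) t" using d by (auto simp: diff_def)
    qed
    then have "\<exists>t. (if x + w < x then x + w < t \<and> t < x else x < t \<and> t < x + w) \<and>
        F (x + w) = (\<Sum>m<2. diff m x / fact m * (x + w - x) ^ m) + diff 2 t / fact 2 * (x + w - x)\<^sup>2"
      using False by (intro Taylor) (auto simp: diff_def)
    then obtain t where "F (x + w) = (\<Sum>m<2. diff m x / fact m * (x + w - x) ^ m) + diff 2 t / fact 2 * (x + w - x)\<^sup>2"
      by blast
    then have "F (x + w) - (F x + F1 x * w) = F2 t * w\<^sup>2 / 2"
      by (simp add: diff_def eval_nat_numeral)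
    moreover have "\<bar>F2 t * w\<^sup>2 / 2\<bar> \<le> 1 * w\<^sup>2 / 2"
      using d(3)[of t] by (simp add: abs_mult mult_left_le_one_le)
    ultimately show ?thesis by (simp only: mult_1)
  qed simp
  \<comment> \<open>The mean of \<open>H\<close> is 0, which removes the linear term of the Taylor
    expansion; half the variance of \<open>H\<close> remains.\<close>
  have inner: "\<bar>(LINT w|H. F (x + w)) - F x\<bar> \<le> b - a" for x
  proof -
    have iF: "integrable H (\<lambda>w. F (x + w))"
      by (rule H.integrable_const_bound[where B = 1]) (auto simp: smooth_tests_bounded F)
    have iw: "integrable H (\<lambda>w. w)" by (rule H.integrable_id_of_square[OF H2])
    have "(LINT w|H. F x + F1 x * w) = F x"
      using iw Hm(2) H.prob_space[simplified] by (simp add: mean_of_def)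
    then have "\<bar>(LINT w|H. F (x + w)) - F x\<bar> = \<bar>LINT w|H. F (x + w) - (F x + F1 x * w)\<bar>"
      using iF iw by (subst Bochner_Integration.integral_diff) auto
    also have "\<dots> \<le> (LINT w|H. \<bar>F (x + w) - (F x + F1 x * w)\<bar>)" by (rule integral_abs_bound)
    also have "\<dots> \<le> (LINT w|H. w\<^sup>2 / 2)" using iF iw H2 sq by (intro integral_mono) auto
    also have "\<dots> = (b - a) / 2"
      using Hm(2,3) by (simp add: var_of_def)
    finally show ?thesis using ba by simp
  qed
  have "(LINT z|centred_gaussian b. F z) = (LINT z|(G \<star> H). F (0 + z))"
    unfolding G_def H_def using convolution_centred_gaussian[OF le(2) ba] by simp
  also have "\<dots> = (LINT x|G. LINT w|H. F (0 + x + w))" by (rule integral_convolution_smooth[OF GR HR F])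
  finally have eq: "(LINT z|centred_gaussian b. F z) = (LINT x|G. LINT w|H. F (x + w))" by simp
  have i1: "integrable G F"
    by (rule G.integrable_const_bound[where B = 1]) (auto simp: smooth_tests_bounded F)
  have i2: "integrable G (\<lambda>x. LINT w|H. F (x + w))"
  proof (rule G.integrable_const_bound[where B = "1 + (b - a)"])
    have "\<bar>LINT w|H. F (x + w)\<bar> \<le> 1 + (b - a)" for x
      using inner[of x] smooth_tests_bounded[OF F, of x] by linarith
    then show "AE x in G. norm (LINT w|H. F (x + w)) \<le> 1 + (b - a)" by simp
  qed measurable
  have "\<bar>LINT x|G. F x - (LINT w|H. F (x + w))\<bar> \<le> (LINT x|G. \<bar>F x - (LINT w|H. F (x + w))\<bar>)"
    by (rule integral_abs_bound)
  also have "\<dots> \<le> (LINT x|G. b - a)"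
    using i1 i2 inner by (intro integral_mono) (auto simp: abs_minus_commute)
  finally show ?case
    using le by (simp add: eq G_def[symmetric] Bochner_Integration.integral_diff[OF i1 i2] G.prob_space[simplified])
qed

section \<open>Measurability of point measures and paths\<close>

lemma space_measure_algebra: "space (measure_algebra E) = {\<mu>. sets \<mu> = sets E}"
  by (auto simp: measure_algebra_def space_Sup_eq_UN)

lemma measurable_emeasure_measure_algebra [measurable]:
  "A \<in> sets E \<Longrightarrow> (\<lambda>\<mu>. emeasure \<mu> A) \<in> borel_measurable (measure_algebra E)"
  by (auto intro!: measurable_Sup1 measurable_vimage_algebra1 simp: measure_algebra_def)

lemma measurable_measure_algebra:
  assumes "\<And>a. a \<in> space M \<Longrightarrow> sets (K a) = sets E"
    and "\<And>A. A \<in> sets E \<Longrightarrow> (\<lambda>a. emeasure (K a) A) \<in> borel_measurable M"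
  shows "K \<in> M \<rightarrow>\<^sub>M measure_algebra E"
  using assms by (auto intro!: measurable_Sup2 measurable_vimage_algebra2 simp: measure_algebra_def)

text \<open>Monotone class induction, as for sub-probability measures; finiteness of
  \<open>\<mu>\<close> never enters, which matters because a population may be infinite.\<close>

lemma nn_integral_measurable_measure_algebra [measurable]:
  assumes f: "f \<in> borel_measurable E"
  shows "(\<lambda>\<mu>. integral\<^sup>N \<mu> f) \<in> borel_measurable (measure_algebra E)" (is "_ \<in> ?B")
  using f
proof induct
  case (cong f g)
  moreover have "(\<lambda>\<mu>. \<integral>\<^sup>+x. f x \<partial>\<mu>) \<in> ?B \<longleftrightarrow> (\<lambda>\<mu>. \<integral>\<^sup>+x. g x \<partial>\<mu>) \<in> ?B"
    by (intro measurable_cong nn_integral_cong cong)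
       (auto simp: space_measure_algebra dest!: sets_eq_imp_space_eq)
  ultimately show ?case by simp
next
  case (set A)
  then have "(\<lambda>\<mu>. \<integral>\<^sup>+x. indicator A x \<partial>\<mu>) \<in> ?B \<longleftrightarrow> (\<lambda>\<mu>. emeasure \<mu> A) \<in> ?B"
    by (intro measurable_cong nn_integral_indicator) (simp add: space_measure_algebra)
  with set show ?case by simp
next
  case (mult f c)
  then have "(\<lambda>\<mu>. \<integral>\<^sup>+x. c * f x \<partial>\<mu>) \<in> ?B \<longleftrightarrow> (\<lambda>\<mu>. c * \<integral>\<^sup>+x. f x \<partial>\<mu>) \<in> ?B"
    by (intro measurable_cong nn_integral_cmult)
       (auto simp add: space_measure_algebra cong: measurable_cong_sets)
  with mult show ?case by simp
next
  case (add f g)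
  then have "(\<lambda>\<mu>. \<integral>\<^sup>+x. f x + g x \<partial>\<mu>) \<in> ?B \<longleftrightarrow> (\<lambda>\<mu>. (\<integral>\<^sup>+x. f x \<partial>\<mu>) + (\<integral>\<^sup>+x. g x \<partial>\<mu>)) \<in> ?B"
    by (intro measurable_cong nn_integral_add)
       (auto simp add: space_measure_algebra cong: measurable_cong_sets)
  with add show ?case by (simp add: ac_simps)
next
  case (seq F)
  then have "(\<lambda>\<mu>. \<integral>\<^sup>+x. (SUP i. F i) x \<partial>\<mu>) \<in> ?B \<longleftrightarrow> (\<lambda>\<mu>. SUP i. (\<integral>\<^sup>+x. F i x \<partial>\<mu>)) \<in> ?B"
    unfolding SUP_apply
    by (intro measurable_cong nn_integral_monotone_convergence_SUP)
       (auto simp add: space_measure_algebra cong: measurable_cong_sets)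
  with seq show ?case by (simp add: ac_simps)
qed

text \<open>Expresses the integral, including its default value 0 without integrability, through
  non-negative integrals, whose dependence on the measure is already known to be measurable.\<close>

lemma integral_eq_enn2real:
  fixes f :: "'a \<Rightarrow> real"
  assumes "f \<in> borel_measurable M"
  shows "(LINT x|M. f x) = (if (\<integral>\<^sup>+x. ennreal \<bar>f x\<bar> \<partial>M) < \<infinity>
    then enn2real (\<integral>\<^sup>+x. ennreal (f x) \<partial>M) - enn2real (\<integral>\<^sup>+x. ennreal (- f x) \<partial>M) else 0)"
  using assms real_lebesgue_integral_def[of M f] not_integrable_integral_eq[of M f]
  by (auto simp: integrable_iff_bounded)

lemma integral_measurable_measure_algebra [measurable]:
  fixes f :: "'a \<Rightarrow> real"
  assumes [measurable]: "f \<in> borel_measurable E"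
  shows "(\<lambda>\<mu>. integral\<^sup>L \<mu> f) \<in> borel_measurable (measure_algebra E)"
proof -
  have "(\<lambda>\<mu>. if (\<integral>\<^sup>+x. ennreal \<bar>f x\<bar> \<partial>\<mu>) < \<infinity>
    then enn2real (\<integral>\<^sup>+x. ennreal (f x) \<partial>\<mu>) - enn2real (\<integral>\<^sup>+x. ennreal (- f x) \<partial>\<mu>) else 0)
    \<in> borel_measurable (measure_algebra E)" by measurable
  then show ?thesis
    by (rule measurable_cong[THEN iffD1, rotated])
       (intro integral_eq_enn2real[symmetric], auto simp: space_measure_algebra cong: measurable_cong_sets)
qed

lemma measurable_path_eval [measurable]:
  "0 \<le> s \<Longrightarrow> (\<lambda>p. p s) \<in> path_space E \<rightarrow>\<^sub>M measure_algebra E"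
  unfolding path_space_def by (rule measurable_component_singleton) simp

lemma nn_integral_count_space_UNIV:
  "(\<integral>\<^sup>+u. f u \<partial>count_space A) = (\<integral>\<^sup>+u. (if u \<in> A then f u else 0) \<partial>count_space UNIV)"
  by (subst nn_integral_count_space_indicator) (auto intro!: nn_integral_cong simp: indicator_def)

lemma integral_count_space_UNIV:
  fixes f :: "'u \<Rightarrow> real"
  shows "(LINT u|count_space A. f u) = (LINT u|count_space UNIV. (if u \<in> A then f u else 0))"
proof -
  have "(LINT u|restrict_space (count_space UNIV) A. f u) = (LINT u|count_space UNIV. (if u \<in> A then f u else 0))"
    by (subst integral_restrict_space) (auto intro!: Bochner_Integration.integral_cong)
  then show ?thesis by (simp add: restrict_count_space)
qed

text \<open>Countability of the label type makes its counting measure sigma-finite and turns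
  measurability for each label into joint measurability.\<close>

lemma measurable_nn_integral_count_space:
  fixes f :: "'w \<Rightarrow> 'u::countable \<Rightarrow> ennreal"
  assumes "\<And>u. (\<lambda>w. f w u) \<in> borel_measurable M"
  shows "(\<lambda>w. \<integral>\<^sup>+u. f w u \<partial>count_space UNIV) \<in> borel_measurable M"
proof -
  interpret sigma_finite_measure "count_space (UNIV :: 'u set)"
    by (rule sigma_finite_measure_count_space)
  have "(\<lambda>(w, u). f w u) \<in> borel_measurable (M \<Otimes>\<^sub>M count_space UNIV)"
    unfolding split_beta'
    by (rule measurable_compose_countable'[where f = "\<lambda>u z. f (fst z) u" and g = snd and I = UNIV])
       (use assms in auto)
  then show ?thesis by (rule borel_measurable_nn_integral)
qed

section \<open>The branching property for finite sets of individuals\<close>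

locale branching =
  fixes B :: "('x, 'u::countable, 'w) branching_model"
  assumes branching_process: "branching_process B"
begin

abbreviation "E \<equiv> trait_space B"
abbreviation "M \<equiv> sample_space B"
abbreviation "P \<equiv> law B"
abbreviation (input) "Zf \<equiv> Zint B"
abbreviation (input) "Zp t f w \<equiv> \<integral>\<^sup>+y. ennreal (f y) \<partial>population B t w"

lemma law_measurable [measurable]: "P \<in> E \<rightarrow>\<^sub>M prob_algebra M"
  using branching_process unfolding branching_process_def by blast

lemma law_subprob_measurable [measurable]: "P \<in> E \<rightarrow>\<^sub>M subprob_algebra M"
  by (rule measurable_prob_algebraD) measurable

lemma prob_space_law: "x \<in> space E \<Longrightarrow> prob_space (P x)"
  and sets_law: "x \<in> space E \<Longrightarrow> sets (P x) = sets M"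
  using measurable_space[OF law_measurable] by (auto simp: space_prob_algebra)

lemma space_law: "x \<in> space E \<Longrightarrow> space (P x) = space M"
  using sets_law by (rule sets_eq_imp_space_eq)

lemma measurable_law: "x \<in> space E \<Longrightarrow> measurable (P x) N = measurable M N"
  using sets_law by (intro measurable_cong_sets) auto

lemma alive_sets [measurable]: "0 \<le> t \<Longrightarrow> Measurable.pred M (\<lambda>w. u \<in> alive B t w)"
  using branching_process unfolding branching_process_def pred_def by blast

lemma progeny_sets [measurable]:
  "0 \<le> t \<Longrightarrow> 0 \<le> s \<Longrightarrow> Measurable.pred M (\<lambda>w. v \<in> progeny B t u s w)"
  using branching_process unfolding branching_process_def pred_def by blast

lemma trait_measurable:
  "0 \<le> t \<Longrightarrow> trait B t u \<in> restrict_space M {w \<in> space M. u \<in> alive B t w} \<rightarrow>\<^sub>M E"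
  using branching_process unfolding branching_process_def by blast

lemma genealogy: "genealogy B"
  using branching_process unfolding branching_process_def by blast

lemma trait_space: "0 \<le> t \<Longrightarrow> w \<in> space M \<Longrightarrow> u \<in> alive B t w \<Longrightarrow> trait B t u w \<in> space E"
  using measurable_space[OF trait_measurable, of t w u] by (auto simp: space_restrict_space)

text \<open>A trait is measurable only on the event that its label is alive. Continuing a function
  of the trait by a constant off a smaller event \<open>Q\<close> gives a function measurable on the
  whole sample space.\<close>

lemma measurable_restricted_trait:
  assumes "0 \<le> t" and f: "f \<in> E \<rightarrow>\<^sub>M N" and "c \<in> space N" and Q: "Measurable.pred M Q"
    and "\<And>w. w \<in> space M \<Longrightarrow> Q w \<Longrightarrow> u \<in> alive B t w"
  shows "(\<lambda>w. if Q w then f (trait B t u w) else c) \<in> M \<rightarrow>\<^sub>M N"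
proof (subst measurable_If_restrict_space_iff)
  show "{w \<in> space M. Q w} \<in> sets M" using Q by (simp add: pred_def)
  have "(\<lambda>w. f (trait B t u w)) \<in> restrict_space M {w \<in> space M. u \<in> alive B t w} \<rightarrow>\<^sub>M N"
    by (rule measurable_compose[OF trait_measurable[OF \<open>0 \<le> t\<close>] f])
  then have "(\<lambda>w. f (trait B t u w)) \<in> restrict_space M {w \<in> space M. Q w} \<rightarrow>\<^sub>M N"
    by (rule measurable_restrict_mono) (use assms(5) in auto)
  \<comment> \<open>A restricted space depends on its set only through the intersection with
    \<open>space M\<close>; the rule for conditionals produces the set in the form
    \<open>{w. Q w}\<close>.\<close>
  moreover have "restrict_space M {w \<in> space M. Q w} = restrict_space M {w. Q w}"
  proof -
    have "(\<inter>) {w \<in> space M. Q w} ` sets M = (\<inter>) {w. Q w} ` sets M"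
      by (intro image_cong) (auto dest: sets.sets_into_space)
    moreover have "{w \<in> space M. Q w} \<inter> space M = {w. Q w} \<inter> space M" by auto
    ultimately show ?thesis by (simp only: restrict_space_def)
  qed
  ultimately show "(\<lambda>w. f (trait B t u w)) \<in> restrict_space M {w. Q w} \<rightarrow>\<^sub>M N \<and>
      (\<lambda>w. c) \<in> restrict_space M {w. \<not> Q w} \<rightarrow>\<^sub>M N"
    using \<open>c \<in> space N\<close> by simp
qed

lemma measurable_alive_trait [measurable]:
  assumes "0 \<le> t" "f \<in> E \<rightarrow>\<^sub>M N" "c \<in> space N"
  shows "(\<lambda>w. if u \<in> alive B t w then f (trait B t u w) else c) \<in> M \<rightarrow>\<^sub>M N"
  using assms by (intro measurable_restricted_trait) auto

lemma progenyD: "v \<in> progeny B t u s w \<Longrightarrow> v \<in> alive B (t + s) w"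
  by (simp add: progeny_def)

lemma sets_population [simp]: "sets (population B t w) = sets E"
  by (simp add: population_def point_measure_of_def)

lemma sets_subpopulation [simp]: "sets (subpopulation B t u s w) = sets E"
  by (simp add: subpopulation_def point_measure_of_def)

lemma nn_integral_population:
  assumes "\<phi> \<in> borel_measurable E" "0 \<le> t" "w \<in> space M"
  shows "(\<integral>\<^sup>+y. \<phi> y \<partial>population B t w)
    = (\<integral>\<^sup>+u. (if u \<in> alive B t w then \<phi> (trait B t u w) else 0) \<partial>count_space UNIV)"
  unfolding population_def point_measure_of_def
  using assms trait_space
  by (subst nn_integral_distr) (auto simp: nn_integral_count_space_UNIV[symmetric])

lemma nn_integral_subpopulation:
  assumes "\<phi> \<in> borel_measurable E" "0 \<le> t" "0 \<le> s" "w \<in> space M"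
  shows "(\<integral>\<^sup>+y. \<phi> y \<partial>subpopulation B t u s w)
    = (\<integral>\<^sup>+v. (if v \<in> progeny B t u s w then \<phi> (trait B (t + s) v w) else 0) \<partial>count_space UNIV)"
  unfolding subpopulation_def point_measure_of_def
  using assms trait_space[of "t + s" w] progenyD
  by (subst nn_integral_distr) (auto simp: nn_integral_count_space_UNIV[symmetric])

lemma integral_population:
  fixes \<phi> :: "'x \<Rightarrow> real"
  assumes "\<phi> \<in> borel_measurable E" "0 \<le> t" "w \<in> space M"
  shows "(LINT y|population B t w. \<phi> y)
    = (LINT u|count_space UNIV. (if u \<in> alive B t w then \<phi> (trait B t u w) else 0))"
  unfolding population_def point_measure_of_def
  using assms trait_space
  by (subst integral_distr) (auto simp: integral_count_space_UNIV[symmetric])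

lemma measurable_population [measurable]:
  assumes "0 \<le> t"
  shows "population B t \<in> M \<rightarrow>\<^sub>M measure_algebra E"
proof (rule measurable_measure_algebra)
  fix A assume A: "A \<in> sets E"
  have "(\<lambda>w. \<integral>\<^sup>+u. (if u \<in> alive B t w then indicator A (trait B t u w) else 0 :: ennreal) \<partial>count_space UNIV)
      \<in> borel_measurable M"
    using assms A by (intro measurable_nn_integral_count_space measurable_alive_trait) auto
  then show "(\<lambda>w. emeasure (population B t w) A) \<in> borel_measurable M"
    by (rule measurable_cong[THEN iffD1, rotated])
       (use A assms in \<open>simp add: nn_integral_population[symmetric]\<close>)
qed simp

lemma measurable_subpopulation [measurable]:
  assumes "0 \<le> t" "0 \<le> s"
  shows "subpopulation B t u s \<in> M \<rightarrow>\<^sub>M measure_algebra E"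
proof (rule measurable_measure_algebra)
  fix A assume A: "A \<in> sets E"
  have "(\<lambda>w. \<integral>\<^sup>+v. (if v \<in> progeny B t u s w then indicator A (trait B (t + s) v w) else 0 :: ennreal) \<partial>count_space UNIV)
      \<in> borel_measurable M"
    using assms A progenyD by (intro measurable_nn_integral_count_space measurable_restricted_trait) auto
  then show "(\<lambda>w. emeasure (subpopulation B t u s w) A) \<in> borel_measurable M"
    by (rule measurable_cong[THEN iffD1, rotated])
       (use A assms in \<open>simp add: nn_integral_subpopulation[symmetric]\<close>)
qed simp

lemma measurable_population_path [measurable]: "population_path B \<in> M \<rightarrow>\<^sub>M path_space E"
  unfolding path_space_def population_path_def by (rule measurable_restrict) simp

lemma measurable_subpopulation_path [measurable]:
  "0 \<le> t \<Longrightarrow> subpopulation_path B t u \<in> M \<rightarrow>\<^sub>M path_space E"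
  unfolding path_space_def subpopulation_path_def by (rule measurable_restrict) simp

lemma Zint_measurable [measurable]:
  "0 \<le> t \<Longrightarrow> f \<in> borel_measurable E \<Longrightarrow> Zf t f \<in> borel_measurable M"
  unfolding Zint_def by (rule measurable_compose[OF measurable_population integral_measurable_measure_algebra])

lemma ancestor_alive:
  assumes "w \<in> space M" "0 \<le> t" "0 \<le> s" "v \<in> alive B (t + s) w"
  shows "ancestor B t (t + s) v w \<in> alive B t w"
  using genealogy assms unfolding genealogy_def by auto

text \<open>Every individual at time \<open>t + s\<close> belongs to the progeny of exactly one individual alive at time \<open>t\<close>.\<close>

lemma nn_integral_population_split:
  assumes \<phi>: "\<phi> \<in> borel_measurable E" and "0 \<le> t" "0 \<le> s" "w \<in> space M"
  shows "(\<integral>\<^sup>+y. \<phi> y \<partial>population B (t + s) w)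
    = (\<integral>\<^sup>+u. (if u \<in> alive B t w then \<integral>\<^sup>+y. \<phi> y \<partial>subpopulation B t u s w else 0) \<partial>count_space UNIV)"
proof -
  let ?g = "\<lambda>u v. if u \<in> alive B t w \<and> v \<in> progeny B t u s w then \<phi> (trait B (t + s) v w) else 0"
  have one: "(\<integral>\<^sup>+u. ?g u v \<partial>count_space UNIV)
      = (if v \<in> alive B (t + s) w then \<phi> (trait B (t + s) v w) else 0)" for v
  proof -
    have "?g u v = (if v \<in> alive B (t + s) w then \<phi> (trait B (t + s) v w) else 0)
        * indicator {ancestor B t (t + s) v w} u" for u
      using ancestor_alive[OF assms(4,2,3), of v] by (auto simp: progeny_def indicator_def)
    then show ?thesis by (simp add: nn_integral_cmult)
  qed
  have "(\<integral>\<^sup>+u. (if u \<in> alive B t w then \<integral>\<^sup>+y. \<phi> y \<partial>subpopulation B t u s w else 0) \<partial>count_space UNIV)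
      = (\<integral>\<^sup>+u. \<integral>\<^sup>+v. ?g u v \<partial>count_space UNIV \<partial>count_space UNIV)"
    using assms by (intro nn_integral_cong) (auto simp: nn_integral_subpopulation)
  also have "\<dots> = (\<integral>\<^sup>+v. \<integral>\<^sup>+u. ?g u v \<partial>count_space UNIV \<partial>count_space UNIV)"
    by (subst nn_integral_count_space_nn_integral) auto
  also have "\<dots> = (\<integral>\<^sup>+y. \<phi> y \<partial>population B (t + s) w)"
    unfolding one using assms by (simp add: nn_integral_population)
  finally show ?thesis by simp
qed

section \<open>Conditional independence of the values of finitely many branches\<close>

definition branch_value :: "real \<Rightarrow> ((real \<Rightarrow> 'x measure) \<Rightarrow> real) \<Rightarrow> 'u \<Rightarrow> 'w \<Rightarrow> real" where
  "branch_value t p u w = (if u \<in> alive B t w then p (subpopulation_path B t u w) else 0)"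

definition path_law :: "((real \<Rightarrow> 'x measure) \<Rightarrow> real) \<Rightarrow> 'x \<Rightarrow> real measure" where
  "path_law p y = distr (P y) borel (\<lambda>w. p (population_path B w))"

text \<open>The conditional law of \<open>branch_value\<close> given the labelled population at time
  \<open>t\<close>. A dead label has value 0 and therefore the Dirac mass at 0, so that all labels
  can be treated alike.\<close>

definition branch_kernel :: "real \<Rightarrow> ((real \<Rightarrow> 'x measure) \<Rightarrow> real) \<Rightarrow> 'u \<Rightarrow> 'w \<Rightarrow> real measure" where
  "branch_kernel t p u w = (if u \<in> alive B t w then path_law p (trait B t u w) else return borel 0)"

lemma branch_value_measurable [measurable]:
  assumes [measurable]: "p \<in> borel_measurable (path_space E)" and "0 \<le> t"
  shows "branch_value t p u \<in> borel_measurable M"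
  unfolding branch_value_def using \<open>0 \<le> t\<close> by measurable

lemma real_distribution_path_law:
  assumes [measurable]: "p \<in> borel_measurable (path_space E)" and x: "x \<in> space E"
  shows "real_distribution (path_law p x)"
proof -
  interpret prob_space "P x" by (rule prob_space_law[OF x])
  have "(\<lambda>w. p (population_path B w)) \<in> borel_measurable (P x)" by (simp add: measurable_law[OF x])
  then show ?thesis
    unfolding path_law_def real_distribution_def real_distribution_axioms_def
    by (auto intro: prob_space_distr)
qed

lemma path_law_measurable [measurable]:
  assumes [measurable]: "p \<in> borel_measurable (path_space E)"
  shows "path_law p \<in> E \<rightarrow>\<^sub>M prob_algebra borel"
  unfolding path_law_def by measurable

lemma branch_kernel_measurable:
  assumes [measurable]: "p \<in> borel_measurable (path_space E)" and "0 \<le> t"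
  shows "branch_kernel t p u \<in> M \<rightarrow>\<^sub>M prob_algebra borel"
  unfolding branch_kernel_def using \<open>0 \<le> t\<close>
  by (intro measurable_alive_trait) (auto simp: space_prob_algebra prob_space_return)

lemma real_distribution_branch_kernel:
  assumes "p \<in> borel_measurable (path_space E)" and "0 \<le> t" "w \<in> space M"
  shows "real_distribution (branch_kernel t p u w)"
  using measurable_space[OF branch_kernel_measurable[OF assms(1,2)] assms(3), of u]
  by (auto simp: space_prob_algebra real_distribution_def real_distribution_axioms_def)

text \<open>Together with \<open>branch_prob\<close>, the real-valued factors of the two sides of
  the branching property; real values allow the subtractions by which dead labels are brought
  in.\<close>

definition branch_event :: "real \<Rightarrow> ('u \<Rightarrow> (real \<Rightarrow> 'x measure) set) \<Rightarrow> 'u \<Rightarrow> 'w \<Rightarrow> real" where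
  "branch_event t A u w = (if u \<in> alive B t w \<and> subpopulation_path B t u w \<in> A u then 1 else 0)"

definition branch_prob :: "real \<Rightarrow> ('u \<Rightarrow> (real \<Rightarrow> 'x measure) set) \<Rightarrow> 'u \<Rightarrow> 'w \<Rightarrow> real" where
  "branch_prob t A u w = (if u \<in> alive B t w
    then measure (P (trait B t u w)) {w' \<in> space M. population_path B w' \<in> A u} else 0)"

lemma branch_event_measurable:
  assumes "0 \<le> t" and [measurable]: "A u \<in> sets (path_space E)"
  shows "branch_event t A u \<in> borel_measurable M"
proof -
  have [measurable]: "Measurable.pred M (\<lambda>w. subpopulation_path B t u w \<in> A u)"
    using measurable_sets[OF measurable_subpopulation_path[OF assms(1)] assms(2), of u]
    by (simp add: pred_def vimage_def Int_def conj_commute)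
  show ?thesis unfolding branch_event_def using assms(1) by measurable
qed

lemma branch_prob_measurable:
  assumes "0 \<le> t" and [measurable]: "A u \<in> sets (path_space E)"
  shows "branch_prob t A u \<in> borel_measurable M"
proof -
  have "{w' \<in> space M. population_path B w' \<in> A u} \<in> sets M"
    using measurable_sets[OF measurable_population_path assms(2)]
    by (simp add: vimage_def Int_def conj_commute)
  then have "(\<lambda>y. measure (P y) {w' \<in> space M. population_path B w' \<in> A u}) \<in> borel_measurable E"
    by (intro measurable_compose[OF law_subprob_measurable measurable_measure_subprob_algebra])
  then show ?thesis unfolding branch_prob_def using assms(1) by measurable
qed

lemma branch_event_bounds: "0 \<le> branch_event t A u w" "branch_event t A u w \<le> 1"
  by (auto simp: branch_event_def)

lemma branch_prob_bounds:
  assumes "0 \<le> t" "w \<in> space M"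
  shows "0 \<le> branch_prob t A u w" "branch_prob t A u w \<le> 1"
  using assms trait_space prob_space.prob_le_1[OF prob_space_law] by (auto simp: branch_prob_def)

text \<open>This is the branching property with the whole space as event of the history. The traits
  stay inside the integral on the right, so it already describes the joint law of the branches as a
  mixture over the labelled populations at time \<open>t\<close>.\<close>

lemma integral_branch_event:
  assumes x: "x \<in> space E" and t: "0 \<le> t" and U: "finite U"
    and A: "\<And>u. u \<in> U \<Longrightarrow> A u \<in> sets (path_space E)"
  shows "(LINT w|P x. (\<Prod>u\<in>U. branch_event t A u w)) = (LINT w|P x. (\<Prod>u\<in>U. branch_prob t A u w))"
proof -
  interpret prob_space "P x" by (rule prob_space_law[OF x])
  have m1: "(\<lambda>w. \<Prod>u\<in>U. branch_event t A u w) \<in> borel_measurable (P x)"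
    unfolding measurable_law[OF x] using A t by (intro borel_measurable_prod branch_event_measurable) auto
  have m2: "(\<lambda>w. \<Prod>u\<in>U. branch_prob t A u w) \<in> borel_measurable (P x)"
    unfolding measurable_law[OF x] using A t by (intro borel_measurable_prod branch_prob_measurable) auto
  let ?S = "{w \<in> space M. \<forall>u\<in>U. u \<in> alive B t w \<and> subpopulation_path B t u w \<in> A u}"
  have ind: "ennreal (\<Prod>u\<in>U. branch_event t A u w) = indicator ?S w" if "w \<in> space M" for w
  proof (cases "w \<in> ?S")
    case True
    then show ?thesis by (simp add: branch_event_def)
  next
    case False
    then obtain u where "u \<in> U" "branch_event t A u w = 0" using \<open>w \<in> space M\<close> by (auto simp: branch_event_def)
    then have "(\<Prod>u\<in>U. branch_event t A u w) = 0" using U by (auto intro!: prod_zero)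
    then show ?thesis using False by simp
  qed
  have S: "?S \<in> sets (P x)"
    unfolding sets_law[OF x]
  proof (rule sets.sets_Collect_finite_All[OF _ U])
    fix u assume "u \<in> U"
    have "{w \<in> space M. u \<in> alive B t w \<and> subpopulation_path B t u w \<in> A u}
        = {w \<in> space M. u \<in> alive B t w} \<inter> (subpopulation_path B t u -` A u \<inter> space M)" by auto
    then show "{w \<in> space M. u \<in> alive B t w \<and> subpopulation_path B t u w \<in> A u} \<in> sets M"
      using measurable_sets[OF measurable_subpopulation_path[OF t] A[OF \<open>u \<in> U\<close>]] alive_sets[OF t, of u]
      by (auto simp: pred_def)
  qed
  have bp: "branching_property B" using branching_process unfolding branching_process_def by blast
  have H: "space M \<in> history B t"
    by (simp add: history_def sigma_sets_top)
  have "(\<integral>\<^sup>+w. ennreal (\<Prod>u\<in>U. branch_event t A u w) \<partial>P x) = (\<integral>\<^sup>+w. indicator ?S w \<partial>P x)"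
    by (intro nn_integral_cong) (simp add: ind space_law[OF x])
  also have "\<dots> = emeasure (P x) ?S" using S by simp
  also have "\<dots> = (\<integral>\<^sup>+ w. indicator (space M) w *
           (\<Prod>u\<in>U. indicator (alive B t w) u *
              emeasure (P (trait B t u w)) {w' \<in> space M. population_path B w' \<in> A u}) \<partial>P x)"
    using bp[unfolded branching_property_def, THEN bspec, OF x, THEN spec, THEN mp, OF t, THEN spec, THEN spec, THEN spec,
      THEN mp, OF conjI[OF U conjI[OF ballI[OF A] H]]]
    unfolding Set.Collect_conj_eq[symmetric] by (simp only: ball_conj_distrib)
  also have "\<dots> = (\<integral>\<^sup>+w. ennreal (\<Prod>u\<in>U. branch_prob t A u w) \<partial>P x)"
  proof (intro nn_integral_cong)
    fix w assume "w \<in> space (P x)"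
    then have w: "w \<in> space M" by (simp add: space_law[OF x])
    have "indicator (alive B t w) u * emeasure (P (trait B t u w)) {w' \<in> space M. population_path B w' \<in> A u}
        = ennreal (branch_prob t A u w)" for u
    proof (cases "u \<in> alive B t w")
      case True
      interpret T: prob_space "P (trait B t u w)" by (rule prob_space_law[OF trait_space[OF t w True]])
      show ?thesis using True by (simp add: branch_prob_def T.emeasure_eq_measure)
    qed (simp add: branch_prob_def)
    then show "indicator (space M) w * (\<Prod>u\<in>U. indicator (alive B t w) u *
              emeasure (P (trait B t u w)) {w' \<in> space M. population_path B w' \<in> A u})
        = ennreal (\<Prod>u\<in>U. branch_prob t A u w)"
      using w branch_prob_bounds[OF t w] by (simp add: prod_ennreal)
  qed
  finally have eq: "(\<integral>\<^sup>+w. ennreal (\<Prod>u\<in>U. branch_event t A u w) \<partial>P x)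
      = (\<integral>\<^sup>+w. ennreal (\<Prod>u\<in>U. branch_prob t A u w) \<partial>P x)" .
  show ?thesis
    using m1 m2 eq branch_prob_bounds(1)[OF t]
    by (subst (1 2) integral_eq_nn_integral)
       (auto simp: space_law[OF x] intro!: prod_nonneg branch_event_bounds)
qed

definition value_event :: "real \<Rightarrow> ((real \<Rightarrow> 'x measure) \<Rightarrow> real) \<Rightarrow> ('u \<Rightarrow> real set) \<Rightarrow> 'u \<Rightarrow> 'w \<Rightarrow> real" where
  "value_event t p C u w = indicator (C u) (branch_value t p u w)"

definition value_prob :: "real \<Rightarrow> ((real \<Rightarrow> 'x measure) \<Rightarrow> real) \<Rightarrow> ('u \<Rightarrow> real set) \<Rightarrow> 'u \<Rightarrow> 'w \<Rightarrow> real" where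
  "value_prob t p C u w = measure (branch_kernel t p u w) (C u)"

text \<open>An individual that is not alive contributes the value \<open>0\<close>; the events of its value are thus
  linear combinations of the events to which the branching property applies.\<close>

lemma value_event_eq:
  assumes "w \<in> space M" "0 \<le> t"
  shows "value_event t p C u w = branch_event t (\<lambda>_. p -` C u \<inter> space (path_space E)) u w
    + indicator (C u) 0 * (1 - branch_event t (\<lambda>_. space (path_space E)) u w)"
  using measurable_space[OF measurable_subpopulation_path assms(1), of t u] assms(2)
  by (auto simp: value_event_def branch_event_def branch_value_def)

text \<open>The counterpart of \<open>value_event_eq\<close> for conditional probabilities: for a
  living label the whole path space has probability 1 and the second term vanishes, for a dead one
  the Dirac mass at 0 is left.\<close>

lemma value_prob_eq:
  assumes w: "w \<in> space M" and t: "0 \<le> t" and p [measurable]: "p \<in> borel_measurable (path_space E)"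
    and C: "C u \<in> sets borel"
  shows "value_prob t p C u w = branch_prob t (\<lambda>_. p -` C u \<inter> space (path_space E)) u w
    + indicator (C u) 0 * (1 - branch_prob t (\<lambda>_. space (path_space E)) u w)"
proof (cases "u \<in> alive B t w")
  case True
  note y = trait_space[OF t w True]
  interpret T: prob_space "P (trait B t u w)" by (rule prob_space_law[OF y])
  have "{w' \<in> space M. population_path B w' \<in> space (path_space E)} = space (P (trait B t u w))"
    using measurable_space[OF measurable_population_path] by (auto simp: space_law[OF y])
  moreover have "(\<lambda>w. p (population_path B w)) \<in> borel_measurable (P (trait B t u w))"
    by (simp add: measurable_law[OF y])
  then have "measure (path_law p (trait B t u w)) (C u)
      = measure (P (trait B t u w)) {w' \<in> space M. population_path B w' \<in> p -` C u \<inter> space (path_space E)}"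
    unfolding path_law_def using C measurable_space[OF measurable_population_path]
    by (subst measure_distr) (auto simp: space_law[OF y] intro!: arg_cong[where f = "measure _"])
  ultimately show ?thesis using True by (simp add: value_prob_def branch_kernel_def branch_prob_def T.prob_space)
next
  case False
  then show ?thesis using C by (simp add: value_prob_def branch_kernel_def branch_prob_def measure_return)
qed

lemma value_event_measurable:
  assumes "0 \<le> t" "p \<in> borel_measurable (path_space E)" "C u \<in> sets borel"
  shows "value_event t p C u \<in> borel_measurable M"
  unfolding value_event_def using assms
  by (intro measurable_compose[OF branch_value_measurable borel_measurable_indicator]) auto

lemma value_prob_measurable:
  assumes "0 \<le> t" "p \<in> borel_measurable (path_space E)" "C u \<in> sets borel"
  shows "value_prob t p C u \<in> borel_measurable M"
  unfolding value_prob_def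
  by (rule measurable_compose[OF measurable_prob_algebraD[OF branch_kernel_measurable[OF assms(2,1)]]
    measurable_measure_subprob_algebra[OF assms(3)]])

lemma value_prob_bounds:
  assumes "0 \<le> t" "w \<in> space M" "p \<in> borel_measurable (path_space E)"
  shows "0 \<le> value_prob t p C u w" "value_prob t p C u w \<le> 1"
proof -
  interpret real_distribution "branch_kernel t p u w" using assms by (intro real_distribution_branch_kernel)
  show "0 \<le> value_prob t p C u w" "value_prob t p C u w \<le> 1" by (auto simp: value_prob_def)
qed

text \<open>Induction over \<open>D\<close>, moving one label at a time to \<open>U\<close>. The
  value event of \<open>e\<close> is a path event, plus a constant times the complement of being
  alive; linearity leaves three integrals with \<open>D\<close> smaller, so \<open>U\<close> and
  \<open>A\<close> have to be arbitrary.\<close>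

lemma integral_value_event:
  assumes x: "x \<in> space E" and t: "0 \<le> t" and p: "p \<in> borel_measurable (path_space E)"
    and "finite D" "finite U" "U \<inter> D = {}" "\<And>u. u \<in> U \<Longrightarrow> A u \<in> sets (path_space E)"
    and C: "\<And>u. u \<in> D \<Longrightarrow> C u \<in> sets borel"
  shows "(LINT w|P x. (\<Prod>u\<in>U. branch_event t A u w) * (\<Prod>u\<in>D. value_event t p C u w))
    = (LINT w|P x. (\<Prod>u\<in>U. branch_prob t A u w) * (\<Prod>u\<in>D. value_prob t p C u w))"
  using assms(4-8)
proof (induction D arbitrary: U A rule: finite_induct)
  case empty
  then show ?case using integral_branch_event[OF x t, of U A] by simp
next
  case (insert e D)
  interpret prob_space "P x" by (rule prob_space_law[OF x])
  \<comment> \<open>\<open>A1\<close> asks that \<open>e\<close> is alive with value in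
    \<open>C e\<close>, \<open>A2\<close> merely that it is alive; \<open>c\<close> records whether
    \<open>C e\<close> contains 0, the value of a dead label.\<close>
  define A1 where "A1 = A(e := p -` C e \<inter> space (path_space E))"
  define A2 where "A2 = A(e := space (path_space E))"
  define c :: real where "c = indicator (C e) 0"
  have A1: "A1 u \<in> sets (path_space E)" and A2: "A2 u \<in> sets (path_space E)" if "u \<in> insert e U" for u
    using that insert.prems measurable_sets[OF p, of "C e"] by (auto simp: A1_def A2_def)
  have e: "e \<notin> U" using insert.prems by auto
  let ?b = "\<lambda>A U w. (\<Prod>u\<in>U. branch_event t A u w) * (\<Prod>u\<in>D. value_event t p C u w)"
  let ?\<beta> = "\<lambda>A U w. (\<Prod>u\<in>U. branch_prob t A u w) * (\<Prod>u\<in>D. value_prob t p C u w)"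
  have C: "C u \<in> sets borel" if "u \<in> insert e D" for u using insert.prems that by auto
  have ib: "integrable (P x) (?b A' U')" if "finite U'" "\<And>u. u \<in> U' \<Longrightarrow> A' u \<in> sets (path_space E)" for A' U'
  proof (rule integrable_const_bound[where B = 1])
    show "?b A' U' \<in> borel_measurable (P x)"
      unfolding measurable_law[OF x] using that C t p
      by (intro borel_measurable_times borel_measurable_prod branch_event_measurable value_event_measurable) auto
    have "\<bar>?b A' U' w\<bar> \<le> 1" for w
      unfolding abs_mult abs_prod
      by (intro mult_le_one prod_le_1 prod_nonneg)
         (auto simp: branch_event_def value_event_def indicator_def)
    then show "AE w in P x. norm (?b A' U' w) \<le> 1" by simp
  qed
  have i\<beta>: "integrable (P x) (?\<beta> A' U')" if "finite U'" "\<And>u. u \<in> U' \<Longrightarrow> A' u \<in> sets (path_space E)" for A' U'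
  proof (rule integrable_const_bound[where B = 1])
    show "?\<beta> A' U' \<in> borel_measurable (P x)"
      unfolding measurable_law[OF x] using that C t p
      by (intro borel_measurable_times borel_measurable_prod branch_prob_measurable value_prob_measurable) auto
    have "\<bar>?\<beta> A' U' w\<bar> \<le> 1" if "w \<in> space M" for w
      unfolding abs_mult abs_prod using branch_prob_bounds[OF t that] value_prob_bounds[OF t that p]
      by (intro mult_le_one prod_le_1 prod_nonneg) auto
    then show "AE w in P x. norm (?\<beta> A' U' w) \<le> 1" by (auto simp: space_law[OF x])
  qed
  have lin: "(LINT w|P x. f w + (c * g w - c * h w))
      = (LINT w|P x. f w) + (c * (LINT w|P x. g w) - c * (LINT w|P x. h w))"
    if "integrable (P x) f" "integrable (P x) g" "integrable (P x) h" for f g h :: "'w \<Rightarrow> real"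
    using that by simp
  have s1: "(\<Prod>u\<in>U. branch_event t A1 u w) = (\<Prod>u\<in>U. branch_event t A u w)"
    "(\<Prod>u\<in>U. branch_event t A2 u w) = (\<Prod>u\<in>U. branch_event t A u w)"
    "(\<Prod>u\<in>U. branch_prob t A1 u w) = (\<Prod>u\<in>U. branch_prob t A u w)"
    "(\<Prod>u\<in>U. branch_prob t A2 u w) = (\<Prod>u\<in>U. branch_prob t A u w)" for w
    using e by (auto intro!: prod.cong simp: A1_def A2_def branch_event_def branch_prob_def)
  have ev: "branch_event t A1 e w = branch_event t (\<lambda>_. p -` C e \<inter> space (path_space E)) e w"
    "branch_event t A2 e w = branch_event t (\<lambda>_. space (path_space E)) e w"
    "branch_prob t A1 e w = branch_prob t (\<lambda>_. p -` C e \<inter> space (path_space E)) e w"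
    "branch_prob t A2 e w = branch_prob t (\<lambda>_. space (path_space E)) e w" for w
    by (auto simp: A1_def A2_def branch_event_def branch_prob_def)
  have "(LINT w|P x. (\<Prod>u\<in>U. branch_event t A u w) * (\<Prod>u\<in>insert e D. value_event t p C u w))
      = (LINT w|P x. ?b A1 (insert e U) w + (c * ?b A U w - c * ?b A2 (insert e U) w))"
  proof (intro Bochner_Integration.integral_cong refl)
    fix w assume "w \<in> space (P x)"
    then have "w \<in> space M" by (simp add: space_law[OF x])
    from value_event_eq[OF this t, of p C e]
    have "value_event t p C e w = branch_event t A1 e w + c * (1 - branch_event t A2 e w)"
      by (simp add: ev c_def)
    then show "(\<Prod>u\<in>U. branch_event t A u w) * (\<Prod>u\<in>insert e D. value_event t p C u w)
        = ?b A1 (insert e U) w + (c * ?b A U w - c * ?b A2 (insert e U) w)"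
      unfolding prod.insert[OF insert.hyps] prod.insert[OF \<open>finite U\<close> e] s1 by (simp only: ring_distribs ac_simps mult_1)
  qed
  also have "\<dots> = (LINT w|P x. ?b A1 (insert e U) w) + (c * (LINT w|P x. ?b A U w) - c * (LINT w|P x. ?b A2 (insert e U) w))"
    using insert.prems A1 A2 by (intro lin ib) auto
  also have "\<dots> = (LINT w|P x. ?\<beta> A1 (insert e U) w) + (c * (LINT w|P x. ?\<beta> A U w) - c * (LINT w|P x. ?\<beta> A2 (insert e U) w))"
  proof -
    have "(LINT w|P x. ?b A1 (insert e U) w) = (LINT w|P x. ?\<beta> A1 (insert e U) w)"
      by (rule insert.IH) (use insert.prems insert.hyps A1 in auto)
    moreover have "(LINT w|P x. ?b A2 (insert e U) w) = (LINT w|P x. ?\<beta> A2 (insert e U) w)"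
      by (rule insert.IH) (use insert.prems insert.hyps A2 in auto)
    moreover have "(LINT w|P x. ?b A U w) = (LINT w|P x. ?\<beta> A U w)"
      by (rule insert.IH) (use insert.prems insert.hyps in auto)
    ultimately show ?thesis by (simp only:)
  qed
  also have "\<dots> = (LINT w|P x. ?\<beta> A1 (insert e U) w + (c * ?\<beta> A U w - c * ?\<beta> A2 (insert e U) w))"
    using insert.prems A1 A2 by (intro lin[symmetric] i\<beta>) auto
  also have "\<dots> = (LINT w|P x. (\<Prod>u\<in>U. branch_prob t A u w) * (\<Prod>u\<in>insert e D. value_prob t p C u w))"
  proof (intro Bochner_Integration.integral_cong refl)
    fix w assume "w \<in> space (P x)"
    then have "w \<in> space M" by (simp add: space_law[OF x])
    from value_prob_eq[OF this t p, of C e] C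
    have "value_prob t p C e w = branch_prob t A1 e w + c * (1 - branch_prob t A2 e w)"
      by (simp add: ev c_def)
    then show "?\<beta> A1 (insert e U) w + (c * ?\<beta> A U w - c * ?\<beta> A2 (insert e U) w)
        = (\<Prod>u\<in>U. branch_prob t A u w) * (\<Prod>u\<in>insert e D. value_prob t p C u w)"
      unfolding prod.insert[OF insert.hyps] prod.insert[OF \<open>finite U\<close> e] s1 by (simp only: ring_distribs ac_simps mult_1)
  qed
  finally show ?case .
qed

text \<open>Rectangles generate the product and are stable under intersection, and the measure of a
  rectangle is a finite product of measurable functions.\<close>

lemma kernel_PiM_measurable:
  assumes "0 \<le> t" and p: "p \<in> borel_measurable (path_space E)" and U: "finite U"
  shows "(\<lambda>w. \<Pi>\<^sub>M u\<in>U. branch_kernel t p u w) \<in> M \<rightarrow>\<^sub>M prob_algebra (\<Pi>\<^sub>M u\<in>U. borel)"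
proof (rule measurable_prob_algebra_generated[where \<Omega> = "\<Pi>\<^sub>E u\<in>U. space (borel :: real measure)"
    and G = "prod_algebra U (\<lambda>_. borel :: real measure)"])
  note R = real_distribution_branch_kernel[OF p \<open>0 \<le> t\<close>]
  have sK: "sets (branch_kernel t p u w) = sets borel" "space (branch_kernel t p u w) = UNIV" if "w \<in> space M" for w u
  proof -
    interpret K: real_distribution "branch_kernel t p u w" by (rule R[OF that])
    show "sets (branch_kernel t p u w) = sets borel" "space (branch_kernel t p u w) = UNIV" by auto
  qed
  show "sets (\<Pi>\<^sub>M u\<in>U. (borel :: real measure)) = sigma_sets (\<Pi>\<^sub>E u\<in>U. space borel) (prod_algebra U (\<lambda>_. borel))"
    by (rule sets_PiM)
  show "Int_stable (prod_algebra U (\<lambda>_. borel :: real measure))" by (rule Int_stable_prod_algebra)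
  show "prod_algebra U (\<lambda>_. borel :: real measure) \<subseteq> Pow (\<Pi>\<^sub>E u\<in>U. space borel)" by (rule prod_algebra_sets_into_space)
  show "prob_space (\<Pi>\<^sub>M u\<in>U. branch_kernel t p u w)" if "w \<in> space M" for w
    using R[OF that] by (intro prob_space_PiM) (auto simp: real_distribution_def)
  show "sets (\<Pi>\<^sub>M u\<in>U. branch_kernel t p u w) = sets (\<Pi>\<^sub>M u\<in>U. (borel :: real measure))" if "w \<in> space M" for w
    using sK[OF that] by (intro sets_PiM_cong) auto
  fix A assume "A \<in> prod_algebra U (\<lambda>_. borel :: real measure)"
  then obtain C where A: "A = (\<Pi>\<^sub>E u\<in>U. C u)" and C: "\<And>u. u \<in> U \<Longrightarrow> C u \<in> sets borel"
    using U by (auto simp: prod_algebra_eq_finite)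
  have "(\<lambda>w. \<Prod>u\<in>U. emeasure (branch_kernel t p u w) (C u)) \<in> borel_measurable M"
    using C by (intro borel_measurable_prod_ennreal
      measurable_compose[OF measurable_prob_algebraD[OF branch_kernel_measurable[OF p \<open>0 \<le> t\<close>]] measurable_emeasure_subprob_algebra])
  then show "(\<lambda>w. emeasure (\<Pi>\<^sub>M u\<in>U. branch_kernel t p u w) A) \<in> borel_measurable M"
  proof (rule measurable_cong[THEN iffD1, rotated])
    fix w assume w: "w \<in> space M"
    interpret Q: product_prob_space "\<lambda>u. branch_kernel t p u w" U
      using R[OF w] by (intro product_prob_spaceI) (simp add: real_distribution_def)
    show "(\<Prod>u\<in>U. emeasure (branch_kernel t p u w) (C u)) = emeasure (\<Pi>\<^sub>M u\<in>U. branch_kernel t p u w) A"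
      unfolding A using U C sK[OF w] by (subst Q.emeasure_PiM) auto
  qed
qed

text \<open>Both measures give the same mass to rectangles by \<open>integral_value_event\<close>,
  and rectangles determine a finite measure on a finite product. From here on the branches are
  independent given the population, without events of being alive.\<close>

lemma distr_branch_values:
  assumes x: "x \<in> space E" and t: "0 \<le> t" and p: "p \<in> borel_measurable (path_space E)" and U: "finite U"
  shows "distr (P x) (\<Pi>\<^sub>M u\<in>U. borel) (\<lambda>w. \<lambda>u\<in>U. branch_value t p u w)
    = P x \<bind> (\<lambda>w. \<Pi>\<^sub>M u\<in>U. branch_kernel t p u w)" (is "?L = ?R")
proof (rule measure_eqI_PiM_finite[OF U, where A = "\<lambda>_. space (\<Pi>\<^sub>M u\<in>U. (borel :: real measure))"])
  interpret prob_space "P x" by (rule prob_space_law[OF x])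
  note R = real_distribution_branch_kernel[OF p t]
  note K = kernel_PiM_measurable[OF t p U]
  have KP: "(\<lambda>w. \<Pi>\<^sub>M u\<in>U. branch_kernel t p u w) \<in> P x \<rightarrow>\<^sub>M subprob_algebra (\<Pi>\<^sub>M u\<in>U. borel)"
    unfolding measurable_law[OF x] by (rule measurable_prob_algebraD[OF K])
  have mL: "(\<lambda>w. \<lambda>u\<in>U. branch_value t p u w) \<in> P x \<rightarrow>\<^sub>M (\<Pi>\<^sub>M u\<in>U. borel)"
    unfolding measurable_law[OF x] using t p by measurable
  show "sets ?L = sets (\<Pi>\<^sub>M u\<in>U. borel)" by simp
  show "sets ?R = sets (\<Pi>\<^sub>M u\<in>U. borel)"
    by (rule sets_bind[OF sets_kernel[OF KP] not_empty])
  show "range (\<lambda>_. space (\<Pi>\<^sub>M u\<in>U. (borel :: real measure))) \<subseteq> prod_algebra U (\<lambda>_. borel)"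
    using U by (auto simp: space_PiM prod_algebra_eq_finite)
  show "(\<Union>i :: nat. space (\<Pi>\<^sub>M u\<in>U. (borel :: real measure))) = space (\<Pi>\<^sub>M u\<in>U. borel)" by simp
  show "emeasure ?L (space (\<Pi>\<^sub>M u\<in>U. borel)) \<noteq> \<infinity>" 
    using prob_space.emeasure_space_1[OF prob_space_distr[OF mL]] by simp
  fix C :: "'u \<Rightarrow> real set" assume C: "\<And>u. u \<in> U \<Longrightarrow> C u \<in> sets borel"
  have "emeasure ?L (Pi\<^sub>E U C) = (\<integral>\<^sup>+w. indicator (Pi\<^sub>E U C) (\<lambda>u\<in>U. branch_value t p u w) \<partial>P x)"
    using C U sets_PiM_I_finite[OF U C]
    by (subst nn_integral_distr[symmetric, OF mL]) auto
  \<comment> \<open>The product over the empty set brings the integrand into the shape of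
    \<open>integral_value_event\<close>, with no path events left to prescribe.\<close>
  also have "\<dots> = (\<integral>\<^sup>+w. ennreal ((\<Prod>u\<in>{}. branch_event t (\<lambda>_. {}) u w) * (\<Prod>u\<in>U. value_event t p C u w)) \<partial>P x)"
  proof (rule nn_integral_cong)
    fix w
    show "indicator (Pi\<^sub>E U C) (\<lambda>u\<in>U. branch_value t p u w)
        = ennreal ((\<Prod>u\<in>{}. branch_event t (\<lambda>_. {}) u w) * (\<Prod>u\<in>U. value_event t p C u w))"
    proof (cases "\<forall>u\<in>U. branch_value t p u w \<in> C u")
      case True
      then show ?thesis by (auto simp: value_event_def PiE_iff)
    next
      case False
      then have "(\<Prod>u\<in>U. value_event t p C u w) = 0" using U by (simp add: prod_zero_iff value_event_def indicator_eq_0_iff)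
      then show ?thesis using False by (auto simp: PiE_iff)
    qed
  qed
  also have "\<dots> = ennreal (LINT w|P x. (\<Prod>u\<in>{}. branch_event t (\<lambda>_. {}) u w) * (\<Prod>u\<in>U. value_event t p C u w))"
  proof (rule nn_integral_eq_integral)
    show "integrable (P x) (\<lambda>w. (\<Prod>u\<in>{}. branch_event t (\<lambda>_. {}) u w) * (\<Prod>u\<in>U. value_event t p C u w))"
    proof (rule integrable_const_bound[where B = 1])
      show "(\<lambda>w. (\<Prod>u\<in>{}. branch_event t (\<lambda>_. {}) u w) * (\<Prod>u\<in>U. value_event t p C u w)) \<in> borel_measurable (P x)"
        unfolding measurable_law[OF x] using C t p
        by (intro borel_measurable_times borel_measurable_prod value_event_measurable) auto
    qed (auto simp: abs_prod value_event_def intro!: AE_I2 prod_le_1)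
  qed (auto simp: value_event_def intro!: AE_I2 prod_nonneg)
  also have "\<dots> = ennreal (LINT w|P x. (\<Prod>u\<in>{}. branch_prob t (\<lambda>_. {}) u w) * (\<Prod>u\<in>U. value_prob t p C u w))"
    by (subst integral_value_event[OF x t p U]) (use C in auto)
  also have "\<dots> = (\<integral>\<^sup>+w. ennreal ((\<Prod>u\<in>{}. branch_prob t (\<lambda>_. {}) u w) * (\<Prod>u\<in>U. value_prob t p C u w)) \<partial>P x)"
  proof (rule nn_integral_eq_integral[symmetric])
    show "integrable (P x) (\<lambda>w. (\<Prod>u\<in>{}. branch_prob t (\<lambda>_. {}) u w) * (\<Prod>u\<in>U. value_prob t p C u w))"
    proof (rule integrable_const_bound[where B = 1])
      show "(\<lambda>w. (\<Prod>u\<in>{}. branch_prob t (\<lambda>_. {}) u w) * (\<Prod>u\<in>U. value_prob t p C u w)) \<in> borel_measurable (P x)"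
        unfolding measurable_law[OF x] using C t p
        by (intro borel_measurable_times borel_measurable_prod value_prob_measurable) auto
    qed (use value_prob_bounds[OF t _ p] in \<open>auto simp: abs_prod space_law[OF x] intro!: AE_I2 prod_le_1\<close>)
  qed (use value_prob_bounds[OF t _ p] in \<open>auto simp: space_law[OF x] intro!: AE_I2 prod_nonneg\<close>)
  also have "\<dots> = (\<integral>\<^sup>+w. emeasure (\<Pi>\<^sub>M u\<in>U. branch_kernel t p u w) (Pi\<^sub>E U C) \<partial>P x)"
  proof (rule nn_integral_cong)
    fix w assume "w \<in> space (P x)"
    then have w: "w \<in> space M" by (simp add: space_law[OF x])
    have sK: "sets (branch_kernel t p u w) = sets borel" for u
    proof -
      interpret K: real_distribution "branch_kernel t p u w" by (rule R[OF w])
      show ?thesis by auto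
    qed
    interpret Q: product_prob_space "\<lambda>u. branch_kernel t p u w" U
      using R[OF w] by (intro product_prob_spaceI) (simp add: real_distribution_def)
    have "emeasure (\<Pi>\<^sub>M u\<in>U. branch_kernel t p u w) (Pi\<^sub>E U C) = (\<Prod>u\<in>U. emeasure (branch_kernel t p u w) (C u))"
      using U C sK by (subst Q.emeasure_PiM) auto
    also have "\<dots> = (\<Prod>u\<in>U. ennreal (value_prob t p C u w))"
      by (simp add: value_prob_def Q.M.emeasure_eq_measure)
    also have "\<dots> = ennreal (\<Prod>u\<in>U. value_prob t p C u w)"
      by (rule prod_ennreal) (rule value_prob_bounds(1)[OF t w p])
    finally show "ennreal ((\<Prod>u\<in>{}. branch_prob t (\<lambda>_. {}) u w) * (\<Prod>u\<in>U. value_prob t p C u w))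
        = emeasure (\<Pi>\<^sub>M u\<in>U. branch_kernel t p u w) (Pi\<^sub>E U C)" by simp
  qed
  also have "\<dots> = emeasure ?R (Pi\<^sub>E U C)"
    using sets_PiM_I_finite[OF U C] by (subst emeasure_bind[OF not_empty KP]) auto
  finally show "emeasure ?L (Pi\<^sub>E U C) = emeasure ?R (Pi\<^sub>E U C)" .
qed

section \<open>Laws of sums over finitely many branches\<close>

definition kernel_sum :: "real \<Rightarrow> ((real \<Rightarrow> 'x measure) \<Rightarrow> real) \<Rightarrow> 'u set \<Rightarrow> 'w \<Rightarrow> real measure" where
  "kernel_sum t p U w = sum_law U (\<lambda>u. branch_kernel t p u w)"

lemma kernel_sum_measurable:
  assumes "0 \<le> t" "p \<in> borel_measurable (path_space E)" "finite U"
  shows "kernel_sum t p U \<in> M \<rightarrow>\<^sub>M prob_algebra borel"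
  unfolding kernel_sum_def sum_law_def
  by (rule measurable_compose[OF kernel_PiM_measurable[OF assms] measurable_distr_prob_space])
     (auto intro!: measurable_sum_PiM)

lemma distr_branch_sum:
  assumes x: "x \<in> space E" and t: "0 \<le> t" and p: "p \<in> borel_measurable (path_space E)" and U: "finite U"
  shows "distr (P x) borel (\<lambda>w. \<Sum>u\<in>U. branch_value t p u w) = P x \<bind> kernel_sum t p U"
proof -
  interpret prob_space "P x" by (rule prob_space_law[OF x])
  have KP: "(\<lambda>w. \<Pi>\<^sub>M u\<in>U. branch_kernel t p u w) \<in> P x \<rightarrow>\<^sub>M subprob_algebra (\<Pi>\<^sub>M u\<in>U. borel)"
    unfolding measurable_law[OF x] by (rule measurable_prob_algebraD[OF kernel_PiM_measurable[OF t p U]])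
  have mL: "(\<lambda>w. \<lambda>u\<in>U. branch_value t p u w) \<in> P x \<rightarrow>\<^sub>M (\<Pi>\<^sub>M u\<in>U. borel)"
    unfolding measurable_law[OF x] using t p by measurable
  have s: "(\<lambda>z. \<Sum>u\<in>U. z u) \<in> borel_measurable (\<Pi>\<^sub>M u\<in>U. (borel :: real measure))"
    by (rule measurable_sum_PiM) simp
  have "distr (P x) borel (\<lambda>w. \<Sum>u\<in>U. branch_value t p u w)
      = distr (distr (P x) (\<Pi>\<^sub>M u\<in>U. borel) (\<lambda>w. \<lambda>u\<in>U. branch_value t p u w)) borel (\<lambda>z. \<Sum>u\<in>U. z u)"
    by (subst distr_distr[OF s mL]) (auto intro!: distr_cong)
  also have "\<dots> = distr (P x \<bind> (\<lambda>w. \<Pi>\<^sub>M u\<in>U. branch_kernel t p u w)) borel (\<lambda>z. \<Sum>u\<in>U. z u)"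
    by (simp add: distr_branch_values[OF assms])
  also have "\<dots> = P x \<bind> kernel_sum t p U"
    unfolding kernel_sum_def sum_law_def by (rule distr_bind[OF KP not_empty s])
  finally show ?thesis .
qed

text \<open>Stated for non-negative integrands, to serve for moments not yet known to be finite; the
  companion \<open>integral_branch_sum\<close> serves for bounded signed integrands.\<close>

lemma nn_integral_branch_sum:
  assumes x: "x \<in> space E" and t: "0 \<le> t" and p [measurable]: "p \<in> borel_measurable (path_space E)" and U: "finite U"
    and G: "G \<in> borel_measurable borel"
  shows "(\<integral>\<^sup>+w. G (\<Sum>u\<in>U. branch_value t p u w) \<partial>P x) = (\<integral>\<^sup>+w. \<integral>\<^sup>+z. G z \<partial>kernel_sum t p U w \<partial>P x)"
proof -
  have K: "kernel_sum t p U \<in> P x \<rightarrow>\<^sub>M subprob_algebra borel"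
    unfolding measurable_law[OF x] by (rule measurable_prob_algebraD[OF kernel_sum_measurable[OF t p U]])
  have m: "(\<lambda>w. \<Sum>u\<in>U. branch_value t p u w) \<in> borel_measurable (P x)"
    unfolding measurable_law[OF x] using t by measurable
  have "(\<integral>\<^sup>+w. G (\<Sum>u\<in>U. branch_value t p u w) \<partial>P x)
      = (\<integral>\<^sup>+z. G z \<partial>distr (P x) borel (\<lambda>w. \<Sum>u\<in>U. branch_value t p u w))"
    using G by (simp add: nn_integral_distr m)
  also have "\<dots> = (\<integral>\<^sup>+w. \<integral>\<^sup>+z. G z \<partial>kernel_sum t p U w \<partial>P x)"
    unfolding distr_branch_sum[OF x t p U] by (rule nn_integral_bind[OF G K])
  finally show ?thesis .
qed

lemma integral_branch_sum:
  fixes G :: "real \<Rightarrow> real"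
  assumes x: "x \<in> space E" and t: "0 \<le> t" and p [measurable]: "p \<in> borel_measurable (path_space E)" and U: "finite U"
    and G: "G \<in> borel_measurable borel" "\<And>z. \<bar>G z\<bar> \<le> c"
  shows "(LINT w|P x. G (\<Sum>u\<in>U. branch_value t p u w)) = (LINT w|P x. LINT z|kernel_sum t p U w. G z)"
proof -
  interpret prob_space "P x" by (rule prob_space_law[OF x])
  have K: "kernel_sum t p U \<in> P x \<rightarrow>\<^sub>M subprob_algebra borel"
    unfolding measurable_law[OF x] by (rule measurable_prob_algebraD[OF kernel_sum_measurable[OF t p U]])
  have m: "(\<lambda>w. \<Sum>u\<in>U. branch_value t p u w) \<in> borel_measurable (P x)"
    unfolding measurable_law[OF x] using t by measurable
  have "(LINT z|(P x \<bind> kernel_sum t p U). G z) = (LINT w|P x. LINT z|kernel_sum t p U w. G z)"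
    using subprob_space.subprob_emeasure_le_1[OF subprob_space_kernel[OF K]]
    by (intro integral_bind[OF G(1) _ K finite_measure_axioms, where B' = 1 and B = c]) (auto simp: G)
  then show ?thesis
    using integral_distr[OF m G(1)] by (simp add: distr_branch_sum[OF x t p U])
qed

end

section \<open>Passing to countably many individuals\<close>

text \<open>An increasing exhaustion of the countable label type by finite sets. The set of living
  labels may be infinite, so sums over branches are formed along this exhaustion.\<close>

definition labels :: "nat \<Rightarrow> 'u::countable set" where
  "labels n = {u. to_nat u < n}"

lemma finite_labels [simp]: "finite (labels n :: 'u::countable set)"
proof -
  have "finite (to_nat -` {..<n} \<inter> (UNIV :: 'u set))"
    by (intro finite_vimage_IntI) auto
  then show ?thesis by (simp add: labels_def vimage_def)
qed

lemma sum_labels_eq: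
  fixes f :: "'u::countable \<Rightarrow> real"
  shows "(\<Sum>u\<in>labels n. f u) = (LINT u|count_space UNIV. indicator (labels n) u * f u)"
proof -
  have "(LINT u|count_space UNIV. indicator (labels n) u * f u) = (\<Sum>u | u \<in> UNIV \<and> indicator (labels n) u * f u \<noteq> 0. indicator (labels n) u * f u)"
    by (rule lebesgue_integral_count_space_finite_support)
       (rule finite_subset[OF _ finite_labels[of n]], auto simp: indicator_def)
  also have "\<dots> = (\<Sum>u\<in>labels n. f u)"
    by (rule sum.mono_neutral_cong_left) (auto simp: indicator_def split: if_splits)
  finally show ?thesis by simp
qed

lemma labels_sum_tendsto:
  fixes f :: "'u::countable \<Rightarrow> real"
  assumes "(\<integral>\<^sup>+u. ennreal \<bar>f u\<bar> \<partial>count_space UNIV) < \<infinity>"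
  shows "(\<lambda>n. \<Sum>u\<in>labels n. f u) \<longlonglongrightarrow> (LINT u|count_space UNIV. f u)"
  unfolding sum_labels_eq
proof (rule integral_dominated_convergence[where w = "\<lambda>u. \<bar>f u\<bar>"])
  show "integrable (count_space UNIV) (\<lambda>u. \<bar>f u\<bar>)"
    using assms by (simp add: integrable_iff_bounded)
  have "(\<lambda>n. indicator (labels n) u * f u) \<longlonglongrightarrow> f u" for u
  proof (rule tendsto_eventually)
    show "\<forall>\<^sub>F n in sequentially. indicator (labels n) u * f u = f u"
      using eventually_gt_at_top[of "to_nat u"] by eventually_elim (simp add: labels_def)
  qed
  then show "AE u in count_space UNIV. (\<lambda>n. indicator (labels n) u * f u) \<longlonglongrightarrow> f u" by simp
qed (auto simp: indicator_def)

lemma labels_sum_le: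
  fixes f :: "'u::countable \<Rightarrow> real"
  shows "ennreal (\<Sum>u\<in>labels n. \<bar>f u\<bar>) \<le> (\<integral>\<^sup>+u. ennreal \<bar>f u\<bar> \<partial>count_space UNIV)"
proof -
  have "ennreal (\<Sum>u\<in>labels n. \<bar>f u\<bar>) = (\<integral>\<^sup>+u. ennreal \<bar>f u\<bar> \<partial>count_space (labels n))"
    by (simp add: nn_integral_count_space_finite)
  also have "\<dots> \<le> (\<integral>\<^sup>+u. ennreal \<bar>f u\<bar> \<partial>count_space UNIV)"
    by (subst nn_integral_count_space_UNIV) (auto intro!: nn_integral_mono)
  finally show ?thesis .
qed

text \<open>Written over the standard normal law, with mean and standard deviation inside
  \<open>F\<close>, so that joint measurability in mean and variance is an instance of Fubini's
  theorem.\<close>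

definition gauss_smooth :: "(real \<Rightarrow> real) \<Rightarrow> real \<Rightarrow> real \<Rightarrow> real" where
  "gauss_smooth F m v = (LINT n|std_normal_distribution. F (m + sqrt v * n))"

lemma smooth_tests_shift:
  assumes "F \<in> smooth_tests" shows "(\<lambda>z. F (m + z)) \<in> smooth_tests"
proof -
  from assms obtain F1 F2 F3 where d: "\<forall>y. (F has_real_derivative F1 y) (at y) \<and> (F1 has_real_derivative F2 y) (at y) \<and>
      (F2 has_real_derivative F3 y) (at y) \<and> \<bar>F y\<bar> \<le> 1 \<and> \<bar>F1 y\<bar> \<le> 1 \<and> \<bar>F2 y\<bar> \<le> 1 \<and> \<bar>F3 y\<bar> \<le> 1"
    unfolding smooth_tests_def by blast
  have shift: "((\<lambda>z. G (m + z)) has_real_derivative G' (m + y)) (at y)"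
    if "\<And>y. (G has_real_derivative G' y) (at y)" for G G' :: "real \<Rightarrow> real" and y
    using that[of "m + y"] unfolding add.commute[of m] by (simp only: DERIV_shift)
  have "\<forall>y. ((\<lambda>z. F (m + z)) has_real_derivative F1 (m + y)) (at y) \<and>
      ((\<lambda>z. F1 (m + z)) has_real_derivative F2 (m + y)) (at y) \<and>
      ((\<lambda>z. F2 (m + z)) has_real_derivative F3 (m + y)) (at y) \<and>
      \<bar>F (m + y)\<bar> \<le> 1 \<and> \<bar>F1 (m + y)\<bar> \<le> 1 \<and> \<bar>F2 (m + y)\<bar> \<le> 1 \<and> \<bar>F3 (m + y)\<bar> \<le> 1"
    using d by (intro allI conjI shift) auto
  then show ?thesis unfolding smooth_tests_def by (intro CollectI exI)
qed

lemma gauss_smooth_eq: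
  assumes "F \<in> smooth_tests"
  shows "gauss_smooth F m v = (LINT z|centred_gaussian v. F (m + z))"
  unfolding gauss_smooth_def centred_gaussian_def
  using smooth_tests_measurable[OF smooth_tests_shift[OF assms]] by (subst integral_distr) auto

lemma gauss_smooth_bounded:
  assumes F: "F \<in> smooth_tests"
  shows "\<bar>gauss_smooth F m v\<bar> \<le> 1"
proof -
  interpret real_distribution std_normal_distribution by (rule real_dist_normal_dist)
  note [measurable] = smooth_tests_measurable[OF F]
  have "\<bar>gauss_smooth F m v\<bar> \<le> (LINT n|std_normal_distribution. \<bar>F (m + sqrt v * n)\<bar>)"
    unfolding gauss_smooth_def by (rule integral_abs_bound)
  also have "\<dots> \<le> (LINT n|std_normal_distribution. 1)"
    by (intro integral_mono integrable_const_bound[where B = 1]) (auto simp: smooth_tests_bounded F)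
  finally show ?thesis by (simp add: prob_space[simplified])
qed

lemma gauss_smooth_lipschitz:
  assumes F: "F \<in> smooth_tests" and "0 \<le> v" "0 \<le> w"
  shows "\<bar>gauss_smooth F m v - gauss_smooth F k w\<bar> \<le> \<bar>m - k\<bar> + \<bar>v - w\<bar>"
proof -
  interpret real_distribution std_normal_distribution by (rule real_dist_normal_dist)
  note [measurable] = smooth_tests_measurable[OF F]
  have i: "integrable std_normal_distribution (\<lambda>n. F (m + c * n))" for m c
    by (intro integrable_const_bound[where B = 1]) (auto simp: smooth_tests_bounded F)
  have eq: "gauss_smooth F m v - gauss_smooth F k v = (LINT n|std_normal_distribution. F (m + sqrt v * n) - F (k + sqrt v * n))"
    unfolding gauss_smooth_def by (rule Bochner_Integration.integral_diff[symmetric, OF i i])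
  have "\<bar>gauss_smooth F m v - gauss_smooth F k v\<bar> \<le> (LINT n|std_normal_distribution. \<bar>F (m + sqrt v * n) - F (k + sqrt v * n)\<bar>)"
    unfolding eq by (rule integral_abs_bound)
  also have "\<dots> \<le> (LINT n|std_normal_distribution. \<bar>m - k\<bar>)"
  proof (rule integral_mono)
    fix n show "\<bar>F (m + sqrt v * n) - F (k + sqrt v * n)\<bar> \<le> \<bar>m - k\<bar>"
      using smooth_tests_lipschitz[OF F, of "m + sqrt v * n" "k + sqrt v * n"] by simp
  qed (intro integrable_abs Bochner_Integration.integrable_diff i, simp)
  finally have 1: "\<bar>gauss_smooth F m v - gauss_smooth F k v\<bar> \<le> \<bar>m - k\<bar>" by (simp add: prob_space[simplified])
  have "\<bar>gauss_smooth F k v - gauss_smooth F k w\<bar> \<le> \<bar>v - w\<bar>"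
    unfolding gauss_smooth_eq[OF F]
    by (rule centred_gaussian_lipschitz[OF smooth_tests_shift[OF F] assms(2,3)])
  with 1 show ?thesis by linarith
qed

lemma gauss_smooth_measurable:
  assumes F: "F \<in> smooth_tests" and [measurable]: "f \<in> borel_measurable N" "g \<in> borel_measurable N"
  shows "(\<lambda>x. gauss_smooth F (f x) (g x)) \<in> borel_measurable N"
proof -
  interpret real_distribution std_normal_distribution by (rule real_dist_normal_dist)
  note [measurable] = smooth_tests_measurable[OF F]
  show ?thesis unfolding gauss_smooth_def by measurable
qed

text \<open>Dead labels have kernel \<open>return borel 0\<close>; these values let them drop out of
  every sum over labels.\<close>

lemma mean_of_return [simp]: "mean_of (return borel 0) = 0"
  and var_of_return [simp]: "var_of (return borel 0) = 0"
  and lindeberg_error_return [simp]: "lindeberg_error (return borel 0) = 0"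
  by (simp_all add: mean_of_def var_of_def lindeberg_error_def third_of_def integral_return)

section \<open>Moments of finite sums over branches\<close>

context branching
begin

lemma integrable_branch_kernel:
  assumes "\<And>y. y \<in> space E \<Longrightarrow> integrable (path_law p y) f" "f \<in> borel_measurable borel" "0 \<le> t" "w \<in> space M"
  shows "integrable (branch_kernel t p u w) (f :: real \<Rightarrow> real)"
  using assms trait_space by (auto simp: branch_kernel_def intro!: integrable_return)

lemma branch_kernel_if:
  assumes "\<Phi> (return borel 0) = 0"
  shows "\<Phi> (branch_kernel t p u w) = (if u \<in> alive B t w then \<Phi> (path_law p (trait B t u w)) else 0)"
  using assms by (simp add: branch_kernel_def)

definition trait_value :: "real \<Rightarrow> ('x \<Rightarrow> real) \<Rightarrow> 'u \<Rightarrow> 'w \<Rightarrow> real" where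
  "trait_value t f u w = (if u \<in> alive B t w then f (trait B t u w) else 0)"

lemma trait_value_measurable [measurable]:
  assumes "0 \<le> t" "f \<in> borel_measurable E"
  shows "trait_value t f u \<in> borel_measurable M"
  unfolding trait_value_def using assms by (intro measurable_alive_trait) auto

lemma nn_integral_trait_value:
  assumes [measurable]: "f \<in> borel_measurable E" and "0 \<le> t" "w \<in> space M"
  shows "(\<integral>\<^sup>+u. ennreal \<bar>trait_value t f u w\<bar> \<partial>count_space UNIV) = (Zp t (\<lambda>y. \<bar>f y\<bar>) w)"
  using assms by (subst nn_integral_population) (auto intro!: nn_integral_cong simp: trait_value_def)

lemma trait_value_tendsto:
  assumes [measurable]: "f \<in> borel_measurable E" and "0 \<le> t" "w \<in> space M"
    and "(Zp t (\<lambda>y. \<bar>f y\<bar>) w) < \<infinity>"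
  shows "(\<lambda>n. \<Sum>u\<in>labels n. trait_value t f u w) \<longlonglongrightarrow> Zf t f w"
proof -
  have "(\<integral>\<^sup>+u. ennreal \<bar>trait_value t f u w\<bar> \<partial>count_space UNIV) < \<infinity>"
    using assms by (simp add: nn_integral_trait_value)
  from labels_sum_tendsto[OF this]
  show ?thesis using assms by (simp add: Zint_def integral_population trait_value_def)
qed

lemma trait_value_sum_le:
  assumes [measurable]: "f \<in> borel_measurable E" "wt \<in> borel_measurable E" and "0 \<le> t" "w \<in> space M"
    and "\<And>y. y \<in> space E \<Longrightarrow> \<bar>f y\<bar> \<le> wt y"
  shows "ennreal (\<Sum>u\<in>labels n. \<bar>trait_value t f u w\<bar>) \<le> (Zp t wt w)"
proof -
  have "ennreal (\<Sum>u\<in>labels n. \<bar>trait_value t f u w\<bar>) \<le> (\<integral>\<^sup>+u. ennreal \<bar>trait_value t f u w\<bar> \<partial>count_space UNIV)"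
    by (rule labels_sum_le)
  also have "\<dots> = (Zp t (\<lambda>y. \<bar>f y\<bar>) w)"
    using assms by (simp add: nn_integral_trait_value)
  also have "\<dots> \<le> (Zp t wt w)"
    using assms(5) sets_eq_imp_space_eq[OF sets_population] by (intro nn_integral_mono ennreal_leI) auto
  finally show ?thesis .
qed

definition branch_sum :: "real \<Rightarrow> ((real \<Rightarrow> 'x measure) \<Rightarrow> real) \<Rightarrow> nat \<Rightarrow> 'w \<Rightarrow> real" where
  "branch_sum t p n w = (\<Sum>u\<in>labels n. branch_value t p u w)"

lemma branch_sum_measurable [measurable]:
  assumes "0 \<le> t" "p \<in> borel_measurable (path_space E)"
  shows "branch_sum t p n \<in> borel_measurable M"
  unfolding branch_sum_def using assms by measurable

text \<open>Viewed as functions of the starting trait: \<open>path_mean\<close> and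
  \<open>path_var\<close>, summed over the population at time \<open>t\<close>, give the conditional
  mean and variance of the sum over the branches.\<close>

definition path_mean :: "((real \<Rightarrow> 'x measure) \<Rightarrow> real) \<Rightarrow> 'x \<Rightarrow> real" where
  "path_mean p y = mean_of (path_law p y)"

definition path_var :: "((real \<Rightarrow> 'x measure) \<Rightarrow> real) \<Rightarrow> 'x \<Rightarrow> real" where
  "path_var p y = var_of (path_law p y)"

lemma integral_path_law:
  assumes "y \<in> space E" "p \<in> borel_measurable (path_space E)" "f \<in> borel_measurable borel"
  shows "(LINT z|path_law p y. f z) = (LINT w|P y. (f (p (population_path B w)) :: real))"
proof -
  have "(\<lambda>w. p (population_path B w)) \<in> borel_measurable (P y)"
    using assms by (simp add: measurable_law)
  then show ?thesis using assms(3) by (simp add: path_law_def integral_distr)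
qed

lemma integrable_path_law:
  assumes "y \<in> space E" "p \<in> borel_measurable (path_space E)" "f \<in> borel_measurable borel"
  shows "integrable (path_law p y) f \<longleftrightarrow> integrable (P y) (\<lambda>w. (f (p (population_path B w)) :: real))"
proof -
  have "(\<lambda>w. p (population_path B w)) \<in> borel_measurable (P y)"
    using assms by (simp add: measurable_law)
  then show ?thesis using assms(3) by (simp add: path_law_def integrable_distr_eq)
qed

lemma path_mean_measurable [measurable]:
  assumes "p \<in> borel_measurable (path_space E)"
  shows "path_mean p \<in> borel_measurable E"
  unfolding path_mean_def mean_of_def
  by (rule measurable_compose[OF measurable_prob_algebraD[OF path_law_measurable[OF assms]]
    integral_measurable_subprob_algebra]) simp

text \<open>The integrand itself depends on the trait through the mean, so the variance is read as a
  non-negative kernel integral of a jointly measurable function.\<close>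

lemma path_var_measurable [measurable]:
  assumes [measurable]: "p \<in> borel_measurable (path_space E)"
  shows "path_var p \<in> borel_measurable E"
proof -
  have "(\<lambda>y. enn2real (\<integral>\<^sup>+z. ennreal ((z - path_mean p y)\<^sup>2) \<partial>path_law p y)) \<in> borel_measurable E"
    by (intro borel_measurable_enn2real
      nn_integral_measurable_subprob_algebra2[OF _ measurable_prob_algebraD[OF path_law_measurable[OF assms]]]) measurable
  moreover have "path_var p y = enn2real (\<integral>\<^sup>+z. ennreal ((z - path_mean p y)\<^sup>2) \<partial>path_law p y)" for y
    unfolding path_var_def var_of_def path_mean_def by (rule integral_eq_nn_integral) (auto simp: path_law_def)
  ultimately show ?thesis by (simp cong: measurable_cong)
qed

lemma path_var_nonneg: "0 \<le> path_var p y"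
  by (simp add: path_var_def var_of_nonneg)

context
  fixes x :: 'x and t :: real and p :: "(real \<Rightarrow> 'x measure) \<Rightarrow> real"
  assumes x: "x \<in> space E" and t: "0 \<le> t" and p [measurable]: "p \<in> borel_measurable (path_space E)"
begin

lemma real_distribution_kernel_sum: "w \<in> space M \<Longrightarrow> real_distribution (kernel_sum t p U w)"
  unfolding kernel_sum_def by (rule real_distribution_sum_law) (rule real_distribution_branch_kernel[OF p t])

lemma kernel_sum_second_moment:
  assumes int: "\<And>y. y \<in> space E \<Longrightarrow> integrable (path_law p y) (\<lambda>z. z\<^sup>2)" and w: "w \<in> space M"
  shows "integrable (kernel_sum t p (labels n) w) (\<lambda>z. z\<^sup>2)"
    and "mean_of (kernel_sum t p (labels n) w) = (\<Sum>u\<in>labels n. trait_value t (path_mean p) u w)"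
    and "(LINT z|kernel_sum t p (labels n) w. z\<^sup>2) = (\<Sum>u\<in>labels n. trait_value t (path_var p) u w)
      + (\<Sum>u\<in>labels n. trait_value t (path_mean p) u w)\<^sup>2"
proof -
  note R = real_distribution_branch_kernel[OF p t w]
  have I: "integrable (branch_kernel t p u w) (\<lambda>z. z\<^sup>2)" for u
    by (rule integrable_branch_kernel) (auto intro: int t w)
  note m = sum_law_moments2[of "labels n" "\<lambda>u. branch_kernel t p u w", OF finite_labels R I] and s = sum_law_second_moment[of "labels n" "\<lambda>u. branch_kernel t p u w", OF finite_labels R I]
  have e: "mean_of (branch_kernel t p u w) = trait_value t (path_mean p) u w"
    "var_of (branch_kernel t p u w) = trait_value t (path_var p) u w" for u
    by (simp_all add: trait_value_def path_mean_def path_var_def branch_kernel_if)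
  show "integrable (kernel_sum t p (labels n) w) (\<lambda>z. z\<^sup>2)"
    "mean_of (kernel_sum t p (labels n) w) = (\<Sum>u\<in>labels n. trait_value t (path_mean p) u w)"
    "(LINT z|kernel_sum t p (labels n) w. z\<^sup>2) = (\<Sum>u\<in>labels n. trait_value t (path_var p) u w)
      + (\<Sum>u\<in>labels n. trait_value t (path_mean p) u w)\<^sup>2"
    unfolding kernel_sum_def using m s by (simp_all add: e)
qed

text \<open>Under each conditional law the second moment is variance plus squared mean, and both are
  sums over labels; averaging over the population gives the decomposition of the total
  variance.\<close>

lemma branch_sum_second_moment:
  assumes int: "\<And>y. y \<in> space E \<Longrightarrow> integrable (path_law p y) (\<lambda>z. z\<^sup>2)"
  shows "(\<integral>\<^sup>+w. ennreal ((branch_sum t p n w)\<^sup>2) \<partial>P x) =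
    (\<integral>\<^sup>+w. ennreal ((\<Sum>u\<in>labels n. trait_value t (path_var p) u w)
      + (\<Sum>u\<in>labels n. trait_value t (path_mean p) u w)\<^sup>2) \<partial>P x)"
proof -
  have "(\<integral>\<^sup>+w. ennreal ((branch_sum t p n w)\<^sup>2) \<partial>P x)
      = (\<integral>\<^sup>+w. \<integral>\<^sup>+z. ennreal (z\<^sup>2) \<partial>kernel_sum t p (labels n) w \<partial>P x)"
    unfolding branch_sum_def by (rule nn_integral_branch_sum[OF x t p]) auto
  also have "\<dots> = (\<integral>\<^sup>+w. ennreal ((\<Sum>u\<in>labels n. trait_value t (path_var p) u w)
      + (\<Sum>u\<in>labels n. trait_value t (path_mean p) u w)\<^sup>2) \<partial>P x)"
    using kernel_sum_second_moment[OF int]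
    by (intro nn_integral_cong) (simp add: space_law[OF x] nn_integral_eq_integral)
  finally show ?thesis .
qed

text \<open>Fatou's lemma for the fourth moment; \<open>Q\<close> is allowed to be infinite because the lemma is also
  used to establish finiteness of moments.\<close>

lemma branch_fourth_moment_le:
  assumes int: "\<And>y. y \<in> space E \<Longrightarrow> integrable (path_law p y) (\<lambda>z. z ^ 4)"
    and [measurable]: "w1 \<in> borel_measurable E" "w2 \<in> borel_measurable E" "w4 \<in> borel_measurable E"
    and w1: "\<And>y. y \<in> space E \<Longrightarrow> \<bar>path_mean p y\<bar> \<le> w1 y"
    and w2: "\<And>y. y \<in> space E \<Longrightarrow> (LINT z|path_law p y. z\<^sup>2) \<le> w2 y"
    and w4: "\<And>y. y \<in> space E \<Longrightarrow> (LINT z|path_law p y. z ^ 4) \<le> w4 y"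
    and Q: "AE w in P x. Q w \<le> liminf (\<lambda>n. ennreal ((branch_sum t p n w) ^ 4))"
  shows "(\<integral>\<^sup>+w. Q w \<partial>P x) \<le> (\<integral>\<^sup>+w. 64 * (Zp t w4 w)
    + 24 * (Zp t w2 w)\<^sup>2 + 72 * (Zp t w1 w) ^ 4 \<partial>P x)"
    (is "_ \<le> (\<integral>\<^sup>+w. ?R w \<partial>P x)")
proof -
  define s2 where "s2 = (\<lambda>y. LINT z|path_law p y. z\<^sup>2)"
  define s4 where "s4 = (\<lambda>y. LINT z|path_law p y. z ^ 4)"
  have [measurable]: "s2 \<in> borel_measurable E" "s4 \<in> borel_measurable E"
    unfolding s2_def s4_def
    by (rule measurable_compose[OF measurable_prob_algebraD[OF path_law_measurable[OF p]]
      integral_measurable_subprob_algebra], simp)+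
  \<comment> \<open>The bound does not depend on \<open>n\<close>: sums of non-negative terms over a
    finite label set are at most the integral over the whole population.\<close>
  have bound: "(\<integral>\<^sup>+z. ennreal (z ^ 4) \<partial>kernel_sum t p (labels n) w) \<le> ?R w" if w: "w \<in> space M" for n w
  proof -
    note R = real_distribution_branch_kernel[OF p t w]
    have I: "integrable (branch_kernel t p u w) (\<lambda>z. z ^ 4)" for u
      by (rule integrable_branch_kernel) (auto intro: int t w)
    have e: "mean_of (branch_kernel t p u w) = trait_value t (path_mean p) u w"
      "(LINT z|branch_kernel t p u w. z\<^sup>2) = trait_value t s2 u w"
      "(LINT z|branch_kernel t p u w. z ^ 4) = trait_value t s4 u w" for u
      by (simp_all add: trait_value_def path_mean_def s2_def s4_def branch_kernel_def integral_return)
    have nn: "0 \<le> trait_value t s2 u w" "0 \<le> trait_value t s4 u w" for u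
      by (simp_all add: trait_value_def s2_def s4_def)
    let ?s = "\<lambda>f. \<Sum>u\<in>labels n. \<bar>trait_value t f u w\<bar>"
    have le: "ennreal (?s s4) \<le> (Zp t w4 w)"
      "ennreal (?s s2) \<le> (Zp t w2 w)"
      "ennreal (?s (path_mean p)) \<le> (Zp t w1 w)"
    proof -
      have "\<bar>s2 y\<bar> \<le> w2 y" "\<bar>s4 y\<bar> \<le> w4 y" if "y \<in> space E" for y
        using w2[OF that] w4[OF that] by (auto simp: s2_def s4_def abs_of_nonneg integral_nonneg)
      then show "ennreal (?s s4) \<le> (Zp t w4 w)"
        "ennreal (?s s2) \<le> (Zp t w2 w)"
        "ennreal (?s (path_mean p)) \<le> (Zp t w1 w)"
        using w1 w t by (auto intro!: trait_value_sum_le)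
    qed
    have "(\<integral>\<^sup>+z. ennreal (z ^ 4) \<partial>kernel_sum t p (labels n) w) = ennreal (LINT z|kernel_sum t p (labels n) w. z ^ 4)"
      unfolding kernel_sum_def using sum_law_fourth[of "labels n" "\<lambda>u. branch_kernel t p u w", OF finite_labels R I]
      by (intro nn_integral_eq_integral) auto
    also have "\<dots> \<le> ennreal (64 * ?s s4 + 24 * (?s s2)\<^sup>2 + 72 * (?s (path_mean p)) ^ 4)"
      unfolding kernel_sum_def using sum_law_fourth_moment_le[of "labels n" "\<lambda>u. branch_kernel t p u w", OF finite_labels R I] nn
      by (intro ennreal_leI) (simp add: e)
    also have "\<dots> = 64 * ennreal (?s s4) + 24 * (ennreal (?s s2))\<^sup>2 + 72 * (ennreal (?s (path_mean p))) ^ 4"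
      by (simp add: sum_nonneg ennreal_mult ennreal_power)
    also have "\<dots> \<le> ?R w"
      by (intro add_mono mult_left_mono power_mono le) auto
    finally show ?thesis .
  qed
  have "(\<integral>\<^sup>+w. Q w \<partial>P x) \<le> (\<integral>\<^sup>+w. liminf (\<lambda>n. ennreal ((branch_sum t p n w) ^ 4)) \<partial>P x)"
    by (rule nn_integral_mono_AE[OF Q])
  also have "\<dots> \<le> liminf (\<lambda>n. \<integral>\<^sup>+w. ennreal ((branch_sum t p n w) ^ 4) \<partial>P x)"
    using t by (intro nn_integral_liminf) (simp add: measurable_law[OF x])
  also have "\<dots> = liminf (\<lambda>n. \<integral>\<^sup>+w. \<integral>\<^sup>+z. ennreal (z ^ 4) \<partial>kernel_sum t p (labels n) w \<partial>P x)"
    unfolding branch_sum_def by (subst nn_integral_branch_sum[OF x t p, where G = "\<lambda>z. ennreal (z ^ 4)"]) auto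
  also have "\<dots> \<le> liminf (\<lambda>n. \<integral>\<^sup>+w. ?R w \<partial>P x)"
    by (intro Liminf_mono always_eventually allI nn_integral_mono bound) (simp add: space_law[OF x])
  finally show ?thesis by (simp add: Liminf_const)
qed

section \<open>From finite label sets to the whole population\<close>

context
  fixes L D :: "'w \<Rightarrow> real"
  assumes D: "AE w in P x. (\<integral>\<^sup>+u. ennreal \<bar>branch_value t p u w\<bar> \<partial>count_space UNIV) \<le> ennreal (D w)"
    and L: "AE w in P x. L w = (LINT u|count_space UNIV. branch_value t p u w)"
    and [measurable]: "L \<in> borel_measurable (P x)" "D \<in> borel_measurable (P x)"
    and D_nonneg: "\<And>w. 0 \<le> D w"
begin

lemma branch_sum_measurable_law [measurable]: "branch_sum t p n \<in> borel_measurable (P x)"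
  unfolding measurable_law[OF x] using t by measurable

lemma branch_sum_limit: "AE w in P x. (\<lambda>n. branch_sum t p n w) \<longlonglongrightarrow> L w"
  using D L
proof eventually_elim
  case (elim w)
  then have "(\<integral>\<^sup>+u. ennreal \<bar>branch_value t p u w\<bar> \<partial>count_space UNIV) < \<infinity>"
    by (auto intro: le_less_trans)
  from labels_sum_tendsto[OF this] elim(2) show ?case by (simp add: branch_sum_def)
qed

lemma branch_sum_dominated: "AE w in P x. \<forall>n. \<bar>branch_sum t p n w\<bar> \<le> D w"
  using D
proof eventually_elim
  case (elim w)
  show ?case
  proof
    fix n
    have "ennreal \<bar>branch_sum t p n w\<bar> \<le> ennreal (\<Sum>u\<in>labels n. \<bar>branch_value t p u w\<bar>)"
      unfolding branch_sum_def by (intro ennreal_leI sum_abs)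
    also have "\<dots> \<le> ennreal (D w)"
      using labels_sum_le[of "\<lambda>u. branch_value t p u w" n] elim by (rule order_trans)
    finally show "\<bar>branch_sum t p n w\<bar> \<le> D w"
      using D_nonneg[of w] by simp
  qed
qed

context
  fixes w1 w2 :: "'x \<Rightarrow> real"
  assumes wt [measurable]: "w1 \<in> borel_measurable E" "w2 \<in> borel_measurable E"
    and w1: "\<And>y. y \<in> space E \<Longrightarrow> \<bar>path_mean p y\<bar> \<le> w1 y"
    and w2: "\<And>y. y \<in> space E \<Longrightarrow> path_var p y \<le> w2 y"
    and w1_int: "(\<integral>\<^sup>+w. (Zp t w1 w)\<^sup>2 \<partial>P x) < \<infinity>"
    and w2_int: "(\<integral>\<^sup>+w. (Zp t w2 w) \<partial>P x) < \<infinity>"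
begin

lemma weight_measurable [measurable]:
  "f \<in> borel_measurable E \<Longrightarrow> (\<lambda>w. \<integral>\<^sup>+y. f y \<partial>population B t w) \<in> borel_measurable (P x)"
  unfolding measurable_law[OF x]
  by (rule measurable_compose[OF measurable_population[OF t] nn_integral_measurable_measure_algebra])

lemma trait_value_measurable_law [measurable]: "f \<in> borel_measurable E \<Longrightarrow> trait_value t f u \<in> borel_measurable (P x)"
  unfolding measurable_law[OF x] using t by measurable

lemma Zint_measurable_law [measurable]: "f \<in> borel_measurable E \<Longrightarrow> Zf t f \<in> borel_measurable (P x)"
  unfolding measurable_law[OF x] using t by measurable

lemma weights_finite:
  "AE w in P x. (Zp t w1 w) < \<infinity> \<and> (Zp t w2 w) < \<infinity>"
proof -
  have "AE w in P x. (Zp t w1 w)\<^sup>2 \<noteq> \<infinity>"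
    using w1_int by (intro nn_integral_PInf_AE) (auto simp: less_top)
  moreover have "AE w in P x. (Zp t w2 w) \<noteq> \<infinity>"
    using w2_int by (intro nn_integral_PInf_AE) (auto simp: less_top)
  ultimately show ?thesis
    by eventually_elim (auto simp: less_top power2_eq_square ennreal_mult_eq_top_iff)
qed

definition "mean_weight w = enn2real (Zp t w1 w)"
definition "var_weight w = enn2real (Zp t w2 w)"

lemma weights_measurable [measurable]:
  "mean_weight \<in> borel_measurable (P x)" "var_weight \<in> borel_measurable (P x)"
  unfolding mean_weight_def[abs_def] var_weight_def[abs_def] by measurable

lemma trait_sums:
  "AE w in P x. (\<lambda>n. \<Sum>u\<in>labels n. trait_value t (path_mean p) u w) \<longlonglongrightarrow> Zf t (path_mean p) w
    \<and> (\<lambda>n. \<Sum>u\<in>labels n. trait_value t (path_var p) u w) \<longlonglongrightarrow> Zf t (path_var p) w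
    \<and> (\<forall>n. \<bar>\<Sum>u\<in>labels n. trait_value t (path_mean p) u w\<bar> \<le> mean_weight w)
    \<and> (\<forall>n. \<bar>\<Sum>u\<in>labels n. trait_value t (path_var p) u w\<bar> \<le> var_weight w)"
  using weights_finite AE_space
proof eventually_elim
  case (elim w)
  then have w: "w \<in> space M" by (simp add: space_law[OF x])
  have sp: "space (population B t w) = space E" by (rule sets_eq_imp_space_eq) simp
  have v: "\<bar>path_var p y\<bar> \<le> w2 y" if "y \<in> space E" for y
    using w2[OF that] path_var_nonneg[of p y] by simp
  have main: "(\<lambda>n. \<Sum>u\<in>labels n. trait_value t f u w) \<longlonglongrightarrow> Zf t f w
      \<and> (\<forall>n. \<bar>\<Sum>u\<in>labels n. trait_value t f u w\<bar> \<le> enn2real (Zp t g w))"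
    if [measurable]: "f \<in> borel_measurable E" "g \<in> borel_measurable E"
      and fg: "\<And>y. y \<in> space E \<Longrightarrow> \<bar>f y\<bar> \<le> g y" and fin: "(Zp t g w) < \<infinity>" for f g
  proof
    have "(Zp t (\<lambda>y. \<bar>f y\<bar>) w) \<le> (Zp t g w)"
      by (intro nn_integral_mono ennreal_leI fg) (simp add: sp)
    also note fin
    finally show "(\<lambda>n. \<Sum>u\<in>labels n. trait_value t f u w) \<longlonglongrightarrow> Zf t f w"
      by (intro trait_value_tendsto t w) auto
    show "\<forall>n. \<bar>\<Sum>u\<in>labels n. trait_value t f u w\<bar> \<le> enn2real (Zp t g w)"
    proof
      fix n
      have "ennreal (\<Sum>u\<in>labels n. \<bar>trait_value t f u w\<bar>) \<le> (Zp t g w)"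
        by (rule trait_value_sum_le) (use t w fg in auto)
      from enn2real_mono[OF this] fin
      have "(\<Sum>u\<in>labels n. \<bar>trait_value t f u w\<bar>) \<le> enn2real (Zp t g w)"
        by (simp add: sum_nonneg)
      then show "\<bar>\<Sum>u\<in>labels n. trait_value t f u w\<bar> \<le> enn2real (Zp t g w)"
        using sum_abs[of "\<lambda>u. trait_value t f u w" "labels n"] by linarith
    qed
  qed
  show ?case
    using main[of "path_mean p" w1] main[of "path_var p" w2] elim w1 v
    by (simp add: mean_weight_def var_weight_def)
qed

lemma integrable_weights:
  shows "integrable (P x) (\<lambda>w. (mean_weight w)\<^sup>2)" "integrable (P x) var_weight" "integrable (P x) mean_weight"
proof -
  interpret prob_space "P x" by (rule prob_space_law[OF x])
  have "(\<integral>\<^sup>+w. ennreal ((mean_weight w)\<^sup>2) \<partial>P x) = (\<integral>\<^sup>+w. (Zp t w1 w)\<^sup>2 \<partial>P x)"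
    using weights_finite
    by (intro nn_integral_cong_AE, eventually_elim) (simp add: mean_weight_def ennreal_power[symmetric])
  then show sq: "integrable (P x) (\<lambda>w. (mean_weight w)\<^sup>2)"
    using w1_int by (simp add: integrable_iff_bounded)
  have "(\<integral>\<^sup>+w. ennreal (var_weight w) \<partial>P x) = (\<integral>\<^sup>+w. (Zp t w2 w) \<partial>P x)"
    using weights_finite by (intro nn_integral_cong_AE, eventually_elim) (simp add: var_weight_def)
  then show "integrable (P x) var_weight"
    using w2_int by (simp add: integrable_iff_bounded var_weight_def)
  show "integrable (P x) mean_weight"
    using integrable_power_le[OF sq, of 1] by simp
qed

text \<open>The total variance formula for finite label sets passes to the limit by domination, with
  \<open>D^2\<close> on one side and the weights on the other. The first moment needs a detour,
  since the exchange formula for signed integrands asks for boundedness.\<close>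

lemma branch_second_moment:
  assumes int: "\<And>y. y \<in> space E \<Longrightarrow> integrable (path_law p y) (\<lambda>z. z\<^sup>2)"
    and D2: "integrable (P x) (\<lambda>w. (D w)\<^sup>2)"
  shows "integrable (P x) (\<lambda>w. (L w)\<^sup>2)" "integrable (P x) (Zf t (path_var p))"
    "integrable (P x) (\<lambda>w. (Zf t (path_mean p) w)\<^sup>2)"
    "(LINT w|P x. (L w)\<^sup>2) = (LINT w|P x. Zf t (path_var p) w) + (LINT w|P x. (Zf t (path_mean p) w)\<^sup>2)"
    "(LINT w|P x. L w) = (LINT w|P x. Zf t (path_mean p) w)"
proof -
  interpret prob_space "P x" by (rule prob_space_law[OF x])
  let ?g = "\<lambda>n w. \<Sum>u\<in>labels n. trait_value t (path_mean p) u w"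
  let ?v = "\<lambda>n w. \<Sum>u\<in>labels n. trait_value t (path_var p) u w"
  have v_nonneg: "0 \<le> ?v n w" for n w
    by (intro sum_nonneg) (simp add: trait_value_def path_var_nonneg)
  have Dint: "integrable (P x) D"
    using integrable_power_le[OF D2, of 1] by simp
  have S2: "AE w in P x. (\<lambda>n. (branch_sum t p n w)\<^sup>2) \<longlonglongrightarrow> (L w)\<^sup>2"
    using branch_sum_limit by eventually_elim (rule tendsto_power)
  have S2_le: "AE w in P x. norm ((branch_sum t p n w)\<^sup>2) \<le> (D w)\<^sup>2" for n
    using branch_sum_dominated by eventually_elim (auto intro!: abs_le_square_iff[THEN iffD1] simp: D_nonneg)
  show L2: "integrable (P x) (\<lambda>w. (L w)\<^sup>2)"
    by (rule integrable_dominated_convergence[OF _ _ D2 S2 S2_le]) auto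
  have l1: "(\<lambda>n. LINT w|P x. (branch_sum t p n w)\<^sup>2) \<longlonglongrightarrow> (LINT w|P x. (L w)\<^sup>2)"
    by (rule integral_dominated_convergence[OF _ _ D2 S2 S2_le]) auto
  show Zv: "integrable (P x) (Zf t (path_var p))"
  proof (rule integrable_dominated_convergence[where s = ?v, OF _ _ integrable_weights(2)])
    show "AE w in P x. (\<lambda>n. ?v n w) \<longlonglongrightarrow> Zf t (path_var p) w"
      using trait_sums by eventually_elim auto
    show "AE w in P x. norm (?v n w) \<le> var_weight w" for n
      using trait_sums by eventually_elim auto
  qed auto
  have gle: "AE w in P x. norm ((?g n w)\<^sup>2) \<le> (mean_weight w)\<^sup>2" for n
    using trait_sums
    by eventually_elim (auto intro!: abs_le_square_iff[THEN iffD1] simp: mean_weight_def)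
  show Zg: "integrable (P x) (\<lambda>w. (Zf t (path_mean p) w)\<^sup>2)"
  proof (rule integrable_dominated_convergence[where s = "\<lambda>n w. (?g n w)\<^sup>2", OF _ _ integrable_weights(1)])
    show "AE w in P x. (\<lambda>n. (?g n w)\<^sup>2) \<longlonglongrightarrow> (Zf t (path_mean p) w)\<^sup>2"
      using trait_sums by eventually_elim (auto intro: tendsto_power)
  qed (use gle in auto)
  have N_int: "integrable (P x) (\<lambda>w. var_weight w + (mean_weight w)\<^sup>2)"
    using integrable_weights by simp
  have N_le: "AE w in P x. norm (?v n w + (?g n w)\<^sup>2) \<le> var_weight w + (mean_weight w)\<^sup>2" for n
    using trait_sums gle[of n] by eventually_elim (auto intro!: abs_triangle_ineq[THEN order_trans] add_mono)
  have l2: "(\<lambda>n. LINT w|P x. ?v n w + (?g n w)\<^sup>2) \<longlonglongrightarrow> (LINT w|P x. Zf t (path_var p) w + (Zf t (path_mean p) w)\<^sup>2)"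
  proof (rule integral_dominated_convergence[OF _ _ N_int])
    show "AE w in P x. (\<lambda>n. ?v n w + (?g n w)\<^sup>2) \<longlonglongrightarrow> Zf t (path_var p) w + (Zf t (path_mean p) w)\<^sup>2"
      using trait_sums by eventually_elim (auto intro!: tendsto_add tendsto_power)
  qed (use N_le in auto)
  have "(LINT w|P x. (branch_sum t p n w)\<^sup>2) = (LINT w|P x. ?v n w + (?g n w)\<^sup>2)" for n
    using branch_sum_second_moment[OF int, of n] v_nonneg
    by (subst (1 2) integral_eq_nn_integral) auto
  with l1 l2 have "(LINT w|P x. (L w)\<^sup>2) = (LINT w|P x. Zf t (path_var p) w + (Zf t (path_mean p) w)\<^sup>2)"
    by (simp add: LIMSEQ_unique)
  then show "(LINT w|P x. (L w)\<^sup>2) = (LINT w|P x. Zf t (path_var p) w) + (LINT w|P x. (Zf t (path_mean p) w)\<^sup>2)"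
    using Zv Zg by simp
  have mean_n: "(LINT w|P x. branch_sum t p n w) = (LINT w|P x. ?g n w)" for n
  proof (rule LIMSEQ_unique)
    \<comment> \<open>Truncation at level \<open>k\<close>: bounded, as
      \<open>integral_branch_sum\<close> demands, and converging to the identity. Both limits in
      \<open>k\<close> of the same sequence are then compared.\<close>
    define G where "G = (\<lambda>(k :: nat) z. max (- real k) (min (real k) z))"
    have [measurable]: "G k \<in> borel_measurable borel" for k unfolding G_def by simp
    have Gk: "\<bar>G k z\<bar> \<le> real k" "\<bar>G k z\<bar> \<le> \<bar>z\<bar>" for k z unfolding G_def by auto
    have Gl: "(\<lambda>k. G k z) \<longlonglongrightarrow> z" for z
    proof (rule tendsto_eventually)
      show "\<forall>\<^sub>F k in sequentially. G k z = z"
        using eventually_ge_at_top[of "nat \<lceil>\<bar>z\<bar>\<rceil>"]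
        by eventually_elim (use real_nat_ceiling_ge[of "\<bar>z\<bar>"] in \<open>auto simp: G_def\<close>)
    qed
    show "(\<lambda>k. LINT w|P x. G k (branch_sum t p n w)) \<longlonglongrightarrow> (LINT w|P x. branch_sum t p n w)"
    proof (rule integral_dominated_convergence[OF _ _ Dint])
      show "AE w in P x. norm (G k (branch_sum t p n w)) \<le> D w" for k
        using branch_sum_dominated by eventually_elim (auto intro: order_trans[OF Gk(2)])
    qed (auto intro: Gl)
    \<comment> \<open>Since \<open>|z| \<le> 1 + z^2\<close>, the conditional second moment bounds
      the truncated conditional means for all \<open>k\<close> at once.\<close>
    have ks: "\<bar>LINT z|kernel_sum t p (labels n) w. G k z\<bar> \<le> 1 + (?v n w + (?g n w)\<^sup>2)"
      "(\<lambda>k. LINT z|kernel_sum t p (labels n) w. G k z) \<longlonglongrightarrow> ?g n w" if w: "w \<in> space M" for k w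
    proof -
      interpret K: real_distribution "kernel_sum t p (labels n) w"
        by (rule real_distribution_kernel_sum[OF w])
      note m = kernel_sum_second_moment[OF int w, of n]
      have i1: "integrable (kernel_sum t p (labels n) w) (\<lambda>z. 1 + z\<^sup>2)"
        by (intro Bochner_Integration.integrable_add m(1)) simp
      have "\<bar>G k z\<bar> \<le> 1 + z\<^sup>2" for k z
        using Gk(2)[of k z] power_abs_le_one_plus_power[of 1 2 z] by simp
      note Gb = this
      have "\<bar>LINT z|kernel_sum t p (labels n) w. G k z\<bar> \<le> (LINT z|kernel_sum t p (labels n) w. \<bar>G k z\<bar>)"
        by (rule integral_abs_bound)
      also have "\<dots> \<le> (LINT z|kernel_sum t p (labels n) w. 1 + z\<^sup>2)"
        by (intro integral_mono i1 K.integrable_const_bound[where B = k] Gb) (auto simp: Gk)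
      also have "\<dots> = 1 + (?v n w + (?g n w)\<^sup>2)"
        using m K.prob_space by simp
      finally show "\<bar>LINT z|kernel_sum t p (labels n) w. G k z\<bar> \<le> 1 + (?v n w + (?g n w)\<^sup>2)" .
      have "(\<lambda>k. LINT z|kernel_sum t p (labels n) w. G k z) \<longlonglongrightarrow> (LINT z|kernel_sum t p (labels n) w. z)"
        by (rule integral_dominated_convergence[OF _ _ i1]) (use Gl Gb in auto)
      then show "(\<lambda>k. LINT z|kernel_sum t p (labels n) w. G k z) \<longlonglongrightarrow> ?g n w"
        using m(2) by (simp add: mean_of_def)
    qed
    have "(\<lambda>k. LINT w|P x. LINT z|kernel_sum t p (labels n) w. G k z) \<longlonglongrightarrow> (LINT w|P x. ?g n w)"
    proof (rule integral_dominated_convergence[where w = "\<lambda>w. 1 + (var_weight w + (mean_weight w)\<^sup>2)"])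
      show "integrable (P x) (\<lambda>w. 1 + (var_weight w + (mean_weight w)\<^sup>2))" using N_int by simp
      show "(\<lambda>w. LINT z|kernel_sum t p (labels n) w. G k z) \<in> borel_measurable (P x)" for k
        unfolding measurable_law[OF x]
        by (rule measurable_compose[OF measurable_prob_algebraD[OF kernel_sum_measurable[OF t p finite_labels]]
          integral_measurable_subprob_algebra]) measurable
      show "AE w in P x. (\<lambda>k. LINT z|kernel_sum t p (labels n) w. G k z) \<longlonglongrightarrow> ?g n w"
        by (intro AE_I2 ks) (simp add: space_law[OF x])
      show "AE w in P x. norm (LINT z|kernel_sum t p (labels n) w. G k z) \<le> 1 + (var_weight w + (mean_weight w)\<^sup>2)" for k
        using N_le[of n] AE_space
      proof eventually_elim
        case (elim w)
        with ks(1)[of w k] show ?case by (simp add: space_law[OF x])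
      qed
    qed measurable
    then show "(\<lambda>k. LINT w|P x. G k (branch_sum t p n w)) \<longlonglongrightarrow> (LINT w|P x. ?g n w)"
      unfolding branch_sum_def by (subst integral_branch_sum[OF x t p finite_labels _ Gk(1)]) auto
  qed
  have "(\<lambda>n. LINT w|P x. branch_sum t p n w) \<longlonglongrightarrow> (LINT w|P x. L w)"
  proof (rule integral_dominated_convergence[OF _ _ Dint])
    show "AE w in P x. norm (branch_sum t p n w) \<le> D w" for n
      using branch_sum_dominated by eventually_elim auto
  qed (use branch_sum_limit in auto)
  moreover have "(\<lambda>n. LINT w|P x. ?g n w) \<longlonglongrightarrow> (LINT w|P x. Zf t (path_mean p) w)"
  proof (rule integral_dominated_convergence[OF _ _ integrable_weights(3)])
    show "AE w in P x. (\<lambda>n. ?g n w) \<longlonglongrightarrow> Zf t (path_mean p) w"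
      using trait_sums by eventually_elim auto
    show "AE w in P x. norm (?g n w) \<le> mean_weight w" for n
      using trait_sums by eventually_elim auto
  qed auto
  ultimately show "(LINT w|P x. L w) = (LINT w|P x. Zf t (path_mean p) w)"
    unfolding mean_n by (rule LIMSEQ_unique)
qed

text \<open>Given the population the branches are independent, so the Gaussian replacement applies
  to every finite label set. Its errors add up to at most the integral of \<open>w3\<close> over the
  population, uniformly in the number of labels, and thus survive the limit.\<close>

lemma branch_lindeberg:
  assumes int: "\<And>y. y \<in> space E \<Longrightarrow> integrable (path_law p y) (\<lambda>z. z ^ 4)"
    and F: "F \<in> smooth_tests"
    and [measurable]: "w3 \<in> borel_measurable E"
    and w3: "\<And>y. y \<in> space E \<Longrightarrow> lindeberg_error (path_law p y) \<le> w3 y"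
    and e: "(\<integral>\<^sup>+w. (Zp t w3 w) \<partial>P x) \<le> ennreal e" "0 \<le> e"
  shows "\<bar>(LINT w|P x. F (L w)) - (LINT w|P x. gauss_smooth F (Zf t (path_mean p) w) (Zf t (path_var p) w))\<bar> \<le> e"
proof -
  interpret prob_space "P x" by (rule prob_space_law[OF x])
  note [measurable] = smooth_tests_measurable[OF F]
  let ?g = "\<lambda>n w. \<Sum>u\<in>labels n. trait_value t (path_mean p) u w"
  let ?v = "\<lambda>n w. \<Sum>u\<in>labels n. trait_value t (path_var p) u w"
  have v_nonneg: "0 \<le> ?v n w" for n w
    by (intro sum_nonneg) (simp add: trait_value_def path_var_nonneg)
  have Zv_nonneg: "0 \<le> Zf t (path_var p) w" for w
    by (simp add: Zint_def path_var_nonneg)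
  have gm: "(\<lambda>w. gauss_smooth F (f w) (f' w)) \<in> borel_measurable (P x)"
    if "f \<in> borel_measurable (P x)" "f' \<in> borel_measurable (P x)" for f f'
    by (rule gauss_smooth_measurable[OF F that])
  have gi: "integrable (P x) (\<lambda>w. gauss_smooth F (f w) (f' w))"
    if "f \<in> borel_measurable (P x)" "f' \<in> borel_measurable (P x)" for f f'
    by (rule integrable_const_bound[where B = 1]) (auto intro!: gm that gauss_smooth_bounded[OF F])
  have step: "\<bar>(LINT w|P x. F (branch_sum t p n w)) - (LINT w|P x. gauss_smooth F (?g n w) (?v n w))\<bar> \<le> e" for n
  proof -
    let ?k = "\<lambda>w. LINT z|kernel_sum t p (labels n) w. F z"
    have kb: "\<bar>?k w\<bar> \<le> 1" if w: "w \<in> space M" for w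
    proof -
      interpret K: real_distribution "kernel_sum t p (labels n) w"
        by (rule real_distribution_kernel_sum[OF w])
      have "\<bar>?k w\<bar> \<le> (LINT z|kernel_sum t p (labels n) w. \<bar>F z\<bar>)" by (rule integral_abs_bound)
      also have "\<dots> \<le> (LINT z|kernel_sum t p (labels n) w. 1)"
        by (intro integral_mono K.integrable_const_bound[where B = 1]) (auto simp: smooth_tests_bounded F)
      finally show ?thesis by (simp add: K.prob_space[simplified])
    qed
    have km: "?k \<in> borel_measurable (P x)"
      unfolding measurable_law[OF x]
      by (rule measurable_compose[OF measurable_prob_algebraD[OF kernel_sum_measurable[OF t p finite_labels]]
        integral_measurable_subprob_algebra]) measurable
    have ki: "integrable (P x) ?k"
      by (rule integrable_const_bound[where B = 1, OF _ km]) (auto simp: space_law[OF x] intro!: AE_I2 kb)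
    have diff: "ennreal \<bar>?k w - gauss_smooth F (?g n w) (?v n w)\<bar> \<le> (Zp t w3 w)"
      if w: "w \<in> space M" for w
    proof -
      note R = real_distribution_branch_kernel[OF p t w]
      have I: "integrable (branch_kernel t p u w) (\<lambda>z. z ^ 4)" for u
        by (rule integrable_branch_kernel) (auto intro: int t w)
      define l where "l = (\<lambda>y. lindeberg_error (path_law p y))"
      have ev: "mean_of (branch_kernel t p u w) = trait_value t (path_mean p) u w"
        "var_of (branch_kernel t p u w) = trait_value t (path_var p) u w"
        "lindeberg_error (branch_kernel t p u w) = trait_value t l u w" for u
        by (simp_all add: trait_value_def path_mean_def path_var_def l_def branch_kernel_if)
      have tl: "0 \<le> trait_value t l u w" "trait_value t l u w \<le> \<bar>trait_value t w3 u w\<bar>" for u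
        using w3 trait_space[OF t w, of u] lindeberg_error_nonneg
        by (auto simp: trait_value_def l_def intro: order_trans[OF _ abs_ge_self])
      have w3n: "\<bar>w3 y\<bar> \<le> w3 y" if "y \<in> space E" for y
        using w3[OF that] lindeberg_error_nonneg[of "path_law p y"] by linarith
      have "\<bar>?k w - gauss_smooth F (?g n w) (?v n w)\<bar> \<le> (\<Sum>u\<in>labels n. trait_value t l u w)"
        using lindeberg_replacement[of "labels n" F "\<lambda>u. branch_kernel t p u w" 0, OF finite_labels F R I]
        by (simp add: kernel_sum_def gauss_smooth_eq[OF F] ev)
      also have "\<dots> \<le> (\<Sum>u\<in>labels n. \<bar>trait_value t w3 u w\<bar>)" by (intro sum_mono tl)
      finally have "ennreal \<bar>?k w - gauss_smooth F (?g n w) (?v n w)\<bar> \<le> ennreal \<dots>" by (rule ennreal_leI)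
      also have "\<dots> \<le> (Zp t w3 w)"
        by (rule trait_value_sum_le) (use t w w3n in auto)
      finally show ?thesis .
    qed
    have i: "integrable (P x) (\<lambda>w. gauss_smooth F (?g n w) (?v n w))" by (rule gi) measurable
    have "(LINT w|P x. F (branch_sum t p n w)) = (LINT w|P x. ?k w)"
      unfolding branch_sum_def by (rule integral_branch_sum[OF x t p finite_labels _ smooth_tests_bounded[OF F]]) measurable
    then have "\<bar>(LINT w|P x. F (branch_sum t p n w)) - (LINT w|P x. gauss_smooth F (?g n w) (?v n w))\<bar>
        = \<bar>LINT w|P x. ?k w - gauss_smooth F (?g n w) (?v n w)\<bar>"
      by (simp add: Bochner_Integration.integral_diff[OF ki i])
    also have "\<dots> \<le> (LINT w|P x. \<bar>?k w - gauss_smooth F (?g n w) (?v n w)\<bar>)" by (rule integral_abs_bound)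
    also have "\<dots> = enn2real (\<integral>\<^sup>+w. ennreal \<bar>?k w - gauss_smooth F (?g n w) (?v n w)\<bar> \<partial>P x)"
      using ki i by (intro integral_eq_nn_integral) auto
    also have "\<dots> \<le> e"
    proof (rule enn2real_leI[OF e(2)])
      have "(\<integral>\<^sup>+w. ennreal \<bar>?k w - gauss_smooth F (?g n w) (?v n w)\<bar> \<partial>P x)
          \<le> (\<integral>\<^sup>+w. (Zp t w3 w) \<partial>P x)"
        by (intro nn_integral_mono diff) (simp add: space_law[OF x])
      then show "(\<integral>\<^sup>+w. ennreal \<bar>?k w - gauss_smooth F (?g n w) (?v n w)\<bar> \<partial>P x) \<le> ennreal e"
        using e(1) by (rule order_trans)
    qed
    finally show ?thesis .
  qed
  have one: "integrable (P x) (\<lambda>_. 1 :: real)" by simp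
  have "(\<lambda>n. LINT w|P x. F (branch_sum t p n w)) \<longlonglongrightarrow> (LINT w|P x. F (L w))"
  proof (rule integral_dominated_convergence[OF _ _ one])
    show "AE w in P x. (\<lambda>n. F (branch_sum t p n w)) \<longlonglongrightarrow> F (L w)"
      using branch_sum_limit by eventually_elim (rule isCont_tendsto_compose[OF smooth_tests_continuous[OF F]])
  qed (auto simp: smooth_tests_bounded[OF F])
  moreover have "(\<lambda>n. LINT w|P x. gauss_smooth F (?g n w) (?v n w)) \<longlonglongrightarrow>
      (LINT w|P x. gauss_smooth F (Zf t (path_mean p) w) (Zf t (path_var p) w))"
  proof (rule integral_dominated_convergence[OF _ _ one])
    show "AE w in P x. (\<lambda>n. gauss_smooth F (?g n w) (?v n w)) \<longlonglongrightarrow>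
        gauss_smooth F (Zf t (path_mean p) w) (Zf t (path_var p) w)"
      using trait_sums
    proof eventually_elim
      case (elim w)
      let ?G = "Zf t (path_mean p) w" and ?V = "Zf t (path_var p) w"
      \<comment> \<open>The Lipschitz estimate plays the part of joint continuity of
        \<open>gauss_smooth\<close> in mean and variance.\<close>
      have "(\<lambda>n. \<bar>?g n w - ?G\<bar> + \<bar>?v n w - ?V\<bar>) \<longlonglongrightarrow> \<bar>?G - ?G\<bar> + \<bar>?V - ?V\<bar>"
        using elim by (intro tendsto_intros) auto
      then have "(\<lambda>n. \<bar>?g n w - ?G\<bar> + \<bar>?v n w - ?V\<bar>) \<longlonglongrightarrow> 0" by simp
      then have "(\<lambda>n. gauss_smooth F (?g n w) (?v n w) - gauss_smooth F ?G ?V) \<longlonglongrightarrow> 0"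
        by (rule Lim_null_comparison[rotated])
           (auto intro!: always_eventually gauss_smooth_lipschitz[OF F] v_nonneg Zv_nonneg)
      then show ?case by (rule LIM_zero_cancel)
    qed
    show "(\<lambda>w. gauss_smooth F (?g n w) (?v n w)) \<in> borel_measurable (P x)" for n by (rule gm) measurable
  qed (auto simp: gauss_smooth_bounded[OF F] intro!: gm)
  ultimately have "(\<lambda>n. \<bar>(LINT w|P x. F (branch_sum t p n w)) - (LINT w|P x. gauss_smooth F (?g n w) (?v n w))\<bar>) \<longlonglongrightarrow>
      \<bar>(LINT w|P x. F (L w)) - (LINT w|P x. gauss_smooth F (Zf t (path_mean p) w) (Zf t (path_var p) w))\<bar>"
    by (intro tendsto_intros)
  then show ?thesis by (rule LIMSEQ_le_const2) (use step in auto)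
qed

end

end

end

end

section \<open>Functionals of the path\<close>

text \<open>Two times are allowed so that one construction covers a fluctuation with
  \<open>W\<close> replaced by the martingale at a later time, an increment of the martingale, and,
  with \<open>b = 0\<close>, a single population integral.\<close>

definition path_functional ::
    "real \<Rightarrow> ('x \<Rightarrow> real) \<Rightarrow> real \<Rightarrow> real \<Rightarrow> ('x \<Rightarrow> real) \<Rightarrow> real \<Rightarrow> (real \<Rightarrow> 'x measure) \<Rightarrow> real" where
  "path_functional a f s b k r p = a * (LINT y|p s. f y) + b * (LINT y|p r. k y)"

context branching
begin

lemma path_functional_measurable [measurable]:
  assumes "f \<in> borel_measurable E" "k \<in> borel_measurable E" "0 \<le> s" "0 \<le> r"
  shows "path_functional a f s b k r \<in> borel_measurable (path_space E)"
  unfolding path_functional_def[abs_def]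
  using measurable_compose[OF measurable_path_eval[OF assms(3)] integral_measurable_measure_algebra[OF assms(1)]]
    measurable_compose[OF measurable_path_eval[OF assms(4)] integral_measurable_measure_algebra[OF assms(2)]]
  by measurable

lemma path_functional_population:
  assumes "0 \<le> s" "0 \<le> r"
  shows "path_functional a f s b k r (population_path B w) = a * Zf s f w + b * Zf r k w"
  using assms by (simp add: path_functional_def population_path_def Zint_def)

text \<open>Positive and negative part are split over the branches separately by the non-negative
  version. Finite total mass of \<open>|f|\<close> makes each branch integral finite, so that the
  default value of a non-existing integral never interferes.\<close>

lemma Zint_split:
  fixes f :: "'x \<Rightarrow> real"
  assumes [measurable]: "f \<in> borel_measurable E" and t: "0 \<le> t" and s: "0 \<le> s" and w: "w \<in> space M"
    and fin: "(\<integral>\<^sup>+y. ennreal \<bar>f y\<bar> \<partial>population B (t + s) w) < \<infinity>"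
  defines "z \<equiv> \<lambda>u. if u \<in> alive B t w then \<integral>y. f y \<partial>subpopulation B t u s w else 0"
  shows "(\<integral>\<^sup>+u. ennreal \<bar>z u\<bar> \<partial>count_space UNIV) \<le> (\<integral>\<^sup>+y. ennreal \<bar>f y\<bar> \<partial>population B (t + s) w)"
    and "integrable (count_space UNIV) z" and "Zf (t + s) f w = (LINT u|count_space UNIV. z u)"
proof -
  define A where "A g u = (if u \<in> alive B t w then \<integral>\<^sup>+y. ennreal (g y) \<partial>subpopulation B t u s w else 0)"
    for g :: "'x \<Rightarrow> real" and u
  have split: "(\<integral>\<^sup>+y. ennreal (g y) \<partial>population B (t + s) w) = (\<integral>\<^sup>+u. A g u \<partial>count_space UNIV)"
    if [measurable]: "g \<in> borel_measurable E" for g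
    unfolding A_def by (rule nn_integral_population_split) (use t s w in auto)
  have Ale: "A g u \<le> A (\<lambda>y. \<bar>f y\<bar>) u" if "\<And>y. g y \<le> \<bar>f y\<bar>" for g u
    unfolding A_def using that by (auto intro!: nn_integral_mono ennreal_leI)
  have tot: "(\<integral>\<^sup>+u. A (\<lambda>y. \<bar>f y\<bar>) u \<partial>count_space UNIV) < \<infinity>"
    using fin split[of "\<lambda>y. \<bar>f y\<bar>"] by simp
  have "AE u in count_space UNIV. A (\<lambda>y. \<bar>f y\<bar>) u \<noteq> \<infinity>"
    using tot by (intro nn_integral_PInf_AE) (auto simp: less_top)
  then have Afin: "A (\<lambda>y. \<bar>f y\<bar>) u < \<infinity>" for u by (simp add: AE_count_space less_top)
  have gfin: "A g u < \<infinity>" if "\<And>y. g y \<le> \<bar>f y\<bar>" for g u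
    using Ale[of g u] that Afin[of u] by (auto intro: le_less_trans)
  have z: "z u = enn2real (A f u) - enn2real (A (\<lambda>y. - f y) u)" for u
  proof (cases "u \<in> alive B t w")
    case True
    have "f \<in> borel_measurable (subpopulation B t u s w)" by (simp cong: measurable_cong_sets)
    from integral_eq_enn2real[OF this] show ?thesis
      using True Afin[of u] by (simp add: z_def A_def)
  qed (simp add: z_def A_def)
  \<comment> \<open>If the integral over a branch does not exist, its value is 0 and the bound is
    trivial.\<close>
  have "ennreal \<bar>z u\<bar> \<le> A (\<lambda>y. \<bar>f y\<bar>) u" for u
    unfolding z_def A_def using integral_norm_bound_ennreal[of "subpopulation B t u s w" f]
    by (cases "integrable (subpopulation B t u s w) f") (auto simp: not_integrable_integral_eq)
  then have "(\<integral>\<^sup>+u. ennreal \<bar>z u\<bar> \<partial>count_space UNIV) \<le> (\<integral>\<^sup>+u. A (\<lambda>y. \<bar>f y\<bar>) u \<partial>count_space UNIV)"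
    by (intro nn_integral_mono)
  also have "\<dots> = (\<integral>\<^sup>+y. ennreal \<bar>f y\<bar> \<partial>population B (t + s) w)" by (rule split[symmetric]) simp
  finally show le: "(\<integral>\<^sup>+u. ennreal \<bar>z u\<bar> \<partial>count_space UNIV) \<le> (\<integral>\<^sup>+y. ennreal \<bar>f y\<bar> \<partial>population B (t + s) w)" .
  then show "integrable (count_space UNIV) z"
    using fin by (simp add: integrable_iff_bounded le_less_trans)
  have part: "integrable (count_space UNIV) (\<lambda>u. enn2real (A g u))"
    "(LINT u|count_space UNIV. enn2real (A g u)) = enn2real (\<integral>\<^sup>+y. ennreal (g y) \<partial>population B (t + s) w)"
    if [measurable]: "g \<in> borel_measurable E" and g: "\<And>y. g y \<le> \<bar>f y\<bar>" for g
  proof -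
    have eq: "ennreal (enn2real (A g u)) = A g u" for u using gfin[of g u] g by simp
    have "(\<integral>\<^sup>+u. A g u \<partial>count_space UNIV) \<le> (\<integral>\<^sup>+u. A (\<lambda>y. \<bar>f y\<bar>) u \<partial>count_space UNIV)"
      by (intro nn_integral_mono Ale g)
    then show "integrable (count_space UNIV) (\<lambda>u. enn2real (A g u))"
      using tot by (simp add: integrable_iff_bounded eq le_less_trans)
    show "(LINT u|count_space UNIV. enn2real (A g u)) = enn2real (\<integral>\<^sup>+y. ennreal (g y) \<partial>population B (t + s) w)"
      by (subst integral_eq_nn_integral) (auto simp: eq split)
  qed
  have "f \<in> borel_measurable (population B (t + s) w)" by (simp cong: measurable_cong_sets)
  from integral_eq_enn2real[OF this]
  have "Zf (t + s) f w = enn2real (\<integral>\<^sup>+y. ennreal (f y) \<partial>population B (t + s) w)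
      - enn2real (\<integral>\<^sup>+y. ennreal (- f y) \<partial>population B (t + s) w)"
    using fin by (simp add: Zint_def)
  also have "\<dots> = (LINT u|count_space UNIV. enn2real (A f u)) - (LINT u|count_space UNIV. enn2real (A (\<lambda>y. - f y) u))"
    using part(2)[of f] part(2)[of "\<lambda>y. - f y"] by simp
  also have "\<dots> = (LINT u|count_space UNIV. z u)"
    unfolding z using part(1)[of f] part(1)[of "\<lambda>y. - f y"] by simp
  finally show "Zf (t + s) f w = (LINT u|count_space UNIV. z u)" .
qed

lemma path_functional_split:
  fixes f k :: "'x \<Rightarrow> real"
  assumes "f \<in> borel_measurable E" "k \<in> borel_measurable E" "0 \<le> t" "0 \<le> s" "0 \<le> r" "w \<in> space M"
    and f: "(\<integral>\<^sup>+y. ennreal \<bar>f y\<bar> \<partial>population B (t + s) w) \<le> ennreal d" "0 \<le> d"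
    and k: "(\<integral>\<^sup>+y. ennreal \<bar>k y\<bar> \<partial>population B (t + r) w) \<le> ennreal e" "0 \<le> e"
  shows "(\<integral>\<^sup>+u. ennreal \<bar>branch_value t (path_functional a f s b k r) u w\<bar> \<partial>count_space UNIV) \<le> ennreal (\<bar>a\<bar> * d + \<bar>b\<bar> * e)"
    and "a * Zf (t + s) f w + b * Zf (t + r) k w
      = (LINT u|count_space UNIV. branch_value t (path_functional a f s b k r) u w)"
proof -
  let ?z = "\<lambda>u. if u \<in> alive B t w then \<integral>y. f y \<partial>subpopulation B t u s w else 0"
  let ?y = "\<lambda>u. if u \<in> alive B t w then \<integral>y. k y \<partial>subpopulation B t u r w else 0"
  have bv: "branch_value t (path_functional a f s b k r) u w = a * ?z u + b * ?y u" for u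
    using assms by (simp add: branch_value_def path_functional_def subpopulation_path_def)
  have f': "(\<integral>\<^sup>+y. ennreal \<bar>f y\<bar> \<partial>population B (t + s) w) < \<infinity>"
    and k': "(\<integral>\<^sup>+y. ennreal \<bar>k y\<bar> \<partial>population B (t + r) w) < \<infinity>"
    using f k by (auto intro: le_less_trans)
  note F = Zint_split[OF assms(1,3,4,6) f'] and K = Zint_split[OF assms(2,3,5,6) k']
  have "(\<integral>\<^sup>+u. ennreal \<bar>a * ?z u + b * ?y u\<bar> \<partial>count_space UNIV)
      \<le> (\<integral>\<^sup>+u. ennreal \<bar>a\<bar> * ennreal \<bar>?z u\<bar> + ennreal \<bar>b\<bar> * ennreal \<bar>?y u\<bar> \<partial>count_space UNIV)"
    by (intro nn_integral_mono)
       (simp add: ennreal_mult[symmetric] ennreal_plus[symmetric] abs_mult[symmetric] abs_triangle_ineq del: ennreal_plus)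
  also have "\<dots> = ennreal \<bar>a\<bar> * (\<integral>\<^sup>+u. ennreal \<bar>?z u\<bar> \<partial>count_space UNIV) + ennreal \<bar>b\<bar> * (\<integral>\<^sup>+u. ennreal \<bar>?y u\<bar> \<partial>count_space UNIV)"
    by (simp add: nn_integral_add nn_integral_cmult)
  also have "\<dots> \<le> ennreal \<bar>a\<bar> * ennreal d + ennreal \<bar>b\<bar> * ennreal e"
    by (intro add_mono mult_left_mono order_trans[OF F(1) f(1)] order_trans[OF K(1) k(1)]) auto
  also have "\<dots> = ennreal (\<bar>a\<bar> * d + \<bar>b\<bar> * e)"
    using f(2) k(2) by (simp add: ennreal_mult[symmetric] ennreal_plus[symmetric] del: ennreal_plus)
  finally show "(\<integral>\<^sup>+u. ennreal \<bar>branch_value t (path_functional a f s b k r) u w\<bar> \<partial>count_space UNIV) \<le> ennreal (\<bar>a\<bar> * d + \<bar>b\<bar> * e)"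
    by (simp add: bv)
  show "a * Zf (t + s) f w + b * Zf (t + r) k w
      = (LINT u|count_space UNIV. branch_value t (path_functional a f s b k r) u w)"
    unfolding bv F(3) K(3) using F(2) K(2) by simp
qed

text \<open>For a single label the branching property bounds the probability of a bad branch by an
  average of probabilities that all vanish. Countably many labels then allow one common null
  set.\<close>

lemma AE_subpopulation:
  assumes x: "x \<in> space E" and t: "0 \<le> t" and s: "0 \<le> s" and C [measurable]: "C \<in> sets (measure_algebra E)"
    and null: "\<And>y. y \<in> space E \<Longrightarrow> AE w in P y. population B s w \<notin> C"
  shows "AE w in P x. \<forall>u\<in>alive B t w. subpopulation B t u s w \<notin> C"
proof -
  interpret prob_space "P x" by (rule prob_space_law[OF x])
  define A where "A = {p \<in> space (path_space E). p s \<in> C}"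
  have A: "A \<in> sets (path_space E)"
    unfolding A_def using measurable_sets[OF measurable_path_eval[OF s] C] by (simp add: vimage_def Int_def conj_commute)
  have "AE w in P x. branch_event t (\<lambda>_. A) u w = 0" for u
  proof -
    have [measurable]: "branch_event t (\<lambda>_. A) u \<in> borel_measurable (P x)"
      unfolding measurable_law[OF x] by (rule branch_event_measurable[OF t A])
    have "branch_prob t (\<lambda>_. A) u w = 0" if w: "w \<in> space M" for w
    proof (cases "u \<in> alive B t w")
      case True
      note y = trait_space[OF t w True]
      interpret Y: prob_space "P (trait B t u w)" by (rule prob_space_law[OF y])
      have "{w' \<in> space M. population_path B w' \<in> A} \<in> null_sets (P (trait B t u w))"
      proof (rule AE_iff_null_sets[THEN iffD2])
        show "{w' \<in> space M. population_path B w' \<in> A} \<in> sets (P (trait B t u w))"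
          using measurable_sets[OF measurable_population_path A]
          by (simp add: sets_law[OF y] vimage_def Int_def conj_commute)
        show "AE w' in P (trait B t u w). w' \<notin> {w' \<in> space M. population_path B w' \<in> A}"
          using null[OF y] by eventually_elim (use s in \<open>simp add: A_def population_path_def\<close>)
      qed
      then show ?thesis using True by (simp add: branch_prob_def measure_def null_setsD1)
    qed (simp add: branch_prob_def)
    then have "(LINT w|P x. branch_prob t (\<lambda>_. A) u w) = 0"
      by (intro integral_eq_zero_AE AE_I2) (simp add: space_law[OF x])
    then have "(LINT w|P x. branch_event t (\<lambda>_. A) u w) = 0"
      using integral_branch_event[OF x t, of "{u}" "\<lambda>_. A"] A by simp
    then show ?thesis
      by (subst (asm) integral_nonneg_eq_0_iff_AE)
         (auto intro!: integrable_const_bound[where B = 1] simp: branch_event_def)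
  qed
  then have "AE w in P x. \<forall>u. branch_event t (\<lambda>_. A) u w = 0"
    by (simp add: AE_all_countable)
  then show ?thesis
    using AE_space
  proof eventually_elim
    case (elim w)
    then have w: "w \<in> space M" by (simp add: space_law[OF x])
    show ?case
    proof
      fix u assume "u \<in> alive B t w"
      then have "subpopulation_path B t u w \<notin> A" using elim(1) by (auto simp: branch_event_def split: if_splits)
      then show "subpopulation B t u s w \<notin> C"
        using measurable_space[OF measurable_subpopulation_path[OF t] w, of u] s
        by (simp add: A_def subpopulation_path_def)
    qed
  qed
qed

text \<open>Each term is at most the whole sum, so all factors of its power but one can be replaced
  by the sum. Moments of \<open>Z_t(V^j)\<close> are thereby reduced to moments of
  \<open>Z_t(V)\<close>. Exponent 0 is excluded by \<open>Suc n\<close>, as it would count the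
  individuals.\<close>

lemma population_power_le:
  assumes [measurable]: "f \<in> borel_measurable E" and "0 \<le> t" "w \<in> space M"
  shows "(\<integral>\<^sup>+y. f y ^ Suc n \<partial>population B t w) \<le> (\<integral>\<^sup>+y. f y \<partial>population B t w) ^ Suc n"
proof -
  let ?a = "\<lambda>u. if u \<in> alive B t w then f (trait B t u w) else 0"
  let ?S = "\<integral>\<^sup>+u. ?a u \<partial>count_space UNIV"
  have a: "?a u \<le> ?S" for u
  proof -
    have "?a u = (\<integral>\<^sup>+v. ?a u * indicator {u} v \<partial>count_space UNIV)" by (simp add: nn_integral_cmult)
    also have "\<dots> \<le> ?S" by (intro nn_integral_mono) (auto simp: indicator_def)
    finally show ?thesis .
  qed
  have "(\<integral>\<^sup>+y. f y ^ Suc n \<partial>population B t w) = (\<integral>\<^sup>+u. ?a u * ?a u ^ n \<partial>count_space UNIV)"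
    using assms by (subst nn_integral_population) (auto intro!: nn_integral_cong)
  also have "\<dots> \<le> (\<integral>\<^sup>+u. ?a u * ?S ^ n \<partial>count_space UNIV)"
    by (intro nn_integral_mono mult_left_mono power_mono a) auto
  also have "\<dots> = ?S * ?S ^ n" by (subst nn_integral_multc) auto
  finally show ?thesis using assms by (simp add: nn_integral_population)
qed

end


text \<open>The elementary bound is applied to \<open>z / V\<close>, which keeps homogeneity: from a
  fourth moment of order \<open>V^4\<close> one obtains a \<open>k\<close>-th moment of order
  \<open>V^k\<close>.\<close>

lemma power_le_of_fourth:
  fixes z V :: real
  assumes "0 < V" "k \<le> 4"
  shows "\<bar>z\<bar> ^ k \<le> V ^ k * (1 + z ^ 4 / V ^ 4)"
proof -
  have "\<bar>z\<bar> ^ k = V ^ k * \<bar>z / V\<bar> ^ k" using assms by (simp add: power_divide)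
  also have "\<dots> \<le> V ^ k * (1 + \<bar>z / V\<bar> ^ 4)"
    using assms by (intro mult_left_mono power_abs_le_one_plus_power) auto
  finally show ?thesis by (simp add: power_divide power_even_abs)
qed

section \<open>Moments of the weighted population\<close>

lemma ennreal_fourth_poly:
  assumes "0 \<le> p" "0 \<le> q" "0 \<le> r"
  shows "64 * ennreal p + 24 * (ennreal q)\<^sup>2 + 72 * (ennreal r) ^ 4 = ennreal (64 * p + 24 * q\<^sup>2 + 72 * r ^ 4)"
  using assms by (simp add: ennreal_mult ennreal_power)

lemma tendsto_power4_ennreal:
  fixes f :: "'a \<Rightarrow> ennreal"
  assumes "(f \<longlongrightarrow> l) F"
  shows "((\<lambda>n. f n ^ 4) \<longlongrightarrow> l ^ 4) F"
proof -
  have sq: "((\<lambda>n. g n * g n) \<longlongrightarrow> m * m) F" if "(g \<longlongrightarrow> m) F" for g :: "'a \<Rightarrow> ennreal" and m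
    using that by (intro tendsto_mult_ennreal) auto
  have "((\<lambda>n. (f n * f n) * (f n * f n)) \<longlongrightarrow> (l * l) * (l * l)) F"
    by (intro sq assms)
  then show ?thesis by (simp add: power4_eq_xxxx mult.assoc)
qed

locale weighted_branching = branching B for B :: "('x, 'u::countable, 'w) branching_model" +
  fixes V :: "'x \<Rightarrow> real" and \<kappa> :: nat
  assumes V_measurable [measurable]: "V \<in> borel_measurable (trait_space B)"
    and V_pos: "x \<in> space (trait_space B) \<Longrightarrow> 0 < V x"
    and kappa: "4 \<le> \<kappa>"
    and moments: "assumption_moments B V \<kappa>"
begin

text \<open>Formulated with non-negative integrals, so that it includes almost sure finiteness of
  \<open>Z_t(V)\<close> and can be established before integrability is known.\<close>

definition fourth_bound :: "real \<Rightarrow> real \<Rightarrow> bool" where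
  "fourth_bound t c \<longleftrightarrow> 0 \<le> c \<and> (\<forall>x\<in>space E.
     (\<integral>\<^sup>+w. (Zp t V w) ^ 4 \<partial>P x) \<le> ennreal (c * V x ^ 4))"

lemma population_measurable_law:
  "x \<in> space E \<Longrightarrow> 0 \<le> t \<Longrightarrow> f \<in> borel_measurable E \<Longrightarrow> (\<lambda>w. \<integral>\<^sup>+y. f y \<partial>population B t w) \<in> borel_measurable (P x)"
  unfolding measurable_law
  by (rule measurable_compose[OF measurable_population nn_integral_measurable_measure_algebra])

lemma Zint_measurable_law:
  "x \<in> space E \<Longrightarrow> 0 \<le> t \<Longrightarrow> f \<in> borel_measurable E \<Longrightarrow> Zf t f \<in> borel_measurable (P x)"
  unfolding measurable_law by measurable

lemma space_population [simp]: "space (population B t w) = space E"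
  by (rule sets_eq_imp_space_eq) simp

lemma measurable_population_eq: "measurable (population B t w) N = measurable E N"
  by (rule measurable_cong_sets) auto

lemma Zint_V_eq: "Zf t V w = enn2real (Zp t V w)"
  unfolding Zint_def
  by (rule integral_eq_nn_integral) (auto simp: measurable_population_eq intro!: AE_I2 less_imp_le V_pos)

lemma Zint_V_nonneg: "0 \<le> Zf t V w"
  by (simp add: Zint_V_eq)

lemma finite_population_bound:
  assumes f: "\<And>y. y \<in> space E \<Longrightarrow> \<bar>f y\<bar> \<le> c * V y ^ Suc n" and [measurable]: "f \<in> borel_measurable E"
    and c: "0 \<le> c" and t: "0 \<le> t" and w: "w \<in> space M"
    and fin: "(Zp t V w) < \<infinity>"
  shows "(Zp t (\<lambda>y. \<bar>f y\<bar>) w) \<le> ennreal (c * Zf t V w ^ Suc n)"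
    and "integrable (population B t w) f"
    and "\<bar>Zf t f w\<bar> \<le> c * Zf t V w ^ Suc n"
proof -
  have fm: "f \<in> borel_measurable (population B t w)" by (simp add: measurable_population_eq)
  have "(Zp t (\<lambda>y. \<bar>f y\<bar>) w) \<le> (\<integral>\<^sup>+y. ennreal c * ennreal (V y) ^ Suc n \<partial>population B t w)"
    using V_pos f c by (intro nn_integral_mono) (simp add: ennreal_power ennreal_mult[symmetric] less_imp_le del: power_Suc)
  also have "\<dots> = ennreal c * (\<integral>\<^sup>+y. ennreal (V y) ^ Suc n \<partial>population B t w)"
    by (rule nn_integral_cmult) (simp add: measurable_population_eq del: power_Suc)
  also have "\<dots> \<le> ennreal c * (Zp t V w) ^ Suc n"
    by (intro mult_left_mono population_power_le) (use t w in auto)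
  also have "\<dots> = ennreal (c * Zf t V w ^ Suc n)"
    using fin c by (simp add: Zint_V_eq ennreal_mult ennreal_power[symmetric] del: power_Suc)
  finally show le: "(Zp t (\<lambda>y. \<bar>f y\<bar>) w) \<le> ennreal (c * Zf t V w ^ Suc n)" .
  then show "integrable (population B t w) f"
    using fm by (auto simp: integrable_iff_bounded intro: le_less_trans)
  have "ennreal \<bar>Zf t f w\<bar> \<le> (Zp t (\<lambda>y. \<bar>f y\<bar>) w)"
    unfolding Zint_def using integral_norm_bound_ennreal[of "population B t w" f] \<open>integrable (population B t w) f\<close>
    by simp
  also note le
  finally show "\<bar>Zf t f w\<bar> \<le> c * Zf t V w ^ Suc n"
    using c Zint_V_nonneg[of t w] by (simp add: ennreal_le_iff del: power_Suc)
qed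

lemma power_moments:
  fixes Y :: "'w \<Rightarrow> real"
  assumes x: "x \<in> space E" and [measurable]: "Y \<in> borel_measurable (P x)"
    and int: "integrable (P x) (\<lambda>w. Y w ^ 4)" and le: "(LINT w|P x. Y w ^ 4) \<le> c * V x ^ 4" and k: "k \<le> 4"
  shows "integrable (P x) (\<lambda>w. \<bar>Y w\<bar> ^ k)" and "(LINT w|P x. \<bar>Y w\<bar> ^ k) \<le> (1 + c) * V x ^ k"
proof -
  interpret prob_space "P x" by (rule prob_space_law[OF x])
  show i: "integrable (P x) (\<lambda>w. \<bar>Y w\<bar> ^ k)"
    using integrable_power_le[of "\<lambda>w. \<bar>Y w\<bar>" 4 k] int k by (simp add: power_even_abs)
  have "(LINT w|P x. \<bar>Y w\<bar> ^ k) \<le> (LINT w|P x. V x ^ k * (1 + Y w ^ 4 / V x ^ 4))"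
    using i int V_pos[OF x] k by (intro integral_mono power_le_of_fourth) auto
  also have "\<dots> = V x ^ k * (1 + (LINT w|P x. Y w ^ 4) / V x ^ 4)"
    using int by (simp add: prob_space)
  also have "\<dots> \<le> V x ^ k * (1 + c)"
    using le V_pos[OF x] by (intro mult_left_mono add_mono) (auto simp: field_simps)
  finally show "(LINT w|P x. \<bar>Y w\<bar> ^ k) \<le> (1 + c) * V x ^ k" by (simp add: mult.commute)
qed

lemma fourth_boundD:
  assumes c: "fourth_bound t c" and t: "0 \<le> t" and x: "x \<in> space E"
  shows "AE w in P x. (Zp t V w) < \<infinity>"
    and "integrable (P x) (\<lambda>w. Zf t V w ^ 4)"
    and "(LINT w|P x. Zf t V w ^ 4) \<le> c * V x ^ 4"
    and "(\<integral>\<^sup>+w. (Zp t V w) ^ 4 \<partial>P x) = ennreal (LINT w|P x. Zf t V w ^ 4)"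
proof -
  have le: "(\<integral>\<^sup>+w. (Zp t V w) ^ 4 \<partial>P x) \<le> ennreal (c * V x ^ 4)" and c0: "0 \<le> c"
    using c x by (auto simp: fourth_bound_def)
  have [measurable]: "(\<lambda>w. Zp t V w) \<in> borel_measurable (P x)"
    by (rule population_measurable_law[OF x t]) simp
  have [measurable]: "Zf t V \<in> borel_measurable (P x)"
    by (rule Zint_measurable_law[OF x t V_measurable])
  have "AE w in P x. (Zp t V w) ^ 4 \<noteq> \<infinity>"
  proof (rule nn_integral_PInf_AE)
    show "(\<lambda>w. (Zp t V w) ^ 4) \<in> borel_measurable (P x)" by measurable
    have "(\<integral>\<^sup>+w. (Zp t V w) ^ 4 \<partial>P x) < \<infinity>" by (rule le_less_trans[OF le]) simp
    then show "(\<integral>\<^sup>+w. (Zp t V w) ^ 4 \<partial>P x) \<noteq> \<infinity>" by (rule less_imp_neq)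
  qed
  then show fin: "AE w in P x. (Zp t V w) < \<infinity>"
    by eventually_elim (simp only: infinity_ennreal_def power_eq_top_ennreal less_top[symmetric], simp)
  have eq: "(\<integral>\<^sup>+w. (Zp t V w) ^ 4 \<partial>P x) = (\<integral>\<^sup>+w. ennreal (Zf t V w ^ 4) \<partial>P x)"
    using fin by (intro nn_integral_cong_AE, eventually_elim) (simp add: Zint_V_eq ennreal_power[symmetric])
  show int: "integrable (P x) (\<lambda>w. Zf t V w ^ 4)"
  proof (rule integrableI_nonneg)
    show "(\<integral>\<^sup>+w. ennreal (Zf t V w ^ 4) \<partial>P x) < \<infinity>"
      using le unfolding eq by (auto intro: le_less_trans)
  qed auto
  show eq2: "(\<integral>\<^sup>+w. (Zp t V w) ^ 4 \<partial>P x) = ennreal (LINT w|P x. Zf t V w ^ 4)"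
    unfolding eq by (rule nn_integral_eq_integral[OF int]) simp
  show "(LINT w|P x. Zf t V w ^ 4) \<le> c * V x ^ 4"
    using le c0 V_pos[OF x] unfolding eq2 by (simp add: ennreal_le_iff less_imp_le)
qed

lemma fourth_bound_short_time: "\<exists>r>0. \<exists>a. \<forall>t. 0 \<le> t \<and> t \<le> r \<longrightarrow> fourth_bound t a"
proof -
  obtain r a where r: "0 < r" and a: "0 < a" and *: "\<forall>x\<in>space E. \<forall>k\<in>{1..\<kappa>}.
        (SUP t\<in>{0..r}. \<integral>\<^sup>+ w. (\<integral>\<^sup>+ y. ennreal (V y) \<partial>population B t w) ^ k \<partial>P x) \<le> ennreal (a * V x ^ k)"
    using moments unfolding assumption_moments_def by blast
  have "fourth_bound t a" if "0 \<le> t" "t \<le> r" for t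
    unfolding fourth_bound_def
  proof (intro conjI ballI)
    fix x assume x: "x \<in> space E"
    have "4 \<in> {1..\<kappa>}" using kappa by simp
    then have "(SUP t\<in>{0..r}. \<integral>\<^sup>+ w. (\<integral>\<^sup>+ y. ennreal (V y) \<partial>population B t w) ^ 4 \<partial>P x) \<le> ennreal (a * V x ^ 4)"
      using * x by blast
    then show "(\<integral>\<^sup>+ w. (\<integral>\<^sup>+ y. ennreal (V y) \<partial>population B t w) ^ 4 \<partial>P x) \<le> ennreal (a * V x ^ 4)"
      using that by (auto simp: SUP_le_iff)
  qed (use a in simp)
  with r show ?thesis by blast
qed

text \<open>The population at time \<open>t + s\<close> is the sum of the branches started at time
  \<open>t\<close>, so the fourth-moment inequality for independent sums multiplies the two bounds,
  up to the polynomial in \<open>a\<close>. As finiteness is part of the claim, Fatou's lemma is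
  applied to a left side that may be infinite.\<close>

lemma fourth_bound_step:
  assumes s: "fourth_bound s a" "0 \<le> s" and t: "fourth_bound t c" "0 \<le> t"
  shows "fourth_bound (t + s) ((64 * a + 24 * (1 + a)\<^sup>2 + 72 * (1 + a) ^ 4) * c)"
  unfolding fourth_bound_def
proof (intro conjI ballI)
  have a0: "0 \<le> a" and c0: "0 \<le> c" using assms by (auto simp: fourth_bound_def)
  show "0 \<le> (64 * a + 24 * (1 + a)\<^sup>2 + 72 * (1 + a) ^ 4) * c" using a0 c0 by simp
  fix x assume x: "x \<in> space E"
  \<comment> \<open>A real-valued integral, hence 0 on paths of infinite mass at time
    \<open>s\<close>; such branches have to be excluded almost surely.\<close>
  define p where "p = (\<lambda>p' :: real \<Rightarrow> 'x measure. LINT y|p' s. V y)"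
  have pfm [measurable]: "p \<in> borel_measurable (path_space E)"
    unfolding p_def by (rule measurable_compose[OF measurable_path_eval[OF s(2)] integral_measurable_measure_algebra]) simp
  have pp': "p (population_path B w) = Zf s V w" for w
    using s by (simp add: p_def population_path_def Zint_def)
  have pl: "integrable (path_law p y) (\<lambda>z. z ^ 4)" "(LINT z|path_law p y. z ^ 4) \<le> a * V y ^ 4"
    "(LINT z|path_law p y. z\<^sup>2) \<le> (1 + a) * V y ^ 2" "\<bar>path_mean p y\<bar> \<le> (1 + a) * V y"
    if y: "y \<in> space E" for y
  proof -
    note fb = fourth_boundD[OF s y]
    have [measurable]: "Zf s V \<in> borel_measurable (P y)" by (rule Zint_measurable_law[OF y s(2) V_measurable])
    note pm = power_moments[OF y _ fb(2,3)]
    show "integrable (path_law p y) (\<lambda>z. z ^ 4)" "(LINT z|path_law p y. z ^ 4) \<le> a * V y ^ 4"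
      using fb y by (simp_all add: integrable_path_law integral_path_law pp')
    show "(LINT z|path_law p y. z\<^sup>2) \<le> (1 + a) * V y ^ 2"
      using pm(2)[of 2] y by (simp add: integral_path_law pp')
    show "\<bar>path_mean p y\<bar> \<le> (1 + a) * V y"
      using pm(2)[of 1] y Zint_V_nonneg by (simp add: path_mean_def mean_of_def integral_path_law pp')
  qed
  let ?pop = "\<lambda>w. Zp t V w"
  have Q: "AE w in P x. (\<integral>\<^sup>+y. ennreal (V y) \<partial>population B (t + s) w) ^ 4 \<le> liminf (\<lambda>n. ennreal (branch_sum t p n w ^ 4))"
  proof -
    \<comment> \<open>The populations of infinite mass. Starting from any single trait they have
      probability 0 at time \<open>s\<close>, hence almost surely no branch belongs to
      \<open>C\<close>.\<close>
    define C where "C = {\<mu> \<in> space (measure_algebra E). (\<integral>\<^sup>+y. ennreal (V y) \<partial>\<mu>) = \<infinity>}"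
    have C: "C \<in> sets (measure_algebra E)" unfolding C_def by measurable
    have "AE w in P x. \<forall>u\<in>alive B t w. subpopulation B t u s w \<notin> C"
    proof (rule AE_subpopulation[OF x t(2) s(2) C])
      fix y assume y: "y \<in> space E"
      show "AE w in P y. population B s w \<notin> C"
        using fourth_boundD(1)[OF s y] by eventually_elim (auto simp: C_def)
    qed
    then show ?thesis
      using AE_space
    proof eventually_elim
      case (elim w)
      then have w: "w \<in> space M" by (simp add: space_law[OF x])
      let ?A = "\<lambda>u. if u \<in> alive B t w then \<integral>\<^sup>+y. ennreal (V y) \<partial>subpopulation B t u s w else 0"
      have A: "?A u = ennreal (branch_value t p u w)" for u
      proof (cases "u \<in> alive B t w")
        case True
        have fin: "(\<integral>\<^sup>+y. ennreal (V y) \<partial>subpopulation B t u s w) < \<infinity>"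
          using elim(1) True by (auto simp: C_def space_measure_algebra less_top)
        have "space (subpopulation B t u s w) = space E" by (rule sets_eq_imp_space_eq) simp
        moreover have "V \<in> borel_measurable (subpopulation B t u s w)" by (simp cong: measurable_cong_sets)
        ultimately have "(LINT y|subpopulation B t u s w. V y) = enn2real (\<integral>\<^sup>+y. ennreal (V y) \<partial>subpopulation B t u s w)"
          by (intro integral_eq_nn_integral) (auto intro!: AE_I2 less_imp_le V_pos)
        then show ?thesis using True fin s by (simp add: branch_value_def p_def subpopulation_path_def)
      qed (simp add: branch_value_def)
      have bv0: "0 \<le> branch_value t p u w" for u
      proof (cases "u \<in> alive B t w")
        case True
        have "space (subpopulation B t u s w) = space E" by (rule sets_eq_imp_space_eq) simp
        then have "0 \<le> (LINT y|subpopulation B t u s w. V y)"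
          using V_pos by (intro integral_nonneg_AE AE_I2 less_imp_le) simp
        then show ?thesis using True s by (simp add: branch_value_def p_def subpopulation_path_def)
      qed (simp add: branch_value_def)
      have "(\<integral>\<^sup>+y. ennreal (V y) \<partial>population B (t + s) w) = (\<integral>\<^sup>+u. ?A u \<partial>count_space UNIV)"
        by (rule nn_integral_population_split) (use t s w in auto)
      also have "\<dots> = (\<integral>\<^sup>+u. ennreal (branch_value t p u w) \<partial>count_space UNIV)"
        unfolding A ..
      \<comment> \<open>Monotone convergence along the exhaustion identifies the possibly infinite
        population integral with the supremum of the finite branch sums; its fourth power is then
        the limit required by Fatou's lemma.\<close>
      also have "\<dots> = (\<integral>\<^sup>+u. (SUP n. ennreal (branch_value t p u w) * indicator (labels n) u) \<partial>count_space UNIV)"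
      proof (rule nn_integral_cong)
        fix u
        have "ennreal (branch_value t p u w) * indicator (labels n) u \<le> ennreal (branch_value t p u w)" for n
          by (simp split: split_indicator)
        moreover have "ennreal (branch_value t p u w) \<le> ennreal (branch_value t p u w) * indicator (labels (Suc (to_nat u))) u"
          by (simp add: labels_def)
        ultimately show "ennreal (branch_value t p u w) = (SUP n. ennreal (branch_value t p u w) * indicator (labels n) u)"
          by (intro antisym SUP_least SUP_upper2[of "Suc (to_nat u)"]) auto
      qed
      also have "\<dots> = (SUP n. \<integral>\<^sup>+u. ennreal (branch_value t p u w) * indicator (labels n) u \<partial>count_space UNIV)"
      proof (rule nn_integral_monotone_convergence_SUP)
        show "incseq (\<lambda>n u. ennreal (branch_value t p u w) * indicator (labels n) u)"
          by (auto simp: incseq_def le_fun_def labels_def split: split_indicator)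
      qed simp
      also have "\<dots> = (SUP n. ennreal (branch_sum t p n w))"
      proof (intro SUP_cong refl)
        fix n
        have "(\<integral>\<^sup>+u. ennreal (branch_value t p u w) * indicator (labels n) u \<partial>count_space UNIV)
            = (\<integral>\<^sup>+u. ennreal (branch_value t p u w) \<partial>count_space (labels n))"
          by (rule nn_integral_count_space_indicator[symmetric]) simp
        also have "\<dots> = ennreal (branch_sum t p n w)"
          using bv0 by (simp add: nn_integral_count_space_finite branch_sum_def)
        finally show "(\<integral>\<^sup>+u. ennreal (branch_value t p u w) * indicator (labels n) u \<partial>count_space UNIV)
            = ennreal (branch_sum t p n w)" .
      qed
      finally have sup: "(\<integral>\<^sup>+y. ennreal (V y) \<partial>population B (t + s) w) = (SUP n. ennreal (branch_sum t p n w))" .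
      have inc: "incseq (\<lambda>n. ennreal (branch_sum t p n w))"
        unfolding incseq_def branch_sum_def
        by (intro allI impI ennreal_leI sum_mono2 bv0 finite_labels) (auto simp: labels_def)
      have "(\<lambda>n. ennreal (branch_sum t p n w)) \<longlonglongrightarrow> (\<integral>\<^sup>+y. ennreal (V y) \<partial>population B (t + s) w)"
        unfolding sup by (rule LIMSEQ_SUP[OF inc])
      then have "(\<lambda>n. ennreal (branch_sum t p n w) ^ 4) \<longlonglongrightarrow> (\<integral>\<^sup>+y. ennreal (V y) \<partial>population B (t + s) w) ^ 4"
        by (rule tendsto_power4_ennreal)
      moreover have "ennreal (branch_sum t p n w) ^ 4 = ennreal (branch_sum t p n w ^ 4)" for n
        using bv0 by (intro ennreal_power) (auto simp: branch_sum_def intro: sum_nonneg)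
      ultimately have "(\<lambda>n. ennreal (branch_sum t p n w ^ 4)) \<longlonglongrightarrow> (\<integral>\<^sup>+y. ennreal (V y) \<partial>population B (t + s) w) ^ 4" by simp
      from lim_imp_Liminf[OF _ this] show ?case by simp
    qed
  qed
  have "(\<integral>\<^sup>+w. (\<integral>\<^sup>+y. ennreal (V y) \<partial>population B (t + s) w) ^ 4 \<partial>P x)
      \<le> (\<integral>\<^sup>+w. 64 * (\<integral>\<^sup>+y. ennreal (a * V y ^ 4) \<partial>population B t w)
    + 24 * (\<integral>\<^sup>+y. ennreal ((1 + a) * V y ^ 2) \<partial>population B t w)\<^sup>2 + 72 * (\<integral>\<^sup>+y. ennreal ((1 + a) * V y) \<partial>population B t w) ^ 4 \<partial>P x)"
    by (rule branch_fourth_moment_le[OF x t(2) pfm pl(1) _ _ _ pl(4,3,2) Q]) measurable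
  also have "\<dots> \<le> (\<integral>\<^sup>+w. ennreal (64 * a + 24 * (1 + a)\<^sup>2 + 72 * (1 + a) ^ 4) * ennreal (Zf t V w ^ 4) \<partial>P x)"
    using fourth_boundD(1)[OF t x] AE_space[of "P x"]
  proof (intro nn_integral_mono_AE, eventually_elim)
    case (elim w)
    then have w: "w \<in> space M" by (simp add: space_law[OF x])
    let ?Z = "Zf t V w"
    have Z0: "0 \<le> ?Z" by (rule Zint_V_nonneg)
    have b: "(\<integral>\<^sup>+y. ennreal (d * V y ^ Suc n) \<partial>population B t w) \<le> ennreal (d * ?Z ^ Suc n)" if "0 \<le> d" for d n
    proof -
      have "(\<integral>\<^sup>+y. ennreal (d * V y ^ Suc n) \<partial>population B t w) \<le> (\<integral>\<^sup>+y. ennreal \<bar>d * V y ^ Suc n\<bar> \<partial>population B t w)"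
        by (intro nn_integral_mono ennreal_leI) auto
      also have "\<dots> \<le> ennreal (d * ?Z ^ Suc n)"
        by (rule finite_population_bound(1)) (use V_pos that t elim w in \<open>auto simp: abs_mult power_abs less_imp_le\<close>)
      finally show ?thesis .
    qed
    have "64 * (\<integral>\<^sup>+y. ennreal (a * V y ^ 4) \<partial>population B t w)
        + 24 * (\<integral>\<^sup>+y. ennreal ((1 + a) * V y ^ 2) \<partial>population B t w)\<^sup>2 + 72 * (\<integral>\<^sup>+y. ennreal ((1 + a) * V y) \<partial>population B t w) ^ 4
        \<le> 64 * ennreal (a * ?Z ^ 4) + 24 * (ennreal ((1 + a) * ?Z ^ 2))\<^sup>2 + 72 * (ennreal ((1 + a) * ?Z)) ^ 4"
      using b[of a 3] b[of "1 + a" 1] b[of "1 + a" 0] a0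
      by (intro add_mono mult_left_mono power_mono) (auto simp: eval_nat_numeral)
    also have "\<dots> = ennreal (64 * (a * ?Z ^ 4) + 24 * ((1 + a) * ?Z ^ 2)\<^sup>2 + 72 * ((1 + a) * ?Z) ^ 4)"
      using a0 Z0 by (intro ennreal_fourth_poly) auto
    also have "64 * (a * ?Z ^ 4) + 24 * ((1 + a) * ?Z ^ 2)\<^sup>2 + 72 * ((1 + a) * ?Z) ^ 4
        = (64 * a + 24 * (1 + a)\<^sup>2 + 72 * (1 + a) ^ 4) * ?Z ^ 4"
    proof -
      have e: "(b * z\<^sup>2)\<^sup>2 = b\<^sup>2 * z ^ 4" "(b * z) ^ 4 = b ^ 4 * z ^ 4" for b z :: real
        by (simp_all add: power_mult_distrib flip: power_mult)
      show ?thesis unfolding e by (simp only: distrib_right mult.assoc)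
    qed
    finally show ?case using a0 by (simp add: ennreal_mult)
  qed
  also have "\<dots> = ennreal (64 * a + 24 * (1 + a)\<^sup>2 + 72 * (1 + a) ^ 4) * ennreal (LINT w|P x. Zf t V w ^ 4)"
    using fourth_boundD(2)[OF t x] by (subst nn_integral_cmult) (auto simp: nn_integral_eq_integral)
  also have "\<dots> \<le> ennreal (64 * a + 24 * (1 + a)\<^sup>2 + 72 * (1 + a) ^ 4) * ennreal (c * V x ^ 4)"
    by (intro mult_left_mono ennreal_leI fourth_boundD(3)[OF t x]) simp
  also have "\<dots> = ennreal ((64 * a + 24 * (1 + a)\<^sup>2 + 72 * (1 + a) ^ 4) * c * V x ^ 4)"
    using a0 c0 V_pos[OF x] unfolding mult.assoc by (intro ennreal_mult[symmetric]) auto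
  finally show "(\<integral>\<^sup>+w. (\<integral>\<^sup>+y. ennreal (V y) \<partial>population B (t + s) w) ^ 4 \<partial>P x)
      \<le> ennreal ((64 * a + 24 * (1 + a)\<^sup>2 + 72 * (1 + a) ^ 4) * c * V x ^ 4)" .
qed

text \<open>Iteration over steps of the short time length. The constant deteriorates with each step,
  so it depends on \<open>T\<close>; it provides the base cases of the contraction arguments, which
  then give the true growth.\<close>

lemma fourth_bound_locally: "\<exists>c. \<forall>t. 0 \<le> t \<and> t \<le> T \<longrightarrow> fourth_bound t c"
proof -
  obtain r a where r: "0 < r" and a: "\<And>t. 0 \<le> t \<Longrightarrow> t \<le> r \<Longrightarrow> fourth_bound t a"
    using fourth_bound_short_time by blast
  have "\<exists>c. \<forall>t. 0 \<le> t \<and> t \<le> real n * r \<longrightarrow> fourth_bound t c" for n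
  proof (induction n)
    case 0
    then show ?case using a[of 0] r by auto
  next
    case (Suc n)
    then obtain c where c: "\<And>t. 0 \<le> t \<Longrightarrow> t \<le> real n * r \<Longrightarrow> fourth_bound t c" by blast
    have "fourth_bound t ((64 * a + 24 * (1 + a)\<^sup>2 + 72 * (1 + a) ^ 4) * c)" if "0 \<le> t" "t \<le> real (Suc n) * r" for t
    proof -
      \<comment> \<open>The last step has length at most \<open>r\<close>, and \<open>t - s\<close>
        falls into the range of the induction hypothesis.\<close>
      define s where "s = min t r"
      have "fourth_bound ((t - s) + s) ((64 * a + 24 * (1 + a)\<^sup>2 + 72 * (1 + a) ^ 4) * c)"
        using that r by (intro fourth_bound_step a c) (auto simp: s_def min_def algebra_simps)
      then show ?thesis by simp
    qed
    then show ?case by blast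
  qed
  moreover obtain n where "T \<le> real n * r"
    using reals_Archimedean3[OF r] less_imp_le by blast
  ultimately show ?thesis by (meson order_trans)
qed

end

lemma add_power_le:
  fixes p q :: real
  assumes "0 \<le> p" "0 \<le> q"
  shows "(p + q) ^ k \<le> 2 ^ k * (p ^ k + q ^ k)"
proof -
  have "(p + q) ^ k \<le> (2 * max p q) ^ k" using assms by (intro power_mono) auto
  also have "\<dots> = 2 ^ k * max p q ^ k" by (simp add: power_mult_distrib)
  also have "\<dots> \<le> 2 ^ k * (p ^ k + q ^ k)" using assms by (intro mult_left_mono) (auto simp: max_def)
  finally show ?thesis .
qed

section \<open>Functions bounded by powers of the weight\<close>

context weighted_branching
begin

text \<open>An explicit constant in place of the weighted norm: any upper bound may be carried
  along, and estimates can be stated uniformly over all functions with the same constant.\<close>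

definition weighted :: "nat \<Rightarrow> real \<Rightarrow> ('x \<Rightarrow> real) \<Rightarrow> bool" where
  "weighted j c f \<longleftrightarrow> f \<in> borel_measurable E \<and> 0 \<le> c \<and> (\<forall>y\<in>space E. \<bar>f y\<bar> \<le> c * V y ^ j)"

lemma weighted_measurable [measurable_dest]: "weighted j c f \<Longrightarrow> f \<in> borel_measurable E"
  by (simp add: weighted_def)

lemma weighted_V [simp]: "weighted j 1 (\<lambda>y. V y ^ j)"
  using V_pos by (auto simp: weighted_def power_abs less_imp_le)

lemma fourth_bound_ex: "0 \<le> t \<Longrightarrow> \<exists>c. fourth_bound t c"
  using fourth_bound_locally[of t] by auto

lemma AE_population_finite:
  "0 \<le> t \<Longrightarrow> x \<in> space E \<Longrightarrow> AE w in P x. (Zp t V w) < \<infinity>"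
  using fourth_bound_ex fourth_boundD(1) by blast

lemma Zint_AE_bound:
  assumes f: "weighted j c f" "1 \<le> j" and t: "0 \<le> t" and x: "x \<in> space E"
  shows "AE w in P x. (Zp t (\<lambda>y. \<bar>f y\<bar>) w) \<le> ennreal (c * Zf t V w ^ j)
    \<and> integrable (population B t w) f \<and> \<bar>Zf t f w\<bar> \<le> c * Zf t V w ^ j"
  using AE_population_finite[OF t x] AE_space
proof eventually_elim
  case (elim w)
  obtain n where j: "j = Suc n" using f(2) by (cases j) auto
  have "w \<in> space M" using elim by (simp add: space_law[OF x])
  then show ?case
    using finite_population_bound[of f c n t w] elim f t unfolding j weighted_def by auto
qed

lemma Zint_V_moment:
  assumes c: "fourth_bound t c" and t: "0 \<le> t" and x: "x \<in> space E" and k: "k \<le> 4"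
  shows "integrable (P x) (\<lambda>w. Zf t V w ^ k)" and "(LINT w|P x. Zf t V w ^ k) \<le> (1 + c) * V x ^ k"
  using power_moments[OF x Zint_measurable_law[OF x t V_measurable] fourth_boundD(2,3)[OF c t x] k] Zint_V_nonneg
  by simp_all

lemma Zint_power_integrable:
  assumes f: "weighted j c f" "1 \<le> j" and t: "0 \<le> t" and x: "x \<in> space E" and k: "j * k \<le> 4"
  shows "integrable (P x) (\<lambda>w. Zf t f w ^ k)"
    and "(LINT w|P x. \<bar>Zf t f w\<bar> ^ k) \<le> c ^ k * (LINT w|P x. Zf t V w ^ (j * k))"
proof -
  obtain C where C: "fourth_bound t C" using fourth_bound_ex[OF t] by blast
  have c: "0 \<le> c" using f by (simp add: weighted_def)
  have [measurable]: "Zf t f \<in> borel_measurable (P x)"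
    by (rule Zint_measurable_law[OF x t weighted_measurable[OF f(1)]])
  have int: "integrable (P x) (\<lambda>w. c ^ k * Zf t V w ^ (j * k))"
    using Zint_V_moment(1)[OF C t x k] by simp
  have b: "AE w in P x. \<bar>Zf t f w\<bar> ^ k \<le> c ^ k * Zf t V w ^ (j * k)"
    using Zint_AE_bound[OF f t x]
  proof eventually_elim
    case (elim w)
    then have "\<bar>Zf t f w\<bar> ^ k \<le> (c * Zf t V w ^ j) ^ k" by (intro power_mono) auto
    then show ?case by (simp add: power_mult_distrib power_mult)
  qed
  show "integrable (P x) (\<lambda>w. Zf t f w ^ k)"
  proof (rule Bochner_Integration.integrable_bound[OF int])
    show "AE w in P x. norm (Zf t f w ^ k) \<le> norm (c ^ k * Zf t V w ^ (j * k))"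
      using b by eventually_elim (simp add: power_abs order_trans[OF _ abs_ge_self])
  qed measurable
  then have i: "integrable (P x) (\<lambda>w. \<bar>Zf t f w\<bar> ^ k)" by (simp add: power_abs[symmetric])
  have "(LINT w|P x. \<bar>Zf t f w\<bar> ^ k) \<le> (LINT w|P x. c ^ k * Zf t V w ^ (j * k))"
    by (rule integral_mono_AE[OF i int b])
  then show "(LINT w|P x. \<bar>Zf t f w\<bar> ^ k) \<le> c ^ k * (LINT w|P x. Zf t V w ^ (j * k))" by simp
qed

lemma Zint_integrable:
  assumes f: "weighted j c f" "1 \<le> j" "j \<le> 4" and t: "0 \<le> t" and x: "x \<in> space E"
  shows "integrable (P x) (Zf t f)"
  using Zint_power_integrable(1)[OF f(1,2) t x, of 1] f(3) by simp

text \<open>Here \<open>K\<close> may depend on the times \<open>s\<close> and \<open>r\<close>. The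
  lemma supplies integrability and the right power of \<open>V\<close>; bounds uniform in time come
  from the contraction estimates.\<close>

lemma functional_moment:
  assumes f: "weighted j c f" and k: "weighted j d k" and j: "1 \<le> j" and s: "0 \<le> s" and r: "0 \<le> r" and m: "j * m \<le> 4"
  shows "\<exists>K\<ge>0. \<forall>y\<in>space E. integrable (P y) (\<lambda>w. (a * Zf s f w + b * Zf r k w) ^ m)
    \<and> (LINT w|P y. \<bar>a * Zf s f w + b * Zf r k w\<bar> ^ m) \<le> K * V y ^ (j * m)"
proof -
  obtain C where C: "fourth_bound s C" using fourth_bound_ex[OF s] by blast
  obtain D where D: "fourth_bound r D" using fourth_bound_ex[OF r] by blast
  have nn: "0 \<le> c" "0 \<le> d" "0 \<le> C" "0 \<le> D" using f k C D by (auto simp: weighted_def fourth_bound_def)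
  define K where "K = 2 ^ m * ((\<bar>a\<bar> ^ m * c ^ m) * (1 + C) + (\<bar>b\<bar> ^ m * d ^ m) * (1 + D))"
  have "integrable (P y) (\<lambda>w. (a * Zf s f w + b * Zf r k w) ^ m)
    \<and> (LINT w|P y. \<bar>a * Zf s f w + b * Zf r k w\<bar> ^ m) \<le> K * V y ^ (j * m)" if y: "y \<in> space E" for y
  proof -
    have [measurable]: "Zf s f \<in> borel_measurable (P y)" "Zf r k \<in> borel_measurable (P y)"
      by (rule Zint_measurable_law[OF y s weighted_measurable[OF f]], rule Zint_measurable_law[OF y r weighted_measurable[OF k]])
    note F = Zint_power_integrable[OF f j s y m] and G = Zint_power_integrable[OF k j r y m]
    let ?b = "\<lambda>w. 2 ^ m * (\<bar>a\<bar> ^ m * \<bar>Zf s f w\<bar> ^ m + \<bar>b\<bar> ^ m * \<bar>Zf r k w\<bar> ^ m)"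
    have i: "integrable (P y) (\<lambda>w. \<bar>Zf s f w\<bar> ^ m)" "integrable (P y) (\<lambda>w. \<bar>Zf r k w\<bar> ^ m)"
      using F(1) G(1) by (simp_all add: power_abs[symmetric])
    then have ib: "integrable (P y) ?b" by simp
    have le: "\<bar>a * Zf s f w + b * Zf r k w\<bar> ^ m \<le> ?b w" for w
    proof -
      have "\<bar>a * Zf s f w + b * Zf r k w\<bar> ^ m \<le> (\<bar>a * Zf s f w\<bar> + \<bar>b * Zf r k w\<bar>) ^ m"
        by (intro power_mono abs_triangle_ineq) auto
      also have "\<dots> \<le> ?b w"
        using add_power_le[of "\<bar>a * Zf s f w\<bar>" "\<bar>b * Zf r k w\<bar>" m] by (simp add: abs_mult power_mult_distrib)
      finally show ?thesis .
    qed
    have I: "integrable (P y) (\<lambda>w. (a * Zf s f w + b * Zf r k w) ^ m)"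
    proof (rule Bochner_Integration.integrable_bound[OF ib])
      show "AE w in P y. norm ((a * Zf s f w + b * Zf r k w) ^ m) \<le> norm (?b w)"
        using le by (intro AE_I2) (simp add: power_abs order_trans[OF _ abs_ge_self])
    qed measurable
    have "(LINT w|P y. \<bar>a * Zf s f w + b * Zf r k w\<bar> ^ m) \<le> (LINT w|P y. ?b w)"
      using I ib le by (intro integral_mono) (auto simp: power_abs[symmetric])
    also have "\<dots> = 2 ^ m * (\<bar>a\<bar> ^ m * (LINT w|P y. \<bar>Zf s f w\<bar> ^ m) + \<bar>b\<bar> ^ m * (LINT w|P y. \<bar>Zf r k w\<bar> ^ m))"
      using i by simp
    also have "\<dots> \<le> 2 ^ m * (\<bar>a\<bar> ^ m * (c ^ m * ((1 + C) * V y ^ (j * m))) + \<bar>b\<bar> ^ m * (d ^ m * ((1 + D) * V y ^ (j * m))))"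
      using nn Zint_V_moment(2)[OF C s y m] Zint_V_moment(2)[OF D r y m]
      by (intro mult_left_mono add_mono order_trans[OF F(2)] order_trans[OF G(2)]) auto
    also have "\<dots> = K * V y ^ (j * m)" by (simp add: K_def algebra_simps)
    finally show ?thesis using I by blast
  qed
  moreover have "0 \<le> K" using nn by (simp add: K_def)
  ultimately show ?thesis by blast
qed

section \<open>Functionals of two times along the branches\<close>

context
  fixes x :: 'x and t a s b r c d :: real and f k :: "'x \<Rightarrow> real" and j :: nat
  assumes x: "x \<in> space E" and t: "0 \<le> t" and s: "0 \<le> s" and r: "0 \<le> r" and j: "1 \<le> j"
    and f: "weighted j c f" and k: "weighted j d k"
begin

abbreviation (input) "init_path \<equiv> path_functional a f s b k r"
abbreviation (input) "init_value \<equiv> \<lambda>w. a * Zf s f w + b * Zf r k w"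
abbreviation (input) "shifted_value \<equiv> \<lambda>w. a * Zf (t + s) f w + b * Zf (t + r) k w"
abbreviation (input) "shift_bound \<equiv> \<lambda>w. \<bar>a\<bar> * (c * Zf (t + s) V w ^ j) + \<bar>b\<bar> * (d * Zf (t + r) V w ^ j)"

lemma functional_measurable: "init_path \<in> borel_measurable (path_space E)"
  by (rule path_functional_measurable[OF weighted_measurable[OF f] weighted_measurable[OF k] s r])

lemma integral_functional:
  assumes "y \<in> space E" "g \<in> borel_measurable borel"
  shows "(LINT z|path_law init_path y. g z) = (LINT w|P y. (g (init_value w) :: real))"
    and "integrable (path_law init_path y) g \<longleftrightarrow> integrable (P y) (\<lambda>w. (g (init_value w) :: real))"
  using assms functional_measurable s r
  by (simp_all add: integral_path_law integrable_path_law path_functional_population)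

text \<open>Powers of the weighted populations at the two shifted times bound the absolute values of
  all branches together; this is the dominating function for the passage to countably many
  labels.\<close>

lemma functional_decomposition:
  "AE w in P x. (\<integral>\<^sup>+u. ennreal \<bar>branch_value t init_path u w\<bar> \<partial>count_space UNIV) \<le> ennreal (shift_bound w)"
  "AE w in P x. shifted_value w = (LINT u|count_space UNIV. branch_value t init_path u w)"
proof -
  have cd: "0 \<le> c" "0 \<le> d" using f k by (auto simp: weighted_def)
  have ts: "0 \<le> t + s" and tr: "0 \<le> t + r" using t s r by auto
  have "AE w in P x. (\<integral>\<^sup>+u. ennreal \<bar>branch_value t init_path u w\<bar> \<partial>count_space UNIV) \<le> ennreal (shift_bound w)
      \<and> shifted_value w = (LINT u|count_space UNIV. branch_value t init_path u w)"
    using Zint_AE_bound[OF f j ts x] Zint_AE_bound[OF k j tr x] AE_space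
  proof eventually_elim
    case (elim w)
    then have w: "w \<in> space M" by (simp add: space_law[OF x])
    show ?case
      using path_functional_split[OF weighted_measurable[OF f] weighted_measurable[OF k] t s r w,
          of "c * Zf (t + s) V w ^ j" "d * Zf (t + r) V w ^ j" a b]
        elim cd Zint_V_nonneg[of "t + s" w] Zint_V_nonneg[of "t + r" w] by auto
  qed
  then show "AE w in P x. (\<integral>\<^sup>+u. ennreal \<bar>branch_value t init_path u w\<bar> \<partial>count_space UNIV) \<le> ennreal (shift_bound w)"
    "AE w in P x. shifted_value w = (LINT u|count_space UNIV. branch_value t init_path u w)"
    by (auto elim: eventually_mono)
qed

lemma functional_L_measurable: "shifted_value \<in> borel_measurable (P x)" "shift_bound \<in> borel_measurable (P x)"
proof -
  have ts: "0 \<le> t + s" and tr: "0 \<le> t + r" using t s r by auto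
  have [measurable]: "Zf (t + s) f \<in> borel_measurable (P x)" "Zf (t + r) k \<in> borel_measurable (P x)"
    "Zf (t + s) V \<in> borel_measurable (P x)" "Zf (t + r) V \<in> borel_measurable (P x)"
    by (rule Zint_measurable_law[OF x ts weighted_measurable[OF f]], rule Zint_measurable_law[OF x tr weighted_measurable[OF k]],
      rule Zint_measurable_law[OF x ts V_measurable], rule Zint_measurable_law[OF x tr V_measurable])
  show "shifted_value \<in> borel_measurable (P x)" "shift_bound \<in> borel_measurable (P x)" by measurable
qed

lemma functional_D_nonneg: "0 \<le> shift_bound w"
  using f k Zint_V_nonneg by (simp add: weighted_def)

lemma functional_D_square:
  assumes "j * 2 \<le> 4"
  shows "integrable (P x) (\<lambda>w. (shift_bound w)\<^sup>2)"
proof (rule Bochner_Integration.integrable_bound)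
  have ts: "0 \<le> t + s" and tr: "0 \<le> t + r" using t s r by auto
  obtain C where C: "fourth_bound (t + s) C" using fourth_bound_ex[OF ts] by blast
  obtain C' where C': "fourth_bound (t + r) C'" using fourth_bound_ex[OF tr] by blast
  let ?b = "\<lambda>w. 2 * ((\<bar>a\<bar> * c)\<^sup>2 * Zf (t + s) V w ^ (j * 2) + (\<bar>b\<bar> * d)\<^sup>2 * Zf (t + r) V w ^ (j * 2))"
  show "integrable (P x) ?b"
    using Zint_V_moment(1)[OF C ts x assms] Zint_V_moment(1)[OF C' tr x assms] by auto
  show "(\<lambda>w. (shift_bound w)\<^sup>2) \<in> borel_measurable (P x)"
    using functional_L_measurable(2) by (rule borel_measurable_power)
  have "(shift_bound w)\<^sup>2 \<le> ?b w" for w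
    using power2_sum_le[of "\<bar>a\<bar> * c * Zf (t + s) V w ^ j" "\<bar>b\<bar> * d * Zf (t + r) V w ^ j"]
    by (simp add: power_mult_distrib power_mult mult.assoc)
  then show "AE w in P x. norm ((shift_bound w)\<^sup>2) \<le> norm (?b w)"
    by (intro AE_I2) (simp add: order_trans[OF _ abs_ge_self])
qed

lemma weight_moment:
  assumes K: "0 \<le> K" and n: "1 \<le> n" "n * m \<le> 4"
  shows "(\<integral>\<^sup>+w. (\<integral>\<^sup>+y. ennreal (K * V y ^ n) \<partial>population B t w) ^ m \<partial>P x) < \<infinity>"
proof -
  have wt: "weighted n K (\<lambda>y. K * V y ^ n)"
    using K V_pos by (auto simp: weighted_def abs_mult power_abs less_imp_le)
  obtain C where C: "fourth_bound t C" using fourth_bound_ex[OF t] by blast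
  have "(\<integral>\<^sup>+w. (\<integral>\<^sup>+y. ennreal (K * V y ^ n) \<partial>population B t w) ^ m \<partial>P x)
      \<le> (\<integral>\<^sup>+w. ennreal (K ^ m * Zf t V w ^ (n * m)) \<partial>P x)"
    using Zint_AE_bound[OF wt n(1) t x]
  proof (intro nn_integral_mono_AE, eventually_elim)
    case (elim w)
    have "(\<integral>\<^sup>+y. ennreal (K * V y ^ n) \<partial>population B t w) \<le> (\<integral>\<^sup>+y. ennreal \<bar>K * V y ^ n\<bar> \<partial>population B t w)"
      by (intro nn_integral_mono ennreal_leI) auto
    also have "\<dots> \<le> ennreal (K * Zf t V w ^ n)" using elim by auto
    finally have "(\<integral>\<^sup>+y. ennreal (K * V y ^ n) \<partial>population B t w) ^ m \<le> ennreal (K * Zf t V w ^ n) ^ m"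
      by (intro power_mono) auto
    also have "\<dots> = ennreal (K ^ m * Zf t V w ^ (n * m))"
      using K Zint_V_nonneg[of t w] by (simp add: ennreal_power power_mult_distrib power_mult)
    finally show ?case .
  qed
  also have "\<dots> < \<infinity>"
    using Zint_V_moment(1)[OF C t x n(2)] K Zint_V_nonneg
    by (subst nn_integral_eq_integral) auto
  finally show ?thesis .
qed

lemma functional_weights:
  assumes "j * 2 \<le> 4"
  shows "\<exists>K1\<ge>0. \<exists>K2\<ge>0. \<forall>y\<in>space E. \<bar>path_mean init_path y\<bar> \<le> K1 * V y ^ j
    \<and> path_var init_path y \<le> K2 * V y ^ (j * 2) \<and> integrable (path_law init_path y) (\<lambda>z. z\<^sup>2)
    \<and> path_var init_path y \<le> (LINT w|P y. (init_value w)\<^sup>2)"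
proof -
  have j1: "j * 1 \<le> 4" using assms by simp
  obtain K1 where K1: "0 \<le> K1" "\<And>y. y \<in> space E \<Longrightarrow> integrable (P y) (\<lambda>w. init_value w ^ 1)"
    "\<And>y. y \<in> space E \<Longrightarrow> (LINT w|P y. \<bar>init_value w\<bar> ^ 1) \<le> K1 * V y ^ (j * 1)"
    using functional_moment[OF f k j s r j1, of a b] by blast
  obtain K2 where K2: "0 \<le> K2" "\<And>y. y \<in> space E \<Longrightarrow> integrable (P y) (\<lambda>w. init_value w ^ 2)"
    "\<And>y. y \<in> space E \<Longrightarrow> (LINT w|P y. \<bar>init_value w\<bar> ^ 2) \<le> K2 * V y ^ (j * 2)"
    using functional_moment[OF f k j s r assms, of a b] by blast
  have m: "\<bar>path_mean init_path y\<bar> \<le> K1 * V y ^ j" if y: "y \<in> space E" for y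
  proof -
    have "\<bar>path_mean init_path y\<bar> = \<bar>LINT w|P y. init_value w\<bar>"
      by (simp add: path_mean_def mean_of_def integral_functional[OF y])
    also have "\<dots> \<le> (LINT w|P y. \<bar>init_value w\<bar>)" by (rule integral_abs_bound)
    also have "\<dots> \<le> K1 * V y ^ j" using K1(3)[OF y] by simp
    finally show ?thesis .
  qed
  have i: "integrable (path_law init_path y) (\<lambda>z. z\<^sup>2)" if y: "y \<in> space E" for y
    using K2(2)[OF y] by (subst integral_functional(2)[OF y]) auto
  have v: "path_var init_path y \<le> (LINT w|P y. (init_value w)\<^sup>2)" if y: "y \<in> space E" for y
    using real_distribution.var_of_eq[OF real_distribution_path_law[OF functional_measurable y] i[OF y]]
    by (simp add: path_var_def integral_functional[OF y])
  have v2: "path_var init_path y \<le> K2 * V y ^ (j * 2)" if y: "y \<in> space E" for y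
    using v[OF y] K2(3)[OF y] by simp
  show ?thesis using K1(1) K2(1) m v2 i v by blast
qed

lemma functional_second_moment:
  assumes j2: "j * 2 \<le> 4"
  shows "integrable (P x) (\<lambda>w. (shifted_value w)\<^sup>2)" "integrable (P x) (Zf t (path_var init_path))"
    "integrable (P x) (\<lambda>w. (Zf t (path_mean init_path) w)\<^sup>2)"
    "(LINT w|P x. (shifted_value w)\<^sup>2) = (LINT w|P x. Zf t (path_var init_path) w) + (LINT w|P x. (Zf t (path_mean init_path) w)\<^sup>2)"
    "(LINT w|P x. shifted_value w) = (LINT w|P x. Zf t (path_mean init_path) w)"
proof -
  obtain K1 K2 where K: "0 \<le> K1" "0 \<le> K2" "\<And>y. y \<in> space E \<Longrightarrow> \<bar>path_mean init_path y\<bar> \<le> K1 * V y ^ j"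
    "\<And>y. y \<in> space E \<Longrightarrow> path_var init_path y \<le> K2 * V y ^ (j * 2)"
    "\<And>y. y \<in> space E \<Longrightarrow> integrable (path_law init_path y) (\<lambda>z. z\<^sup>2)" using functional_weights[OF j2] by blast
  have w1: "(\<integral>\<^sup>+w. (\<integral>\<^sup>+y. ennreal (K1 * V y ^ j) \<partial>population B t w)\<^sup>2 \<partial>P x) < \<infinity>"
    by (rule weight_moment[OF K(1) j j2])
  have w2: "(\<integral>\<^sup>+w. (\<integral>\<^sup>+y. ennreal (K2 * V y ^ (j * 2)) \<partial>population B t w) \<partial>P x) < \<infinity>"
    using weight_moment[OF K(2), of "j * 2" 1] j j2 by simp
  note bm = branch_second_moment[OF x t functional_measurable functional_decomposition functional_L_measurable functional_D_nonneg
    _ _ K(3,4) w1 w2 K(5) functional_D_square[OF j2]]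
  show "integrable (P x) (\<lambda>w. (shifted_value w)\<^sup>2)" "integrable (P x) (Zf t (path_var init_path))"
    "integrable (P x) (\<lambda>w. (Zf t (path_mean init_path) w)\<^sup>2)"
    "(LINT w|P x. (shifted_value w)\<^sup>2) = (LINT w|P x. Zf t (path_var init_path) w) + (LINT w|P x. (Zf t (path_mean init_path) w)\<^sup>2)"
    "(LINT w|P x. shifted_value w) = (LINT w|P x. Zf t (path_mean init_path) w)"
    by (rule bm; measurable)+
qed

text \<open>The total variance formula in the form in which it is iterated: the variance within the
  branches is estimated by the second moment at the earlier times, the conditional mean is kept
  exactly.\<close>

lemma functional_second_moment_le:
  assumes j2: "j * 2 \<le> 4" and K: "\<And>y. y \<in> space E \<Longrightarrow> (LINT w|P y. (init_value w)\<^sup>2) \<le> K * V y ^ (j * 2)" "0 \<le> K"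
  shows "(LINT w|P x. (shifted_value w)\<^sup>2) \<le> K * (LINT w|P x. Zf t (\<lambda>y. V y ^ (j * 2)) w)
    + (LINT w|P x. (Zf t (path_mean init_path) w)\<^sup>2)"
proof -
  have v: "path_var init_path y \<le> (LINT w|P y. (init_value w)\<^sup>2)" if "y \<in> space E" for y
    using functional_weights[OF j2] that by blast
  have [measurable]: "path_var init_path \<in> borel_measurable E" by (rule path_var_measurable[OF functional_measurable])
  have wv: "weighted (j * 2) K (path_var init_path)"
    using K v path_var_nonneg[of init_path] by (auto simp: weighted_def intro: order_trans)
  have wV: "weighted (j * 2) 1 (\<lambda>y. V y ^ (j * 2))" by simp
  have j2': "1 \<le> j * 2" using j by simp
  have iV: "integrable (P x) (Zf t (\<lambda>y. V y ^ (j * 2)))"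
    by (rule Zint_integrable[OF wV j2' j2 t x])
  have "(LINT w|P x. Zf t (path_var init_path) w) \<le> (LINT w|P x. K * Zf t (\<lambda>y. V y ^ (j * 2)) w)"
  proof (rule integral_mono_AE)
    show "integrable (P x) (Zf t (path_var init_path))" by (rule functional_second_moment(2)[OF j2])
    show "AE w in P x. Zf t (path_var init_path) w \<le> K * Zf t (\<lambda>y. V y ^ (j * 2)) w"
      using Zint_AE_bound[OF wv j2' t x] Zint_AE_bound[OF wV j2' t x]
    proof eventually_elim
      case (elim w)
      then have "(LINT y|population B t w. path_var init_path y) \<le> (LINT y|population B t w. K * V y ^ (j * 2))"
        using v K by (intro integral_mono) (auto intro: order_trans)
      then show ?case using elim by (simp add: Zint_def)
    qed
  qed (use iV in simp)
  then show ?thesis using functional_second_moment(4)[OF j2] by simp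
qed

end

end

context weighted_branching
begin

lemma weight_nn_integral:
  assumes K: "0 \<le> K" and n: "1 \<le> n" and t: "0 \<le> t" and x: "x \<in> space E"
  shows "AE w in P x. (\<integral>\<^sup>+y. ennreal (K * V y ^ n) \<partial>population B t w) = ennreal (K * Zf t (\<lambda>y. V y ^ n) w)"
  using Zint_AE_bound[OF weighted_V n t x]
proof eventually_elim
  case (elim w)
  have "(\<integral>\<^sup>+y. ennreal (K * V y ^ n) \<partial>population B t w) = ennreal (LINT y|population B t w. K * V y ^ n)"
    using elim K by (intro nn_integral_eq_integral) (auto intro!: AE_I2 mult_nonneg_nonneg zero_le_power less_imp_le[OF V_pos])
  then show ?case by (simp add: Zint_def)
qed

lemma Zint_V_power_nonneg: "0 \<le> Zf t (\<lambda>y. V y ^ n) w"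
  unfolding Zint_def using V_pos by (intro integral_nonneg_AE AE_I2) (auto intro: less_imp_le)

lemma weight_expectation:
  assumes K: "0 \<le> K" and n: "1 \<le> n" "n \<le> 4" and t: "0 \<le> t" and x: "x \<in> space E"
  shows "(\<integral>\<^sup>+w. (\<integral>\<^sup>+y. ennreal (K * V y ^ n) \<partial>population B t w) \<partial>P x) = ennreal (K * (LINT w|P x. Zf t (\<lambda>y. V y ^ n) w))"
proof -
  have "(\<integral>\<^sup>+w. (\<integral>\<^sup>+y. ennreal (K * V y ^ n) \<partial>population B t w) \<partial>P x) = (\<integral>\<^sup>+w. ennreal (K * Zf t (\<lambda>y. V y ^ n) w) \<partial>P x)"
    by (rule nn_integral_cong_AE[OF weight_nn_integral[OF K n(1) t x]])
  also have "\<dots> = ennreal (LINT w|P x. K * Zf t (\<lambda>y. V y ^ n) w)"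
    using Zint_integrable[OF weighted_V n t x] K Zint_V_power_nonneg by (intro nn_integral_eq_integral) auto
  finally show ?thesis by simp
qed

context
  fixes x :: 'x and t a s b r c d :: real and f k :: "'x \<Rightarrow> real"
  assumes x: "x \<in> space E" and t: "0 \<le> t" and s: "0 \<le> s" and r: "0 \<le> r"
    and f: "weighted 1 c f" and k: "weighted 1 d k"
begin

lemma integrable_path_law_fourth:
  assumes "y \<in> space E"
  shows "integrable (path_law (path_functional a f s b k r) y) (\<lambda>z. z ^ 4)"
proof -
  have j1: "1 \<le> (1 :: nat)" and j4: "1 * 4 \<le> (4 :: nat)" by auto
  have "integrable (P y) (\<lambda>w. (a * Zf s f w + b * Zf r k w) ^ 4)"
    using functional_moment[OF f k j1 s r j4, of a b] assms by blast
  then show ?thesis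
    by (subst integral_functional(2)[OF x t s r j1 f k assms]) simp_all
qed

text \<open>The bound \<open>b4\<close> is multiplied by the expectation of \<open>Z_t(V^4)\<close>,
  of order \<open>exp (lam * t)\<close>, and not by that of \<open>Z_t(V) ^ 4\<close>, of order
  \<open>exp (4 * lam * t)\<close>. This difference allows the recursion in \<open>b4\<close> to
  contract; the terms in \<open>b2\<close> and \<open>b1\<close> act as a source.\<close>

lemma functional_fourth_moment:
  assumes M4: "\<And>y. y \<in> space E \<Longrightarrow> (LINT w|P y. (a * Zf s f w + b * Zf r k w) ^ 4) \<le> b4 * V y ^ 4" "0 \<le> b4"
    and M2: "\<And>y. y \<in> space E \<Longrightarrow> (LINT w|P y. (a * Zf s f w + b * Zf r k w)\<^sup>2) \<le> b2 * V y ^ 2" "0 \<le> b2"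
    and M1: "\<And>y. y \<in> space E \<Longrightarrow> \<bar>LINT w|P y. (a * Zf s f w + b * Zf r k w)\<bar> \<le> b1 * V y" "0 \<le> b1"
  shows "(LINT w|P x. (a * Zf (t + s) f w + b * Zf (t + r) k w) ^ 4)
    \<le> 64 * b4 * (LINT w|P x. Zf t (\<lambda>y. V y ^ 4) w) + (24 * b2\<^sup>2 + 72 * b1 ^ 4) * (LINT w|P x. Zf t V w ^ 4)"
proof -
  let ?p = "path_functional a f s b k r"
  let ?L = "\<lambda>w. a * Zf (t + s) f w + b * Zf (t + r) k w"
  have ts: "0 \<le> t + s" and tr: "0 \<le> t + r" using t s r by auto
  note j1 = order_refl[of "1 :: nat"]
  note pfm = functional_measurable[OF x t s r j1 f k, of a b]
  note dec = functional_decomposition[OF x t s r j1 f k, of a b] and Lm = functional_L_measurable[OF x t s r j1 f k, of a b]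
  note ifn = integral_functional[OF x t s r j1 f k, of _ _ a b]
  have L4: "integrable (P x) (\<lambda>w. ?L w ^ 4)"
    using functional_moment[OF f k j1 ts tr, of 4 a b] x by (simp only: mult_1 order_refl) blast
  obtain C where C: "fourth_bound t C" using fourth_bound_ex[OF t] by blast
  have iZ: "integrable (P x) (\<lambda>w. Zf t V w ^ 4)" using Zint_V_moment(1)[OF C t x] by simp
  have iV: "integrable (P x) (Zf t (\<lambda>y. V y ^ 4))" by (rule Zint_integrable[OF weighted_V _ _ t x]) auto
  have lim: "AE w in P x. ennreal (?L w ^ 4) \<le> liminf (\<lambda>n. ennreal ((branch_sum t ?p n w) ^ 4))"
    using branch_sum_limit[OF x t pfm dec Lm functional_D_nonneg[OF x t s r j1 f k]]
  proof eventually_elim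
    case (elim w)
    then have "(\<lambda>n. ennreal ((branch_sum t ?p n w) ^ 4)) \<longlonglongrightarrow> ennreal (?L w ^ 4)"
      by (intro tendsto_ennrealI tendsto_power)
    from lim_imp_Liminf[OF _ this] show ?case by simp
  qed
  have pm: "\<bar>path_mean ?p y\<bar> \<le> b1 * V y" if "y \<in> space E" for y
    using M1(1)[OF that] by (simp add: path_mean_def mean_of_def ifn[OF that])
  have p2: "(LINT z|path_law ?p y. z\<^sup>2) \<le> b2 * V y ^ 2" if "y \<in> space E" for y
    using M2(1)[OF that] by (simp add: ifn[OF that])
  have p4: "(LINT z|path_law ?p y. z ^ 4) \<le> b4 * V y ^ 4" if "y \<in> space E" for y
    using M4(1)[OF that] by (simp add: ifn[OF that])
  have one4: "1 \<le> (4 :: nat)" and one2: "1 \<le> (2 :: nat)" by auto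
  have w2: "weighted 2 b2 (\<lambda>y. b2 * V y ^ 2)" and w1: "weighted 1 b1 (\<lambda>y. b1 * V y)"
    using M1(2) M2(2) V_pos by (auto simp: weighted_def abs_mult less_imp_le)
  have "ennreal (LINT w|P x. ?L w ^ 4) = (\<integral>\<^sup>+w. ennreal (?L w ^ 4) \<partial>P x)"
    by (rule nn_integral_eq_integral[symmetric, OF L4]) simp
  also have "\<dots> \<le> (\<integral>\<^sup>+w. 64 * (\<integral>\<^sup>+y. ennreal (b4 * V y ^ 4) \<partial>population B t w)
    + 24 * (\<integral>\<^sup>+y. ennreal (b2 * V y ^ 2) \<partial>population B t w)\<^sup>2 + 72 * (\<integral>\<^sup>+y. ennreal (b1 * V y) \<partial>population B t w) ^ 4 \<partial>P x)"
    by (rule branch_fourth_moment_le[OF x t pfm integrable_path_law_fourth _ _ _ pm p2 p4 lim]) measurable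
  also have "\<dots> \<le> (\<integral>\<^sup>+w. ennreal (64 * b4 * Zf t (\<lambda>y. V y ^ 4) w + (24 * b2\<^sup>2 + 72 * b1 ^ 4) * Zf t V w ^ 4) \<partial>P x)"
    using weight_nn_integral[OF M4(2) one4 t x] Zint_AE_bound[OF w2 one2 t x] Zint_AE_bound[OF w1 j1 t x]
  proof (intro nn_integral_mono_AE, goal_cases)
    case 1
    then show ?case
    proof eventually_elim
      case (elim w)
      let ?Z = "Zf t V w"
      have Z0: "0 \<le> ?Z" by (rule Zint_V_nonneg)
      have "(\<integral>\<^sup>+y. ennreal (b2 * V y ^ 2) \<partial>population B t w) \<le> (\<integral>\<^sup>+y. ennreal \<bar>b2 * V y ^ 2\<bar> \<partial>population B t w)"
        by (intro nn_integral_mono ennreal_leI abs_ge_self)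
      also have "\<dots> \<le> ennreal (b2 * ?Z ^ 2)" using elim(2) by (rule conjunct1)
      finally have 2: "(\<integral>\<^sup>+y. ennreal (b2 * V y ^ 2) \<partial>population B t w) \<le> ennreal (b2 * ?Z ^ 2)" .
      have "(\<integral>\<^sup>+y. ennreal (b1 * V y) \<partial>population B t w) \<le> (\<integral>\<^sup>+y. ennreal \<bar>b1 * V y\<bar> \<partial>population B t w)"
        by (intro nn_integral_mono ennreal_leI abs_ge_self)
      also have "\<dots> \<le> ennreal (b1 * ?Z)" using elim(3)[THEN conjunct1] by (simp only: power_one_right)
      finally have 1: "(\<integral>\<^sup>+y. ennreal (b1 * V y) \<partial>population B t w) \<le> ennreal (b1 * ?Z)" .
      have "64 * (\<integral>\<^sup>+y. ennreal (b4 * V y ^ 4) \<partial>population B t w)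
        + 24 * (\<integral>\<^sup>+y. ennreal (b2 * V y ^ 2) \<partial>population B t w)\<^sup>2 + 72 * (\<integral>\<^sup>+y. ennreal (b1 * V y) \<partial>population B t w) ^ 4
        \<le> 64 * ennreal (b4 * Zf t (\<lambda>y. V y ^ 4) w) + 24 * (ennreal (b2 * ?Z ^ 2))\<^sup>2 + 72 * (ennreal (b1 * ?Z)) ^ 4"
        unfolding elim(1) using 1 2 by (intro add_mono mult_left_mono power_mono) auto
      also have "\<dots> = ennreal (64 * (b4 * Zf t (\<lambda>y. V y ^ 4) w) + 24 * (b2 * ?Z ^ 2)\<^sup>2 + 72 * (b1 * ?Z) ^ 4)"
        using M4(2) M2(2) M1(2) Z0 Zint_V_power_nonneg by (intro ennreal_fourth_poly) auto
      also have "64 * (b4 * Zf t (\<lambda>y. V y ^ 4) w) + 24 * (b2 * ?Z ^ 2)\<^sup>2 + 72 * (b1 * ?Z) ^ 4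
          = 64 * b4 * Zf t (\<lambda>y. V y ^ 4) w + (24 * b2\<^sup>2 + 72 * b1 ^ 4) * ?Z ^ 4"
        by (simp add: power_mult_distrib power_mult[symmetric] distrib_right)
      finally show ?case .
    qed
  qed
  also have "\<dots> = ennreal (LINT w|P x. 64 * b4 * Zf t (\<lambda>y. V y ^ 4) w + (24 * b2\<^sup>2 + 72 * b1 ^ 4) * Zf t V w ^ 4)"
    using iZ iV M4(2) M2(2) M1(2) Zint_V_power_nonneg Zint_V_nonneg
    by (intro nn_integral_eq_integral) (auto intro!: AE_I2 add_nonneg_nonneg mult_nonneg_nonneg)
  finally have "(LINT w|P x. ?L w ^ 4)
      \<le> (LINT w|P x. 64 * b4 * Zf t (\<lambda>y. V y ^ 4) w + (24 * b2\<^sup>2 + 72 * b1 ^ 4) * Zf t V w ^ 4)"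
    using M4(2) M2(2) M1(2) Zint_V_power_nonneg Zint_V_nonneg
    by (subst (asm) ennreal_le_iff) (auto intro!: integral_nonneg_AE AE_I2 add_nonneg_nonneg mult_nonneg_nonneg)
  then show ?thesis using iZ iV by simp
qed

text \<open>The replacement errors are additive over the individuals alive at time \<open>t\<close>,
  so a third moment of order \<open>V^3\<close> per individual results in the expectation of
  \<open>Z_t(V^3)\<close>.\<close>

lemma functional_lindeberg:
  assumes F: "F \<in> smooth_tests" and b3: "0 \<le> b3"
    and le: "\<And>y. y \<in> space E \<Longrightarrow> lindeberg_error (path_law (path_functional a f s b k r) y) \<le> b3 * V y ^ 3"
  shows "\<bar>(LINT w|P x. F (a * Zf (t + s) f w + b * Zf (t + r) k w))
    - (LINT w|P x. gauss_smooth F (Zf t (path_mean (path_functional a f s b k r)) w)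
        (Zf t (path_var (path_functional a f s b k r)) w))\<bar>
    \<le> b3 * (LINT w|P x. Zf t (\<lambda>y. V y ^ 3) w)"
proof -
  let ?p = "path_functional a f s b k r"
  note j1 = order_refl[of "1 :: nat"]
  note pfm = functional_measurable[OF x t s r j1 f k, of a b]
  note dec = functional_decomposition[OF x t s r j1 f k, of a b] and Lm = functional_L_measurable[OF x t s r j1 f k, of a b]
  have j2: "1 * 2 \<le> (4 :: nat)" by simp
  obtain K1 K2 where K: "0 \<le> K1" "0 \<le> K2" "\<And>y. y \<in> space E \<Longrightarrow> \<bar>path_mean ?p y\<bar> \<le> K1 * V y ^ 1"
    "\<And>y. y \<in> space E \<Longrightarrow> path_var ?p y \<le> K2 * V y ^ (1 * 2)"
    using functional_weights[OF x t s r j1 f k j2, of a b] by blast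
  have w1: "(\<integral>\<^sup>+w. (\<integral>\<^sup>+y. ennreal (K1 * V y ^ 1) \<partial>population B t w)\<^sup>2 \<partial>P x) < \<infinity>"
    by (rule weight_moment[OF x t s r j1 f k K(1)]) auto
  have w2: "(\<integral>\<^sup>+w. (\<integral>\<^sup>+y. ennreal (K2 * V y ^ (1 * 2)) \<partial>population B t w) \<partial>P x) < \<infinity>"
    using weight_moment[OF x t s r j1 f k K(2), of "1 * 2" 1] by simp
  have e: "(\<integral>\<^sup>+w. (\<integral>\<^sup>+y. ennreal (b3 * V y ^ 3) \<partial>population B t w) \<partial>P x) \<le> ennreal (b3 * (LINT w|P x. Zf t (\<lambda>y. V y ^ 3) w))"
    using weight_expectation[OF b3 _ _ t x, of 3] by simp
  have e0: "0 \<le> b3 * (LINT w|P x. Zf t (\<lambda>y. V y ^ 3) w)"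
    using b3 Zint_V_power_nonneg by (intro mult_nonneg_nonneg integral_nonneg_AE AE_I2) auto
  show ?thesis
    by (rule branch_lindeberg[OF x t pfm dec Lm functional_D_nonneg[OF x t s r j1 f k] _ _ K(3,4) w1 w2
      integrable_path_law_fourth F _ le e e0]) measurable
qed

end

end

section \<open>Ergodicity of the mean semigroup\<close>

locale ergodic_branching = weighted_branching B V \<kappa>
  for B :: "('x, 'u::countable, 'w) branching_model" and V \<kappa> +
  fixes \<gamma> :: "'x measure" and h :: "'x \<Rightarrow> real" and lam \<rho> :: real
  assumes ergodic: "assumption_ergodic B V \<kappa> \<gamma> h lam \<rho>"
    and rate: "lam < 2 * \<rho>"
begin

lemma sets_gamma [measurable_cong]: "sets \<gamma> = sets E"
  and h_measurable [measurable]: "h \<in> borel_measurable E"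
  and h_nonneg: "x \<in> space E \<Longrightarrow> 0 \<le> h x"
  and lam_pos: "0 < lam" and rho_pos: "0 < \<rho>"
  and gamma_h: "(LINT x|\<gamma>. h x) = 1"
  using ergodic by (auto simp: assumption_ergodic_def wbounded_def)

lemma semigroup_h: "0 \<le> t \<Longrightarrow> x \<in> space E \<Longrightarrow> mean_semigroup B t h x = exp (lam * t) * h x"
  using ergodic by (auto simp: assumption_ergodic_def)

lemma gamma_invariant:
  "0 \<le> t \<Longrightarrow> A \<in> sets E \<Longrightarrow> (\<integral>\<^sup>+ x. (\<integral>\<^sup>+ w. emeasure (population B t w) A \<partial>P x) \<partial>\<gamma>)
    = ennreal (exp (lam * t)) * emeasure \<gamma> A"
  using ergodic by (auto simp: assumption_ergodic_def)

lemma space_gamma: "space \<gamma> = space E"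
  by (rule sets_eq_imp_space_eq[OF sets_gamma])

lemma space_nonempty: "space E \<noteq> {}"
proof
  assume "space E = {}"
  then have "(LINT x|\<gamma>. h x) = 0" by (intro integral_eq_zero_AE AE_I2) (simp add: space_gamma)
  then show False using gamma_h by simp
qed

lemma V_power_le_Vmax: "1 \<le> j \<Longrightarrow> j \<le> 4 \<Longrightarrow> V x ^ j \<le> Vmax V \<kappa> x"
  and Vmin_le_V_power: "1 \<le> j \<Longrightarrow> j \<le> 4 \<Longrightarrow> Vmin V \<kappa> x \<le> V x ^ j"
  using kappa by (auto simp: Vmax_def Vmin_def intro!: Max_ge Min_le)

lemma Vmin_pos: "x \<in> space E \<Longrightarrow> 0 < Vmin V \<kappa> x"
  using kappa V_pos by (simp add: Vmin_def)

lemma integrable_gamma: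
  assumes "weighted j c f" "1 \<le> j" "j \<le> 4"
  shows "integrable \<gamma> f"
proof (rule Bochner_Integration.integrable_bound)
  have "(\<integral>\<^sup>+x. ennreal (V x ^ j) \<partial>\<gamma>) \<le> (\<integral>\<^sup>+x. ennreal (Vmax V \<kappa> x) \<partial>\<gamma>)"
    by (intro nn_integral_mono ennreal_leI V_power_le_Vmax assms)
  also have "\<dots> < \<infinity>" using ergodic by (auto simp: assumption_ergodic_def)
  finally have "integrable \<gamma> (\<lambda>x. V x ^ j)"
    using V_pos by (intro integrableI_nonneg) (auto simp: space_gamma intro!: AE_I2 less_imp_le)
  then show "integrable \<gamma> (\<lambda>x. c * V x ^ j)" by simp
  show "AE x in \<gamma>. norm (f x) \<le> norm (c * V x ^ j)"
    using assms(1) by (auto simp: weighted_def space_gamma intro!: AE_I2 order_trans[OF _ abs_ge_self])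
  show "f \<in> borel_measurable \<gamma>" using assms(1) unfolding measurable_cong_sets[OF sets_gamma refl] by (simp add: weighted_def)
qed

text \<open>A bound by the smallest of the powers of \<open>V\<close> holds for each of them, with
  one common constant.\<close>

lemma h_weighted: "\<exists>c. \<forall>j. 1 \<le> j \<and> j \<le> 4 \<longrightarrow> weighted j c h"
proof -
  have "bdd_above ((\<lambda>x. \<bar>h x\<bar> / Vmin V \<kappa> x) ` space E)"
    using ergodic by (auto simp: assumption_ergodic_def wbounded_def)
  then obtain c where c: "\<And>x. x \<in> space E \<Longrightarrow> \<bar>h x\<bar> / Vmin V \<kappa> x \<le> c"
    by (auto simp: bdd_above_def)
  obtain x0 where "x0 \<in> space E" using space_nonempty by auto
  then have c0: "0 \<le> c" using c[of x0] Vmin_pos[of x0] by (auto intro: order_trans[rotated])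
  have "weighted j c h" if "1 \<le> j" "j \<le> 4" for j
    unfolding weighted_def
  proof (intro conjI ballI c0 h_measurable)
    fix y assume y: "y \<in> space E"
    have "\<bar>h y\<bar> \<le> c * Vmin V \<kappa> y" using c[OF y] Vmin_pos[OF y] by (simp add: divide_le_eq)
    also have "\<dots> \<le> c * V y ^ j" by (intro mult_left_mono Vmin_le_V_power that c0)
    finally show "\<bar>h y\<bar> \<le> c * V y ^ j" .
  qed
  then show ?thesis by blast
qed

lemma wnorm_le:
  assumes "weighted j c f"
  shows "wnorm E (\<lambda>y. V y ^ j) f \<le> c" and "f \<in> wbounded E (\<lambda>y. V y ^ j)"
proof -
  have le: "\<bar>f y\<bar> / V y ^ j \<le> c" if "y \<in> space E" for y
    using assms V_pos[OF that] that by (auto simp: weighted_def divide_le_eq)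
  show "wnorm E (\<lambda>y. V y ^ j) f \<le> c"
    unfolding wnorm_def using le space_nonempty by (intro cSUP_least) auto
  show "f \<in> wbounded E (\<lambda>y. V y ^ j)"
    using assms le by (auto simp: wbounded_def weighted_def intro!: bdd_aboveI[of _ c])
qed

text \<open>Any bound \<open>c\<close> may replace the norm, since the right side is monotone in it.
  The constant is enlarged to \<open>max a 1\<close> so that time 0, where the semigroup is the
  identity, can be included afterwards.\<close>

lemma ergodic_bound:
  "\<exists>a\<ge>1. \<forall>x\<in>space E. \<forall>j c f t. 1 \<le> j \<and> j \<le> 4 \<and> weighted j c f \<and> 0 < t \<longrightarrow>
    \<bar>exp (- lam * t) * mean_semigroup B t f x - (LINT y|\<gamma>. f y) * h x\<bar> \<le> a * exp (- \<rho> * t) * c * V x ^ j"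
proof -
  obtain a where a: "0 < a" and *: "\<forall>x\<in>space E. \<forall>k\<in>{1..\<kappa>}. \<forall>f\<in>wbounded E (\<lambda>y. V y ^ k). \<forall>t>0.
          \<bar>exp (- lam * t) * mean_semigroup B t f x - (LINT y|\<gamma>. f y) * h x\<bar>
            \<le> a * exp (- \<rho> * t) * wnorm E (\<lambda>y. V y ^ k) f * V x ^ k"
    using ergodic unfolding assumption_ergodic_def by blast
  have "\<bar>exp (- lam * t) * mean_semigroup B t f x - (LINT y|\<gamma>. f y) * h x\<bar> \<le> max a 1 * exp (- \<rho> * t) * c * V x ^ j"
    if x: "x \<in> space E" and j: "1 \<le> j" "j \<le> 4" and f: "weighted j c f" and t: "0 < t" for x j c f t
  proof -
    have "j \<in> {1..\<kappa>}" using j kappa by simp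
    with * x t wnorm_le(2)[OF f]
    have "\<bar>exp (- lam * t) * mean_semigroup B t f x - (LINT y|\<gamma>. f y) * h x\<bar>
            \<le> a * exp (- \<rho> * t) * wnorm E (\<lambda>y. V y ^ j) f * V x ^ j" by blast
    also have "\<dots> \<le> a * exp (- \<rho> * t) * c * V x ^ j"
      using wnorm_le(1)[OF f] a V_pos[OF x] by (intro mult_right_mono mult_left_mono) auto
    also have "\<dots> \<le> max a 1 * exp (- \<rho> * t) * c * V x ^ j"
      using V_pos[OF x] f by (intro mult_right_mono) (auto simp: weighted_def)
    finally show ?thesis .
  qed
  then show ?thesis by (intro exI[of _ "max a 1"]) auto
qed

lemma Zint_initial:
  assumes x: "x \<in> space E" and f: "f \<in> borel_measurable E"
  shows "AE w in P x. Zf 0 f w = f x"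
proof -
  have "AE w in P x. population B 0 w = return E x"
    using branching_process x unfolding branching_process_def by blast
  then show ?thesis
    by eventually_elim (use x f in \<open>simp add: Zint_def integral_return\<close>)
qed

lemma semigroup_0:
  assumes x: "x \<in> space E" and f: "f \<in> borel_measurable E"
  shows "mean_semigroup B 0 f x = f x"
proof -
  interpret prob_space "P x" by (rule prob_space_law[OF x])
  have "mean_semigroup B 0 f x = (LINT w|P x. f x)"
    unfolding mean_semigroup_def
    using Zint_initial[OF x f] Zint_measurable_law[OF x order_refl f] by (intro integral_cong_AE) auto
  then show ?thesis by (simp add: prob_space)
qed

lemma semigroup_measurable [measurable]:
  assumes "0 \<le> t" "f \<in> borel_measurable E"
  shows "mean_semigroup B t f \<in> borel_measurable E"
  unfolding mean_semigroup_def[abs_def]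
  by (rule measurable_compose[OF law_subprob_measurable integral_measurable_subprob_algebra[OF Zint_measurable[OF assms]]])

text \<open>The leading term vanishes when the \<open>\<gamma>\<close>-integral of \<open>f\<close>
  is 0, which leaves the growth rate \<open>lam - \<rho>\<close>. At time 0 the bound holds because
  \<open>a \<ge> 1\<close>.\<close>

lemma semigroup_centred:
  "\<exists>a\<ge>1. \<forall>j c f t. 1 \<le> j \<and> j \<le> 4 \<and> weighted j c f \<and> 0 \<le> t \<and> (LINT y|\<gamma>. f y) = 0 \<longrightarrow>
    weighted j (a * exp ((lam - \<rho>) * t) * c) (mean_semigroup B t f)"
proof -
  obtain a where a: "1 \<le> a" and *: "\<And>x j c f t. x \<in> space E \<Longrightarrow> 1 \<le> j \<and> j \<le> 4 \<and> weighted j c f \<and> 0 < t \<Longrightarrow>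
    \<bar>exp (- lam * t) * mean_semigroup B t f x - (LINT y|\<gamma>. f y) * h x\<bar> \<le> a * exp (- \<rho> * t) * c * V x ^ j"
    using ergodic_bound by blast
  have "weighted j (a * exp ((lam - \<rho>) * t) * c) (mean_semigroup B t f)"
    if j: "1 \<le> j" "j \<le> 4" and f: "weighted j c f" and t: "0 \<le> t" and 0: "(LINT y|\<gamma>. f y) = 0" for j c f t
    unfolding weighted_def
  proof (intro conjI ballI)
    have c: "0 \<le> c" and fm: "f \<in> borel_measurable E" using f by (auto simp: weighted_def)
    show "mean_semigroup B t f \<in> borel_measurable E" using t fm by measurable
    show "0 \<le> a * exp ((lam - \<rho>) * t) * c" using a c by simp
    fix x assume x: "x \<in> space E"
    show "\<bar>mean_semigroup B t f x\<bar> \<le> a * exp ((lam - \<rho>) * t) * c * V x ^ j"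
    proof (cases "t = 0")
      case True
      have "\<bar>f x\<bar> \<le> 1 * c * V x ^ j" using f x by (simp add: weighted_def)
      also have "\<dots> \<le> a * c * V x ^ j" using a c V_pos[OF x] by (intro mult_right_mono) auto
      finally show ?thesis using True semigroup_0[OF x fm] by simp
    next
      case False
      then have "\<bar>exp (- lam * t) * mean_semigroup B t f x\<bar> \<le> a * exp (- \<rho> * t) * c * V x ^ j"
        using *[of x j c f t] x j f t 0 by simp
      then have A: "exp (lam * t) * (exp (- lam * t) * \<bar>mean_semigroup B t f x\<bar>) \<le> exp (lam * t) * (a * exp (- \<rho> * t) * c * V x ^ j)"
        by (intro mult_left_mono) (auto simp: abs_mult)
      have B: "exp (lam * t) * (exp (- lam * t) * \<bar>mean_semigroup B t f x\<bar>) = \<bar>mean_semigroup B t f x\<bar>"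
        by (simp add: mult.assoc[symmetric] exp_add[symmetric])
      have e: "exp ((lam - \<rho>) * t) = exp (lam * t) * exp (- \<rho> * t)"
        by (simp add: exp_add[symmetric] algebra_simps)
      have C: "exp (lam * t) * (a * exp (- \<rho> * t) * c * V x ^ j) = a * exp ((lam - \<rho>) * t) * c * V x ^ j"
        unfolding e by (simp only: ac_simps)
      show ?thesis using A unfolding B C .
    qed
  qed
  then show ?thesis using a by blast
qed

lemma semigroup_V_bound:
  "\<exists>A\<ge>0. \<forall>x\<in>space E. \<forall>j t. 1 \<le> j \<and> j \<le> 4 \<and> 0 \<le> t \<longrightarrow>
    (LINT w|P x. Zf t (\<lambda>y. V y ^ j) w) \<le> A * exp (lam * t) * V x ^ j"
proof -
  obtain a where a: "1 \<le> a" and *: "\<And>x j c f t. x \<in> space E \<Longrightarrow> 1 \<le> j \<and> j \<le> 4 \<and> weighted j c f \<and> 0 < t \<Longrightarrow>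
    \<bar>exp (- lam * t) * mean_semigroup B t f x - (LINT y|\<gamma>. f y) * h x\<bar> \<le> a * exp (- \<rho> * t) * c * V x ^ j"
    using ergodic_bound by blast
  obtain ch where ch: "\<And>j. 1 \<le> j \<Longrightarrow> j \<le> 4 \<Longrightarrow> weighted j ch h" using h_weighted by blast
  have ch0: "0 \<le> ch" using ch[of 1] by (simp add: weighted_def)
  \<comment> \<open>\<open>a\<close> bounds the ergodic error and, being at least 1, the case of
    time 0; the sum over the four exponents bounds the leading term for each of them.\<close>
  define A where "A = a + ch * (\<Sum>j=1..4. LINT y|\<gamma>. V y ^ j)"
  have g0: "0 \<le> (LINT y|\<gamma>. V y ^ j)" for j
    using V_pos by (intro integral_nonneg_AE AE_I2) (auto simp: space_gamma intro: less_imp_le)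
  have "(LINT w|P x. Zf t (\<lambda>y. V y ^ j) w) \<le> A * exp (lam * t) * V x ^ j"
    if x: "x \<in> space E" and j: "1 \<le> j" "j \<le> 4" and t: "0 \<le> t" for x j t
  proof (cases "t = 0")
    case True
    have "1 \<le> A" using a ch0 g0 by (auto simp: A_def intro!: order_trans[OF a] mult_nonneg_nonneg sum_nonneg)
    then have "1 * V x ^ j \<le> A * V x ^ j" using V_pos[OF x] by (intro mult_right_mono) auto
    then show ?thesis using True semigroup_0[OF x, of "\<lambda>y. V y ^ j"] by (simp add: mean_semigroup_def)
  next
    case False
    with t have t: "0 < t" by simp
    have "exp (- lam * t) * mean_semigroup B t (\<lambda>y. V y ^ j) x \<le> (LINT y|\<gamma>. V y ^ j) * h x + a * exp (- \<rho> * t) * 1 * V x ^ j"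
      using *[of x j 1 "\<lambda>y. V y ^ j" t] x j t by simp
    also have "\<dots> \<le> (\<Sum>j=1..4. LINT y|\<gamma>. V y ^ j) * (ch * V x ^ j) + a * 1 * 1 * V x ^ j"
    proof (intro add_mono mult_mono)
      show "(LINT y|\<gamma>. V y ^ j) \<le> (\<Sum>j=1..4. LINT y|\<gamma>. V y ^ j)"
        using j g0 by (intro member_le_sum) auto
      show "h x \<le> ch * V x ^ j" using ch[OF j] x by (auto simp: weighted_def)
    qed (use a g0 h_nonneg[OF x] V_pos[OF x] t rho_pos ch0 in \<open>auto intro!: sum_nonneg\<close>)
    also have "\<dots> = A * V x ^ j" by (simp add: A_def algebra_simps)
    finally have "exp (lam * t) * (exp (- lam * t) * mean_semigroup B t (\<lambda>y. V y ^ j) x) \<le> exp (lam * t) * (A * V x ^ j)"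
      by (intro mult_left_mono) auto
    moreover have "exp (lam * t) * (exp (- lam * t) * mean_semigroup B t (\<lambda>y. V y ^ j) x) = mean_semigroup B t (\<lambda>y. V y ^ j) x"
      by (simp add: mult.assoc[symmetric] exp_add[symmetric])
    moreover have "exp (lam * t) * (A * V x ^ j) = A * exp (lam * t) * V x ^ j" by simp
    ultimately show ?thesis by (simp only: mean_semigroup_def)
  qed
  moreover have "0 \<le> A" using a ch0 g0 by (auto simp: A_def intro!: add_nonneg_nonneg mult_nonneg_nonneg sum_nonneg)
  ultimately show ?thesis by blast
qed

text \<open>Monotone class induction through three nested integrals, starting from the indicator
  functions for which the invariance is assumed.\<close>

lemma gamma_invariant_nn:
  assumes t: "0 \<le> t" and "\<phi> \<in> borel_measurable E"
  shows "(\<integral>\<^sup>+x. \<integral>\<^sup>+w. \<integral>\<^sup>+y. \<phi> y \<partial>population B t w \<partial>P x \<partial>\<gamma>) = ennreal (exp (lam * t)) * (\<integral>\<^sup>+y. \<phi> y \<partial>\<gamma>)"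
  using assms(2)
proof induct
  have pm: "(\<lambda>w. \<integral>\<^sup>+y. \<phi> y \<partial>population B t w) \<in> borel_measurable M" if "\<phi> \<in> borel_measurable E" for \<phi>
    by (rule measurable_compose[OF measurable_population[OF t] nn_integral_measurable_measure_algebra[OF that]])
  have gm: "(\<lambda>x. \<integral>\<^sup>+w. \<integral>\<^sup>+y. \<phi> y \<partial>population B t w \<partial>P x) \<in> borel_measurable \<gamma>" if "\<phi> \<in> borel_measurable E" for \<phi>
    unfolding measurable_cong_sets[OF sets_gamma refl]
    by (rule measurable_compose[OF law_subprob_measurable nn_integral_measurable_subprob_algebra[OF pm[OF that]]])
  note pmx = population_measurable_law[OF _ t]
  {
    case (cong f g)
    then show ?case
      using nn_integral_cong[of \<gamma> f g] nn_integral_cong[of "population B t _" f g] by (simp add: space_gamma)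
  next
    case (set A)
    then show ?case using gamma_invariant[OF t] by (simp add: sets_gamma)
  next
    case (mult f c)
    have "(\<integral>\<^sup>+x. \<integral>\<^sup>+w. \<integral>\<^sup>+y. c * f y \<partial>population B t w \<partial>P x \<partial>\<gamma>) = (\<integral>\<^sup>+x. c * (\<integral>\<^sup>+w. \<integral>\<^sup>+y. f y \<partial>population B t w \<partial>P x) \<partial>\<gamma>)"
      using mult(1,2) by (intro nn_integral_cong) (simp add: nn_integral_cmult measurable_population_eq pmx space_gamma)
    also have "\<dots> = c * (\<integral>\<^sup>+x. (\<integral>\<^sup>+w. \<integral>\<^sup>+y. f y \<partial>population B t w \<partial>P x) \<partial>\<gamma>)"
      using mult by (intro nn_integral_cmult gm)
    finally show ?case using mult by (simp add: nn_integral_cmult measurable_cong_sets[OF sets_gamma refl] ac_simps)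
  next
    case (add f g)
    have "(\<integral>\<^sup>+x. \<integral>\<^sup>+w. \<integral>\<^sup>+y. g y + f y \<partial>population B t w \<partial>P x \<partial>\<gamma>) = (\<integral>\<^sup>+x. (\<integral>\<^sup>+w. \<integral>\<^sup>+y. g y \<partial>population B t w \<partial>P x) + (\<integral>\<^sup>+w. \<integral>\<^sup>+y. f y \<partial>population B t w \<partial>P x) \<partial>\<gamma>)"
      using add by (intro nn_integral_cong) (simp add: nn_integral_add measurable_population_eq pmx space_gamma)
    also have "\<dots> = (\<integral>\<^sup>+x. \<integral>\<^sup>+w. \<integral>\<^sup>+y. g y \<partial>population B t w \<partial>P x \<partial>\<gamma>) + (\<integral>\<^sup>+x. \<integral>\<^sup>+w. \<integral>\<^sup>+y. f y \<partial>population B t w \<partial>P x \<partial>\<gamma>)"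
      using add by (intro nn_integral_add gm)
    finally show ?case
      using add by (simp add: nn_integral_add measurable_cong_sets[OF sets_gamma refl] distrib_left)
  next
    case (seq U)
    have iU: "incseq (\<lambda>i w. \<integral>\<^sup>+y. U i y \<partial>population B t w)"
      using seq by (auto simp: incseq_def le_fun_def intro!: nn_integral_mono)
    have iU2: "incseq (\<lambda>i x. \<integral>\<^sup>+w. \<integral>\<^sup>+y. U i y \<partial>population B t w \<partial>P x)"
      using seq by (auto simp: incseq_def le_fun_def intro!: nn_integral_mono)
    have "(\<integral>\<^sup>+x. \<integral>\<^sup>+w. \<integral>\<^sup>+y. (SUP i. U i) y \<partial>population B t w \<partial>P x \<partial>\<gamma>)
        = (\<integral>\<^sup>+x. (SUP i. \<integral>\<^sup>+w. \<integral>\<^sup>+y. U i y \<partial>population B t w \<partial>P x) \<partial>\<gamma>)"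
    proof (rule nn_integral_cong)
      fix x assume "x \<in> space \<gamma>"
      then have x: "x \<in> space E" by (simp add: space_gamma)
      have "(\<integral>\<^sup>+w. \<integral>\<^sup>+y. (SUP i. U i) y \<partial>population B t w \<partial>P x) = (\<integral>\<^sup>+w. (SUP i. \<integral>\<^sup>+y. U i y \<partial>population B t w) \<partial>P x)"
        unfolding SUP_apply using seq
        by (intro nn_integral_cong nn_integral_monotone_convergence_SUP) (auto simp: measurable_population_eq)
      also have "\<dots> = (SUP i. \<integral>\<^sup>+w. \<integral>\<^sup>+y. U i y \<partial>population B t w \<partial>P x)"
        using seq by (intro nn_integral_monotone_convergence_SUP iU pmx x)
      finally show "(\<integral>\<^sup>+w. \<integral>\<^sup>+y. (SUP i. U i) y \<partial>population B t w \<partial>P x) = (SUP i. \<integral>\<^sup>+w. \<integral>\<^sup>+y. U i y \<partial>population B t w \<partial>P x)" .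
    qed
    also have "\<dots> = (SUP i. \<integral>\<^sup>+x. \<integral>\<^sup>+w. \<integral>\<^sup>+y. U i y \<partial>population B t w \<partial>P x \<partial>\<gamma>)"
      using seq by (intro nn_integral_monotone_convergence_SUP iU2 gm)
    also have "\<dots> = ennreal (exp (lam * t)) * (SUP i. \<integral>\<^sup>+y. U i y \<partial>\<gamma>)"
      using seq by (simp add: SUP_mult_left_ennreal)
    also have "(SUP i. \<integral>\<^sup>+y. U i y \<partial>\<gamma>) = (\<integral>\<^sup>+y. (SUP i. U i) y \<partial>\<gamma>)"
      unfolding SUP_apply using seq
      by (intro nn_integral_monotone_convergence_SUP[symmetric]) (auto simp: measurable_cong_sets[OF sets_gamma refl])
    finally show ?case .
  }
qed

text \<open>Positive and negative part are bounded by the same weight, so both are integrable and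
  the non-negative version can be subtracted.\<close>

lemma gamma_semigroup:
  assumes f: "weighted j c f" "1 \<le> j" "j \<le> 4" and t: "0 \<le> t"
  shows "integrable \<gamma> (mean_semigroup B t f)" and "(LINT x|\<gamma>. mean_semigroup B t f x) = exp (lam * t) * (LINT x|\<gamma>. f x)"
proof -
  have nonneg_case: "integrable \<gamma> (mean_semigroup B t g) \<and> (LINT x|\<gamma>. mean_semigroup B t g x) = exp (lam * t) * (LINT x|\<gamma>. g x)"
    if g: "weighted j c g" and g0: "\<And>y. 0 \<le> g y" for g
  proof -
    have [measurable]: "g \<in> borel_measurable E" using g by (simp add: weighted_def)
    note ig = integrable_gamma[OF g f(2,3)]
    have eq: "ennreal (mean_semigroup B t g x) = (\<integral>\<^sup>+w. Zp t g w \<partial>P x)" if x: "x \<in> space E" for x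
    proof -
      have "ennreal (mean_semigroup B t g x) = (\<integral>\<^sup>+w. ennreal (Zf t g w) \<partial>P x)"
        unfolding mean_semigroup_def
        by (rule nn_integral_eq_integral[symmetric, OF Zint_integrable[OF g f(2,3) t x]]) (simp add: Zint_def g0)
      also have "\<dots> = (\<integral>\<^sup>+w. Zp t g w \<partial>P x)"
      proof (rule nn_integral_cong_AE)
        show "AE w in P x. ennreal (Zf t g w) = (Zp t g w)"
          using Zint_AE_bound[OF g f(2) t x] by eventually_elim (simp add: Zint_def g0 nn_integral_eq_integral)
      qed
      finally show ?thesis .
    qed
    have g1: "0 \<le> mean_semigroup B t g x" for x by (simp add: mean_semigroup_def Zint_def g0)
    have [measurable]: "mean_semigroup B t g \<in> borel_measurable \<gamma>"
      unfolding measurable_cong_sets[OF sets_gamma refl] using t by measurable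
    have "(\<integral>\<^sup>+x. ennreal (mean_semigroup B t g x) \<partial>\<gamma>) = (\<integral>\<^sup>+x. \<integral>\<^sup>+w. Zp t g w \<partial>P x \<partial>\<gamma>)"
      by (intro nn_integral_cong eq) (simp add: space_gamma)
    also have "\<dots> = ennreal (exp (lam * t)) * (\<integral>\<^sup>+y. ennreal (g y) \<partial>\<gamma>)" by (rule gamma_invariant_nn[OF t]) simp
    also have "\<dots> = ennreal (exp (lam * t) * (LINT y|\<gamma>. g y))"
      by (simp add: nn_integral_eq_integral[OF ig] g0 ennreal_mult)
    finally have nn: "(\<integral>\<^sup>+x. ennreal (mean_semigroup B t g x) \<partial>\<gamma>) = ennreal (exp (lam * t) * (LINT y|\<gamma>. g y))" .
    have i: "integrable \<gamma> (mean_semigroup B t g)"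
      by (rule integrableI_nonneg) (auto simp: nn g1)
    have "ennreal (LINT x|\<gamma>. mean_semigroup B t g x) = ennreal (exp (lam * t) * (LINT y|\<gamma>. g y))"
      using nn nn_integral_eq_integral[OF i] g1 by simp
    then show ?thesis using i g0 g1 by (simp add: integral_nonneg_AE)
  qed
  have wt: "weighted j c (\<lambda>y. max 0 (f y))" "weighted j c (\<lambda>y. max 0 (- f y))"
    using f(1) V_pos by (auto simp: weighted_def abs_le_iff max_def intro: order_trans)
  note p = nonneg_case[OF wt(1)] and n = nonneg_case[OF wt(2)]
  have split: "f = (\<lambda>y. max 0 (f y) - max 0 (- f y))" by (auto simp: max_def)
  have Ms: "mean_semigroup B t f x = mean_semigroup B t (\<lambda>y. max 0 (f y)) x - mean_semigroup B t (\<lambda>y. max 0 (- f y)) x"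
    if x: "x \<in> space E" for x
  proof -
    have "mean_semigroup B t f x = (LINT w|P x. Zf t (\<lambda>y. max 0 (f y)) w - Zf t (\<lambda>y. max 0 (- f y)) w)"
      unfolding mean_semigroup_def
    proof (rule integral_cong_AE)
      show "AE w in P x. Zf t f w = Zf t (\<lambda>y. max 0 (f y)) w - Zf t (\<lambda>y. max 0 (- f y)) w"
        using Zint_AE_bound[OF wt(1) f(2) t x] Zint_AE_bound[OF wt(2) f(2) t x]
        by eventually_elim (subst split, simp add: Zint_def)
    qed (use Zint_measurable_law[OF x t weighted_measurable[OF f(1)]] Zint_measurable_law[OF x t weighted_measurable[OF wt(1)]]
      Zint_measurable_law[OF x t weighted_measurable[OF wt(2)]] in auto)
    also have "\<dots> = mean_semigroup B t (\<lambda>y. max 0 (f y)) x - mean_semigroup B t (\<lambda>y. max 0 (- f y)) x"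
      unfolding mean_semigroup_def
      by (intro Bochner_Integration.integral_diff Zint_integrable[OF wt(1) f(2,3) t x] Zint_integrable[OF wt(2) f(2,3) t x])
    finally show ?thesis .
  qed
  have i: "integrable \<gamma> (\<lambda>x. mean_semigroup B t (\<lambda>y. max 0 (f y)) x - mean_semigroup B t (\<lambda>y. max 0 (- f y)) x)"
    using p n by auto
  show "integrable \<gamma> (mean_semigroup B t f)"
    by (rule Bochner_Integration.integrable_cong[THEN iffD2, OF refl _ i]) (simp add: Ms space_gamma)
  have "(LINT x|\<gamma>. mean_semigroup B t f x) = (LINT x|\<gamma>. mean_semigroup B t (\<lambda>y. max 0 (f y)) x - mean_semigroup B t (\<lambda>y. max 0 (- f y)) x)"
    by (rule Bochner_Integration.integral_cong) (auto simp: Ms space_gamma)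
  also have "\<dots> = exp (lam * t) * ((LINT y|\<gamma>. max 0 (f y)) - (LINT y|\<gamma>. max 0 (- f y)))"
    using p n by (simp add: right_diff_distrib)
  also have "(LINT y|\<gamma>. max 0 (f y)) - (LINT y|\<gamma>. max 0 (- f y)) = (LINT y|\<gamma>. f y)"
  proof -
    have "(LINT y|\<gamma>. max 0 (f y)) - (LINT y|\<gamma>. max 0 (- f y)) = (LINT y|\<gamma>. max 0 (f y) - max 0 (- f y))"
      by (rule Bochner_Integration.integral_diff[symmetric, OF integrable_gamma[OF wt(1) f(2,3)] integrable_gamma[OF wt(2) f(2,3)]])
    also have "\<dots> = (LINT y|\<gamma>. f y)"
      by (rule Bochner_Integration.integral_cong) (auto simp: max_def)
    finally show ?thesis .
  qed
  finally show "(LINT x|\<gamma>. mean_semigroup B t f x) = exp (lam * t) * (LINT x|\<gamma>. f x)" .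
qed

end

section \<open>Contraction estimates\<close>

lemma ex_contraction_time:
  fixes A c :: real
  assumes "0 \<le> A" "0 < c"
  shows "\<exists>T>0. A * exp (- c * T) \<le> 1 / 2"
proof -
  define T where "T = (2 * A + 1) / c"
  have T: "0 < T" "c * T = 2 * A + 1" using assms by (auto simp: T_def)
  have "2 * A \<le> exp (c * T)" using exp_ge_add_one_self[of "c * T"] T by linarith
  then have "A * exp (- c * T) \<le> 1 / 2" by (simp add: exp_minus field_simps)
  with T show ?thesis by blast
qed

lemma step_induct:
  fixes T t :: real
  assumes T: "0 < T" and base: "\<And>t. 0 \<le> t \<Longrightarrow> t \<le> T \<Longrightarrow> Q t" and step: "\<And>t. 0 \<le> t \<Longrightarrow> Q t \<Longrightarrow> Q (t + T)"
    and "0 \<le> t"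
  shows "Q t"
proof -
  have Qn: "Q (r + real n * T)" if "0 \<le> r" "r \<le> T" for r n
  proof (induction n)
    case 0
    then show ?case using base that by simp
  next
    case (Suc n)
    have "Q (r + real n * T + T)" using Suc that T by (intro step) auto
    then show ?case by (simp add: algebra_simps)
  qed
  define n where "n = nat \<lfloor>t / T\<rfloor>"
  have n: "real n = of_int \<lfloor>t / T\<rfloor>" using \<open>0 \<le> t\<close> T by (simp add: n_def)
  have "0 \<le> t - real n * T" "t - real n * T \<le> T"
    using floor_divide_lower[OF T, of t] floor_divide_upper[OF T, of t] by (auto simp: n algebra_simps)
  from Qn[OF this, of n] show ?thesis by simp
qed

text \<open>If a step of length \<open>T\<close> turns a bound \<open>N\<close> into
  \<open>N / 2 + K\<close>, a fixed bound propagates to all times. The index set carries more than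
  the starting point when the step changes the function under consideration, which is why the
  hypothesis of \<open>step\<close> covers all of \<open>I\<close>.\<close>

lemma contraction_bound:
  fixes m :: "real \<Rightarrow> 'i \<Rightarrow> real"
  assumes T: "0 < T" and "0 \<le> C" "0 \<le> K" "0 \<le> \<alpha>" and w: "\<And>i. i \<in> I \<Longrightarrow> 0 \<le> w i"
    and base: "\<And>t i. 0 \<le> t \<Longrightarrow> t \<le> T \<Longrightarrow> i \<in> I \<Longrightarrow> m t i \<le> C * w i"
    and step: "\<And>t N i. 0 \<le> t \<Longrightarrow> 0 \<le> N \<Longrightarrow> (\<And>i. i \<in> I \<Longrightarrow> m t i \<le> N * exp (\<alpha> * t) * w i) \<Longrightarrow> i \<in> I \<Longrightarrow>
      m (t + T) i \<le> (N / 2 + K) * exp (\<alpha> * (t + T)) * w i"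
  shows "\<exists>N\<ge>0. \<forall>t\<ge>0. \<forall>i\<in>I. m t i \<le> N * exp (\<alpha> * t) * w i"
proof -
  \<comment> \<open>\<open>2 * K\<close> is the fixed point of \<open>N / 2 + K\<close>; adding
    \<open>C\<close> covers the initial interval.\<close>
  define N where "N = C + 2 * K"
  have N: "0 \<le> N" "C \<le> N" "N / 2 + K \<le> N" using assms(2,3) by (auto simp: N_def)
  have "\<forall>i\<in>I. m t i \<le> N * exp (\<alpha> * t) * w i" if "0 \<le> t" for t
  proof (rule step_induct[OF T _ _ that])
    fix t assume t: "0 \<le> t" "t \<le> T"
    show "\<forall>i\<in>I. m t i \<le> N * exp (\<alpha> * t) * w i"
    proof
      fix i assume i: "i \<in> I"
      have "C * 1 \<le> N * exp (\<alpha> * t)" using assms(2,4) N t by (intro mult_mono) auto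
      then have "C * w i \<le> N * exp (\<alpha> * t) * w i" using w[OF i] by (intro mult_right_mono) auto
      then show "m t i \<le> N * exp (\<alpha> * t) * w i" using base[OF t i] by linarith
    qed
  next
    fix t assume t: "0 \<le> t" and Q: "\<forall>i\<in>I. m t i \<le> N * exp (\<alpha> * t) * w i"
    show "\<forall>i\<in>I. m (t + T) i \<le> N * exp (\<alpha> * (t + T)) * w i"
    proof
      fix i assume i: "i \<in> I"
      have "m (t + T) i \<le> (N / 2 + K) * exp (\<alpha> * (t + T)) * w i" using Q by (intro step[OF t N(1) _ i]) auto
      also have "\<dots> \<le> N * exp (\<alpha> * (t + T)) * w i" using N(3) w[OF i] by (intro mult_right_mono) auto
      finally show "m (t + T) i \<le> N * exp (\<alpha> * (t + T)) * w i" .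
    qed
  qed
  then show ?thesis using N(1) by blast
qed

context weighted_branching
begin

lemma Zint_cong: "(\<And>y. y \<in> space E \<Longrightarrow> f y = g y) \<Longrightarrow> Zf t f w = Zf t g w"
  unfolding Zint_def by (intro Bochner_Integration.integral_cong) auto

lemma path_mean_functional:
  assumes f: "weighted j c f" and k: "weighted j d k" and j: "1 \<le> j" "j \<le> 4" and s: "0 \<le> s" and r: "0 \<le> r" and y: "y \<in> space E"
  shows "path_mean (path_functional a f s b k r) y = a * mean_semigroup B s f y + b * mean_semigroup B r k y"
proof -
  have "path_mean (path_functional a f s b k r) y = (LINT w|P y. a * Zf s f w + b * Zf r k w)"
    unfolding path_mean_def mean_of_def by (rule integral_functional(1)[OF y order_refl s r j(1) f k y]) simp
  also have "\<dots> = a * mean_semigroup B s f y + b * mean_semigroup B r k y"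
    unfolding mean_semigroup_def using Zint_integrable[OF f j s y] Zint_integrable[OF k j r y] by simp
  finally show ?thesis .
qed

lemma weighted_mono:
  assumes f: "weighted j c f" and "c \<le> d"
  shows "weighted j d f"
  unfolding weighted_def
proof (intro conjI ballI)
  show "f \<in> borel_measurable E" "0 \<le> d" using assms by (auto simp: weighted_def)
  fix y assume y: "y \<in> space E"
  have "\<bar>f y\<bar> \<le> c * V y ^ j" using f y by (simp add: weighted_def)
  also have "\<dots> \<le> d * V y ^ j" using assms(2) V_pos[OF y] by (intro mult_right_mono) auto
  finally show "\<bar>f y\<bar> \<le> d * V y ^ j" .
qed

lemma weighted_scale:
  assumes f: "weighted j c f"
  shows "weighted j (\<bar>a\<bar> * c) (\<lambda>y. a * f y)"
  unfolding weighted_def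
proof (intro conjI ballI)
  show "(\<lambda>y. a * f y) \<in> borel_measurable E" using weighted_measurable[OF f] by simp
  show "0 \<le> \<bar>a\<bar> * c" using f by (simp add: weighted_def)
  fix y assume "y \<in> space E"
  then have "\<bar>f y\<bar> \<le> c * V y ^ j" using f by (simp add: weighted_def)
  from mult_left_mono[OF this, of "\<bar>a\<bar>"] show "\<bar>a * f y\<bar> \<le> \<bar>a\<bar> * c * V y ^ j" by (simp add: abs_mult mult.assoc)
qed

lemma weighted_add:
  assumes f: "weighted j c f" and g: "weighted j d g"
  shows "weighted j (c + d) (\<lambda>y. f y + g y)"
  unfolding weighted_def
proof (intro conjI ballI)
  show "(\<lambda>y. f y + g y) \<in> borel_measurable E" using weighted_measurable[OF f] weighted_measurable[OF g] by simp
  show "0 \<le> c + d" using f g by (simp add: weighted_def)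
  fix y assume "y \<in> space E"
  then have "\<bar>f y\<bar> \<le> c * V y ^ j" "\<bar>g y\<bar> \<le> d * V y ^ j" using f g by (simp_all add: weighted_def)
  then show "\<bar>f y + g y\<bar> \<le> (c + d) * V y ^ j" by (simp add: distrib_right)
qed

lemma Zint_power_bound:
  assumes f: "weighted j c f" "1 \<le> j" and t: "0 \<le> t" and C: "fourth_bound t C" and x: "x \<in> space E" and k: "j * k \<le> 4"
  shows "(LINT w|P x. \<bar>Zf t f w\<bar> ^ k) \<le> c ^ k * (1 + C) * V x ^ (j * k)"
proof -
  have "(LINT w|P x. \<bar>Zf t f w\<bar> ^ k) \<le> c ^ k * (LINT w|P x. Zf t V w ^ (j * k))"
    by (rule Zint_power_integrable(2)[OF f t x k])
  also have "\<dots> \<le> c ^ k * ((1 + C) * V x ^ (j * k))"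
    using f by (intro mult_left_mono Zint_V_moment(2)[OF C t x k]) (auto simp: weighted_def)
  finally show ?thesis by (simp add: mult.assoc)
qed

end

context ergodic_branching
begin

section \<open>Growth in time of the martingale and of centred functions\<close>

lemma Zint_path_mean:
  assumes f: "weighted j c f" and k: "weighted j d k" and j: "1 \<le> j" "j \<le> 4" and s: "0 \<le> s" and r: "0 \<le> r"
    and "\<And>y. y \<in> space E \<Longrightarrow> a * mean_semigroup B s f y + b * mean_semigroup B r k y = g y"
  shows "Zf t (path_mean (path_functional a f s b k r)) = Zf t g"
proof (rule ext, rule Zint_cong)
  fix y assume "y \<in> space E"
  then show "path_mean (path_functional a f s b k r) y = g y"
    using path_mean_functional[OF f k j s r, of y a b] assms(7)[of y] by metis
qed

text \<open>Starting the branches at time \<open>T\<close>, the previous bound is summed over a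
  population of order \<open>exp (lam * T)\<close>, while the target gains
  \<open>exp (2 * lam * T)\<close>: the ratio \<open>A * exp (- lam * T)\<close> is at most 1/2. The
  conditional means contribute a term already of the target order.\<close>

lemma martingale_second_moment:
  "\<exists>N\<ge>0. \<forall>t\<ge>0. \<forall>x\<in>space E. (LINT w|P x. (Zf t h w)\<^sup>2) \<le> N * exp (2 * lam * t) * V x ^ 2"
proof -
  obtain ch where ch: "\<And>j. 1 \<le> j \<Longrightarrow> j \<le> 4 \<Longrightarrow> weighted j ch h" using h_weighted by blast
  obtain A where A: "0 \<le> A" "\<And>x j t. x \<in> space E \<Longrightarrow> 1 \<le> j \<and> j \<le> 4 \<and> 0 \<le> t \<Longrightarrow>
    (LINT w|P x. Zf t (\<lambda>y. V y ^ j) w) \<le> A * exp (lam * t) * V x ^ j" using semigroup_V_bound by blast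
  obtain T where T: "0 < T" "A * exp (- lam * T) \<le> 1 / 2" using ex_contraction_time[OF A(1) lam_pos] by blast
  obtain C where C: "\<And>t. 0 \<le> t \<Longrightarrow> t \<le> T \<Longrightarrow> fourth_bound t C" using fourth_bound_locally by blast
  have C0: "0 \<le> C" using C[of 0] T by (auto simp: fourth_bound_def)
  have h1: "weighted 1 ch h" using ch by simp
  have T0: "0 \<le> T" using T by simp
  show ?thesis
  proof (rule contraction_bound[OF T(1)])
    fix t x assume t: "0 \<le> t" "t \<le> T" and x: "x \<in> space E"
    show "(LINT w|P x. (Zf t h w)\<^sup>2) \<le> (ch\<^sup>2 * (1 + C)) * V x ^ 2"
      using Zint_power_bound[OF h1 order_refl t(1) C[OF t] x, of 2] by simp
  next
    fix t N x assume t: "0 \<le> t" and N0: "0 \<le> N" and x: "x \<in> space E"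
      and Q: "\<And>x. x \<in> space E \<Longrightarrow> (LINT w|P x. (Zf t h w)\<^sup>2) \<le> N * exp (2 * lam * t) * V x ^ 2"
    \<comment> \<open>As \<open>h\<close> is an eigenfunction, the conditional mean after a further
      time \<open>t\<close> is \<open>exp (lam * t)\<close> times \<open>Z_T(h)\<close>, whose
      moments are known for fixed \<open>T\<close>.\<close>
    have mean: "Zf T (path_mean (path_functional 1 h t 0 h t)) = Zf T (\<lambda>y. exp (lam * t) * h y)"
      using semigroup_h[OF t] by (intro Zint_path_mean[OF h1 h1 order_refl _ t t]) auto
    have "(LINT w|P x. (1 * Zf (T + t) h w + 0 * Zf (T + t) h w)\<^sup>2)
        \<le> (N * exp (2 * lam * t)) * (LINT w|P x. Zf T (\<lambda>y. V y ^ (1 * 2)) w)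
          + (LINT w|P x. (Zf T (path_mean (path_functional 1 h t 0 h t)) w)\<^sup>2)"
      using Q N0 by (intro functional_second_moment_le[OF x T0 t t order_refl h1 h1]) auto
    also have "\<dots> \<le> (N * exp (2 * lam * t)) * (A * exp (lam * T) * V x ^ 2) + (exp (lam * t) * ch)\<^sup>2 * (1 + C) * V x ^ 2"
      unfolding mean
    proof (rule add_mono)
      show "(N * exp (2 * lam * t)) * (LINT w|P x. Zf T (\<lambda>y. V y ^ (1 * 2)) w) \<le> (N * exp (2 * lam * t)) * (A * exp (lam * T) * V x ^ 2)"
        using A(2)[of x 2 T] x T0 N0 by (intro mult_left_mono) auto
      show "(LINT w|P x. (Zf T (\<lambda>y. exp (lam * t) * h y) w)\<^sup>2) \<le> (exp (lam * t) * ch)\<^sup>2 * (1 + C) * V x ^ 2"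
        using Zint_power_bound[OF weighted_scale[OF h1, of "exp (lam * t)"] order_refl T0 C[OF T0 order_refl] x, of 2] by simp
    qed
    also have "\<dots> = (N * (A * exp (- lam * T)) + ch\<^sup>2 * (1 + C) * exp (- 2 * lam * T)) * exp (2 * lam * (t + T)) * V x ^ 2"
    proof -
      have e: "exp (2 * lam * t) * exp (lam * T) = exp (- lam * T) * exp (2 * lam * (t + T))"
        "(exp (lam * t))\<^sup>2 = exp (- 2 * lam * T) * exp (2 * lam * (t + T))"
        by (simp_all only: mult_exp_exp power2_eq_square) (simp_all add: algebra_simps)
      have "N * exp (2 * lam * t) * (A * exp (lam * T) * V x ^ 2) = N * (A * exp (- lam * T)) * exp (2 * lam * (t + T)) * V x ^ 2"
        using arg_cong[OF e(1), of "\<lambda>z. N * A * V x ^ 2 * z"] by (simp only: ac_simps)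
      moreover have "(exp (lam * t) * ch)\<^sup>2 * (1 + C) * V x ^ 2 = ch\<^sup>2 * (1 + C) * exp (- 2 * lam * T) * exp (2 * lam * (t + T)) * V x ^ 2"
        unfolding power_mult_distrib e(2) by (simp only: ac_simps)
      ultimately show ?thesis by (simp only: distrib_right[of _ _ "exp (2 * lam * (t + T))"] distrib_right[of _ _ "V x ^ 2"])
    qed
    also have "\<dots> \<le> (N / 2 + ch\<^sup>2 * (1 + C)) * exp (2 * lam * (t + T)) * V x ^ 2"
    proof (intro mult_right_mono add_mono)
      have "N * (A * exp (- lam * T)) \<le> N * (1 / 2)" by (rule mult_left_mono[OF T(2) N0])
      then show "N * (A * exp (- lam * T)) \<le> N / 2" by simp
      have "ch\<^sup>2 * (1 + C) * exp (- 2 * lam * T) \<le> ch\<^sup>2 * (1 + C) * 1"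
        using T0 lam_pos C0 by (intro mult_left_mono) auto
      then show "ch\<^sup>2 * (1 + C) * exp (- 2 * lam * T) \<le> ch\<^sup>2 * (1 + C)" by simp
    qed auto
    finally show "(LINT w|P x. (Zf (t + T) h w)\<^sup>2) \<le> (N / 2 + ch\<^sup>2 * (1 + C)) * exp (2 * lam * (t + T)) * V x ^ 2"
      by (simp add: add.commute)
  qed (use C0 lam_pos in auto)
qed

text \<open>The same split at time \<open>T\<close>: order \<open>exp (lam * T)\<close> individuals
  stand against a target factor \<open>exp (4 * lam * T)\<close>, so the recursion contracts by
  \<open>64 * A * exp (- (3 * lam) * T)\<close>. Squared second moments and fourth powers of the
  means are both of order \<open>exp (4 * lam * t)\<close> and form the source
  \<open>K\<close>.\<close>

lemma martingale_fourth_moment: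
  "\<exists>N\<ge>0. \<forall>t\<ge>0. \<forall>x\<in>space E. (LINT w|P x. (Zf t h w) ^ 4) \<le> N * exp (4 * lam * t) * V x ^ 4"
proof -
  obtain ch where ch: "\<And>j. 1 \<le> j \<Longrightarrow> j \<le> 4 \<Longrightarrow> weighted j ch h" using h_weighted by blast
  obtain A where A: "0 \<le> A" "\<And>x j t. x \<in> space E \<Longrightarrow> 1 \<le> j \<and> j \<le> 4 \<and> 0 \<le> t \<Longrightarrow>
    (LINT w|P x. Zf t (\<lambda>y. V y ^ j) w) \<le> A * exp (lam * t) * V x ^ j" using semigroup_V_bound by blast
  obtain N2 where N2: "0 \<le> N2" "\<And>x t. x \<in> space E \<Longrightarrow> 0 \<le> t \<Longrightarrow> (LINT w|P x. (Zf t h w)\<^sup>2) \<le> N2 * exp (2 * lam * t) * V x ^ 2"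
    using martingale_second_moment by blast
  have "0 \<le> 64 * A" "0 < 3 * lam" using A lam_pos by auto
  then obtain T where T: "0 < T" "64 * A * exp (- (3 * lam) * T) \<le> 1 / 2" using ex_contraction_time by blast
  obtain C where C: "\<And>t. 0 \<le> t \<Longrightarrow> t \<le> T \<Longrightarrow> fourth_bound t C" using fourth_bound_locally by blast
  have C0: "0 \<le> C" using C[of 0] T by (auto simp: fourth_bound_def)
  have h1: "weighted 1 ch h" using ch by simp
  have ch0: "0 \<le> ch" using h1 by (simp add: weighted_def)
  have T0: "0 \<le> T" using T by simp
  define K where "K = (24 * N2\<^sup>2 + 72 * ch ^ 4) * (1 + C)"
  have K0: "0 \<le> K" using C0 by (simp add: K_def)
  show ?thesis
  proof (rule contraction_bound[OF T(1)])
    fix t x assume t: "0 \<le> t" "t \<le> T" and x: "x \<in> space E"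
    show "(LINT w|P x. (Zf t h w) ^ 4) \<le> (ch ^ 4 * (1 + C)) * V x ^ 4"
      using Zint_power_bound[OF h1 order_refl t(1) C[OF t] x, of 4] by (simp add: power_even_abs)
  next
    fix t N x assume t: "0 \<le> t" and N0: "0 \<le> N" and x: "x \<in> space E"
      and Q: "\<And>x. x \<in> space E \<Longrightarrow> (LINT w|P x. (Zf t h w) ^ 4) \<le> N * exp (4 * lam * t) * V x ^ 4"
    let ?b2 = "N2 * exp (2 * lam * t)" and ?b1 = "ch * exp (lam * t)"
    have m1: "\<bar>LINT w|P y. 1 * Zf t h w + 0 * Zf t h w\<bar> \<le> ?b1 * V y" if y: "y \<in> space E" for y
      using semigroup_h[OF t y] h1 y h_nonneg[OF y] by (auto simp: mean_semigroup_def weighted_def)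
    have "(LINT w|P x. (1 * Zf (T + t) h w + 0 * Zf (T + t) h w) ^ 4)
        \<le> 64 * (N * exp (4 * lam * t)) * (LINT w|P x. Zf T (\<lambda>y. V y ^ 4) w)
          + (24 * ?b2\<^sup>2 + 72 * ?b1 ^ 4) * (LINT w|P x. Zf T V w ^ 4)"
      using Q N0 N2 ch0 t m1 by (intro functional_fourth_moment[OF x T0 t t h1 h1]) auto
    also have "\<dots> \<le> 64 * (N * exp (4 * lam * t)) * (A * exp (lam * T) * V x ^ 4)
          + (24 * ?b2\<^sup>2 + 72 * ?b1 ^ 4) * ((1 + C) * V x ^ 4)"
      using A(2)[of x 4 T] x T0 N0 Zint_V_moment(2)[OF C[OF T0 order_refl] T0 x, of 4] by (intro add_mono mult_left_mono) auto
    also have "\<dots> = (N * (64 * A * exp (- (3 * lam) * T)) + K * exp (- 4 * lam * T)) * exp (4 * lam * (t + T)) * V x ^ 4"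
    proof -
      have e: "exp (4 * lam * t) * exp (lam * T) = exp (- (3 * lam) * T) * exp (4 * lam * (t + T))"
        "(exp (2 * lam * t))\<^sup>2 = exp (- 4 * lam * T) * exp (4 * lam * (t + T))"
        "exp (lam * t) ^ 4 = exp (- 4 * lam * T) * exp (4 * lam * (t + T))"
        by (simp_all only: mult_exp_exp power2_eq_square power4_eq_xxxx) (simp_all add: algebra_simps)
      have "64 * (N * exp (4 * lam * t)) * (A * exp (lam * T) * V x ^ 4) = N * (64 * A * exp (- (3 * lam) * T)) * exp (4 * lam * (t + T)) * V x ^ 4"
        using arg_cong[OF e(1), of "\<lambda>z. 64 * N * A * V x ^ 4 * z"] by (simp only: ac_simps)
      moreover have "(24 * ?b2\<^sup>2 + 72 * ?b1 ^ 4) * ((1 + C) * V x ^ 4) = K * exp (- 4 * lam * T) * exp (4 * lam * (t + T)) * V x ^ 4"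
      proof -
        have "24 * ?b2\<^sup>2 + 72 * ?b1 ^ 4 = (24 * N2\<^sup>2 + 72 * ch ^ 4) * (exp (- 4 * lam * T) * exp (4 * lam * (t + T)))"
          unfolding power_mult_distrib e(2,3) distrib_right by (simp only: ac_simps)
        then show ?thesis unfolding K_def by (simp only: ac_simps)
      qed
      ultimately show ?thesis by (simp only: distrib_right[of _ _ "exp (4 * lam * (t + T))"] distrib_right[of _ _ "V x ^ 4"])
    qed
    also have "\<dots> \<le> (N / 2 + K) * exp (4 * lam * (t + T)) * V x ^ 4"
    proof (intro mult_right_mono add_mono)
      have "N * (64 * A * exp (- (3 * lam) * T)) \<le> N * (1 / 2)" by (rule mult_left_mono[OF T(2) N0])
      then show "N * (64 * A * exp (- (3 * lam) * T)) \<le> N / 2" by simp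
      have "K * exp (- 4 * lam * T) \<le> K * 1" using T0 lam_pos K0 by (intro mult_left_mono) auto
      then show "K * exp (- 4 * lam * T) \<le> K" by simp
    qed auto
    finally show "(LINT w|P x. (Zf (t + T) h w) ^ 4) \<le> (N / 2 + K) * exp (4 * lam * (t + T)) * V x ^ 4"
      by (simp add: add.commute)
  qed (use C0 K0 ch0 lam_pos in auto)
qed

text \<open>Here the branches are started at time \<open>t\<close> and run for the fixed time
  \<open>T\<close>. Their conditional mean is \<open>mean_semigroup B T g\<close>, again centred,
  with constant smaller by \<open>a * exp ((lam - \<rho>) * T)\<close>. Its square against the
  target factor \<open>exp (lam * T)\<close> is \<open>a^2 * exp (- (2 * \<rho> - lam) * T)\<close>,
  small because \<open>lam < 2 * \<rho>\<close>. The variance within the branches contributes order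
  \<open>exp (lam * t)\<close>.\<close>

lemma centred_second_moment:
  assumes j: "j = 1 \<or> j = 2"
  shows "\<exists>N\<ge>0. \<forall>t\<ge>0. \<forall>x\<in>space E. \<forall>g c. weighted j c g \<and> (LINT y|\<gamma>. g y) = 0 \<longrightarrow>
    (LINT w|P x. (Zf t g w)\<^sup>2) \<le> N * exp (lam * t) * (c\<^sup>2 * V x ^ (j * 2))"
proof -
  have j1: "1 \<le> j" "j \<le> 4" "j * 2 \<le> 4" "1 \<le> j * 2" using j by auto
  obtain A where A: "0 \<le> A" "\<And>x j t. x \<in> space E \<Longrightarrow> 1 \<le> j \<and> j \<le> 4 \<and> 0 \<le> t \<Longrightarrow>
    (LINT w|P x. Zf t (\<lambda>y. V y ^ j) w) \<le> A * exp (lam * t) * V x ^ j" using semigroup_V_bound by blast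
  obtain a where a: "1 \<le> a" "\<And>j c f t. 1 \<le> j \<and> j \<le> 4 \<and> weighted j c f \<and> 0 \<le> t \<and> (LINT y|\<gamma>. f y) = 0 \<Longrightarrow>
    weighted j (a * exp ((lam - \<rho>) * t) * c) (mean_semigroup B t f)" using semigroup_centred by blast
  have "0 \<le> a\<^sup>2" "0 < 2 * \<rho> - lam" using rate by auto
  then obtain T where T: "0 < T" "a\<^sup>2 * exp (- (2 * \<rho> - lam) * T) \<le> 1 / 2" using ex_contraction_time by blast
  obtain C where C: "\<And>t. 0 \<le> t \<Longrightarrow> t \<le> T \<Longrightarrow> fourth_bound t C" using fourth_bound_locally by blast
  have C0: "0 \<le> C" using C[of 0] T by (auto simp: fourth_bound_def)
  have T0: "0 \<le> T" using T by simp
  \<comment> \<open>The recursion replaces \<open>g\<close> by its image under the semigroup, so the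
    bound is propagated for all centred functions and their constants simultaneously.\<close>
  define I where "I = {(x, g, c). x \<in> space E \<and> weighted j c g \<and> (LINT y|\<gamma>. g y) = 0}"
  have loc: "(LINT w|P x. (Zf t g w)\<^sup>2) \<le> c\<^sup>2 * (1 + C) * V x ^ (j * 2)"
    if "0 \<le> t" "t \<le> T" "x \<in> space E" "weighted j c g" for t x g c
    using Zint_power_bound[OF that(4) j1(1) that(1) C[OF that(1,2)] that(3) j1(3)] by simp
  have "\<exists>N\<ge>0. \<forall>t\<ge>0. \<forall>i\<in>I. (\<lambda>(x, g, c). LINT w|P x. (Zf t g w)\<^sup>2) i \<le> N * exp (lam * t) * (\<lambda>(x, g, c). c\<^sup>2 * V x ^ (j * 2)) i"
  proof (rule contraction_bound[OF T(1)])
    fix t i assume t: "0 \<le> t" "t \<le> T" and i: "i \<in> I"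
    then obtain x g c where "i = (x, g, c)" "x \<in> space E" "weighted j c g" by (auto simp: I_def)
    with loc[OF t this(2,3)]
    show "(\<lambda>(x, g, c). LINT w|P x. (Zf t g w)\<^sup>2) i \<le> (1 + C) * (\<lambda>(x, g, c). c\<^sup>2 * V x ^ (j * 2)) i"
      by (simp add: ac_simps)
  next
    fix t N i assume t: "0 \<le> t" and N0: "0 \<le> N" and i: "i \<in> I"
      and Q: "\<And>i. i \<in> I \<Longrightarrow> (\<lambda>(x, g, c). LINT w|P x. (Zf t g w)\<^sup>2) i \<le> N * exp (lam * t) * (\<lambda>(x, g, c). c\<^sup>2 * V x ^ (j * 2)) i"
    obtain x g c where ieq: "i = (x, g, c)" and x: "x \<in> space E" and gw: "weighted j c g" and g0: "(LINT y|\<gamma>. g y) = 0"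
      using i by (auto simp: I_def)
    let ?c = "a * exp ((lam - \<rho>) * T) * c" and ?p = "path_functional 1 g T 0 g T"
    have mean: "Zf t (path_mean ?p) = Zf t (mean_semigroup B T g)"
      by (intro Zint_path_mean[OF gw gw j1(1,2) T0 T0]) auto
    have "weighted j ?c (mean_semigroup B T g)"
      using a(2)[of j c g T] gw g0 j1 T0 by simp
    moreover have "(LINT y|\<gamma>. mean_semigroup B T g y) = 0"
      using gamma_semigroup(2)[OF gw j1(1,2) T0] g0 by simp
    ultimately have iI: "(x, mean_semigroup B T g, ?c) \<in> I" using x by (simp add: I_def)
    have "(LINT w|P x. (1 * Zf (t + T) g w + 0 * Zf (t + T) g w)\<^sup>2)
        \<le> (c\<^sup>2 * (1 + C)) * (LINT w|P x. Zf t (\<lambda>y. V y ^ (j * 2)) w) + (LINT w|P x. (Zf t (path_mean ?p) w)\<^sup>2)"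
      using loc[OF T0 order_refl _ gw] C0 by (intro functional_second_moment_le[OF x t T0 T0 j1(1) gw gw j1(3)]) auto
    also have "\<dots> \<le> (c\<^sup>2 * (1 + C)) * (A * exp (lam * t) * V x ^ (j * 2)) + N * exp (lam * t) * (?c\<^sup>2 * V x ^ (j * 2))"
      unfolding mean using A(2)[of x "j * 2" t] x t C0 j1 Q[OF iI] by (intro add_mono mult_left_mono) auto
    also have "\<dots> = (N * (a\<^sup>2 * exp (- (2 * \<rho> - lam) * T)) + (1 + C) * A * exp (- lam * T)) * exp (lam * (t + T)) * (c\<^sup>2 * V x ^ (j * 2))"
    proof -
      have e: "exp (lam * t) = exp (- lam * T) * exp (lam * (t + T))"
        "exp (lam * t) * (exp ((lam - \<rho>) * T))\<^sup>2 = exp (- (2 * \<rho> - lam) * T) * exp (lam * (t + T))"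
        by (simp_all only: mult_exp_exp power2_eq_square) (simp_all add: algebra_simps)
      have "c\<^sup>2 * (1 + C) * (A * exp (lam * t) * V x ^ (j * 2)) = (1 + C) * A * exp (- lam * T) * exp (lam * (t + T)) * (c\<^sup>2 * V x ^ (j * 2))"
        unfolding e(1) by (simp only: ac_simps)
      moreover have "N * exp (lam * t) * (?c\<^sup>2 * V x ^ (j * 2)) = N * a\<^sup>2 * (exp (lam * t) * (exp ((lam - \<rho>) * T))\<^sup>2) * (c\<^sup>2 * V x ^ (j * 2))"
        by (simp only: power_mult_distrib ac_simps)
      ultimately show ?thesis
        unfolding e(2) distrib_right[of _ _ "exp (lam * (t + T))"] distrib_right[of _ _ "c\<^sup>2 * V x ^ (j * 2)"] by (simp only: ac_simps)
    qed
    also have "\<dots> \<le> (N / 2 + (1 + C) * A) * exp (lam * (t + T)) * (c\<^sup>2 * V x ^ (j * 2))"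
    proof (intro mult_right_mono add_mono)
      have "N * (a\<^sup>2 * exp (- (2 * \<rho> - lam) * T)) \<le> N * (1 / 2)" by (rule mult_left_mono[OF T(2) N0])
      then show "N * (a\<^sup>2 * exp (- (2 * \<rho> - lam) * T)) \<le> N / 2" by simp
      have "((1 + C) * A) * exp (- lam * T) \<le> ((1 + C) * A) * 1"
        using T0 lam_pos C0 A(1) by (intro mult_left_mono mult_nonneg_nonneg) (simp_all add: mult_nonneg_nonneg)
      then show "(1 + C) * A * exp (- lam * T) \<le> (1 + C) * A" by simp
    qed (use V_pos[OF x] in auto)
    finally show "(\<lambda>(x, g, c). LINT w|P x. (Zf (t + T) g w)\<^sup>2) i
        \<le> (N / 2 + (1 + C) * A) * exp (lam * (t + T)) * (\<lambda>(x, g, c). c\<^sup>2 * V x ^ (j * 2)) i"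
      by (simp add: ieq)
  qed (use C0 A lam_pos V_pos in \<open>auto simp: I_def less_imp_le\<close>)
  then obtain N where N: "0 \<le> N" "\<And>t i. 0 \<le> t \<Longrightarrow> i \<in> I \<Longrightarrow>
    (\<lambda>(x, g, c). LINT w|P x. (Zf t g w)\<^sup>2) i \<le> N * exp (lam * t) * (\<lambda>(x, g, c). c\<^sup>2 * V x ^ (j * 2)) i" by blast
  have "(LINT w|P x. (Zf t g w)\<^sup>2) \<le> N * exp (lam * t) * (c\<^sup>2 * V x ^ (j * 2))"
    if "0 \<le> t" "x \<in> space E" "weighted j c g \<and> (LINT y|\<gamma>. g y) = 0" for t x g c
    using N(2)[OF that(1), of "(x, g, c)"] that(2,3) by (simp add: I_def)
  with N(1) show ?thesis by blast
qed

text \<open>From time \<open>s\<close> on, the increment is a sum of independent centred increments,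
  one per individual, so the conditional mean is 0 and variances of order \<open>V^2\<close> add up
  to order \<open>exp (lam * s)\<close>. The scale \<open>exp (- 2 * lam * s)\<close> leaves
  \<open>exp (- lam * s)\<close>.\<close>

lemma martingale_increment:
  "\<exists>N\<ge>0. \<forall>x\<in>space E. \<forall>s t. 0 \<le> s \<and> s \<le> t \<longrightarrow>
    (LINT w|P x. (exp (- lam * s) * Zf s h w - exp (- lam * t) * Zf t h w)\<^sup>2) \<le> N * exp (- lam * s) * V x ^ 2"
proof -
  obtain ch where ch: "\<And>j. 1 \<le> j \<Longrightarrow> j \<le> 4 \<Longrightarrow> weighted j ch h" using h_weighted by blast
  have h1: "weighted 1 ch h" using ch by simp
  obtain A where A: "0 \<le> A" "\<And>x j t. x \<in> space E \<Longrightarrow> 1 \<le> j \<and> j \<le> 4 \<and> 0 \<le> t \<Longrightarrow>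
    (LINT w|P x. Zf t (\<lambda>y. V y ^ j) w) \<le> A * exp (lam * t) * V x ^ j" using semigroup_V_bound by blast
  obtain N2 where N2: "0 \<le> N2" "\<And>x t. x \<in> space E \<Longrightarrow> 0 \<le> t \<Longrightarrow> (LINT w|P x. (Zf t h w)\<^sup>2) \<le> N2 * exp (2 * lam * t) * V x ^ 2"
    using martingale_second_moment by blast
  have "(LINT w|P x. (exp (- lam * s) * Zf s h w - exp (- lam * t) * Zf t h w)\<^sup>2) \<le> 4 * N2 * A * exp (- lam * s) * V x ^ 2"
    if x: "x \<in> space E" and s: "0 \<le> s" "s \<le> t" for x s t
  proof -
    define r where "r = t - s"
    have r: "0 \<le> r" "t = s + r" using s by (auto simp: r_def)
    let ?p = "path_functional 1 h 0 (- exp (- lam * r)) h r"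
    \<comment> \<open>The square of a difference is at most twice the sum of the squares, each with
      expectation at most \<open>N2 * V y ^ 2\<close> after scaling; this gives
      \<open>4 * N2\<close>.\<close>
    have Y2: "(LINT w|P y. (1 * Zf 0 h w + (- exp (- lam * r)) * Zf r h w)\<^sup>2) \<le> 4 * N2 * V y ^ (1 * 2)"
      if y: "y \<in> space E" for y
    proof -
      have i: "integrable (P y) (\<lambda>w. (Zf u h w)\<^sup>2)" if "0 \<le> u" for u
        using Zint_power_integrable(1)[OF h1 order_refl that y, of 2] by simp
      have i2: "integrable (P y) (\<lambda>w. (1 * Zf 0 h w + (- exp (- lam * r)) * Zf r h w)\<^sup>2)"
        using functional_moment[OF h1 h1 order_refl order_refl r(1), of 2 1 "- exp (- lam * r)"] y by auto
      have "(LINT w|P y. (1 * Zf 0 h w + (- exp (- lam * r)) * Zf r h w)\<^sup>2)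
          \<le> (LINT w|P y. 2 * ((Zf 0 h w)\<^sup>2 + exp (- 2 * lam * r) * (Zf r h w)\<^sup>2))"
      proof (rule integral_mono[OF i2])
        show "integrable (P y) (\<lambda>w. 2 * ((Zf 0 h w)\<^sup>2 + exp (- 2 * lam * r) * (Zf r h w)\<^sup>2))"
          using i[of 0] i[OF r(1)] by simp
        fix w
        have e: "exp (- 2 * lam * r) = (- exp (- lam * r))\<^sup>2" by (simp add: mult.assoc flip: exp_of_nat_mult)
        show "(1 * Zf 0 h w + (- exp (- lam * r)) * Zf r h w)\<^sup>2
            \<le> 2 * ((Zf 0 h w)\<^sup>2 + exp (- 2 * lam * r) * (Zf r h w)\<^sup>2)"
          using power2_sum_le[of "1 * Zf 0 h w" "(- exp (- lam * r)) * Zf r h w"]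
          unfolding e power_mult_distrib by simp
      qed
      also have "\<dots> = 2 * ((LINT w|P y. (Zf 0 h w)\<^sup>2) + exp (- 2 * lam * r) * (LINT w|P y. (Zf r h w)\<^sup>2))"
        using i[of 0] i[OF r(1)] by simp
      also have "\<dots> \<le> 2 * (N2 * exp (2 * lam * 0) * V y ^ 2 + exp (- 2 * lam * r) * (N2 * exp (2 * lam * r) * V y ^ 2))"
        using N2(2)[OF y, of 0] N2(2)[OF y r(1)] by (intro mult_left_mono add_mono) auto
      also have "exp (- 2 * lam * r) * (N2 * exp (2 * lam * r) * V y ^ 2) = N2 * V y ^ 2"
        by (simp add: exp_minus)
      finally show ?thesis by simp
    qed
    have mean0: "Zf s (path_mean ?p) = Zf s (\<lambda>_. 0)"
      using semigroup_h[OF order_refl] semigroup_h[OF r(1)]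
      by (intro Zint_path_mean[OF h1 h1 order_refl _ order_refl r(1)]) (auto simp: exp_minus)
    have "(LINT w|P x. (1 * Zf (s + 0) h w + (- exp (- lam * r)) * Zf (s + r) h w)\<^sup>2)
        \<le> (4 * N2) * (LINT w|P x. Zf s (\<lambda>y. V y ^ (1 * 2)) w) + (LINT w|P x. (Zf s (path_mean ?p) w)\<^sup>2)"
      using Y2 N2(1) by (intro functional_second_moment_le[OF x s(1) order_refl r(1) order_refl h1 h1]) auto
    also have "\<dots> \<le> 4 * N2 * (A * exp (lam * s) * V x ^ 2)"
      unfolding mean0 using A(2)[of x 2 s] x s N2 by (auto simp: Zint_def intro!: mult_left_mono)
    finally have "exp (- 2 * lam * s) * (LINT w|P x. (Zf s h w - exp (- lam * r) * Zf t h w)\<^sup>2)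
        \<le> exp (- 2 * lam * s) * (4 * N2 * (A * exp (lam * s) * V x ^ 2))"
      using r by (intro mult_left_mono) auto
    also have "exp (- 2 * lam * s) * (LINT w|P x. (Zf s h w - exp (- lam * r) * Zf t h w)\<^sup>2)
        = (LINT w|P x. (exp (- lam * s) * Zf s h w - exp (- lam * t) * Zf t h w)\<^sup>2)"
    proof -
      have "exp (- 2 * lam * s) * (u - exp (- lam * r) * v)\<^sup>2 = (exp (- lam * s) * u - exp (- lam * t) * v)\<^sup>2" for u v
      proof -
        have e: "exp (- 2 * lam * s) = (exp (- lam * s))\<^sup>2" "exp (- lam * t) = exp (- lam * s) * exp (- lam * r)"
          by (simp_all only: r mult_exp_exp power2_eq_square) (simp_all add: algebra_simps)
        show ?thesis unfolding e power_mult_distrib[symmetric] by (simp add: right_diff_distrib mult.assoc)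
      qed
      then show ?thesis unfolding integral_mult_right_zero[symmetric] by (simp only:)
    qed
    also have "exp (- 2 * lam * s) * (4 * N2 * (A * exp (lam * s) * V x ^ 2)) = 4 * N2 * A * exp (- lam * s) * V x ^ 2"
    proof -
      have e: "exp (- lam * s) = exp (- 2 * lam * s) * exp (lam * s)" by (simp add: mult_exp_exp)
      show ?thesis unfolding e by (simp only: ac_simps)
    qed
    finally show ?thesis .
  qed
  moreover have "0 \<le> 4 * N2 * A" using A(1) N2(1) by simp
  ultimately show ?thesis by blast
qed

end

section \<open>Approximate fluctuations\<close>

text \<open>Interpolation at scale \<open>d\<close>: applied with \<open>d^4\<close> bounding a
  fourth moment, it yields a third moment of order \<open>d^3\<close> and so keeps homogeneity in
  the weight.\<close>

lemma abs_cube_le: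
  fixes u d :: real
  assumes "0 < d"
  shows "\<bar>u\<bar> ^ 3 \<le> u ^ 4 / d + d ^ 3"
proof (cases "\<bar>u\<bar> \<le> d")
  case True
  then have "\<bar>u\<bar> ^ 3 \<le> d ^ 3" by (intro power_mono) auto
  moreover have "0 \<le> u ^ 4 / d" using assms by simp
  ultimately show ?thesis by linarith
next
  case False
  then have "\<bar>u\<bar> ^ 3 * d \<le> \<bar>u\<bar> ^ 3 * \<bar>u\<bar>" by (intro mult_left_mono) auto
  also have "\<dots> = u ^ 4" by (simp add: power4_eq_xxxx power3_eq_cube flip: abs_mult)
  finally have "\<bar>u\<bar> ^ 3 \<le> u ^ 4 / d" using assms by (simp add: le_divide_eq)
  moreover have "0 \<le> d ^ 3" using assms by simp
  ultimately show ?thesis by linarith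
qed

lemma square_le_fourth:
  fixes u d :: real
  assumes "0 < d"
  shows "u\<^sup>2 \<le> (u ^ 4 / d\<^sup>2 + d\<^sup>2) / 2"
proof -
  have "2 * (u\<^sup>2 * d\<^sup>2) \<le> u ^ 4 + d\<^sup>2 * d\<^sup>2"
    using sum_squares_bound[of "u\<^sup>2" "d\<^sup>2"] by (simp add: power2_eq_square power4_eq_xxxx mult.assoc)
  then have "2 * u\<^sup>2 \<le> (u ^ 4 + d\<^sup>2 * d\<^sup>2) / d\<^sup>2" using assms by (simp add: le_divide_eq mult.assoc)
  also have "\<dots> = u ^ 4 / d\<^sup>2 + d\<^sup>2" using assms by (simp add: add_divide_distrib power2_eq_square)
  finally show ?thesis by simp
qed

context real_distribution
begin

lemma second_moment_le_fourth:
  assumes i4: "integrable M (\<lambda>z. z ^ 4)" and d: "0 < d" and le: "(LINT z|M. z ^ 4) \<le> d ^ 4"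
  shows "integrable M (\<lambda>z. z\<^sup>2)" and "(LINT z|M. z\<^sup>2) \<le> d\<^sup>2"
proof -
  show i2: "integrable M (\<lambda>z. z\<^sup>2)" using integrable_power_le[OF i4, of 2] by simp
  have "(LINT z|M. z\<^sup>2) \<le> (LINT z|M. (z ^ 4 / d\<^sup>2 + d\<^sup>2) / 2)"
    using i2 i4 square_le_fourth[OF d] by (intro integral_mono) auto
  also have "\<dots> = ((LINT z|M. z ^ 4) / d\<^sup>2 + d\<^sup>2) / 2" using i4 by (simp add: prob_space[simplified])
  also have "\<dots> \<le> (d ^ 4 / d\<^sup>2 + d\<^sup>2) / 2"
    using le by (intro divide_right_mono add_right_mono) auto
  also have "\<dots> = d\<^sup>2" using d power_diff[of d 2 4] by simp
  finally show "(LINT z|M. z\<^sup>2) \<le> d\<^sup>2" .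
qed

text \<open>Centring costs \<open>8 * (d^4 + d^4)\<close> in the fourth moment, so interpolation
  gives \<open>17 * d^3\<close> for the third moment; the power of the standard deviation adds one
  more \<open>d^3\<close>.\<close>

lemma lindeberg_error_le:
  assumes i4: "integrable M (\<lambda>z. z ^ 4)" and d: "0 < d" and le: "(LINT z|M. z ^ 4) \<le> d ^ 4"
  shows "lindeberg_error M \<le> 18 * d ^ 3"
proof -
  note m2 = second_moment_le_fourth[OF i4 d le]
  have v: "var_of M + (mean_of M)\<^sup>2 \<le> d\<^sup>2" using var_of_eq[OF m2(1)] m2(2) by simp
  have "(mean_of M)\<^sup>2 \<le> d\<^sup>2" using v var_of_nonneg[of M] by linarith
  then have "((mean_of M)\<^sup>2)\<^sup>2 \<le> (d\<^sup>2)\<^sup>2" by (rule power_mono) simp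
  then have m4: "mean_of M ^ 4 \<le> d ^ 4" by (simp flip: power_mult)
  have "var_of M \<le> d\<^sup>2" using v zero_le_power2[of "mean_of M"] by linarith
  then have "sqrt (var_of M) \<le> d" using d by (intro real_le_lsqrt) auto
  then have s: "sqrt (var_of M) ^ 3 \<le> d ^ 3" using var_of_nonneg[of M] by (intro power_mono) auto
  have "third_of M \<le> (LINT z|M. (8 * (z ^ 4 + mean_of M ^ 4)) / d + d ^ 3)"
    unfolding third_of_def
  proof (rule integral_mono)
    show "integrable M (\<lambda>z. \<bar>z - mean_of M\<bar> ^ 3)" by (rule integrable_third[OF i4])
    show "integrable M (\<lambda>z. (8 * (z ^ 4 + mean_of M ^ 4)) / d + d ^ 3)" using i4 by simp
    fix z
    have "(z - mean_of M) ^ 4 \<le> 8 * (z ^ 4 + mean_of M ^ 4)" using power4_sum_le[of z "- mean_of M"] by simp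
    then have "(z - mean_of M) ^ 4 / d \<le> 8 * (z ^ 4 + mean_of M ^ 4) / d" using d by (intro divide_right_mono) auto
    then show "\<bar>z - mean_of M\<bar> ^ 3 \<le> (8 * (z ^ 4 + mean_of M ^ 4)) / d + d ^ 3"
      using abs_cube_le[OF d, of "z - mean_of M"] by linarith
  qed
  also have "\<dots> = (8 * ((LINT z|M. z ^ 4) + mean_of M ^ 4)) / d + d ^ 3" using i4 by (simp add: prob_space[simplified])
  also have "\<dots> \<le> (8 * (d ^ 4 + d ^ 4)) / d + d ^ 3"
    using le m4 d by (intro add_right_mono divide_right_mono mult_left_mono add_mono) auto
  also have "\<dots> = 17 * d ^ 3" using d by (simp add: power4_eq_xxxx power3_eq_cube)
  finally show ?thesis unfolding lindeberg_error_def using s by linarith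
qed

end

context ergodic_branching
begin

text \<open>The projection along \<open>h\<close> onto the functions with
  \<open>\<gamma>\<close>-integral 0, because \<open>\<gamma>(h) = 1\<close>.\<close>

definition centred :: "('x \<Rightarrow> real) \<Rightarrow> 'x \<Rightarrow> real" where
  "centred f y = f y - (LINT z|\<gamma>. f z) * h y"

lemma weighted_centred:
  assumes "weighted j c f" "1 \<le> j" "j \<le> 4"
  shows "\<exists>d. weighted j d (centred f)" and "(LINT y|\<gamma>. centred f y) = 0"
proof -
  obtain ch where ch: "\<And>j. 1 \<le> j \<Longrightarrow> j \<le> 4 \<Longrightarrow> weighted j ch h" using h_weighted by blast
  have "weighted j (c + \<bar>- (LINT z|\<gamma>. f z)\<bar> * ch) (\<lambda>y. f y + (- (LINT z|\<gamma>. f z)) * h y)"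
    by (intro weighted_add weighted_scale assms(1) ch assms(2,3))
  then show "\<exists>d. weighted j d (centred f)" by (auto simp: centred_def[abs_def])
  show "(LINT y|\<gamma>. centred f y) = 0"
    unfolding centred_def using integrable_gamma[OF assms] integrable_gamma[OF ch[OF assms(2,3)] assms(2,3)] gamma_h by simp
qed

lemma Zint_centred:
  assumes f: "weighted j c f" "1 \<le> j" "j \<le> 4" and t: "0 \<le> t" and x: "x \<in> space E"
  shows "AE w in P x. Zf t (centred f) w = Zf t f w - (LINT z|\<gamma>. f z) * Zf t h w"
proof -
  obtain ch where ch: "\<And>j. 1 \<le> j \<Longrightarrow> j \<le> 4 \<Longrightarrow> weighted j ch h" using h_weighted by blast
  show ?thesis
    using Zint_AE_bound[OF f(1,2) t x] Zint_AE_bound[OF ch[OF f(2,3)] f(2) t x]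
    by eventually_elim (simp add: Zint_def centred_def)
qed

lemma semigroup_centred_eq:
  assumes f: "weighted j c f" "1 \<le> j" "j \<le> 4" and t: "0 \<le> t" and x: "x \<in> space E"
  shows "mean_semigroup B t (centred f) x = mean_semigroup B t f x - (LINT z|\<gamma>. f z) * (exp (lam * t) * h x)"
proof -
  obtain ch where ch: "\<And>j. 1 \<le> j \<Longrightarrow> j \<le> 4 \<Longrightarrow> weighted j ch h" using h_weighted by blast
  obtain d where d: "weighted j d (centred f)" using weighted_centred[OF f] by blast
  note i = Zint_integrable[OF f t x] Zint_integrable[OF ch[OF f(2,3)] f(2,3) t x]
  have "mean_semigroup B t (centred f) x = (LINT w|P x. Zf t f w - (LINT z|\<gamma>. f z) * Zf t h w)"
    unfolding mean_semigroup_def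
  proof (rule integral_cong_AE)
    show "Zf t (centred f) \<in> borel_measurable (P x)" by (rule Zint_measurable_law[OF x t weighted_measurable[OF d]])
    show "(\<lambda>w. Zf t f w - (LINT z|\<gamma>. f z) * Zf t h w) \<in> borel_measurable (P x)"
      using i by (auto intro!: borel_measurable_diff borel_measurable_times)
  qed (rule Zint_centred[OF f t x])
  also have "\<dots> = mean_semigroup B t f x - (LINT z|\<gamma>. f z) * (exp (lam * t) * h x)"
    unfolding semigroup_h[OF t x, symmetric] using i by (simp add: mean_semigroup_def)
  finally show ?thesis .
qed

section \<open>Uniform moment bounds for the approximate fluctuations\<close>

definition root_scale :: "real \<Rightarrow> real" where
  "root_scale s = exp (- (lam * s / 2))"

text \<open>The coefficient of \<open>Z_T(h)\<close> in the fluctuation at time \<open>s\<close>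
  once \<open>W\<close> is replaced by \<open>exp (- lam * T) * Z_T(h)\<close>; it is the product of
  \<open>exp (- lam * s / 2)\<close>, \<open>exp (lam * s)\<close> and
  \<open>exp (- lam * T)\<close> with the negative of the \<open>\<gamma>\<close>-integral of
  \<open>f\<close>.\<close>

definition end_scale :: "('x \<Rightarrow> real) \<Rightarrow> real \<Rightarrow> real \<Rightarrow> real" where
  "end_scale f s T = - (LINT z|\<gamma>. f z) * exp (lam * s / 2 - lam * T)"

text \<open>\<open>approx f s T\<close> is the fluctuation at time \<open>s\<close> with \<open>W\<close> replaced by \<open>W\<^sub>T\<close>; unlike the fluctuation itself
  it is a functional of the path of \<open>Z\<close>, to which the branching property applies.\<close>

definition approx :: "('x \<Rightarrow> real) \<Rightarrow> real \<Rightarrow> real \<Rightarrow> 'w \<Rightarrow> real" where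
  "approx f s T w = root_scale s * Zf s f w + end_scale f s T * Zf T h w"

lemma root_scale_pos: "0 < root_scale s"
  and root_scale_le_1: "0 \<le> s \<Longrightarrow> root_scale s \<le> 1"
  and root_scale_square: "(root_scale s)\<^sup>2 = exp (- lam * s)"
  and root_scale_fourth: "root_scale s ^ 4 = exp (- 2 * lam * s)"
  and root_scale_add: "root_scale (t + s) = root_scale t * root_scale s"
proof -
  show "0 < root_scale s" by (simp add: root_scale_def)
  show "root_scale s \<le> 1" if "0 \<le> s" using lam_pos that by (simp add: root_scale_def)
  show sq: "(root_scale s)\<^sup>2 = exp (- lam * s)" unfolding root_scale_def power2_eq_square mult_exp_exp by simp
  show "root_scale s ^ 4 = exp (- 2 * lam * s)"
    using arg_cong[OF sq, of "\<lambda>z. z\<^sup>2"] by (simp add: power2_eq_square[of "exp _"] mult_exp_exp)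
  show "root_scale (t + s) = root_scale t * root_scale s"
    unfolding root_scale_def mult_exp_exp by (simp add: field_simps)
qed

lemma end_scale_add: "end_scale f (t + s) (t + T) = root_scale t * end_scale f s T"
proof -
  have "exp (lam * (t + s) / 2 - lam * (t + T)) = root_scale t * exp (lam * s / 2 - lam * T)"
    by (simp add: root_scale_def mult_exp_exp field_simps)
  then show ?thesis by (simp add: end_scale_def)
qed

lemma approx_measurable:
  assumes "x \<in> space E" "0 \<le> s" "0 \<le> T" "f \<in> borel_measurable E"
  shows "approx f s T \<in> borel_measurable (P x)"
proof -
  have [measurable]: "Zf s f \<in> borel_measurable (P x)" "Zf T h \<in> borel_measurable (P x)"
    by (rule Zint_measurable_law[OF assms(1,2,4)], rule Zint_measurable_law[OF assms(1,3) h_measurable])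
  show ?thesis unfolding approx_def[abs_def] by measurable
qed

context
  fixes f c assumes f: "weighted 1 c f"
begin

text \<open>Separates the two sources of randomness: a centred function of the population at time
  \<open>s\<close>, and an increment of the martingale after \<open>s\<close>. Each has a
  second-moment bound of its own.\<close>

lemma approx_decomposition:
  assumes x: "x \<in> space E" and s: "0 \<le> s"
  shows "AE w in P x. approx f s T w = root_scale s * Zf s (centred f) w
    + (LINT z|\<gamma>. f z) * exp (lam * s / 2) * (exp (- lam * s) * Zf s h w - exp (- lam * T) * Zf T h w)"
  using Zint_centred[OF f order_refl one_le_numeral s x]
proof eventually_elim
  case (elim w)
  have e: "exp (lam * s / 2 - lam * T) = exp (lam * s / 2) * exp (- lam * T)"
    "root_scale s = exp (lam * s / 2) * exp (- lam * s)"
    by (simp_all add: root_scale_def mult_exp_exp) (simp add: field_simps)?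
  show ?case unfolding elim approx_def end_scale_def e by (simp add: algebra_simps)
qed

text \<open>The expectation of \<open>approx f s T\<close>; the martingale property removes the
  dependence on \<open>T\<close>.\<close>

definition approx_mean :: "real \<Rightarrow> 'x \<Rightarrow> real" where
  "approx_mean s y = root_scale s * mean_semigroup B s (centred f) y"

text \<open>Centring leaves the growth rate \<open>lam - \<rho>\<close> and the scaling subtracts
  \<open>lam / 2\<close>. The resulting exponent is negative by \<open>lam < 2 * \<rho>\<close>, so
  the conditional means fade as the branches get older.\<close>

lemma approx_mean_bound:
  "\<exists>C\<ge>0. \<forall>s\<ge>0. weighted 1 (C * exp ((lam / 2 - \<rho>) * s)) (approx_mean s)"
proof -
  obtain c0 where c0: "weighted 1 c0 (centred f)" using weighted_centred(1)[OF f] by auto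
  have z0: "(LINT y|\<gamma>. centred f y) = 0" using weighted_centred(2)[OF f] by auto
  obtain a where a: "1 \<le> a" "\<And>j c f t. 1 \<le> j \<and> j \<le> 4 \<and> weighted j c f \<and> 0 \<le> t \<and> (LINT y|\<gamma>. f y) = 0 \<Longrightarrow>
    weighted j (a * exp ((lam - \<rho>) * t) * c) (mean_semigroup B t f)" using semigroup_centred by blast
  have "weighted 1 ((a * c0) * exp ((lam / 2 - \<rho>) * s)) (approx_mean s)" if s: "0 \<le> s" for s
  proof -
    have "weighted 1 (a * exp ((lam - \<rho>) * s) * c0) (mean_semigroup B s (centred f))"
      using c0 z0 s by (intro a(2)) auto
    from weighted_scale[OF this, of "root_scale s"]
    have "weighted 1 (\<bar>root_scale s\<bar> * (a * exp ((lam - \<rho>) * s) * c0)) (approx_mean s)"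
      by (simp add: approx_mean_def[abs_def])
    moreover have "exp ((lam / 2 - \<rho>) * s) = root_scale s * exp ((lam - \<rho>) * s)"
      unfolding root_scale_def mult_exp_exp by (simp add: field_simps)
    ultimately show ?thesis using root_scale_pos[of s] by (simp add: ac_simps)
  qed
  moreover have "0 \<le> a * c0" using a c0 by (simp add: weighted_def)
  ultimately show ?thesis by blast
qed

lemma approx_mean_centred: "0 \<le> s \<Longrightarrow> (LINT y|\<gamma>. approx_mean s y) = 0"
  using weighted_centred[OF f] gamma_semigroup(2)[of 1 _ "centred f" s] by (auto simp: approx_mean_def)

text \<open>The additional factor \<open>e\<close> allows a branch to be rescaled by the age of the
  population it starts from. The time \<open>T\<close> cancels because \<open>h\<close> is an
  eigenfunction.\<close>

lemma path_mean_approx: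
  assumes s: "0 \<le> s" "s \<le> T" and y: "y \<in> space E"
  shows "path_mean (path_functional (e * root_scale s) f s (e * end_scale f s T) h T) y = e * approx_mean s y"
proof -
  obtain ch where h1: "weighted 1 ch h" using h_weighted by auto
  have T: "0 \<le> T" using s by simp
  have e: "exp (lam * s / 2 - lam * T) * exp (lam * T) = root_scale s * exp (lam * s)"
    unfolding root_scale_def mult_exp_exp by (simp add: field_simps)
  have "path_mean (path_functional (e * root_scale s) f s (e * end_scale f s T) h T) y
      = e * root_scale s * mean_semigroup B s f y + e * end_scale f s T * (exp (lam * T) * h y)"
    using path_mean_functional[OF f h1 order_refl _ s(1) T y, of "e * root_scale s" "e * end_scale f s T"]
      semigroup_h[OF T y] by simp
  also have "e * end_scale f s T * (exp (lam * T) * h y) = - (e * (LINT z|\<gamma>. f z) * h y * (exp (lam * s / 2 - lam * T) * exp (lam * T)))"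
    by (simp add: end_scale_def)
  also have "e * root_scale s * mean_semigroup B s f y + - (e * (LINT z|\<gamma>. f z) * h y * (exp (lam * s / 2 - lam * T) * exp (lam * T))) = e * approx_mean s y"
    unfolding e approx_mean_def semigroup_centred_eq[OF f order_refl one_le_numeral s(1) y]
    by (simp add: algebra_simps)
  finally show ?thesis .
qed

lemma approx_integrable:
  assumes "0 \<le> s" "s \<le> T" "y \<in> space E" "k \<le> 4"
  shows "integrable (P y) (\<lambda>w. (e * approx f s T w) ^ k)"
proof -
  obtain ch where h1: "weighted 1 ch h" using h_weighted by auto
  have T: "0 \<le> T" and k: "1 * k \<le> 4" using assms by auto
  have "integrable (P y) (\<lambda>w. (e * root_scale s * Zf s f w + e * end_scale f s T * Zf T h w) ^ k)"
    using functional_moment[OF f h1 order_refl assms(1) T k, of "e * root_scale s" "e * end_scale f s T"] assms(3) by blast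
  then show ?thesis by (simp add: approx_def distrib_left mult.assoc)
qed

text \<open>Centred functions have second moment of order \<open>exp (lam * s)\<close>, increments
  after \<open>s\<close> of order \<open>exp (- lam * s)\<close>; the two scalings in
  \<open>approx_decomposition\<close> compensate exactly these factors, whence uniformity in
  \<open>s\<close> and \<open>T\<close>.\<close>

lemma approx_second_moment:
  "\<exists>C\<ge>0. \<forall>x\<in>space E. \<forall>s T. 0 \<le> s \<and> s \<le> T \<longrightarrow> (LINT w|P x. (approx f s T w)\<^sup>2) \<le> C * V x ^ 2"
proof -
  obtain ch where h1: "weighted 1 ch h" using h_weighted by auto
  obtain c0 where c0: "weighted 1 c0 (centred f)" using weighted_centred(1)[OF f] by auto
  have z0: "(LINT y|\<gamma>. centred f y) = 0" using weighted_centred(2)[OF f] by auto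
  obtain N where N: "0 \<le> N" "\<And>t x g c. 0 \<le> t \<Longrightarrow> x \<in> space E \<Longrightarrow> weighted 1 c g \<and> (LINT y|\<gamma>. g y) = 0 \<Longrightarrow>
    (LINT w|P x. (Zf t g w)\<^sup>2) \<le> N * exp (lam * t) * (c\<^sup>2 * V x ^ (1 * 2))"
    using centred_second_moment[of 1] by blast
  obtain N' where N': "0 \<le> N'" "\<And>x s t. x \<in> space E \<Longrightarrow> 0 \<le> s \<and> s \<le> t \<Longrightarrow>
    (LINT w|P x. (exp (- lam * s) * Zf s h w - exp (- lam * t) * Zf t h w)\<^sup>2) \<le> N' * exp (- lam * s) * V x ^ 2"
    using martingale_increment by blast
  define C where "C = 2 * (N * c0\<^sup>2) + 2 * ((LINT z|\<gamma>. f z)\<^sup>2 * N')"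
  have "(LINT w|P x. (approx f s T w)\<^sup>2) \<le> C * V x ^ 2" if x: "x \<in> space E" and s: "0 \<le> s" "s \<le> T" for x s T
  proof -
    have T: "0 \<le> T" using s by simp
    let ?Z = "Zf s (centred f)" and ?D = "\<lambda>w. exp (- lam * s) * Zf s h w - exp (- lam * T) * Zf T h w"
    have iZ: "integrable (P x) (\<lambda>w. (?Z w)\<^sup>2)"
      using Zint_power_integrable(1)[OF c0 order_refl s(1) x, of 2] by simp
    have "integrable (P x) (\<lambda>w. (exp (- lam * s) * Zf s h w + (- exp (- lam * T)) * Zf T h w) ^ 2)"
      using functional_moment[OF h1 h1 order_refl s(1) T, of 2 "exp (- lam * s)" "- exp (- lam * T)"] x by auto
    then have iD: "integrable (P x) (\<lambda>w. (?D w)\<^sup>2)" by simp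
    have "(LINT w|P x. (approx f s T w)\<^sup>2)
        \<le> (LINT w|P x. 2 * (exp (- lam * s) * (?Z w)\<^sup>2) + 2 * ((LINT z|\<gamma>. f z)\<^sup>2 * (exp (lam * s) * (?D w)\<^sup>2)))"
    proof (rule integral_mono_AE)
      show "integrable (P x) (\<lambda>w. (approx f s T w)\<^sup>2)" using approx_integrable[OF s x, of 2 1] by simp
      show "integrable (P x) (\<lambda>w. 2 * (exp (- lam * s) * (?Z w)\<^sup>2) + 2 * ((LINT z|\<gamma>. f z)\<^sup>2 * (exp (lam * s) * (?D w)\<^sup>2)))"
        by (intro Bochner_Integration.integrable_add integrable_mult_right iZ iD)
      show "AE w in P x. (approx f s T w)\<^sup>2
          \<le> 2 * (exp (- lam * s) * (?Z w)\<^sup>2) + 2 * ((LINT z|\<gamma>. f z)\<^sup>2 * (exp (lam * s) * (?D w)\<^sup>2))"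
        using approx_decomposition[OF x s(1), of T]
      proof eventually_elim
        case (elim w)
        have e: "exp (lam * s) = (exp (lam * s / 2))\<^sup>2" unfolding power2_eq_square mult_exp_exp by simp
        let ?p = "root_scale s * ?Z w" and ?q = "(LINT z|\<gamma>. f z) * exp (lam * s / 2) * ?D w"
        have "?p\<^sup>2 = exp (- lam * s) * (?Z w)\<^sup>2" by (simp only: power_mult_distrib root_scale_square)
        moreover have "?q\<^sup>2 = (LINT z|\<gamma>. f z)\<^sup>2 * (exp (lam * s) * (?D w)\<^sup>2)" by (simp only: power_mult_distrib e mult.assoc)
        ultimately have pq: "2 * (?p\<^sup>2 + ?q\<^sup>2) = 2 * (exp (- lam * s) * (?Z w)\<^sup>2) + 2 * ((LINT z|\<gamma>. f z)\<^sup>2 * (exp (lam * s) * (?D w)\<^sup>2))"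
          by (simp only: distrib_left)
        show ?case unfolding elim pq[symmetric] by (rule power2_sum_le)
      qed
    qed
    also have "\<dots> = 2 * (exp (- lam * s) * (LINT w|P x. (?Z w)\<^sup>2))
        + 2 * ((LINT z|\<gamma>. f z)\<^sup>2 * (exp (lam * s) * (LINT w|P x. (?D w)\<^sup>2)))"
      by (subst Bochner_Integration.integral_add) (intro integrable_mult_right iZ iD | simp only: integral_mult_right_zero)+
    also have "\<dots> \<le> 2 * (exp (- lam * s) * (N * exp (lam * s) * (c0\<^sup>2 * V x ^ (1 * 2))))
        + 2 * ((LINT z|\<gamma>. f z)\<^sup>2 * (exp (lam * s) * (N' * exp (- lam * s) * V x ^ 2)))"
      using s c0 z0 by (intro add_mono mult_left_mono N(2)[OF s(1) x] N'(2)[OF x] conjI) simp_all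
    also have "\<dots> = C * V x ^ 2"
    proof -
      have e: "exp (- lam * s) * exp (lam * s) = 1" unfolding mult_exp_exp by simp
      have e1: "exp (- lam * s) * (N * exp (lam * s) * (c0\<^sup>2 * V x ^ (1 * 2))) = N * c0\<^sup>2 * V x ^ 2"
        using arg_cong[OF e, of "\<lambda>z. z * (N * c0\<^sup>2 * V x ^ 2)"] by (simp only: ac_simps mult_1_left mult_1_right)
      have e2: "exp (lam * s) * (N' * exp (- lam * s) * V x ^ 2) = N' * V x ^ 2"
        using arg_cong[OF e, of "\<lambda>z. z * (N' * V x ^ 2)"] by (simp only: ac_simps mult_1_left mult_1_right)
      show ?thesis unfolding e1 e2 C_def by (simp only: distrib_right mult.assoc)
    qed
    finally show ?thesis .
  qed
  moreover have "0 \<le> C" using N N' by (simp add: C_def)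
  ultimately show ?thesis by blast
qed

text \<open>The branches start at time \<open>\<tau>\<close>: order
  \<open>exp (lam * \<tau>)\<close> individuals against the fourth power
  \<open>exp (- 2 * lam * \<tau>)\<close> of the scale give the factor
  \<open>64 * A * exp (- lam * \<tau>)\<close>. The second moments and means in the source term are
  bounded uniformly in time, so no growth is left.\<close>

lemma approx_fourth_moment:
  "\<exists>C\<ge>0. \<forall>x\<in>space E. \<forall>s T. 0 \<le> s \<and> s \<le> T \<longrightarrow> (LINT w|P x. (approx f s T w) ^ 4) \<le> C * V x ^ 4"
proof -
  obtain ch where h1: "weighted 1 ch h" using h_weighted by auto
  let ?gf = "LINT z|\<gamma>. f z"
  obtain A where A: "0 \<le> A" "\<And>x j t. x \<in> space E \<Longrightarrow> 1 \<le> j \<and> j \<le> 4 \<and> 0 \<le> t \<Longrightarrow>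
    (LINT w|P x. Zf t (\<lambda>y. V y ^ j) w) \<le> A * exp (lam * t) * V x ^ j" using semigroup_V_bound by blast
  obtain C1 where C1: "0 \<le> C1" "\<And>s. 0 \<le> s \<Longrightarrow> weighted 1 (C1 * exp ((lam / 2 - \<rho>) * s)) (approx_mean s)"
    using approx_mean_bound by blast
  obtain C2 where C2: "0 \<le> C2" "\<And>x s T. x \<in> space E \<Longrightarrow> 0 \<le> s \<and> s \<le> T \<Longrightarrow> (LINT w|P x. (approx f s T w)\<^sup>2) \<le> C2 * V x ^ 2"
    using approx_second_moment by blast
  obtain N4 where N4: "0 \<le> N4" "\<And>t x. 0 \<le> t \<Longrightarrow> x \<in> space E \<Longrightarrow> (LINT w|P x. (Zf t h w) ^ 4) \<le> N4 * exp (4 * lam * t) * V x ^ 4"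
    using martingale_fourth_moment by blast
  have "0 \<le> 64 * A" using A by simp
  then obtain \<tau> where \<tau>: "0 < \<tau>" "64 * A * exp (- lam * \<tau>) \<le> 1 / 2" using ex_contraction_time lam_pos by blast
  have \<tau>0: "0 \<le> \<tau>" using \<tau> by simp
  obtain C where C: "\<And>t. 0 \<le> t \<Longrightarrow> t \<le> \<tau> \<Longrightarrow> fourth_bound t C" using fourth_bound_locally by blast
  have C0: "0 \<le> C" using C[of 0] \<tau> by (auto simp: fourth_bound_def)
  \<comment> \<open>Base case \<open>s \<le> \<tau>\<close>: the population term is bounded over a
    bounded range of times, the martingale at the possibly distant time \<open>s + d\<close> by its
    fourth moment.\<close>
  define K0 where "K0 = 8 * (c ^ 4 * (1 + C)) + 8 * (?gf ^ 4 * exp (2 * lam * \<tau>) * N4)"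
  define K where "K = (24 * C2\<^sup>2 + 72 * C1 ^ 4) * (1 + C)"
  have K_nn: "0 \<le> K0" "0 \<le> K" using C0 N4 by (auto simp: K0_def K_def)
  \<comment> \<open>\<open>d\<close> is the gap \<open>T - s\<close>. Shifting both times leaves it
    unchanged, so the recursion runs in \<open>s\<close> alone.\<close>
  define I where "I = {(x, d). x \<in> space E \<and> 0 \<le> (d :: real)}"
  have "\<exists>N\<ge>0. \<forall>s\<ge>0. \<forall>i\<in>I. (\<lambda>(x, d). LINT w|P x. (approx f s (s + d) w) ^ 4) i \<le> N * exp (0 * s) * (\<lambda>(x, d). V x ^ 4) i"
  proof (rule contraction_bound[OF \<tau>(1) K_nn order_refl])
    fix i assume "i \<in> I"
    then show "0 \<le> (\<lambda>(x, d). V x ^ 4) i" by (auto simp: I_def)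
  next
    fix s i assume s: "0 \<le> s" "s \<le> \<tau>" and "i \<in> I"
    then obtain x d where i: "i = (x, d)" "x \<in> space E" "0 \<le> d" by (auto simp: I_def)
    have sd: "0 \<le> s + d" "s \<le> s + d" using s i by auto
    have ii: "integrable (P x) (\<lambda>w. (Zf s f w) ^ 4)" "integrable (P x) (\<lambda>w. (Zf (s + d) h w) ^ 4)"
      using Zint_power_integrable(1)[OF f order_refl s(1) i(2), of 4] Zint_power_integrable(1)[OF h1 order_refl sd(1) i(2), of 4] by auto
    have "(LINT w|P x. (approx f s (s + d) w) ^ 4)
        \<le> (LINT w|P x. 8 * (root_scale s ^ 4 * (Zf s f w) ^ 4) + 8 * (end_scale f s (s + d) ^ 4 * (Zf (s + d) h w) ^ 4))"
    proof (rule integral_mono)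
      show "integrable (P x) (\<lambda>w. (approx f s (s + d) w) ^ 4)" using approx_integrable[OF s(1) sd(2) i(2), of 4 1] by simp
      fix w
      show "(approx f s (s + d) w) ^ 4 \<le> 8 * (root_scale s ^ 4 * (Zf s f w) ^ 4) + 8 * (end_scale f s (s + d) ^ 4 * (Zf (s + d) h w) ^ 4)"
        using power4_sum_le[of "root_scale s * Zf s f w" "end_scale f s (s + d) * Zf (s + d) h w"]
        by (simp add: approx_def power_mult_distrib)
    qed (use ii in simp)
    also have "\<dots> = 8 * (root_scale s ^ 4 * (LINT w|P x. (Zf s f w) ^ 4)) + 8 * (end_scale f s (s + d) ^ 4 * (LINT w|P x. (Zf (s + d) h w) ^ 4))"
      using ii by simp
    also have "\<dots> \<le> 8 * (1 * (c ^ 4 * (1 + C) * V x ^ 4)) + 8 * (end_scale f s (s + d) ^ 4 * (N4 * exp (4 * lam * (s + d)) * V x ^ 4))"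
    proof (intro add_mono mult_left_mono mult_mono)
      show "root_scale s ^ 4 \<le> 1" using root_scale_le_1[OF s(1)] root_scale_pos[of s] by (simp add: power_le_one)
      show "(LINT w|P x. (Zf s f w) ^ 4) \<le> c ^ 4 * (1 + C) * V x ^ 4"
        using Zint_power_bound[OF f order_refl s(1) C[OF s] i(2), of 4] by (simp add: power_even_abs)
      show "(LINT w|P x. (Zf (s + d) h w) ^ 4) \<le> N4 * exp (4 * lam * (s + d)) * V x ^ 4" by (rule N4(2)[OF sd(1) i(2)])
    qed (auto simp: zero_le_even_power)
    also have "end_scale f s (s + d) ^ 4 * (N4 * exp (4 * lam * (s + d)) * V x ^ 4) = ?gf ^ 4 * exp (2 * lam * s) * N4 * V x ^ 4"
    proof -
      have e: "exp (lam * s / 2 - lam * (s + d)) ^ 4 * exp (4 * lam * (s + d)) = exp (2 * lam * s)"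
        unfolding power4_eq_xxxx mult_exp_exp by (simp add: field_simps)
      have "end_scale f s (s + d) ^ 4 = ?gf ^ 4 * exp (lam * s / 2 - lam * (s + d)) ^ 4"
        unfolding end_scale_def power_mult_distrib by simp
      then show ?thesis unfolding e[symmetric] by (simp only: ac_simps)
    qed
    also have "8 * (1 * (c ^ 4 * (1 + C) * V x ^ 4)) + 8 * (?gf ^ 4 * exp (2 * lam * s) * N4 * V x ^ 4) \<le> K0 * V x ^ 4"
    proof -
      have "?gf ^ 4 * exp (2 * lam * s) * N4 * V x ^ 4 \<le> ?gf ^ 4 * exp (2 * lam * \<tau>) * N4 * V x ^ 4"
        using s lam_pos N4(1) by (intro mult_right_mono mult_left_mono) (auto simp: zero_le_even_power)
      then show ?thesis by (simp add: K0_def distrib_right)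
    qed
    finally show "(\<lambda>(x, d). LINT w|P x. (approx f s (s + d) w) ^ 4) i \<le> K0 * (\<lambda>(x, d). V x ^ 4) i" by (simp add: i)
  next
    fix s N i assume s: "0 \<le> s" and N0: "0 \<le> N" and "i \<in> I"
      and Q: "\<And>i. i \<in> I \<Longrightarrow> (\<lambda>(x, d). LINT w|P x. (approx f s (s + d) w) ^ 4) i \<le> N * exp (0 * s) * (\<lambda>(x, d). V x ^ 4) i"
    then obtain x d where i: "i = (x, d)" "x \<in> space E" "0 \<le> d" by (auto simp: I_def)
    have sd: "0 \<le> s + d" "s \<le> s + d" using s i by auto
    have q4: "(LINT w|P y. (root_scale s * Zf s f w + end_scale f s (s + d) * Zf (s + d) h w) ^ 4) \<le> N * V y ^ 4"
      if "y \<in> space E" for y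
      using Q[of "(y, d)"] that i(3) by (simp add: I_def approx_def)
    have q2: "(LINT w|P y. (root_scale s * Zf s f w + end_scale f s (s + d) * Zf (s + d) h w)\<^sup>2) \<le> C2 * V y ^ 2"
      if "y \<in> space E" for y
      using C2(2)[OF that, of s "s + d"] s sd by (simp add: approx_def)
    have q1: "\<bar>LINT w|P y. (root_scale s * Zf s f w + end_scale f s (s + d) * Zf (s + d) h w)\<bar> \<le> C1 * V y"
      if y: "y \<in> space E" for y
    proof -
      have "(LINT w|P y. (root_scale s * Zf s f w + end_scale f s (s + d) * Zf (s + d) h w)) = approx_mean s y"
        using path_mean_approx[OF s sd(2) y, of 1] path_mean_functional[OF f h1 order_refl _ s sd(1) y]
          Zint_integrable[OF f order_refl _ s y] Zint_integrable[OF h1 order_refl _ sd(1) y]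
        by (simp add: mean_semigroup_def)
      also have "\<bar>approx_mean s y\<bar> \<le> C1 * exp ((lam / 2 - \<rho>) * s) * V y" using C1(2)[OF s] y by (simp add: weighted_def)
      also have "\<dots> \<le> C1 * 1 * V y"
        using C1(1) rate s V_pos[OF y] by (intro mult_right_mono mult_left_mono) (auto simp: mult_nonpos_nonneg)
      finally show ?thesis by simp
    qed
    have "(LINT w|P x. (root_scale s * Zf (\<tau> + s) f w + end_scale f s (s + d) * Zf (\<tau> + (s + d)) h w) ^ 4)
        \<le> 64 * N * (LINT w|P x. Zf \<tau> (\<lambda>y. V y ^ 4) w) + (24 * C2\<^sup>2 + 72 * C1 ^ 4) * (LINT w|P x. Zf \<tau> V w ^ 4)"
      by (rule functional_fourth_moment[OF i(2) \<tau>0 s sd(1) f h1 q4 N0 q2 C2(1) q1 C1(1)])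
    also have "\<dots> \<le> 64 * N * (A * exp (lam * \<tau>) * V x ^ 4) + (24 * C2\<^sup>2 + 72 * C1 ^ 4) * ((1 + C) * V x ^ 4)"
      using A(2)[of x 4 \<tau>] i(2) \<tau>0 N0 Zint_V_moment(2)[OF C[OF \<tau>0 order_refl] \<tau>0 i(2), of 4] by (intro add_mono mult_left_mono) auto
    finally have le: "(LINT w|P x. (root_scale s * Zf (\<tau> + s) f w + end_scale f s (s + d) * Zf (\<tau> + (s + d)) h w) ^ 4)
        \<le> 64 * N * (A * exp (lam * \<tau>) * V x ^ 4) + K * V x ^ 4" by (simp add: K_def mult.assoc)
    have "approx f (s + \<tau>) (s + \<tau> + d) = (\<lambda>w. root_scale \<tau> * (root_scale s * Zf (\<tau> + s) f w + end_scale f s (s + d) * Zf (\<tau> + (s + d)) h w))"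
      using root_scale_add[of \<tau> s] end_scale_add[of f \<tau> s "s + d"] by (auto simp: approx_def fun_eq_iff distrib_left ac_simps)
    then have "(LINT w|P x. (approx f (s + \<tau>) (s + \<tau> + d) w) ^ 4)
        = root_scale \<tau> ^ 4 * (LINT w|P x. (root_scale s * Zf (\<tau> + s) f w + end_scale f s (s + d) * Zf (\<tau> + (s + d)) h w) ^ 4)"
      by (simp only: power_mult_distrib integral_mult_right_zero)
    also have "\<dots> \<le> root_scale \<tau> ^ 4 * (64 * N * (A * exp (lam * \<tau>) * V x ^ 4) + K * V x ^ 4)"
      by (intro mult_left_mono le) (simp add: zero_le_even_power)
    \<comment> \<open>The subtracted term is 0, since the two exponentials multiply to 1; it makes
      this equality a ring identity.\<close>
    also have "\<dots> = (N * (64 * A * exp (- lam * \<tau>)) + K * root_scale \<tau> ^ 4) * V x ^ 4 - N * (64 * A * exp (- lam * \<tau>)) * (1 - exp (- lam * \<tau>) * exp (lam * \<tau>)) * V x ^ 4"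
    proof -
      have e: "root_scale \<tau> ^ 4 = exp (- lam * \<tau>) * exp (- lam * \<tau>)" unfolding root_scale_fourth mult_exp_exp by simp
      show ?thesis unfolding e by (simp only: algebra_simps)
    qed
    also have "\<dots> = (N * (64 * A * exp (- lam * \<tau>)) + K * root_scale \<tau> ^ 4) * V x ^ 4"
      unfolding mult_exp_exp by simp
    also have "\<dots> \<le> (N / 2 + K) * V x ^ 4"
    proof (intro mult_right_mono add_mono)
      have "N * (64 * A * exp (- lam * \<tau>)) \<le> N * (1 / 2)" by (rule mult_left_mono[OF \<tau>(2) N0])
      then show "N * (64 * A * exp (- lam * \<tau>)) \<le> N / 2" by simp
      have "K * root_scale \<tau> ^ 4 \<le> K * 1"
        using root_scale_le_1[OF \<tau>0] root_scale_pos[of \<tau>] K_nn by (intro mult_left_mono power_le_one) auto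
      then show "K * root_scale \<tau> ^ 4 \<le> K" by simp
    qed auto
    finally show "(\<lambda>(x, d). LINT w|P x. (approx f (s + \<tau>) (s + \<tau> + d) w) ^ 4) i \<le> (N / 2 + K) * exp (0 * (s + \<tau>)) * (\<lambda>(x, d). V x ^ 4) i"
      by (simp add: i)
  qed
  then obtain N where N: "0 \<le> N" "\<And>s i. 0 \<le> s \<Longrightarrow> i \<in> I \<Longrightarrow>
    (\<lambda>(x, d). LINT w|P x. (approx f s (s + d) w) ^ 4) i \<le> N * exp (0 * s) * (\<lambda>(x, d). V x ^ 4) i" by blast
  have "(LINT w|P x. (approx f s T w) ^ 4) \<le> N * V x ^ 4" if "x \<in> space E" "0 \<le> s \<and> s \<le> T" for x s T
    using N(2)[of s "(x, T - s)"] that by (simp add: I_def)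
  with N(1) show ?thesis by blast
qed

text \<open>The error is homogeneous of degree 3 in the scale \<open>e\<close>. Over about
  \<open>exp (lam * t)\<close> individuals with \<open>e = root_scale t\<close>, the sum is of order
  \<open>root_scale t\<close>.\<close>

lemma approx_lindeberg:
  "\<exists>C\<ge>0. \<forall>y\<in>space E. \<forall>s T e. 0 \<le> s \<and> s \<le> T \<and> 0 < e \<longrightarrow>
    lindeberg_error (path_law (path_functional (e * root_scale s) f s (e * end_scale f s T) h T) y) \<le> e ^ 3 * C * V y ^ 3"
proof -
  obtain ch where h1: "weighted 1 ch h" using h_weighted by auto
  obtain C where C: "0 \<le> C" "\<And>x s T. x \<in> space E \<Longrightarrow> 0 \<le> s \<and> s \<le> T \<Longrightarrow> (LINT w|P x. (approx f s T w) ^ 4) \<le> C * V x ^ 4"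
    using approx_fourth_moment by blast
  have "lindeberg_error (path_law (path_functional (e * root_scale s) f s (e * end_scale f s T) h T) y) \<le> e ^ 3 * (18 * (1 + C) ^ 3) * V y ^ 3"
    if y: "y \<in> space E" and s: "0 \<le> s" "s \<le> T" and e: "0 < e" for y s T e
  proof -
    let ?p = "path_functional (e * root_scale s) f s (e * end_scale f s T) h T"
    have T: "0 \<le> T" using s by simp
    interpret real_distribution "path_law ?p y"
      by (rule real_distribution_path_law[OF functional_measurable[OF y order_refl s(1) T order_refl f h1] y])
    have i4: "integrable (path_law ?p y) (\<lambda>z. z ^ 4)"
      by (rule integrable_path_law_fourth[OF y order_refl s(1) T f h1 y])
    have eq: "e * root_scale s * Zf s f w + e * end_scale f s T * Zf T h w = e * approx f s T w" for w
      by (simp add: approx_def distrib_left)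
    have "(LINT z|path_law ?p y. z ^ 4) = (LINT w|P y. (e * root_scale s * Zf s f w + e * end_scale f s T * Zf T h w) ^ 4)"
      by (rule integral_functional(1)[OF y order_refl s(1) T order_refl f h1 y]) simp
    also have "\<dots> = e ^ 4 * (LINT w|P y. (approx f s T w) ^ 4)" by (simp add: eq power_mult_distrib)
    also have "\<dots> \<le> e ^ 4 * ((1 + C) ^ 4 * V y ^ 4)"
    proof (rule mult_left_mono)
      \<comment> \<open>\<open>C \<le> (1 + C)^4\<close> turns the bound into a fourth power of
        \<open>d = e * (1 + C) * V y\<close>, as \<open>lindeberg_error_le\<close> expects.\<close>
      have "C \<le> 1 + C" by simp
      also have "\<dots> = (1 + C) ^ 1" by simp
      also have "\<dots> \<le> (1 + C) ^ 4" using C by (intro power_increasing) auto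
      finally have "C * V y ^ 4 \<le> (1 + C) ^ 4 * V y ^ 4" by (intro mult_right_mono) auto
      then show "(LINT w|P y. (approx f s T w) ^ 4) \<le> (1 + C) ^ 4 * V y ^ 4" using C(2)[OF y, of s T] s by simp
    qed simp
    also have "\<dots> = (e * (1 + C) * V y) ^ 4" by (simp add: power_mult_distrib mult.assoc)
    finally have "lindeberg_error (path_law ?p y) \<le> 18 * (e * (1 + C) * V y) ^ 3"
      using e C V_pos[OF y] by (intro lindeberg_error_le[OF i4]) auto
    then show ?thesis by (simp add: power_mult_distrib ac_simps)
  qed
  moreover have "0 \<le> 18 * (1 + C) ^ 3" using C by simp
  ultimately show ?thesis by blast
qed

end

end

section \<open>The asymptotic variance\<close>

context ergodic_branching
begin

definition approx_var :: "('x \<Rightarrow> real) \<Rightarrow> real \<Rightarrow> real \<Rightarrow> 'x \<Rightarrow> real" where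
  "approx_var f s T = path_var (path_functional (root_scale s) f s (end_scale f s T) h T)"

lemma approx_var_nonneg: "0 \<le> approx_var f s T y"
  by (simp add: approx_var_def path_var_nonneg)

context
  fixes f c assumes f: "weighted 1 c f"
begin

lemma approx_var_weighted:
  "\<exists>C\<ge>0. \<forall>s T. 0 \<le> s \<and> s \<le> T \<longrightarrow> weighted 2 C (approx_var f s T)"
proof -
  obtain ch where h1: "weighted 1 ch h" using h_weighted by auto
  obtain C where C: "0 \<le> C" "\<And>x s T. x \<in> space E \<Longrightarrow> 0 \<le> s \<and> s \<le> T \<Longrightarrow> (LINT w|P x. (approx f s T w)\<^sup>2) \<le> C * V x ^ 2"
    using approx_second_moment[OF f] by blast
  have "weighted 2 C (approx_var f s T)" if s: "0 \<le> s \<and> s \<le> T" for s T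
    unfolding weighted_def
  proof (intro conjI ballI)
    have s0: "0 \<le> s" and T: "0 \<le> T" using s by auto
    obtain x0 where x0: "x0 \<in> space E" using space_nonempty by blast
    show "approx_var f s T \<in> borel_measurable E"
      unfolding approx_var_def
      by (rule path_var_measurable[OF functional_measurable[OF x0 order_refl s0 T order_refl f h1]])
    fix y assume y: "y \<in> space E"
    have "approx_var f s T y \<le> (LINT w|P y. (approx f s T w)\<^sup>2)"
      using functional_weights[OF y order_refl s0 T order_refl f h1, of "root_scale s" "end_scale f s T"] y
      by (auto simp: approx_var_def approx_def)
    also have "\<dots> \<le> C * V y ^ 2" by (rule C(2)[OF y s])
    finally show "\<bar>approx_var f s T y\<bar> \<le> C * V y ^ 2" using approx_var_nonneg[of f s T y] by simp
  qed (rule C(1))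
  with C(1) show ?thesis by blast
qed

lemma approx_expectation:
  assumes s: "0 \<le> s" "s \<le> T" and x: "x \<in> space E"
  shows "(LINT w|P x. approx f s T w) = approx_mean f s x"
    and "(LINT w|P x. (approx f s T w)\<^sup>2) = approx_var f s T x + (approx_mean f s x)\<^sup>2"
proof -
  obtain ch where h1: "weighted 1 ch h" using h_weighted by auto
  have T: "0 \<le> T" using s by simp
  let ?p = "path_functional (root_scale s) f s (end_scale f s T) h T"
  interpret real_distribution "path_law ?p x"
    by (rule real_distribution_path_law[OF functional_measurable[OF x order_refl s(1) T order_refl f h1] x])
  have i: "(LINT z|path_law ?p x. g z) = (LINT w|P x. g (approx f s T w))" if "g \<in> borel_measurable borel" for g :: "real \<Rightarrow> real"
    using integral_functional(1)[OF x order_refl s(1) T order_refl f h1 x that, of "root_scale s" "end_scale f s T"]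
    by (simp add: approx_def)
  have i2: "integrable (path_law ?p x) (\<lambda>z. z\<^sup>2)"
    using functional_weights[OF x order_refl s(1) T order_refl f h1, of "root_scale s" "end_scale f s T"] x by auto
  have m: "mean_of (path_law ?p x) = approx_mean f s x"
    using path_mean_approx[OF f s x, of 1] by (simp add: path_mean_def)
  show "(LINT w|P x. approx f s T w) = approx_mean f s x"
    using m i[of "\<lambda>z. z"] by (simp add: mean_of_def)
  show "(LINT w|P x. (approx f s T w)\<^sup>2) = approx_var f s T x + (approx_mean f s x)\<^sup>2"
    using var_of_eq[OF i2] m i[of "\<lambda>z. z\<^sup>2"] by (simp add: approx_var_def path_var_def)
qed

lemma approx_shift:
  "approx f (t + s) (t + T) w = root_scale t * (root_scale s * Zf (t + s) f w + end_scale f s T * Zf (t + T) h w)"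
  unfolding approx_def root_scale_add end_scale_add by (simp add: distrib_left mult.assoc)

lemma Zint_path_mean_approx:
  assumes s: "0 \<le> s" "s \<le> T"
  shows "Zf t (path_mean (path_functional (root_scale s) f s (end_scale f s T) h T)) w = Zf t (approx_mean f s) w"
  by (rule Zint_cong) (use path_mean_approx[OF f s, of _ 1] in simp)

text \<open>By the total variance formula the difference between the outer terms is
  \<open>exp (- lam * t)\<close> times the variance of \<open>Z_t(approx_mean f s)\<close>. It is
  non-negative, which gives the lower inequality, and the second-moment bound for centred functions
  makes it small for large \<open>s\<close>, uniformly in \<open>t\<close>.\<close>

lemma approx_var_step:
  "\<exists>C\<ge>0. \<forall>x\<in>space E. \<forall>t s T. 0 \<le> t \<and> 0 \<le> s \<and> s \<le> T \<longrightarrow>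
    exp (- lam * t) * mean_semigroup B t (approx_var f s T) x \<le> approx_var f (t + s) (t + T) x \<and>
    approx_var f (t + s) (t + T) x \<le> exp (- lam * t) * mean_semigroup B t (approx_var f s T) x + C * exp (- (2 * \<rho> - lam) * s) * V x ^ 2"
proof -
  obtain ch where h1: "weighted 1 ch h" using h_weighted by auto
  obtain N where N: "0 \<le> N" "\<And>t x g c. 0 \<le> t \<Longrightarrow> x \<in> space E \<Longrightarrow> weighted 1 c g \<and> (LINT y|\<gamma>. g y) = 0 \<Longrightarrow>
    (LINT w|P x. (Zf t g w)\<^sup>2) \<le> N * exp (lam * t) * (c\<^sup>2 * V x ^ (1 * 2))"
    using centred_second_moment[of 1] by blast
  obtain C1 where C1: "0 \<le> C1" "\<And>s. 0 \<le> s \<Longrightarrow> weighted 1 (C1 * exp ((lam / 2 - \<rho>) * s)) (approx_mean f s)"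
    using approx_mean_bound[OF f] by blast
  have "exp (- lam * t) * mean_semigroup B t (approx_var f s T) x \<le> approx_var f (t + s) (t + T) x \<and>
    approx_var f (t + s) (t + T) x \<le> exp (- lam * t) * mean_semigroup B t (approx_var f s T) x + (N * C1\<^sup>2) * exp (- (2 * \<rho> - lam) * s) * V x ^ 2"
    if x: "x \<in> space E" and t: "0 \<le> t" and s: "0 \<le> s" "s \<le> T" for x t s T
  proof -
    have T: "0 \<le> T" using s by simp
    have ts: "0 \<le> t + s" "t + s \<le> t + T" using t s by auto
    interpret prob_space "P x" by (rule prob_space_law[OF x])
    note m = functional_second_moment[OF x t s(1) T order_refl f h1, of "root_scale s" "end_scale f s T"]
    let ?X = "Zf t (approx_mean f s)"
    have X2: "integrable (P x) (\<lambda>w. (?X w)\<^sup>2)"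
      using m(3) unfolding Zint_path_mean_approx[OF s] by simp
    have X1: "integrable (P x) ?X"
      by (rule Zint_integrable[OF C1(2)[OF s(1)] order_refl one_le_numeral t x])
    have second: "(LINT w|P x. (root_scale s * Zf (t + s) f w + end_scale f s T * Zf (t + T) h w)\<^sup>2)
        = mean_semigroup B t (approx_var f s T) x + (LINT w|P x. (?X w)\<^sup>2)"
      using m(4) unfolding Zint_path_mean_approx[OF s] mean_semigroup_def approx_var_def by simp
    have first: "(LINT w|P x. root_scale s * Zf (t + s) f w + end_scale f s T * Zf (t + T) h w) = (LINT w|P x. ?X w)"
      using m(5) unfolding Zint_path_mean_approx[OF s] by simp
    have eq2: "approx_var f (t + s) (t + T) x + (approx_mean f (t + s) x)\<^sup>2
        = exp (- lam * t) * (mean_semigroup B t (approx_var f s T) x + (LINT w|P x. (?X w)\<^sup>2))"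
      unfolding approx_expectation(2)[OF ts x, symmetric] approx_shift power_mult_distrib root_scale_square
        integral_mult_right_zero second ..
    have eq1: "approx_mean f (t + s) x = root_scale t * (LINT w|P x. ?X w)"
      unfolding approx_expectation(1)[OF ts x, symmetric] approx_shift integral_mult_right_zero first ..
    \<comment> \<open>Non-negativity of the variance of \<open>?X\<close>, the quantity by which the
      lower bound falls short of equality.\<close>
    have "(LINT w|P x. ?X w)\<^sup>2 \<le> (LINT w|P x. (?X w)\<^sup>2)"
      using variance_positive[of ?X] variance_eq[OF X1 X2] by simp
    then have lower: "(approx_mean f (t + s) x)\<^sup>2 \<le> exp (- lam * t) * (LINT w|P x. (?X w)\<^sup>2)"
      unfolding eq1 power_mult_distrib root_scale_square by (intro mult_left_mono) auto
    have "exp (- lam * t) * (LINT w|P x. (?X w)\<^sup>2)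
        \<le> exp (- lam * t) * (N * exp (lam * t) * ((C1 * exp ((lam / 2 - \<rho>) * s))\<^sup>2 * V x ^ (1 * 2)))"
      using C1(2)[OF s(1)] approx_mean_centred[OF f s(1)] by (intro mult_left_mono N(2)[OF t x] conjI) auto
    also have "\<dots> = (N * C1\<^sup>2) * exp (- (2 * \<rho> - lam) * s) * V x ^ 2"
    proof -
      have e: "exp (- lam * t) * exp (lam * t) = 1" unfolding mult_exp_exp by simp
      have e': "(exp ((lam / 2 - \<rho>) * s))\<^sup>2 = exp (- (2 * \<rho> - lam) * s)"
        unfolding power2_eq_square mult_exp_exp by (simp add: algebra_simps)
      have "exp (- lam * t) * (N * exp (lam * t) * ((C1 * exp ((lam / 2 - \<rho>) * s))\<^sup>2 * V x ^ (1 * 2)))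
          = (exp (- lam * t) * exp (lam * t)) * ((N * C1\<^sup>2) * (exp ((lam / 2 - \<rho>) * s))\<^sup>2 * V x ^ 2)"
        by (simp only: power_mult_distrib ac_simps mult_1_left)
      then show ?thesis unfolding e e' by simp
    qed
    finally show ?thesis
      using eq2 lower zero_le_power2[of "approx_mean f (t + s) x"] unfolding distrib_left by linarith
  qed
  moreover have "0 \<le> N * C1\<^sup>2" using N by simp
  ultimately show ?thesis by blast
qed

text \<open>Integration against \<open>\<gamma>\<close> cancels the scaled semigroup by invariance,
  which turns the pointwise recursion into monotonicity along common shifts of \<open>s\<close> and
  \<open>T\<close>, with a defect that decays in \<open>s\<close>.\<close>

lemma approx_var_gamma_step:
  "\<exists>C\<ge>0. \<forall>t s T. 0 \<le> t \<and> 0 \<le> s \<and> s \<le> T \<longrightarrow>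
    (LINT y|\<gamma>. approx_var f s T y) \<le> (LINT y|\<gamma>. approx_var f (t + s) (t + T) y) \<and>
    (LINT y|\<gamma>. approx_var f (t + s) (t + T) y) \<le> (LINT y|\<gamma>. approx_var f s T y) + C * exp (- (2 * \<rho> - lam) * s)"
proof -
  obtain C where C: "0 \<le> C" "\<And>x t s T. x \<in> space E \<Longrightarrow> 0 \<le> t \<and> 0 \<le> s \<and> s \<le> T \<Longrightarrow>
    exp (- lam * t) * mean_semigroup B t (approx_var f s T) x \<le> approx_var f (t + s) (t + T) x \<and>
    approx_var f (t + s) (t + T) x \<le> exp (- lam * t) * mean_semigroup B t (approx_var f s T) x + C * exp (- (2 * \<rho> - lam) * s) * V x ^ 2"
    using approx_var_step by blast
  obtain D where D: "\<And>s T. 0 \<le> s \<and> s \<le> T \<Longrightarrow> weighted 2 D (approx_var f s T)" using approx_var_weighted by blast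
  have two: "(1 :: nat) \<le> 2" "(2 :: nat) \<le> 4" by auto
  have iV: "integrable \<gamma> (\<lambda>y. V y ^ 2)" by (rule integrable_gamma[OF weighted_V two])
  have V0: "0 \<le> (LINT y|\<gamma>. V y ^ 2)" by simp
  have "(LINT y|\<gamma>. approx_var f s T y) \<le> (LINT y|\<gamma>. approx_var f (t + s) (t + T) y) \<and>
    (LINT y|\<gamma>. approx_var f (t + s) (t + T) y) \<le> (LINT y|\<gamma>. approx_var f s T y) + (C * (LINT y|\<gamma>. V y ^ 2)) * exp (- (2 * \<rho> - lam) * s)"
    if h: "0 \<le> t \<and> 0 \<le> s \<and> s \<le> T" for t s T
  proof -
    have t: "0 \<le> t" and s: "0 \<le> s \<and> s \<le> T" and ts: "0 \<le> t + s \<and> t + s \<le> t + T" using h by auto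
    note g = gamma_semigroup[OF D[OF s] two t]
    have i1: "integrable \<gamma> (\<lambda>y. exp (- lam * t) * mean_semigroup B t (approx_var f s T) y)" using g(1) by simp
    have i2: "integrable \<gamma> (approx_var f (t + s) (t + T))" by (rule integrable_gamma[OF D[OF ts] two])
    have e: "(LINT y|\<gamma>. exp (- lam * t) * mean_semigroup B t (approx_var f s T) y) = (LINT y|\<gamma>. approx_var f s T y)"
      using g(2) by (simp add: mult_exp_exp flip: mult.assoc)
    have "(LINT y|\<gamma>. exp (- lam * t) * mean_semigroup B t (approx_var f s T) y) \<le> (LINT y|\<gamma>. approx_var f (t + s) (t + T) y)"
      using C(2) h by (intro integral_mono i1 i2) (auto simp: space_gamma)
    moreover have "(LINT y|\<gamma>. approx_var f (t + s) (t + T) y)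
        \<le> (LINT y|\<gamma>. exp (- lam * t) * mean_semigroup B t (approx_var f s T) y + C * exp (- (2 * \<rho> - lam) * s) * V y ^ 2)"
      using C(2) h iV by (intro integral_mono i1 i2 Bochner_Integration.integrable_add) (auto simp: space_gamma)
    moreover have "(LINT y|\<gamma>. exp (- lam * t) * mean_semigroup B t (approx_var f s T) y + C * exp (- (2 * \<rho> - lam) * s) * V y ^ 2)
        = (LINT y|\<gamma>. approx_var f s T y) + C * exp (- (2 * \<rho> - lam) * s) * (LINT y|\<gamma>. V y ^ 2)"
      unfolding e[symmetric]
      by (subst Bochner_Integration.integral_add[OF i1]) (intro integrable_mult_right iV | simp only: integral_mult_right_zero)+
    ultimately show ?thesis unfolding e by (simp only: ac_simps)
  qed
  moreover have "0 \<le> C * (LINT y|\<gamma>. V y ^ 2)" using C(1) V0 by simp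
  ultimately show ?thesis by blast
qed

end

end

section \<open>The martingale limit and the limiting variance\<close>

context prob_space
begin

lemma abs_expectation_le_sqrt:
  fixes X :: "'a \<Rightarrow> real"
  assumes [measurable]: "X \<in> borel_measurable M" and X2: "integrable M (\<lambda>w. (X w)\<^sup>2)"
  shows "integrable M X" and "(LINT w|M. \<bar>X w\<bar>) \<le> sqrt (LINT w|M. (X w)\<^sup>2)"
proof -
  show X1: "integrable M X" using integrable_power_le[OF X2, of 1] by simp
  have "(LINT w|M. \<bar>X w\<bar>)\<^sup>2 \<le> (LINT w|M. (X w)\<^sup>2)"
    using variance_positive[of "\<lambda>w. \<bar>X w\<bar>"] variance_eq[of "\<lambda>w. \<bar>X w\<bar>"] X1 X2 by simp
  then show "(LINT w|M. \<bar>X w\<bar>) \<le> sqrt (LINT w|M. (X w)\<^sup>2)" by (rule real_le_rsqrt)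
qed

text \<open>For the squares, Young's inequality gives
  \<open>|a^2 - b^2| \<le> e * b^2 + (1 + 1 / e) * (a - b)^2\<close>, so the fixed variable
  \<open>Y\<close> absorbs the first term and the convergence the second.\<close>

lemma expectation_tendsto:
  fixes Y :: "'a \<Rightarrow> real" and X :: "'i \<Rightarrow> 'a \<Rightarrow> real"
  assumes Y: "Y \<in> borel_measurable M" "integrable M (\<lambda>w. (Y w)\<^sup>2)"
    and X: "eventually (\<lambda>i. X i \<in> borel_measurable M \<and> integrable M (\<lambda>w. (X i w)\<^sup>2)) F"
    and lim: "((\<lambda>i. LINT w|M. (X i w - Y w)\<^sup>2) \<longlongrightarrow> 0) F"
  shows "((\<lambda>i. LINT w|M. X i w) \<longlongrightarrow> (LINT w|M. Y w)) F"
    and "((\<lambda>i. LINT w|M. (X i w)\<^sup>2) \<longlongrightarrow> (LINT w|M. (Y w)\<^sup>2)) F"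
    and "((\<lambda>i. LINT w|M. \<bar>X i w - Y w\<bar>) \<longlongrightarrow> 0) F"
proof -
  have D2: "integrable M (\<lambda>w. (Z w - Y w)\<^sup>2)"
    if "Z \<in> borel_measurable M" "integrable M (\<lambda>w. (Z w)\<^sup>2)" for Z :: "'a \<Rightarrow> real"
  proof (rule Bochner_Integration.integrable_bound)
    show "integrable M (\<lambda>w. 2 * ((Z w)\<^sup>2 + (Y w)\<^sup>2))" using that Y by simp
    show "AE w in M. norm ((Z w - Y w)\<^sup>2) \<le> norm (2 * ((Z w)\<^sup>2 + (Y w)\<^sup>2))"
      using power2_sum_le[of "Z _" "- Y _"] by (intro AE_I2) simp
  qed (use that Y in simp)
  have "((\<lambda>i. sqrt (LINT w|M. (X i w - Y w)\<^sup>2)) \<longlongrightarrow> sqrt 0) F" by (intro tendsto_real_sqrt lim)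
  then have sq: "((\<lambda>i. sqrt (LINT w|M. (X i w - Y w)\<^sup>2)) \<longlongrightarrow> 0) F" by simp
  show abs: "((\<lambda>i. LINT w|M. \<bar>X i w - Y w\<bar>) \<longlongrightarrow> 0) F"
  proof (rule tendsto_sandwich[OF _ _ tendsto_const sq])
    show "eventually (\<lambda>i. (LINT w|M. \<bar>X i w - Y w\<bar>) \<le> sqrt (LINT w|M. (X i w - Y w)\<^sup>2)) F"
      using X
    proof eventually_elim
      case (elim i)
      then show ?case using D2[of "X i"] Y(1) by (intro abs_expectation_le_sqrt(2)) auto
    qed
  qed simp
  have le: "eventually (\<lambda>i. norm ((LINT w|M. X i w) - (LINT w|M. Y w)) \<le> (LINT w|M. \<bar>X i w - Y w\<bar>)) F"
    using X
  proof (rule eventually_mono)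
    fix i assume i: "X i \<in> borel_measurable M \<and> integrable M (\<lambda>w. (X i w)\<^sup>2)"
    have "integrable M (X i)" using i by (auto intro: abs_expectation_le_sqrt(1)[of "X i"])
    then have eq: "(LINT w|M. X i w) - (LINT w|M. Y w) = (LINT w|M. X i w - Y w)"
      by (rule Bochner_Integration.integral_diff[symmetric, OF _ abs_expectation_le_sqrt(1)[OF Y]])
    show "norm ((LINT w|M. X i w) - (LINT w|M. Y w)) \<le> (LINT w|M. \<bar>X i w - Y w\<bar>)"
      unfolding eq real_norm_def by (rule integral_abs_bound)
  qed
  have "((\<lambda>i. (LINT w|M. X i w) - (LINT w|M. Y w)) \<longlongrightarrow> 0) F"
    by (rule Lim_null_comparison[OF le abs])
  then show "((\<lambda>i. LINT w|M. X i w) \<longlongrightarrow> (LINT w|M. Y w)) F" by (simp add: LIM_zero_iff)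
  show "((\<lambda>i. LINT w|M. (X i w)\<^sup>2) \<longlongrightarrow> (LINT w|M. (Y w)\<^sup>2)) F"
  proof (rule tendstoI)
    fix r :: real assume r: "0 < r"
    let ?a = "LINT w|M. (Y w)\<^sup>2"
    \<comment> \<open>Chosen so that \<open>e * ?a \<le> r / 2\<close>; the summand 1 guards against
      \<open>?a = 0\<close>.\<close>
    define e where "e = r / (2 * (?a + 1))"
    have a0: "0 \<le> ?a" by simp
    have a1: "0 < 2 * (?a + 1)" by (rule mult_pos_pos[OF _ add_nonneg_pos[OF a0]]) simp_all
    have e0: "0 < e" unfolding e_def by (rule divide_pos_pos[OF r a1])
    have "e * ?a \<le> e * (?a + 1)" using e0 by (intro mult_left_mono) auto
    also have "\<dots> = r / 2"
    proof -
      have "r / (2 * wt) * wt = r / 2" if "wt \<noteq> 0" for wt using that by simp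
      moreover have "?a + 1 \<noteq> 0" using a1 by force
      ultimately show ?thesis unfolding e_def by blast
    qed
    finally have e: "0 < e" "e * ?a \<le> r / 2" using e0 by auto
    have "((\<lambda>i. (1 + 1 / e) * (LINT w|M. (X i w - Y w)\<^sup>2)) \<longlongrightarrow> (1 + 1 / e) * 0) F" by (intro tendsto_intros lim)
    then have "eventually (\<lambda>i. (1 + 1 / e) * (LINT w|M. (X i w - Y w)\<^sup>2) < r / 2) F"
      using r by (intro order_tendstoD(2)) auto
    then show "eventually (\<lambda>i. dist (LINT w|M. (X i w)\<^sup>2) ?a < r) F"
      using X
    proof eventually_elim
      case (elim i)
      let ?d = "\<lambda>w. X i w - Y w"
      have i2: "integrable M (\<lambda>w. (X i w)\<^sup>2)" and d2: "integrable M (\<lambda>w. (?d w)\<^sup>2)" using elim D2 by auto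
      have "\<bar>(LINT w|M. (X i w)\<^sup>2) - ?a\<bar> = \<bar>LINT w|M. (X i w)\<^sup>2 - (Y w)\<^sup>2\<bar>" using i2 Y by simp
      also have "\<dots> \<le> (LINT w|M. \<bar>(X i w)\<^sup>2 - (Y w)\<^sup>2\<bar>)" by (rule integral_abs_bound)
      also have "\<dots> \<le> (LINT w|M. e * (Y w)\<^sup>2 + (1 + 1 / e) * (?d w)\<^sup>2)"
      proof (rule integral_mono)
        fix w
        have "0 \<le> (e * \<bar>Y w\<bar> - \<bar>?d w\<bar>)\<^sup>2 / e" using e by simp
        also have "\<dots> = e * (Y w)\<^sup>2 - 2 * (\<bar>Y w\<bar> * \<bar>?d w\<bar>) + (?d w)\<^sup>2 / e"
          using e by (simp add: power2_diff power_mult_distrib add_divide_distrib diff_divide_distrib power2_eq_square[of e])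
        finally have "2 * \<bar>Y w * ?d w\<bar> \<le> e * (Y w)\<^sup>2 + (?d w)\<^sup>2 / e" by (simp add: abs_mult)
        moreover have "(X i w)\<^sup>2 - (Y w)\<^sup>2 = 2 * (Y w * ?d w) + (?d w)\<^sup>2"
          by (simp add: power2_eq_square algebra_simps)
        ultimately have "\<bar>(X i w)\<^sup>2 - (Y w)\<^sup>2\<bar> \<le> e * (Y w)\<^sup>2 + (?d w)\<^sup>2 / e + (?d w)\<^sup>2"
          using zero_le_power2[of "?d w"] by linarith
        then show "\<bar>(X i w)\<^sup>2 - (Y w)\<^sup>2\<bar> \<le> e * (Y w)\<^sup>2 + (1 + 1 / e) * (?d w)\<^sup>2" by (simp add: distrib_right)
      qed (use i2 d2 Y in auto)
      also have "\<dots> = e * ?a + (1 + 1 / e) * (LINT w|M. (?d w)\<^sup>2)" using d2 Y by simp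
      also have "\<dots> < r" using e elim by linarith
      finally show ?case by (simp add: dist_real_def)
    qed
  qed
qed

end

locale limit_branching = ergodic_branching B V \<kappa> \<gamma> h lam \<rho>
  for B :: "('x, 'u::countable, 'w) branching_model" and V \<kappa> \<gamma> h lam \<rho> +
  fixes W :: "'w \<Rightarrow> real"
  assumes martingale_limit: "martingale_limit B h lam W"
begin

definition mart :: "real \<Rightarrow> 'w \<Rightarrow> real" where
  "mart t w = exp (- lam * t) * Zf t h w"

lemma W_measurable [measurable]: "W \<in> borel_measurable M"
  using martingale_limit by (simp add: martingale_limit_def)

lemma W_measurable_law: "x \<in> space E \<Longrightarrow> W \<in> borel_measurable (P x)"
  using W_measurable measurable_law by blast

lemma mart_measurable_law:
  assumes "x \<in> space E" "0 \<le> t"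
  shows "mart t \<in> borel_measurable (P x)"
proof -
  have [measurable]: "Zf t h \<in> borel_measurable (P x)" by (rule Zint_measurable_law[OF assms h_measurable])
  show ?thesis unfolding mart_def[abs_def] by measurable
qed

lemma mart_nonneg: "0 \<le> mart t w"
  unfolding mart_def Zint_def using h_nonneg by (intro mult_nonneg_nonneg integral_nonneg_AE AE_I2) auto

lemma mart_power_integrable:
  assumes "x \<in> space E" "0 \<le> t" "k \<le> 4"
  shows "integrable (P x) (\<lambda>w. mart t w ^ k)"
proof -
  obtain ch where h1: "weighted 1 ch h" using h_weighted by auto
  show ?thesis
    unfolding mart_def power_mult_distrib
    using Zint_power_integrable(1)[OF h1 order_refl assms(2,1), of k] assms(3) by simp
qed

text \<open>Convergence in the fourth mean makes the distance finite at some time \<open>t0\<close>;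
  together with the fourth moment of the martingale at \<open>t0\<close> this yields integrability
  of \<open>W ^ 4\<close>, and then of the distance at every time.\<close>

lemma W_fourth:
  assumes x: "x \<in> space E"
  shows "integrable (P x) (\<lambda>w. W w ^ 4)"
    and "0 \<le> t \<Longrightarrow> integrable (P x) (\<lambda>w. (mart t w - W w) ^ 4)"
    and "((\<lambda>t. LINT w|P x. (mart t w - W w) ^ 4) \<longlongrightarrow> 0) at_top"
proof -
  note [measurable] = W_measurable_law[OF x] mart_measurable_law[OF x]
  have lim: "((\<lambda>t. \<integral>\<^sup>+w. ennreal ((mart t w - W w) ^ 4) \<partial>P x) \<longlongrightarrow> 0) at_top"
    using martingale_limit x by (simp add: martingale_limit_def mart_def power_even_abs)
  then have "eventually (\<lambda>t. (\<integral>\<^sup>+w. ennreal ((mart t w - W w) ^ 4) \<partial>P x) < 1) at_top"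
    by (rule order_tendstoD(2)) simp
  then have "eventually (\<lambda>t. (\<integral>\<^sup>+w. ennreal ((mart t w - W w) ^ 4) \<partial>P x) < 1 \<and> 0 \<le> t) at_top"
    by (intro eventually_conj eventually_ge_at_top)
  then obtain t0 where lt: "(\<integral>\<^sup>+w. ennreal ((mart t0 w - W w) ^ 4) \<partial>P x) < 1" and t0: "0 \<le> t0"
    using eventually_happens'[OF trivial_limit_at_top_linorder] by blast
  have "(\<integral>\<^sup>+w. ennreal ((mart t0 w - W w) ^ 4) \<partial>P x) < \<infinity>" by (rule less_trans[OF lt]) (metis ennreal_1 ennreal_less_top infinity_ennreal_def)
  then have i0: "integrable (P x) (\<lambda>w. (mart t0 w - W w) ^ 4)"
    using t0 by (intro integrableI_nonneg) auto
  have add: "integrable (P x) (\<lambda>w. (X w + Y w) ^ 4)"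
    if "integrable (P x) (\<lambda>w. X w ^ 4)" "integrable (P x) (\<lambda>w. Y w ^ 4)" and [measurable]: "X \<in> borel_measurable (P x)" "Y \<in> borel_measurable (P x)"
    for X Y :: "'w \<Rightarrow> real"
  proof (rule Bochner_Integration.integrable_bound)
    show "integrable (P x) (\<lambda>w. 8 * (X w ^ 4 + Y w ^ 4))" using that(1,2) by simp
    have "(X w + Y w) ^ 4 \<le> \<bar>8 * (X w ^ 4 + Y w ^ 4)\<bar>" for w
      using power4_sum_le[of "X w" "Y w"] by linarith
    then show "AE w in P x. norm ((X w + Y w) ^ 4) \<le> norm (8 * (X w ^ 4 + Y w ^ 4))"
      by (simp add: power_even_abs power_abs)
  qed measurable
  have "integrable (P x) (\<lambda>w. (W w - mart t0 w) ^ 4)"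
    using i0 by (simp only: power4_eq_xxxx) (simp add: algebra_simps)
  from add[OF this mart_power_integrable[OF x t0, of 4]] t0
  show i: "integrable (P x) (\<lambda>w. W w ^ 4)" by simp
  show D: "integrable (P x) (\<lambda>w. (mart t w - W w) ^ 4)" if "0 \<le> t" for t
    using add[OF mart_power_integrable[OF x that, of 4], of "\<lambda>w. - W w"] i that by simp
  have "eventually (\<lambda>t. (\<integral>\<^sup>+w. ennreal ((mart t w - W w) ^ 4) \<partial>P x) = ennreal (LINT w|P x. (mart t w - W w) ^ 4)) at_top"
    using eventually_ge_at_top[of 0] by eventually_elim (use D in \<open>simp add: nn_integral_eq_integral\<close>)
  from Lim_transform_eventually[OF lim this]
  have "((\<lambda>t. ennreal (LINT w|P x. (mart t w - W w) ^ 4)) \<longlongrightarrow> ennreal 0) at_top" by simp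
  then show "((\<lambda>t. LINT w|P x. (mart t w - W w) ^ 4) \<longlongrightarrow> 0) at_top"
    by (rule tendsto_ennrealD) auto
qed

lemma W_square:
  assumes x: "x \<in> space E"
  shows "integrable (P x) (\<lambda>w. (W w)\<^sup>2)"
    and "0 \<le> t \<Longrightarrow> integrable (P x) (\<lambda>w. (mart t w - W w)\<^sup>2)"
    and "((\<lambda>t. LINT w|P x. (mart t w - W w)\<^sup>2) \<longlongrightarrow> 0) at_top"
proof -
  interpret prob_space "P x" by (rule prob_space_law[OF x])
  note [measurable] = W_measurable_law[OF x] mart_measurable_law[OF x]
  show "integrable (P x) (\<lambda>w. (W w)\<^sup>2)" by (rule integrable_power_le[OF W_fourth(1)[OF x]]) auto
  show D: "integrable (P x) (\<lambda>w. (mart t w - W w)\<^sup>2)" if "0 \<le> t" for t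
    using that by (intro integrable_power_le[OF W_fourth(2)[OF x that]]) auto
  have "((\<lambda>t. sqrt (LINT w|P x. (mart t w - W w) ^ 4)) \<longlongrightarrow> sqrt 0) at_top"
    by (intro tendsto_real_sqrt W_fourth(3)[OF x])
  then have sq: "((\<lambda>t. sqrt (LINT w|P x. (mart t w - W w) ^ 4)) \<longlongrightarrow> 0) at_top" by simp
  show "((\<lambda>t. LINT w|P x. (mart t w - W w)\<^sup>2) \<longlongrightarrow> 0) at_top"
  proof (rule tendsto_sandwich[OF _ _ tendsto_const sq])
    show "eventually (\<lambda>t. (LINT w|P x. (mart t w - W w)\<^sup>2) \<le> sqrt (LINT w|P x. (mart t w - W w) ^ 4)) at_top"
      using eventually_ge_at_top[of 0]
    proof eventually_elim
      case (elim t)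
      show ?case
        using abs_expectation_le_sqrt(2)[of "\<lambda>w. (mart t w - W w)\<^sup>2"] W_fourth(2)[OF x elim] elim
        by (simp flip: power_mult)
    qed
  qed simp
qed

text \<open>The increment bound does not depend on the later time \<open>T\<close>, which may tend
  to infinity. Splitting the square at time \<open>T\<close> costs the factor 2.\<close>

lemma martingale_limit_rate:
  "\<exists>N\<ge>0. \<forall>x\<in>space E. \<forall>t\<ge>0. (LINT w|P x. (mart t w - W w)\<^sup>2) \<le> N * exp (- lam * t) * V x ^ 2"
proof -
  obtain N where N: "0 \<le> N" "\<And>x s t. x \<in> space E \<Longrightarrow> 0 \<le> s \<and> s \<le> t \<Longrightarrow>
    (LINT w|P x. (exp (- lam * s) * Zf s h w - exp (- lam * t) * Zf t h w)\<^sup>2) \<le> N * exp (- lam * s) * V x ^ 2"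
    using martingale_increment by blast
  have "(LINT w|P x. (mart t w - W w)\<^sup>2) \<le> (2 * N) * exp (- lam * t) * V x ^ 2" if x: "x \<in> space E" and t: "0 \<le> t" for x t
  proof (rule tendsto_lowerbound)
    let ?b = "N * exp (- lam * t) * V x ^ 2"
    have "((\<lambda>T. 2 * ?b + 2 * (LINT w|P x. (mart T w - W w)\<^sup>2)) \<longlongrightarrow> 2 * ?b + 2 * 0) at_top"
      by (intro tendsto_intros W_square(3)[OF x])
    then show "((\<lambda>T. 2 * ?b + 2 * (LINT w|P x. (mart T w - W w)\<^sup>2)) \<longlongrightarrow> 2 * N * exp (- lam * t) * V x ^ 2) at_top"
      by (simp only: mult.assoc mult_zero_right add_0_right)
    show "eventually (\<lambda>T. (LINT w|P x. (mart t w - W w)\<^sup>2) \<le> 2 * ?b + 2 * (LINT w|P x. (mart T w - W w)\<^sup>2)) at_top"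
      using eventually_ge_at_top[of t]
    proof eventually_elim
      case (elim T)
      have T: "0 \<le> T" using elim t by simp
      have eq: "mart t w - mart T w = (mart t w - W w) + - (mart T w - W w)" for w by simp
      note [measurable] = W_measurable_law[OF x] mart_measurable_law[OF x t] mart_measurable_law[OF x T]
      have i: "integrable (P x) (\<lambda>w. (mart t w - mart T w)\<^sup>2)"
      proof (rule Bochner_Integration.integrable_bound)
        show "integrable (P x) (\<lambda>w. 2 * ((mart t w - W w)\<^sup>2 + (mart T w - W w)\<^sup>2))"
          using W_square(2)[OF x t] W_square(2)[OF x T] by simp
        have "(mart t w - mart T w)\<^sup>2 \<le> 2 * ((mart t w - W w)\<^sup>2 + (mart T w - W w)\<^sup>2)" for w
          using power2_sum_le[of "mart t w - W w" "- (mart T w - W w)"] unfolding eq power2_minus .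
        then show "AE w in P x. norm ((mart t w - mart T w)\<^sup>2) \<le> norm (2 * ((mart t w - W w)\<^sup>2 + (mart T w - W w)\<^sup>2))"
          by (intro AE_I2) simp
      qed measurable
      have "(LINT w|P x. (mart t w - W w)\<^sup>2) \<le> (LINT w|P x. 2 * ((mart t w - mart T w)\<^sup>2 + (mart T w - W w)\<^sup>2))"
      proof (rule integral_mono)
        fix w
        show "(mart t w - W w)\<^sup>2 \<le> 2 * ((mart t w - mart T w)\<^sup>2 + (mart T w - W w)\<^sup>2)"
          using power2_sum_le[of "mart t w - mart T w" "mart T w - W w"] by simp
      qed (use i W_square(2)[OF x t] W_square(2)[OF x T] in auto)
      also have "\<dots> = 2 * (LINT w|P x. (mart t w - mart T w)\<^sup>2) + 2 * (LINT w|P x. (mart T w - W w)\<^sup>2)"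
        using i W_square(2)[OF x T] by simp
      also have "\<dots> \<le> 2 * ?b + 2 * (LINT w|P x. (mart T w - W w)\<^sup>2)"
        using N(2)[OF x, of t T] t elim by (simp add: mart_def)
      finally show ?case .
    qed
  qed simp
  moreover have "0 \<le> 2 * N" using N(1) by simp
  ultimately show ?thesis by blast
qed

text \<open>The martingale is non-negative, so the negative part of \<open>W\<close> is at most the
  distance to it. Convergence in mean square thus replaces an almost sure argument.\<close>

lemma W_nonneg:
  assumes x: "x \<in> space E"
  shows "AE w in P x. 0 \<le> W w"
proof -
  note [measurable] = W_measurable_law[OF x] mart_measurable_law[OF x]
  have i: "integrable (P x) (\<lambda>w. (min 0 (W w))\<^sup>2)"
    by (rule Bochner_Integration.integrable_bound[OF W_square(1)[OF x]])
      (auto intro!: AE_I2 simp: min_def)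
  have "(LINT w|P x. (min 0 (W w))\<^sup>2) \<le> 0"
  proof (rule tendsto_lowerbound[OF W_square(3)[OF x]])
    show "eventually (\<lambda>t. (LINT w|P x. (min 0 (W w))\<^sup>2) \<le> (LINT w|P x. (mart t w - W w)\<^sup>2)) at_top"
      using eventually_ge_at_top[of 0]
    proof eventually_elim
      case (elim t)
      show ?case
      proof (rule integral_mono[OF i W_square(2)[OF x elim]])
        fix w
        have "\<bar>min 0 (W w)\<bar> \<le> \<bar>mart t w - W w\<bar>" using mart_nonneg[of t w] by (simp add: min_def)
        then show "(min 0 (W w))\<^sup>2 \<le> (mart t w - W w)\<^sup>2" by (rule abs_le_square_iff[THEN iffD1])
      qed
    qed
  qed simp
  then have "(LINT w|P x. (min 0 (W w))\<^sup>2) = 0" by (intro antisym) simp_all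
  then have "AE w in P x. (min 0 (W w))\<^sup>2 = 0"
    using integral_nonneg_eq_0_iff_AE[OF i] by simp
  then show ?thesis by eventually_elim (simp add: min_def split: if_splits)
qed

section \<open>Fluctuations around the limit and their variance\<close>

context
  fixes f c assumes f: "weighted 1 c f"
begin

abbreviation (input) "fluct \<equiv> fluctuation B \<gamma> lam W f"

lemma approx_minus_fluct:
  "approx f s T w - fluct s w = (LINT z|\<gamma>. f z) * exp (lam * s / 2) * - (mart T w - W w)"
proof -
  have e: "exp (lam * s / 2 - lam * T) = exp (lam * s / 2) * exp (- lam * T)"
    "exp (- lam * s / 2) * exp (lam * s) = exp (lam * s / 2)"
    unfolding mult_exp_exp by simp_all
  have r: "root_scale s = exp (- lam * s / 2)" by (simp add: root_scale_def)
  have "fluct s w = root_scale s * Zf s f w - (exp (- lam * s / 2) * exp (lam * s)) * (LINT z|\<gamma>. f z) * W w"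
    unfolding fluctuation_def r by (simp only: right_diff_distrib mult.assoc)
  then show ?thesis
    unfolding e approx_def end_scale_def mart_def by (simp add: algebra_simps)
qed

lemma fluct_measurable:
  assumes "0 \<le> s"
  shows "fluct s \<in> borel_measurable M" and "x \<in> space E \<Longrightarrow> fluct s \<in> borel_measurable (P x)"
proof -
  show "fluct s \<in> borel_measurable M"
    unfolding fluctuation_def[abs_def] using Zint_measurable[OF assms weighted_measurable[OF f]] by simp
  then show "x \<in> space E \<Longrightarrow> fluct s \<in> borel_measurable (P x)" using measurable_law by blast
qed

lemma fluct_square_integrable:
  assumes s: "0 \<le> s" and x: "x \<in> space E"
  shows "integrable (P x) (\<lambda>w. (fluct s w)\<^sup>2)"
proof (rule Bochner_Integration.integrable_bound)
  let ?a = "(LINT z|\<gamma>. f z) * exp (lam * s / 2)"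
  show "integrable (P x) (\<lambda>w. 2 * ((approx f s s w)\<^sup>2 + (?a * (mart s w - W w))\<^sup>2))"
    using approx_integrable[OF f s order_refl x, of 2 1] W_square(2)[OF x s] unfolding power_mult_distrib by simp
  have "(fluct s w)\<^sup>2 \<le> 2 * ((approx f s s w)\<^sup>2 + (?a * (mart s w - W w))\<^sup>2)" for w
  proof -
    have "fluct s w = approx f s s w + ?a * (mart s w - W w)"
      using approx_minus_fluct[of s s w] by (simp add: algebra_simps)
    then show ?thesis by (simp only: power2_sum_le)
  qed
  then show "AE w in P x. norm ((fluct s w)\<^sup>2) \<le> norm (2 * ((approx f s s w)\<^sup>2 + (?a * (mart s w - W w))\<^sup>2))"
    by (intro AE_I2) simp
qed (use fluct_measurable[OF s] x in simp)

lemma approx_tendsto_fluct: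
  assumes s: "0 \<le> s" and x: "x \<in> space E"
  shows "((\<lambda>T. LINT w|P x. approx f s T w) \<longlongrightarrow> (LINT w|P x. fluct s w)) at_top"
    and "((\<lambda>T. LINT w|P x. (approx f s T w)\<^sup>2) \<longlongrightarrow> (LINT w|P x. (fluct s w)\<^sup>2)) at_top"
    and "((\<lambda>T. LINT w|P x. \<bar>approx f s T w - fluct s w\<bar>) \<longlongrightarrow> 0) at_top"
proof -
  interpret prob_space "P x" by (rule prob_space_law[OF x])
  have X: "eventually (\<lambda>T. approx f s T \<in> borel_measurable (P x) \<and> integrable (P x) (\<lambda>w. (approx f s T w)\<^sup>2)) at_top"
    using eventually_ge_at_top[of s]
  proof eventually_elim
    case (elim T)
    then show ?case
      using approx_integrable[OF f s elim x, of 2 1] approx_measurable[OF x s _ weighted_measurable[OF f], of T] s by simp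
  qed
  have "((\<lambda>T. ((LINT z|\<gamma>. f z) * exp (lam * s / 2))\<^sup>2 * (LINT w|P x. (mart T w - W w)\<^sup>2)) \<longlongrightarrow> ((LINT z|\<gamma>. f z) * exp (lam * s / 2))\<^sup>2 * 0) at_top"
    by (intro tendsto_intros W_square(3)[OF x])
  then have lim: "((\<lambda>T. LINT w|P x. (approx f s T w - fluct s w)\<^sup>2) \<longlongrightarrow> 0) at_top"
    unfolding approx_minus_fluct power_mult_distrib[of _ "- (mart _ _ - W _)"] power2_minus by simp
  note t = expectation_tendsto[OF fluct_measurable(2)[OF s x] fluct_square_integrable[OF s x] X lim]
  show "((\<lambda>T. LINT w|P x. approx f s T w) \<longlongrightarrow> (LINT w|P x. fluct s w)) at_top"
    "((\<lambda>T. LINT w|P x. (approx f s T w)\<^sup>2) \<longlongrightarrow> (LINT w|P x. (fluct s w)\<^sup>2)) at_top"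
    "((\<lambda>T. LINT w|P x. \<bar>approx f s T w - fluct s w\<bar>) \<longlongrightarrow> 0) at_top" by (fact t)+
qed

text \<open>The variance of the fluctuation, whose expectation is again
  \<open>approx_mean f s x\<close>.\<close>

definition fluct_var :: "real \<Rightarrow> 'x \<Rightarrow> real" where
  "fluct_var s x = (LINT w|P x. (fluct s w)\<^sup>2) - (approx_mean f s x)\<^sup>2"

lemma fluct_expectation:
  assumes s: "0 \<le> s" and x: "x \<in> space E"
  shows "(LINT w|P x. fluct s w) = approx_mean f s x"
proof (rule tendsto_unique[OF _ approx_tendsto_fluct(1)[OF s x]])
  have "eventually (\<lambda>T. approx_mean f s x = (LINT w|P x. approx f s T w)) at_top"
    using eventually_ge_at_top[of s] by eventually_elim (simp add: approx_expectation(1)[OF f s _ x])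
  then show "((\<lambda>T. LINT w|P x. approx f s T w) \<longlongrightarrow> approx_mean f s x) at_top"
    by (rule Lim_transform_eventually[OF tendsto_const])
qed simp

lemma approx_var_tendsto:
  assumes s: "0 \<le> s" and x: "x \<in> space E"
  shows "((\<lambda>T. approx_var f s T x) \<longlongrightarrow> fluct_var s x) at_top"
proof -
  have "((\<lambda>T. (LINT w|P x. (approx f s T w)\<^sup>2) - (approx_mean f s x)\<^sup>2) \<longlongrightarrow> fluct_var s x) at_top"
    unfolding fluct_var_def by (intro tendsto_diff approx_tendsto_fluct(2)[OF s x] tendsto_const)
  moreover have "eventually (\<lambda>T. (LINT w|P x. (approx f s T w)\<^sup>2) - (approx_mean f s x)\<^sup>2 = approx_var f s T x) at_top"
    using eventually_ge_at_top[of s] by eventually_elim (simp add: approx_expectation(2)[OF f s _ x])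
  ultimately show ?thesis by (rule Lim_transform_eventually)
qed

lemma fluct_var_measurable:
  assumes s: "0 \<le> s"
  shows "fluct_var s \<in> borel_measurable E"
proof -
  have "approx_mean f s \<in> borel_measurable E" using approx_mean_bound[OF f] s weighted_measurable by blast
  moreover have "(\<lambda>x. LINT w|P x. (fluct s w)\<^sup>2) \<in> borel_measurable E"
    using fluct_measurable(1)[OF s]
    by (intro measurable_compose[OF law_subprob_measurable integral_measurable_subprob_algebra]) simp
  ultimately show ?thesis unfolding fluct_var_def[abs_def] by simp
qed

lemma fluct_var_nonneg: "0 \<le> s \<Longrightarrow> x \<in> space E \<Longrightarrow> 0 \<le> fluct_var s x"
  by (rule tendsto_lowerbound[OF approx_var_tendsto]) (simp_all add: approx_var_nonneg)

text \<open>The variances with finite \<open>T\<close> are dominated by a multiple of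
  \<open>V^2\<close> uniformly in \<open>T\<close>, and \<open>V^2\<close> is integrable against
  \<open>\<gamma>\<close>.\<close>

lemma fluct_var_integral:
  assumes s: "0 \<le> s"
  shows "integrable \<gamma> (fluct_var s)" and "((\<lambda>T. LINT y|\<gamma>. approx_var f s T y) \<longlongrightarrow> (LINT y|\<gamma>. fluct_var s y)) at_top"
proof -
  obtain D where D: "\<And>s T. 0 \<le> s \<and> s \<le> T \<Longrightarrow> weighted 2 D (approx_var f s T)" using approx_var_weighted[OF f] by blast
  have "0 \<le> D" using D[of 0 0] by (simp add: weighted_def)
  have two: "(1 :: nat) \<le> 2" "(2 :: nat) \<le> 4" by auto
  have iV: "integrable \<gamma> (\<lambda>y. D * V y ^ 2)" using integrable_gamma[OF weighted_V two] by simp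
  have m: "fluct_var s \<in> borel_measurable \<gamma>"
    unfolding measurable_cong_sets[OF sets_gamma refl] by (rule fluct_var_measurable[OF s])
  have le: "fluct_var s y \<le> D * V y ^ 2" if y: "y \<in> space E" for y
  proof (rule tendsto_upperbound[OF approx_var_tendsto[OF s y]])
    show "eventually (\<lambda>T. approx_var f s T y \<le> D * V y ^ 2) at_top"
      using eventually_ge_at_top[of s]
    proof eventually_elim
      case (elim T)
      then have "\<bar>approx_var f s T y\<bar> \<le> D * V y ^ 2" using D[of s T] s y by (simp add: weighted_def)
      then show ?case by simp
    qed
  qed simp
  show "integrable \<gamma> (fluct_var s)"
    by (rule Bochner_Integration.integrable_bound[OF iV m])
      (use le fluct_var_nonneg[OF s] in \<open>auto intro!: AE_I2 simp: space_gamma intro: order_trans[OF _ abs_ge_self]\<close>)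
  show "((\<lambda>T. LINT y|\<gamma>. approx_var f s T y) \<longlongrightarrow> (LINT y|\<gamma>. fluct_var s y)) at_top"
  proof (rule tendsto_at_topI_sequentially)
    fix X :: "nat \<Rightarrow> real" assume X: "filterlim X at_top sequentially"
    then have "eventually (\<lambda>n. s \<le> X n) sequentially" by (simp add: filterlim_at_top)
    \<comment> \<open>The bounds hold for end times beyond \<open>s\<close>, so the sequence is
      considered from \<open>n0\<close> on.\<close>
    then obtain n0 where n0: "\<And>n. n0 \<le> n \<Longrightarrow> s \<le> X n" by (auto simp: eventually_sequentially)
    show "(\<lambda>n. LINT y|\<gamma>. approx_var f s (X n) y) \<longlonglongrightarrow> (LINT y|\<gamma>. fluct_var s y)"
    proof (rule LIMSEQ_offset[of _ n0], rule integral_dominated_convergence[OF m _ iV])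
      fix n
      have sX: "0 \<le> s \<and> s \<le> X (n + n0)" using n0 s by simp
      show "approx_var f s (X (n + n0)) \<in> borel_measurable \<gamma>"
        unfolding measurable_cong_sets[OF sets_gamma refl] using D[OF sX] by (rule weighted_measurable)
      show "AE y in \<gamma>. norm (approx_var f s (X (n + n0)) y) \<le> D * V y ^ 2"
        using D[OF sX] by (intro AE_I2) (simp add: weighted_def space_gamma)
    next
      show "AE y in \<gamma>. (\<lambda>n. approx_var f s (X (n + n0)) y) \<longlonglongrightarrow> fluct_var s y"
        by (intro AE_I2 LIMSEQ_ignore_initial_segment filterlim_compose[OF approx_var_tendsto[OF s] X]) (simp add: space_gamma)
    qed
  qed
qed

text \<open>With \<open>T\<close> sent to infinity, the shift inequalities say that \<open>q\<close>
  is increasing and that from time \<open>s\<close> on it gains at most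
  \<open>C * exp (- (2 * \<rho> - lam) * s)\<close>. The second fact gives boundedness, by taking
  \<open>s = 0\<close>, as well as the rate of approach.\<close>

lemma ex_asymptotic_variance:
  "\<exists>v\<ge>0. \<exists>C\<ge>0. \<forall>s\<ge>0. (LINT y|\<gamma>. fluct_var s y) \<le> v \<and> v \<le> (LINT y|\<gamma>. fluct_var s y) + C * exp (- (2 * \<rho> - lam) * s)"
proof -
  obtain C where C: "0 \<le> C" "\<And>t s T. 0 \<le> t \<and> 0 \<le> s \<and> s \<le> T \<Longrightarrow>
    (LINT y|\<gamma>. approx_var f s T y) \<le> (LINT y|\<gamma>. approx_var f (t + s) (t + T) y) \<and>
    (LINT y|\<gamma>. approx_var f (t + s) (t + T) y) \<le> (LINT y|\<gamma>. approx_var f s T y) + C * exp (- (2 * \<rho> - lam) * s)"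
    using approx_var_gamma_step[OF f] by blast
  define q where "q s = (LINT y|\<gamma>. fluct_var s y)" for s
  have lim: "((\<lambda>T. LINT y|\<gamma>. approx_var f s T y) \<longlongrightarrow> q s) at_top" if "0 \<le> s" for s
    unfolding q_def by (rule fluct_var_integral(2)[OF that])
  have step: "q s \<le> q (t + s) \<and> q (t + s) \<le> q s + C * exp (- (2 * \<rho> - lam) * s)" if t: "0 \<le> t" and s: "0 \<le> s" for s t
  proof -
    have "filterlim (\<lambda>T. t + T) at_top at_top" by (rule filterlim_tendsto_add_at_top[OF tendsto_const filterlim_ident])
    from filterlim_compose[OF lim[of "t + s"] this]
    have l: "((\<lambda>T. LINT y|\<gamma>. approx_var f (t + s) (t + T) y) \<longlongrightarrow> q (t + s)) at_top" using s t by simp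
    have ev: "eventually (\<lambda>T. 0 \<le> t \<and> 0 \<le> s \<and> s \<le> T) at_top"
      using eventually_ge_at_top[of s] by eventually_elim (use s t in simp)
    have "q s \<le> q (t + s)"
      by (rule tendsto_le[OF _ l lim[OF s]]) (use C(2) ev in \<open>auto elim!: eventually_mono\<close>)
    moreover have "q (t + s) \<le> q s + C * exp (- (2 * \<rho> - lam) * s)"
      by (rule tendsto_le[OF _ tendsto_add[OF lim[OF s] tendsto_const] l]) (use C(2) ev in \<open>auto elim!: eventually_mono\<close>)
    ultimately show ?thesis by simp
  qed
  have bdd: "bdd_above (q ` {0..})"
    using step[of _ 0] by (auto intro!: bdd_aboveI[of _ "q 0 + C"])
  \<comment> \<open>As \<open>q\<close> is monotone, the supremum is its limit.\<close>
  define v where "v = (SUP s\<in>{0..}. q s)"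
  have le: "q s \<le> v" if "0 \<le> s" for s using cSUP_upper[OF _ bdd, of s] that by (simp add: v_def)
  have "v \<le> q s + C * exp (- (2 * \<rho> - lam) * s)" if s: "0 \<le> s" for s
    unfolding v_def
  proof (rule cSUP_least)
    fix r :: real assume r: "r \<in> {0..}"
    have "q r \<le> q (r + s)" using step[of s r] r s by (simp add: add.commute)
    also have "\<dots> \<le> q s + C * exp (- (2 * \<rho> - lam) * s)" using step[of r s] r s by simp
    finally show "q r \<le> q s + C * exp (- (2 * \<rho> - lam) * s)" .
  qed simp
  moreover have "0 \<le> v"
  proof (rule order_trans[OF _ le[of 0]])
    show "0 \<le> q 0" unfolding q_def
      using fluct_var_nonneg[of 0] by (intro integral_nonneg_AE AE_I2) (simp add: space_gamma)
  qed simp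
  ultimately show ?thesis using C(1) le unfolding q_def by blast
qed

text \<open>A non-negative variance function with \<open>\<gamma>\<close>-average 0 vanishes almost
  everywhere. Where it does, the fluctuation equals its expectation
  \<open>approx_mean f s x\<close>, which is the constant asked for.\<close>

lemma degenerate:
  assumes "\<And>s. 0 \<le> s \<Longrightarrow> (LINT y|\<gamma>. fluct_var s y) \<le> 0"
  shows "degenerate_fluctuation B \<gamma> lam W f"
  unfolding degenerate_fluctuation_def
proof (intro allI impI)
  fix s :: real assume s: "0 \<le> s"
  have nn: "AE y in \<gamma>. 0 \<le> fluct_var s y" using fluct_var_nonneg[OF s] by (intro AE_I2) (simp add: space_gamma)
  have "(LINT y|\<gamma>. fluct_var s y) = 0"
    using assms[OF s] integral_nonneg_AE[OF nn] by simp
  then have "AE y in \<gamma>. fluct_var s y = 0"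
    using integral_nonneg_eq_0_iff_AE[OF fluct_var_integral(1)[OF s] nn] by simp
  then show "AE x in \<gamma>. \<exists>c. AE w in P x. fluct s w = c"
    using AE_space
  proof eventually_elim
    case (elim x)
    then have x: "x \<in> space E" by (simp add: space_gamma)
    interpret prob_space "P x" by (rule prob_space_law[OF x])
    note [measurable] = fluct_measurable(2)[OF s x]
    note i2 = fluct_square_integrable[OF s x]
    have i1: "integrable (P x) (fluct s)" by (rule abs_expectation_le_sqrt(1)[OF _ i2]) simp
    have iv: "integrable (P x) (\<lambda>w. (fluct s w - approx_mean f s x)\<^sup>2)"
      using i1 i2 by (simp add: power2_diff)
    have "(LINT w|P x. (fluct s w - approx_mean f s x)\<^sup>2) = 0"
      using variance_eq[OF i1 i2] elim by (simp add: fluct_expectation[OF s x] fluct_var_def)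
    then have "AE w in P x. (fluct s w - approx_mean f s x)\<^sup>2 = 0"
      using integral_nonneg_eq_0_iff_AE[OF iv] by simp
    then have "AE w in P x. fluct s w = approx_mean f s x" by eventually_elim simp
    then show ?case by blast
  qed
qed

end

end

section \<open>Gaussian approximation\<close>

text \<open>Division by \<open>max 1 |u| ^ 3\<close> dominates the factors \<open>u^j\<close> of all
  derivatives up to order three, so the real and imaginary parts of a character become admissible
  test functions.\<close>

lemma smooth_tests_trig:
  fixes u :: real
  defines "K \<equiv> max 1 (\<bar>u\<bar>) ^ 3"
  shows "(\<lambda>x. cos (u * x) / K) \<in> smooth_tests" and "(\<lambda>x. sin (u * x) / K) \<in> smooth_tests"
proof -
  have K: "0 < K" by (simp add: K_def)
  have u: "\<bar>u\<bar> ^ j \<le> K" if "j \<le> 3" for j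
  proof -
    have "\<bar>u\<bar> ^ j \<le> max 1 \<bar>u\<bar> ^ j" by (intro power_mono) auto
    also have "\<dots> \<le> K" unfolding K_def using that by (intro power_increasing) auto
    finally show ?thesis .
  qed
  have b: "\<bar>u ^ j * z / K\<bar> \<le> 1" if "j \<le> 3" "\<bar>z\<bar> \<le> 1" for j z
  proof -
    have "\<bar>u\<bar> ^ j * \<bar>z\<bar> \<le> K * 1" using u[OF that(1)] that(2) K by (intro mult_mono) auto
    then show ?thesis using K by (simp add: abs_mult power_abs)
  qed
  show "(\<lambda>x. cos (u * x) / K) \<in> smooth_tests"
    unfolding smooth_tests_def mem_Collect_eq
  proof (intro exI allI conjI)
    fix y
    show "((\<lambda>x. cos (u * x) / K) has_real_derivative (u ^ 1 * (- sin (u * y)) / K)) (at y)"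
      using K by (auto intro!: derivative_eq_intros)
    show "((\<lambda>y. u ^ 1 * (- sin (u * y)) / K) has_real_derivative (u ^ 2 * (- cos (u * y)) / K)) (at y)"
      using K by (auto intro!: derivative_eq_intros simp: power2_eq_square)
    show "((\<lambda>y. u ^ 2 * (- cos (u * y)) / K) has_real_derivative (u ^ 3 * sin (u * y) / K)) (at y)"
      using K by (auto intro!: derivative_eq_intros simp: power2_eq_square power3_eq_cube)
    show "\<bar>cos (u * y) / K\<bar> \<le> 1" using b[of 0 "cos (u * y)"] by simp
    show "\<bar>u ^ 1 * (- sin (u * y)) / K\<bar> \<le> 1" by (rule b) auto
    show "\<bar>u ^ 2 * (- cos (u * y)) / K\<bar> \<le> 1" by (rule b) auto
    show "\<bar>u ^ 3 * sin (u * y) / K\<bar> \<le> 1" by (rule b) auto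
  qed
  show "(\<lambda>x. sin (u * x) / K) \<in> smooth_tests"
    unfolding smooth_tests_def mem_Collect_eq
  proof (intro exI allI conjI)
    fix y
    show "((\<lambda>x. sin (u * x) / K) has_real_derivative (u ^ 1 * cos (u * y) / K)) (at y)"
      using K by (auto intro!: derivative_eq_intros)
    show "((\<lambda>y. u ^ 1 * cos (u * y) / K) has_real_derivative (u ^ 2 * (- sin (u * y)) / K)) (at y)"
      using K by (auto intro!: derivative_eq_intros simp: power2_eq_square)
    show "((\<lambda>y. u ^ 2 * (- sin (u * y)) / K) has_real_derivative (u ^ 3 * (- cos (u * y)) / K)) (at y)"
      using K by (auto intro!: derivative_eq_intros simp: power2_eq_square power3_eq_cube)
    show "\<bar>sin (u * y) / K\<bar> \<le> 1" using b[of 0 "sin (u * y)"] by simp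
    show "\<bar>u ^ 1 * cos (u * y) / K\<bar> \<le> 1" by (rule b) auto
    show "\<bar>u ^ 2 * (- sin (u * y)) / K\<bar> \<le> 1" by (rule b) auto
    show "\<bar>u ^ 3 * (- cos (u * y)) / K\<bar> \<le> 1" by (rule b) auto
  qed
qed

text \<open>The scaled cosine and sine are test functions, so characteristic functions converge and
  Levy's continuity theorem applies.\<close>

lemma weak_conv_m_smooth_tests:
  assumes M: "\<And>n. real_distribution (M n)" and N: "real_distribution N"
    and lim: "\<And>F. F \<in> smooth_tests \<Longrightarrow> (\<lambda>n. LINT x|M n. F x) \<longlonglongrightarrow> (LINT x|N. F x)"
  shows "weak_conv_m M N"
proof (rule levy_continuity[OF M N])
  fix u :: real
  define K where "K = max 1 \<bar>u\<bar> ^ 3"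
  have K: "0 < K" by (simp add: K_def)
  have i: "integrable L (\<lambda>x. iexp (u * x))" if "real_distribution L" for L
  proof -
    interpret real_distribution L by fact
    show ?thesis by (rule integrable_iexp) auto
  qed
  have Re: "Re (char L u) = K * (LINT x|L. cos (u * x) / K)" and Im: "Im (char L u) = K * (LINT x|L. sin (u * x) / K)"
    if "real_distribution L" for L
    using integral_Re[OF i[OF that]] integral_Im[OF i[OF that]] K by (simp_all add: char_def Re_exp Im_exp)
  have c: "(\<lambda>x. cos (u * x) / K) \<in> smooth_tests" "(\<lambda>x. sin (u * x) / K) \<in> smooth_tests"
    unfolding K_def by (rule smooth_tests_trig)+
  have "(\<lambda>n. K * (LINT x|M n. cos (u * x) / K)) \<longlonglongrightarrow> K * (LINT x|N. cos (u * x) / K)"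
    "(\<lambda>n. K * (LINT x|M n. sin (u * x) / K)) \<longlonglongrightarrow> K * (LINT x|N. sin (u * x) / K)"
    by (intro tendsto_mult tendsto_const lim c)+
  then show "(\<lambda>n. char (M n) u) \<longlonglongrightarrow> char N u"
    unfolding tendsto_complex_iff Re[OF M] Re[OF N] Im[OF M] Im[OF N] by blast
qed

text \<open>For \<open>V x \<le> 1\<close> the square root dominates the first two powers, for
  \<open>V x > 1\<close> the cube does. These powers are the ones produced by the error
  terms.\<close>

lemma Vstar_bounds:
  assumes "0 < V x"
  shows "V x \<le> Vstar V x" "V x ^ 2 \<le> Vstar V x" "V x ^ 3 \<le> Vstar V x"
proof -
  show "V x ^ 3 \<le> Vstar V x" by (simp add: Vstar_def)
  have "V x \<le> Vstar V x \<and> V x ^ 2 \<le> Vstar V x"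
  proof (cases "V x \<le> 1")
    case True
    have "V x ^ 2 \<le> V x" using assms True by (simp add: power2_eq_square mult_left_le)
    moreover have "V x \<le> sqrt (V x)"
      using assms calculation by (intro real_le_rsqrt)
    ultimately show ?thesis by (auto simp: Vstar_def)
  next
    case False
    then have "V x ^ 1 \<le> V x ^ 3" "V x ^ 2 \<le> V x ^ 3" by (intro power_increasing; simp)+
    then show ?thesis by (auto simp: Vstar_def)
  qed
  then show "V x \<le> Vstar V x" "V x ^ 2 \<le> Vstar V x" by auto
qed

context limit_branching
begin

text \<open>The constant is independent of \<open>g\<close>, as needed for the variance functions,
  which range over all \<open>s\<close> and \<open>T\<close>.\<close>

lemma weighted_centred_uniform:
  "\<exists>K\<ge>0. \<forall>d g. weighted 2 d g \<longrightarrow> weighted 2 (K * d) (centred g)"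
proof -
  obtain ch where ch: "\<And>j. 1 \<le> j \<Longrightarrow> j \<le> 4 \<Longrightarrow> weighted j ch h" using h_weighted by blast
  have two: "(1 :: nat) \<le> 2" "(2 :: nat) \<le> 4" by auto
  have h2: "weighted 2 ch h" by (rule ch) auto
  have ch0: "0 \<le> ch" using h2 by (simp add: weighted_def)
  let ?m = "LINT y|\<gamma>. V y ^ 2"
  have "weighted 2 ((1 + ?m * ch) * d) (centred g)" if g: "weighted 2 d g" for d g
  proof -
    have "\<bar>LINT y|\<gamma>. g y\<bar> \<le> (LINT y|\<gamma>. \<bar>g y\<bar>)" by (rule integral_abs_bound)
    also have "\<dots> \<le> (LINT y|\<gamma>. d * V y ^ 2)"
      using g integrable_gamma[OF g two] integrable_gamma[OF weighted_V two]
      by (intro integral_mono) (auto simp: weighted_def space_gamma)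
    finally have le: "\<bar>LINT y|\<gamma>. g y\<bar> \<le> d * ?m" by simp
    have "weighted 2 (d + \<bar>- (LINT y|\<gamma>. g y)\<bar> * ch) (\<lambda>y. g y + (- (LINT y|\<gamma>. g y)) * h y)"
      by (intro weighted_add weighted_scale g h2)
    moreover have "d + \<bar>- (LINT y|\<gamma>. g y)\<bar> * ch \<le> (1 + ?m * ch) * d"
      using mult_right_mono[OF le ch0] by (simp add: algebra_simps)
    ultimately show ?thesis using weighted_mono by (auto simp: centred_def[abs_def])
  qed
  moreover have "0 \<le> 1 + ?m * ch" using ch0 by simp
  ultimately show ?thesis by blast
qed

lemma Zint_scale: "Zf t (\<lambda>y. a * g y) w = a * Zf t g w"
  by (simp add: Zint_def)

text \<open>By the Cauchy-Schwarz inequality the absolute first moment is at most the root of the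
  second, of order \<open>exp (lam * t / 2)\<close>, which the scale cancels.\<close>

lemma root_scale_abs_Zint:
  assumes j: "j = 1 \<or> j = 2"
  shows "\<exists>N\<ge>0. \<forall>t\<ge>0. \<forall>x\<in>space E. \<forall>g c. weighted j c g \<and> (LINT y|\<gamma>. g y) = 0 \<longrightarrow>
    root_scale t * (LINT w|P x. \<bar>Zf t g w\<bar>) \<le> N * c * V x ^ j"
proof -
  have j1: "1 \<le> j" "j * 2 \<le> 4" using j by auto
  obtain N where N: "0 \<le> N" "\<And>t x g c. 0 \<le> t \<Longrightarrow> x \<in> space E \<Longrightarrow> weighted j c g \<and> (LINT y|\<gamma>. g y) = 0 \<Longrightarrow>
    (LINT w|P x. (Zf t g w)\<^sup>2) \<le> N * exp (lam * t) * (c\<^sup>2 * V x ^ (j * 2))"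
    using centred_second_moment[OF j] by blast
  have "root_scale t * (LINT w|P x. \<bar>Zf t g w\<bar>) \<le> sqrt N * c * V x ^ j"
    if t: "0 \<le> t" and x: "x \<in> space E" and g: "weighted j c g \<and> (LINT y|\<gamma>. g y) = 0" for t x g c
  proof -
    have gw: "weighted j c g" and c: "0 \<le> c" using g by (auto simp: weighted_def)
    interpret prob_space "P x" by (rule prob_space_law[OF x])
    have i2: "integrable (P x) (\<lambda>w. (Zf t g w)\<^sup>2)" by (rule Zint_power_integrable(1)[OF gw j1(1) t x j1(2)])
    have "(root_scale t * (LINT w|P x. \<bar>Zf t g w\<bar>)) \<le> root_scale t * sqrt (LINT w|P x. (Zf t g w)\<^sup>2)"
      using root_scale_pos[of t] abs_expectation_le_sqrt(2)[OF Zint_measurable_law[OF x t weighted_measurable[OF gw]] i2]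
      by (intro mult_left_mono) auto
    also have "\<dots> = sqrt ((root_scale t)\<^sup>2 * (LINT w|P x. (Zf t g w)\<^sup>2))"
      using root_scale_pos[of t] by (simp add: real_sqrt_mult)
    also have "\<dots> \<le> sqrt (N * (c * V x ^ j)\<^sup>2)"
    proof (rule real_sqrt_le_mono)
      have e: "(root_scale t)\<^sup>2 * exp (lam * t) = 1" unfolding root_scale_square mult_exp_exp by simp
      have "(root_scale t)\<^sup>2 * (LINT w|P x. (Zf t g w)\<^sup>2) \<le> (root_scale t)\<^sup>2 * (N * exp (lam * t) * (c\<^sup>2 * V x ^ (j * 2)))"
        by (intro mult_left_mono N(2)[OF t x g]) simp
      also have "\<dots> = ((root_scale t)\<^sup>2 * exp (lam * t)) * (N * (c * V x ^ j)\<^sup>2)"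
        by (simp only: power_mult_distrib power_mult ac_simps)
      finally show "(root_scale t)\<^sup>2 * (LINT w|P x. (Zf t g w)\<^sup>2) \<le> N * (c * V x ^ j)\<^sup>2" unfolding e by simp
    qed
    also have "\<dots> = sqrt N * c * V x ^ j" using c V_pos[OF x] by (simp add: real_sqrt_mult)
    finally show ?thesis .
  qed
  moreover have "0 \<le> sqrt N" using N(1) by simp
  ultimately show ?thesis by blast
qed

section \<open>The Gaussian limit with its error bound\<close>

context
  fixes f c assumes f: "weighted 1 c f"
begin

lemma path_var_scaled:
  assumes s: "0 \<le> s" "s \<le> T" and y: "y \<in> space E"
  shows "path_var (path_functional (e * root_scale s) f s (e * end_scale f s T) h T) y = e\<^sup>2 * approx_var f s T y"
proof -
  obtain ch where h1: "weighted 1 ch h" using h_weighted by auto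
  have T: "0 \<le> T" using s by simp
  let ?p = "path_functional (e * root_scale s) f s (e * end_scale f s T) h T"
  interpret real_distribution "path_law ?p y"
    by (rule real_distribution_path_law[OF functional_measurable[OF y order_refl s(1) T order_refl f h1] y])
  have eq: "e * root_scale s * Zf s f w + e * end_scale f s T * Zf T h w = e * approx f s T w" for w
    by (simp add: approx_def distrib_left)
  have i2: "integrable (path_law ?p y) (\<lambda>z. z\<^sup>2)"
    using functional_weights[OF y order_refl s(1) T order_refl f h1, of "e * root_scale s" "e * end_scale f s T"] y by auto
  have "(LINT z|path_law ?p y. z\<^sup>2) = (LINT w|P y. (e * root_scale s * Zf s f w + e * end_scale f s T * Zf T h w)\<^sup>2)"
    by (rule integral_functional(1)[OF y order_refl s(1) T order_refl f h1 y]) simp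
  also have "\<dots> = e\<^sup>2 * (approx_var f s T y + (approx_mean f s y)\<^sup>2)"
    unfolding eq power_mult_distrib integral_mult_right_zero approx_expectation(2)[OF f s y] ..
  finally show ?thesis
    using var_of_eq[OF i2] path_mean_approx[OF f s y, of e]
    by (simp add: path_var_def path_mean_def power_mult_distrib distrib_left)
qed

text \<open>The three errors have separate origins. \<open>root_scale t\<close> bounds the
  replacement error, the deviation of the summed variances from their mean behaviour and the
  distance of the martingale from \<open>W\<close>; \<open>exp ((lam / 2 - \<rho>) * s)\<close>
  comes from the conditional means; the last term is the bias of the variance at branch age
  \<open>s\<close>.\<close>

lemma approx_gaussian:
  fixes v :: real
  assumes v: "0 \<le> v"
  shows "\<exists>K\<ge>0. \<forall>x\<in>space E. \<forall>F\<in>smooth_tests. \<forall>t s T. 0 \<le> t \<and> 0 \<le> s \<and> s \<le> T \<longrightarrow>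
    \<bar>(LINT w|P x. F (approx f (t + s) (t + T) w)) - (LINT w|P x. gauss_smooth F 0 (v * W w))\<bar>
    \<le> K * (root_scale t + exp ((lam / 2 - \<rho>) * s) + \<bar>(LINT y|\<gamma>. approx_var f s T y) - v\<bar>) * Vstar V x"
proof -
  obtain ch where ch: "\<And>j. 1 \<le> j \<Longrightarrow> j \<le> 4 \<Longrightarrow> weighted j ch h" using h_weighted by blast
  have h1: "weighted 1 ch h" and h2: "weighted 2 ch h" using ch by auto
  have ch0: "0 \<le> ch" using h1 by (simp add: weighted_def)
  obtain C3 where C3: "0 \<le> C3" "\<And>y s T e. y \<in> space E \<Longrightarrow> 0 \<le> s \<and> s \<le> T \<and> 0 < e \<Longrightarrow>
    lindeberg_error (path_law (path_functional (e * root_scale s) f s (e * end_scale f s T) h T) y) \<le> e ^ 3 * C3 * V y ^ 3"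
    using approx_lindeberg[OF f] by blast
  obtain A where A: "0 \<le> A" "\<And>x j t. x \<in> space E \<Longrightarrow> 1 \<le> j \<and> j \<le> 4 \<and> 0 \<le> t \<Longrightarrow>
    (LINT w|P x. Zf t (\<lambda>y. V y ^ j) w) \<le> A * exp (lam * t) * V x ^ j" using semigroup_V_bound by blast
  obtain C1 where C1: "0 \<le> C1" "\<And>s. 0 \<le> s \<Longrightarrow> weighted 1 (C1 * exp ((lam / 2 - \<rho>) * s)) (approx_mean f s)"
    using approx_mean_bound[OF f] by blast
  obtain D where D: "0 \<le> D" "\<And>s T. 0 \<le> s \<and> s \<le> T \<Longrightarrow> weighted 2 D (approx_var f s T)" using approx_var_weighted[OF f] by blast
  obtain K1 where K1: "0 \<le> K1" "\<And>d g. weighted 2 d g \<Longrightarrow> weighted 2 (K1 * d) (centred g)" using weighted_centred_uniform by blast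
  obtain N1 where N1: "0 \<le> N1" "\<And>t x g c. 0 \<le> t \<Longrightarrow> x \<in> space E \<Longrightarrow> weighted 1 c g \<and> (LINT y|\<gamma>. g y) = 0 \<Longrightarrow>
    root_scale t * (LINT w|P x. \<bar>Zf t g w\<bar>) \<le> N1 * c * V x ^ 1" using root_scale_abs_Zint[of 1] by blast
  obtain N2 where N2: "0 \<le> N2" "\<And>t x g c. 0 \<le> t \<Longrightarrow> x \<in> space E \<Longrightarrow> weighted 2 c g \<and> (LINT y|\<gamma>. g y) = 0 \<Longrightarrow>
    root_scale t * (LINT w|P x. \<bar>Zf t g w\<bar>) \<le> N2 * c * V x ^ 2" using root_scale_abs_Zint[of 2] by blast
  obtain NW where NW: "0 \<le> NW" "\<And>x t. x \<in> space E \<Longrightarrow> 0 \<le> t \<Longrightarrow> (LINT w|P x. (mart t w - W w)\<^sup>2) \<le> NW * exp (- lam * t) * V x ^ 2"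
    using martingale_limit_rate by blast
  define K where "K = C3 * A + N1 * C1 + N2 * (K1 * D) + ch + v * sqrt NW"
  have K0: "0 \<le> K" using C3 A N1 C1 N2 K1 D ch0 v NW by (simp add: K_def)
  have "\<bar>(LINT w|P x. F (approx f (t + s) (t + T) w)) - (LINT w|P x. gauss_smooth F 0 (v * W w))\<bar>
    \<le> K * (root_scale t + exp ((lam / 2 - \<rho>) * s) + \<bar>(LINT y|\<gamma>. approx_var f s T y) - v\<bar>) * Vstar V x"
    if x: "x \<in> space E" and F: "F \<in> smooth_tests" and t: "0 \<le> t" and s: "0 \<le> s" "s \<le> T" for x F t s T
  proof -
    interpret prob_space "P x" by (rule prob_space_law[OF x])
    have T: "0 \<le> T" using s by simp
    define e where "e = root_scale t"
    have e: "0 < e" "e \<le> 1" using root_scale_pos root_scale_le_1[OF t] by (auto simp: e_def)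
    have e2: "e\<^sup>2 = exp (- lam * t)" unfolding e_def by (rule root_scale_square)
    define r where "r = exp ((lam / 2 - \<rho>) * s)"
    have r: "0 < r" by (simp add: r_def)
    define q where "q = (LINT y|\<gamma>. approx_var f s T y)"
    have Dw: "weighted 2 D (approx_var f s T)" using D(2) s by simp
    define m where "m = (\<lambda>w. e * Zf t (approx_mean f s) w)"
    define wt where "wt = (\<lambda>w. e\<^sup>2 * Zf t (approx_var f s T) w)"
    \<comment> \<open>The scale \<open>e\<close> of the starting population is built into the
      functional, so that the sum over the branches is exactly \<open>approx\<close> at the shifted
      times.\<close>
    let ?p = "path_functional (e * root_scale s) f s (e * end_scale f s T) h T"
    have Zm: "Zf t (path_mean ?p) = m"
      unfolding m_def Zint_scale[symmetric] by (rule ext, rule Zint_cong, rule path_mean_approx[OF f s])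
    have Zv: "Zf t (path_var ?p) = wt"
      unfolding wt_def Zint_scale[symmetric] by (rule ext, rule Zint_cong, rule path_var_scaled[OF s])
    have L: "e * root_scale s * Zf (t + s) f w + e * end_scale f s T * Zf (t + T) h w = approx f (t + s) (t + T) w" for w
      unfolding approx_shift[OF f] e_def by (simp add: distrib_left)
    have mm: "m \<in> borel_measurable (P x)"
      using Zint_measurable_law[OF x t weighted_measurable[OF C1(2)[OF s(1)]]] unfolding m_def by simp
    have wm: "wt \<in> borel_measurable (P x)"
      using Zint_measurable_law[OF x t weighted_measurable[OF Dw]] unfolding wt_def by simp
    have w0: "0 \<le> wt w" for w
      unfolding wt_def Zint_def by (intro mult_nonneg_nonneg integral_nonneg_AE AE_I2 approx_var_nonneg) simp
    have Zm1: "integrable (P x) (Zf t (approx_mean f s))"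
      by (rule Zint_integrable[OF C1(2)[OF s(1)] order_refl one_le_numeral t x])
    have mi: "integrable (P x) m" unfolding m_def using Zm1 by simp
    have wi: "integrable (P x) wt"
      unfolding wt_def using Zint_integrable[OF Dw _ _ t x] by simp
    have W1: "integrable (P x) W" by (rule abs_expectation_le_sqrt(1)[OF W_measurable_law[OF x] W_square(1)[OF x]])
    have mt: "integrable (P x) (mart t)" using mart_power_integrable[OF x t, of 1] by simp

    have step1: "\<bar>(LINT w|P x. F (approx f (t + s) (t + T) w)) - (LINT w|P x. gauss_smooth F (m w) (wt w))\<bar> \<le> C3 * A * e * V x ^ 3"
    proof -
      have "\<bar>(LINT w|P x. F (e * root_scale s * Zf (t + s) f w + e * end_scale f s T * Zf (t + T) h w))
          - (LINT w|P x. gauss_smooth F (Zf t (path_mean ?p) w) (Zf t (path_var ?p) w))\<bar>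
          \<le> (e ^ 3 * C3) * (LINT w|P x. Zf t (\<lambda>y. V y ^ 3) w)"
        using C3 e s by (intro functional_lindeberg[OF x t s(1) T f h1 F]) auto
      also have "\<dots> \<le> (e ^ 3 * C3) * (A * exp (lam * t) * V x ^ 3)"
        using A(2)[OF x, of 3 t] t C3(1) e by (intro mult_left_mono) auto
      \<comment> \<open>\<open>e^3\<close> against a population of order
        \<open>exp (lam * t) = 1 / e^2\<close> leaves one factor \<open>e\<close>.\<close>
      also have "\<dots> = (e\<^sup>2 * exp (lam * t)) * (C3 * A * e * V x ^ 3)"
        by (simp only: power3_eq_cube power2_eq_square ac_simps)
      also have "e\<^sup>2 * exp (lam * t) = 1" unfolding e2 mult_exp_exp by simp
      finally show ?thesis unfolding Zm Zv L by simp
    qed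

    have gi: "integrable (P x) (\<lambda>w. gauss_smooth F (g w) (k w))"
      if "g \<in> borel_measurable (P x)" "k \<in> borel_measurable (P x)" for g k
      using gauss_smooth_measurable[OF F that] gauss_smooth_bounded[OF F]
      by (intro integrable_const_bound[where B=1]) auto
    have d: "integrable (P x) (\<lambda>w. \<bar>m w\<bar> + \<bar>wt w - v * W w\<bar>)"
      using mi wi W1 by auto
    have step2: "\<bar>(LINT w|P x. gauss_smooth F (m w) (wt w)) - (LINT w|P x. gauss_smooth F 0 (v * W w))\<bar>
        \<le> (LINT w|P x. \<bar>m w\<bar>) + (LINT w|P x. \<bar>wt w - v * W w\<bar>)"
    proof -
      have i1: "integrable (P x) (\<lambda>w. gauss_smooth F (m w) (wt w))" by (rule gi[OF mm wm])
      have i2: "integrable (P x) (\<lambda>w. gauss_smooth F 0 (v * W w))"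
        using gi[of "\<lambda>_. 0" "\<lambda>w. v * W w"] W_measurable_law[OF x] by simp
      have "\<bar>(LINT w|P x. gauss_smooth F (m w) (wt w)) - (LINT w|P x. gauss_smooth F 0 (v * W w))\<bar>
          = \<bar>LINT w|P x. gauss_smooth F (m w) (wt w) - gauss_smooth F 0 (v * W w)\<bar>"
        by (subst Bochner_Integration.integral_diff[OF i1 i2]) (rule refl)
      also have "\<dots> \<le> (LINT w|P x. \<bar>gauss_smooth F (m w) (wt w) - gauss_smooth F 0 (v * W w)\<bar>)"
        by (rule integral_abs_bound)
      also have "\<dots> \<le> (LINT w|P x. \<bar>m w\<bar> + \<bar>wt w - v * W w\<bar>)"
      proof (rule integral_mono_AE[OF _ d])
        show "integrable (P x) (\<lambda>w. \<bar>gauss_smooth F (m w) (wt w) - gauss_smooth F 0 (v * W w)\<bar>)"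
          by (intro integrable_abs Bochner_Integration.integrable_diff i1 i2)
        show "AE w in P x. \<bar>gauss_smooth F (m w) (wt w) - gauss_smooth F 0 (v * W w)\<bar> \<le> \<bar>m w\<bar> + \<bar>wt w - v * W w\<bar>"
          using W_nonneg[OF x]
        proof (rule eventually_mono)
          fix w assume "0 \<le> W w"
          then show "\<bar>gauss_smooth F (m w) (wt w) - gauss_smooth F 0 (v * W w)\<bar> \<le> \<bar>m w\<bar> + \<bar>wt w - v * W w\<bar>"
            using gauss_smooth_lipschitz[OF F w0, of "v * W w" "m w" w 0] v by simp
        qed
      qed
      also have "\<dots> = (LINT w|P x. \<bar>m w\<bar>) + (LINT w|P x. \<bar>wt w - v * W w\<bar>)"
        by (rule Bochner_Integration.integral_add) (use mi wi W1 in auto)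
      finally show ?thesis .
    qed

    have step3: "(LINT w|P x. \<bar>m w\<bar>) \<le> N1 * C1 * r * V x"
    proof -
      have "(LINT w|P x. \<bar>m w\<bar>) = root_scale t * (LINT w|P x. \<bar>Zf t (approx_mean f s) w\<bar>)"
        using e by (simp add: m_def abs_mult e_def)
      also have "\<dots> \<le> N1 * (C1 * r) * V x ^ 1"
        using C1(2)[OF s(1)] approx_mean_centred[OF f s(1)] unfolding r_def by (intro N1(2)[OF t x] conjI) auto
      finally show ?thesis by simp
    qed

    have step4: "(LINT w|P x. \<bar>wt w - v * W w\<bar>) \<le> N2 * (K1 * D) * e * V x ^ 2 + \<bar>q - v\<bar> * (ch * V x) + v * (sqrt NW * e * V x)"
    proof -
      let ?Z = "Zf t (centred (approx_var f s T))"
      have cw: "weighted 2 (K1 * D) (centred (approx_var f s T))" by (rule K1(2)[OF Dw])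
      have c0: "(LINT y|\<gamma>. centred (approx_var f s T) y) = 0" by (rule weighted_centred(2)[OF Dw]) auto
      have Zi: "integrable (P x) ?Z" by (rule Zint_integrable[OF cw _ _ t x]) auto
      have Di: "integrable (P x) (\<lambda>w. mart t w - W w)" using mt W1 by simp
      have bi: "integrable (P x) (\<lambda>w. e\<^sup>2 * \<bar>?Z w\<bar>)" "integrable (P x) (\<lambda>w. \<bar>q - v\<bar> * mart t w)" "integrable (P x) (\<lambda>w. v * \<bar>mart t w - W w\<bar>)"
        using Zi mt Di by auto
      have AEw: "AE w in P x. \<bar>wt w - v * W w\<bar> \<le> (e\<^sup>2 * \<bar>?Z w\<bar> + \<bar>q - v\<bar> * mart t w) + v * \<bar>mart t w - W w\<bar>"
        using Zint_centred[OF Dw _ _ t x]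
      proof (rule eventually_mono)
        fix w assume z: "?Z w = Zf t (approx_var f s T) w - (LINT z|\<gamma>. approx_var f s T z) * Zf t h w"
        have "e\<^sup>2 * Zf t h w = mart t w" by (simp only: mart_def e2)
        then have "wt w = e\<^sup>2 * ?Z w + q * mart t w"
          unfolding z wt_def q_def[symmetric] by (simp add: algebra_simps)
        \<comment> \<open>Three contributions: the centred variance function, the bias
          \<open>q - v\<close> carried by the martingale, and the distance of the martingale from
          \<open>W\<close>.\<close>
        then have eq: "wt w - v * W w = (e\<^sup>2 * ?Z w + (q - v) * mart t w) + v * (mart t w - W w)"
          by (simp add: algebra_simps)
        have "\<bar>wt w - v * W w\<bar> \<le> (\<bar>e\<^sup>2 * ?Z w\<bar> + \<bar>(q - v) * mart t w\<bar>) + \<bar>v * (mart t w - W w)\<bar>"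
          unfolding eq by (intro order_trans[OF abs_triangle_ineq] add_mono abs_triangle_ineq order_refl)
        then show "\<bar>wt w - v * W w\<bar> \<le> (e\<^sup>2 * \<bar>?Z w\<bar> + \<bar>q - v\<bar> * mart t w) + v * \<bar>mart t w - W w\<bar>"
          using mart_nonneg[of t w] v by (simp add: abs_mult)
      qed auto
      have "(LINT w|P x. \<bar>wt w - v * W w\<bar>) \<le> (LINT w|P x. (e\<^sup>2 * \<bar>?Z w\<bar> + \<bar>q - v\<bar> * mart t w) + v * \<bar>mart t w - W w\<bar>)"
      proof (rule integral_mono_AE[OF _ _ AEw])
        show "integrable (P x) (\<lambda>w. \<bar>wt w - v * W w\<bar>)" using wi W1 by auto
        show "integrable (P x) (\<lambda>w. (e\<^sup>2 * \<bar>?Z w\<bar> + \<bar>q - v\<bar> * mart t w) + v * \<bar>mart t w - W w\<bar>)"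
          by (intro Bochner_Integration.integrable_add bi)
      qed
      also have "\<dots> = (e\<^sup>2 * (LINT w|P x. \<bar>?Z w\<bar>) + \<bar>q - v\<bar> * (LINT w|P x. mart t w)) + v * (LINT w|P x. \<bar>mart t w - W w\<bar>)"
        unfolding Bochner_Integration.integral_add[OF Bochner_Integration.integrable_add[OF bi(1,2)] bi(3)]
          Bochner_Integration.integral_add[OF bi(1,2)] integral_mult_right_zero ..
      also have "\<dots> \<le> (N2 * (K1 * D) * e * V x ^ 2 + \<bar>q - v\<bar> * (ch * V x)) + v * (sqrt NW * e * V x)"
      proof (intro add_mono mult_left_mono)
        \<comment> \<open>The summed variances carry \<open>e^2\<close>, but one factor
          \<open>e\<close> already compensates the fluctuation of the centred sum; the other remains
          as rate.\<close>
        have "e * (e * (LINT w|P x. \<bar>?Z w\<bar>)) \<le> e * (N2 * (K1 * D) * V x ^ 2)"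
          using N2(2)[OF t x, of "K1 * D" "centred (approx_var f s T)"] cw c0 e by (intro mult_left_mono) (auto simp: e_def)
        then show "e\<^sup>2 * (LINT w|P x. \<bar>?Z w\<bar>) \<le> N2 * (K1 * D) * e * V x ^ 2"
          by (simp only: power2_eq_square ac_simps)
        have "(LINT w|P x. mart t w) = exp (- lam * t) * mean_semigroup B t h x"
          by (simp add: mart_def mean_semigroup_def)
        also have "\<dots> = h x" unfolding semigroup_h[OF t x] mult.assoc[symmetric] mult_exp_exp by simp
        also have "\<dots> \<le> ch * V x" using h1 x by (auto simp: weighted_def)
        finally show "(LINT w|P x. mart t w) \<le> ch * V x" .
        have "(LINT w|P x. \<bar>mart t w - W w\<bar>) \<le> sqrt (LINT w|P x. (mart t w - W w)\<^sup>2)"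
          by (rule abs_expectation_le_sqrt(2)[OF borel_measurable_integrable[OF Di] W_square(2)[OF x t]])
        also have "\<dots> \<le> sqrt (NW * e\<^sup>2 * V x ^ 2)"
          unfolding e2 by (rule real_sqrt_le_mono[OF NW(2)[OF x t]])
        also have "\<dots> = sqrt NW * e * V x" using e V_pos[OF x] by (simp add: real_sqrt_mult)
        finally show "(LINT w|P x. \<bar>mart t w - W w\<bar>) \<le> sqrt NW * e * V x" .
      qed (use v in auto)
      finally show ?thesis .
    qed

    let ?V = "Vstar V x"
    note Vb = Vstar_bounds[of V x, OF V_pos[OF x]]
    have V0: "0 \<le> ?V" using Vb(1) V_pos[OF x] by linarith
    have b1: "C3 * A * e * V x ^ 3 \<le> C3 * A * e * ?V" using C3 A e Vb by (intro mult_left_mono) auto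
    have b2: "N1 * C1 * r * V x \<le> N1 * C1 * r * ?V" using N1 C1 r Vb by (intro mult_left_mono) auto
    have b3: "N2 * (K1 * D) * e * V x ^ 2 \<le> N2 * (K1 * D) * e * ?V" using N2 K1 D e Vb by (intro mult_left_mono) auto
    have b4: "\<bar>q - v\<bar> * (ch * V x) \<le> \<bar>q - v\<bar> * (ch * ?V)" using ch0 Vb by (intro mult_left_mono) auto
    have b5: "v * (sqrt NW * e * V x) \<le> v * (sqrt NW * e * ?V)" using v NW e Vb by (intro mult_left_mono) auto
    have "\<bar>(LINT w|P x. F (approx f (t + s) (t + T) w)) - (LINT w|P x. gauss_smooth F 0 (v * W w))\<bar>
        \<le> C3 * A * e * ?V + N1 * C1 * r * ?V + N2 * (K1 * D) * e * ?V + \<bar>q - v\<bar> * (ch * ?V) + v * (sqrt NW * e * ?V)"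
      using step1 step2 step3 step4 b1 b2 b3 b4 b5 by linarith
    also have "\<dots> = ((C3 * A + N2 * (K1 * D) + v * sqrt NW) * e + (N1 * C1) * r + ch * \<bar>q - v\<bar>) * ?V"
      by (simp only: distrib_right distrib_left ac_simps)
    also have "\<dots> \<le> (K * e + K * r + K * \<bar>q - v\<bar>) * ?V"
    proof (intro mult_right_mono add_mono V0)
      have nn: "0 \<le> C3 * A" "0 \<le> N1 * C1" "0 \<le> N2 * (K1 * D)" "0 \<le> v * sqrt NW"
        using C3 A N1 C1 N2 K1 D v NW by auto
      show "C3 * A + N2 * (K1 * D) + v * sqrt NW \<le> K" "N1 * C1 \<le> K" "ch \<le> K"
        unfolding K_def using nn ch0 by linarith+
    qed (use e r in auto)
    finally show ?thesis unfolding e_def r_def q_def by (simp only: distrib_left)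
  qed
  with K0 show ?thesis by blast
qed

text \<open>For fixed \<open>t\<close> and \<open>s\<close> the bound for \<open>approx\<close>
  passes to the fluctuation as \<open>T\<close> tends to infinity. Afterwards a given time is
  divided between the population and the age of its branches, so that all errors are of the claimed
  order.\<close>

lemma fluct_gaussian:
  "\<exists>v\<ge>0. (0 < v \<or> degenerate_fluctuation B \<gamma> lam W f) \<and>
    (\<exists>K\<ge>0. \<forall>x\<in>space E. \<forall>F\<in>smooth_tests. \<forall>t\<ge>0.
      \<bar>(LINT w|P x. F (fluctuation B \<gamma> lam W f t w)) - (LINT w|P x. gauss_smooth F 0 (v * W w))\<bar>
      \<le> K * exp (lam * (lam - 2 * \<rho>) / (2 * (lam + 2 * \<rho>)) * t) * Vstar V x)"
proof -
  let ?q = "\<lambda>s. LINT y|\<gamma>. fluct_var f s y"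
  obtain v C where v: "0 \<le> v" and C: "0 \<le> C" and vC: "\<And>s. 0 \<le> s \<Longrightarrow> ?q s \<le> v \<and> v \<le> ?q s + C * exp (- (2 * \<rho> - lam) * s)"
    using ex_asymptotic_variance[OF f] by blast
  have deg: "0 < v \<or> degenerate_fluctuation B \<gamma> lam W f"
  proof (cases "v = 0")
    case True
    then have "?q s \<le> 0" if "0 \<le> s" for s using vC[OF that] by simp
    then show ?thesis using degenerate[OF f] by blast
  qed (use v in simp)
  obtain K where K: "0 \<le> K" "\<And>x F t s T. x \<in> space E \<Longrightarrow> F \<in> smooth_tests \<Longrightarrow> 0 \<le> t \<and> 0 \<le> s \<and> s \<le> T \<Longrightarrow>
    \<bar>(LINT w|P x. F (approx f (t + s) (t + T) w)) - (LINT w|P x. gauss_smooth F 0 (v * W w))\<bar>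
    \<le> K * (root_scale t + exp ((lam / 2 - \<rho>) * s) + \<bar>(LINT y|\<gamma>. approx_var f s T y) - v\<bar>) * Vstar V x"
    using approx_gaussian[OF v] by blast
  have lim: "\<bar>(LINT w|P x. F (fluctuation B \<gamma> lam W f (t + s) w)) - (LINT w|P x. gauss_smooth F 0 (v * W w))\<bar>
      \<le> K * (root_scale t + exp ((lam / 2 - \<rho>) * s) + \<bar>?q s - v\<bar>) * Vstar V x"
    if x: "x \<in> space E" and F: "F \<in> smooth_tests" and t: "0 \<le> t" and s: "0 \<le> s" for x F t s
  proof -
    interpret prob_space "P x" by (rule prob_space_law[OF x])
    have ts: "0 \<le> t + s" using t s by simp
    let ?X = "fluctuation B \<gamma> lam W f (t + s)"
    have shift: "filterlim (\<lambda>T. t + T) at_top at_top" by (rule filterlim_tendsto_add_at_top[OF tendsto_const filterlim_ident])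
    have Xm: "?X \<in> borel_measurable (P x)" by (rule fluct_measurable(2)[OF f ts x])
    have Fi: "integrable (P x) (\<lambda>w. F (Y w))" if "Y \<in> borel_measurable (P x)" for Y
      using that smooth_tests_bounded[OF F] measurable_compose[OF that smooth_tests_measurable[OF F]]
      by (intro integrable_const_bound[where B=1]) auto
    have X1: "integrable (P x) ?X" by (rule abs_expectation_le_sqrt(1)[OF Xm fluct_square_integrable[OF f ts x]])
    \<comment> \<open>Convergence in the mean is enough for the passage to the limit, as test
      functions are Lipschitz with constant 1.\<close>
    have a0: "((\<lambda>T. LINT w|P x. \<bar>approx f (t + s) (t + T) w - ?X w\<bar>) \<longlongrightarrow> 0) at_top"
      by (rule filterlim_compose[OF approx_tendsto_fluct(3)[OF f ts x] shift])
    have ev: "eventually (\<lambda>T. norm ((LINT w|P x. F (approx f (t + s) (t + T) w)) - (LINT w|P x. F (?X w)))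
        \<le> (LINT w|P x. \<bar>approx f (t + s) (t + T) w - ?X w\<bar>)) at_top"
      using eventually_ge_at_top[of s]
    proof (rule eventually_mono)
      fix T assume T: "s \<le> T"
      have T': "0 \<le> t + T" "t + s \<le> t + T" using T t s by auto
      have Ym: "approx f (t + s) (t + T) \<in> borel_measurable (P x)" by (rule approx_measurable[OF x ts T'(1) weighted_measurable[OF f]])
      have Y1: "integrable (P x) (approx f (t + s) (t + T))" using approx_integrable[OF f ts T'(2) x, of 1 1] by simp
      have "(LINT w|P x. F (approx f (t + s) (t + T) w)) - (LINT w|P x. F (?X w)) = (LINT w|P x. F (approx f (t + s) (t + T) w) - F (?X w))"
        by (rule Bochner_Integration.integral_diff[symmetric, OF Fi[OF Ym] Fi[OF Xm]])
      moreover have "\<bar>LINT w|P x. F (approx f (t + s) (t + T) w) - F (?X w)\<bar> \<le> (LINT w|P x. \<bar>F (approx f (t + s) (t + T) w) - F (?X w)\<bar>)"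
        by (rule integral_abs_bound)
      moreover have "(LINT w|P x. \<bar>F (approx f (t + s) (t + T) w) - F (?X w)\<bar>) \<le> (LINT w|P x. \<bar>approx f (t + s) (t + T) w - ?X w\<bar>)"
        by (intro integral_mono integrable_abs Bochner_Integration.integrable_diff Fi Ym Xm Y1 X1 smooth_tests_lipschitz[OF F])
      ultimately show "norm ((LINT w|P x. F (approx f (t + s) (t + T) w)) - (LINT w|P x. F (?X w)))
        \<le> (LINT w|P x. \<bar>approx f (t + s) (t + T) w - ?X w\<bar>)" unfolding real_norm_def by linarith
    qed
    have "((\<lambda>T. (LINT w|P x. F (approx f (t + s) (t + T) w)) - (LINT w|P x. F (?X w))) \<longlongrightarrow> 0) at_top"
      by (rule Lim_null_comparison[OF ev a0])
    then have "((\<lambda>T. LINT w|P x. F (approx f (t + s) (t + T) w)) \<longlongrightarrow> (LINT w|P x. F (?X w))) at_top"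
      by (simp only: LIM_zero_iff)
    then have l1: "((\<lambda>T. \<bar>(LINT w|P x. F (approx f (t + s) (t + T) w)) - (LINT w|P x. gauss_smooth F 0 (v * W w))\<bar>)
        \<longlongrightarrow> \<bar>(LINT w|P x. F (?X w)) - (LINT w|P x. gauss_smooth F 0 (v * W w))\<bar>) at_top"
      by (intro tendsto_rabs tendsto_diff tendsto_const)
    have l2: "((\<lambda>T. K * (root_scale t + exp ((lam / 2 - \<rho>) * s) + \<bar>(LINT y|\<gamma>. approx_var f s T y) - v\<bar>) * Vstar V x)
        \<longlongrightarrow> K * (root_scale t + exp ((lam / 2 - \<rho>) * s) + \<bar>?q s - v\<bar>) * Vstar V x) at_top"
      by (intro tendsto_mult tendsto_add tendsto_rabs tendsto_diff tendsto_const fluct_var_integral(2)[OF f s])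
    have "eventually (\<lambda>T. \<bar>(LINT w|P x. F (approx f (t + s) (t + T) w)) - (LINT w|P x. gauss_smooth F 0 (v * W w))\<bar>
        \<le> K * (root_scale t + exp ((lam / 2 - \<rho>) * s) + \<bar>(LINT y|\<gamma>. approx_var f s T y) - v\<bar>) * Vstar V x) at_top"
      using eventually_ge_at_top[of s] by (rule eventually_mono) (rule K(2)[OF x F], use t s in blast)
    then show ?thesis by (rule tendsto_le[OF trivial_limit_at_top_linorder l2 l1])
  qed
  have rate_bound: "\<bar>(LINT w|P x. F (fluctuation B \<gamma> lam W f t w)) - (LINT w|P x. gauss_smooth F 0 (v * W w))\<bar>
      \<le> (K * (2 + C)) * exp (lam * (lam - 2 * \<rho>) / (2 * (lam + 2 * \<rho>)) * t) * Vstar V x"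
    if x: "x \<in> space E" and F: "F \<in> smooth_tests" and t: "0 \<le> t" for x F t
  proof -
    text \<open>The time \<open>t\<close> is split so that the central limit theorem over the population at time \<open>t - s\<close> gives
      exactly the claimed rate; the errors depending on \<open>s\<close> decay twice as fast.\<close>
    define s where "s = 2 * lam * t / (lam + 2 * \<rho>)"
    define z where "z = exp (lam * (lam - 2 * \<rho>) / (2 * (lam + 2 * \<rho>)) * t)"
    have p: "0 < lam + 2 * \<rho>" using lam_pos rho_pos by simp
    have s0: "0 \<le> s" using lam_pos p t by (simp add: s_def)
    have ts: "t - s = (2 * \<rho> - lam) * t / (lam + 2 * \<rho>)" using p by (simp add: s_def field_simps)
    have ts0: "0 \<le> t - s" unfolding ts using rate p t by simp
    have z0: "0 < z" "z \<le> 1"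
    proof -
      have "lam * (lam - 2 * \<rho>) / (2 * (lam + 2 * \<rho>)) * t \<le> 0"
        using lam_pos rate p t by (intro mult_nonpos_nonneg divide_nonpos_pos mult_nonneg_nonpos) auto
      then show "z \<le> 1" unfolding z_def by simp
    qed (simp add: z_def)
    have r1: "root_scale (t - s) = z"
    proof -
      have "lam * 2 + \<rho> * 4 \<noteq> 0" using p by linarith
      then show ?thesis unfolding root_scale_def z_def ts by (simp add: field_simps)
    qed
    have zz: "z\<^sup>2 = exp ((lam / 2 - \<rho>) * s)"
      unfolding z_def s_def power2_eq_square mult_exp_exp by (simp add: field_simps)
    have z2: "z\<^sup>2 \<le> z" using z0 by (simp add: power2_eq_square mult_left_le)
    \<comment> \<open>The bias of the variance has twice the exponent of the conditional means, so
      it is of order \<open>z^4\<close>.\<close>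
    have zq: "exp (- (2 * \<rho> - lam) * s) = (z\<^sup>2)\<^sup>2"
      unfolding zz unfolding power2_eq_square mult_exp_exp by (simp add: algebra_simps)
    have "\<bar>?q s - v\<bar> \<le> C * exp (- (2 * \<rho> - lam) * s)" using vC[OF s0] by linarith
    also have "\<dots> \<le> C * z"
    proof (rule mult_left_mono[OF _ C])
      have "(z\<^sup>2)\<^sup>2 \<le> z\<^sup>2" using z0 by (intro power_decreasing[of 1 2, simplified]) (auto simp: power_le_one)
      then show "exp (- (2 * \<rho> - lam) * s) \<le> z" unfolding zq using z2 by linarith
    qed
    finally have qv: "\<bar>?q s - v\<bar> \<le> C * z" .
    have V0: "0 \<le> Vstar V x" using Vstar_bounds(1)[of V x] V_pos[OF x] by linarith
    have "\<bar>(LINT w|P x. F (fluctuation B \<gamma> lam W f (t - s + s) w)) - (LINT w|P x. gauss_smooth F 0 (v * W w))\<bar>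
        \<le> K * (root_scale (t - s) + exp ((lam / 2 - \<rho>) * s) + \<bar>?q s - v\<bar>) * Vstar V x"
      by (rule lim[OF x F ts0 s0])
    also have "\<dots> \<le> K * (z + z + C * z) * Vstar V x"
      unfolding r1 zz[symmetric] by (intro mult_right_mono mult_left_mono add_mono order_refl z2 qv V0 K(1))
    also have "K * (z + z + C * z) = (K * (2 + C)) * z" by (simp add: algebra_simps)
    finally show ?thesis unfolding z_def by simp
  qed
  have "0 \<le> K * (2 + C)" using K(1) C by simp
  with v deg rate_bound show ?thesis by blast
qed

end

section \<open>From integrals of test functions to laws\<close>

lemma integral_mixed_gaussian_law:
  assumes x: "x \<in> space E" and F: "F \<in> smooth_tests" and v: "0 \<le> v"
  shows "(LINT z|mixed_gaussian_law B W (sqrt v) x. F z) = (LINT w|P x. gauss_smooth F 0 (v * W w))"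
    and "real_distribution (mixed_gaussian_law B W \<sigma> x)"
proof -
  interpret N: real_distribution std_normal_distribution by (rule real_dist_normal_dist)
  interpret X: prob_space "P x" by (rule prob_space_law[OF x])
  interpret pair_prob_space "P x" std_normal_distribution ..
  note [measurable] = W_measurable_law[OF x] smooth_tests_measurable[OF F]
  have m: "(\<lambda>(w, g). \<sigma> * sqrt (W w) * g) \<in> borel_measurable (P x \<Otimes>\<^sub>M std_normal_distribution)" for \<sigma>
    by measurable
  show "real_distribution (mixed_gaussian_law B W \<sigma> x)"
    unfolding mixed_gaussian_law_def real_distribution_def real_distribution_axioms_def
    using prob_space_distr[OF m] by simp
  have i: "integrable (P x \<Otimes>\<^sub>M std_normal_distribution) (\<lambda>(w, g). F (sqrt v * sqrt (W w) * g))"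
    using smooth_tests_bounded[OF F] by (intro P.integrable_const_bound[where B=1]) auto
  have "(LINT z|mixed_gaussian_law B W (sqrt v) x. F z) = (LINT p|(P x \<Otimes>\<^sub>M std_normal_distribution). F (case p of (w, g) \<Rightarrow> sqrt v * sqrt (W w) * g))"
    unfolding mixed_gaussian_law_def by (rule integral_distr[OF m]) measurable
  also have "\<dots> = (LINT p|(P x \<Otimes>\<^sub>M std_normal_distribution). (case p of (w, g) \<Rightarrow> F (sqrt v * sqrt (W w) * g)))"
    by (rule arg_cong[of _ _ "\<lambda>k. integral\<^sup>L _ k"]) auto
  also have "\<dots> = (LINT w|P x. LINT g|std_normal_distribution. F (sqrt v * sqrt (W w) * g))"
    using integral_fst'[OF i] by simp
  also have "\<dots> = (LINT w|P x. gauss_smooth F 0 (v * W w))"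
    by (simp add: gauss_smooth_def real_sqrt_mult)
  finally show "(LINT z|mixed_gaussian_law B W (sqrt v) x. F z) = (LINT w|P x. gauss_smooth F 0 (v * W w))" .
qed

text \<open>Transfers the estimates, which are proved as expectations on the sample space, to the
  image laws for which distance and weak convergence are formulated.\<close>

lemma fluctuation_law:
  assumes x: "x \<in> space E" and f: "f \<in> borel_measurable E" and t: "0 \<le> t"
  shows "real_distribution (fluctuation_law B \<gamma> lam W f x t)"
    and "F \<in> smooth_tests \<Longrightarrow> (LINT z|fluctuation_law B \<gamma> lam W f x t. F z) = (LINT w|P x. F (fluctuation B \<gamma> lam W f t w))"
proof -
  have "fluctuation B \<gamma> lam W f t \<in> borel_measurable M"
    unfolding fluctuation_def[abs_def] using Zint_measurable[OF t f] by simp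
  then have m: "fluctuation B \<gamma> lam W f t \<in> borel_measurable (P x)" using measurable_law[OF x] by blast
  show "real_distribution (fluctuation_law B \<gamma> lam W f x t)"
    unfolding fluctuation_law_def real_distribution_def real_distribution_axioms_def
    using prob_space.prob_space_distr[OF prob_space_law[OF x] m] by simp
  show "(LINT z|fluctuation_law B \<gamma> lam W f x t. F z) = (LINT w|P x. F (fluctuation B \<gamma> lam W f t w))" if "F \<in> smooth_tests"
    unfolding fluctuation_law_def by (rule integral_distr[OF m smooth_tests_measurable[OF that]])
qed

lemma wbounded_weighted:
  assumes "f \<in> wbounded E V"
  shows "\<exists>c. weighted 1 c f"
proof -
  obtain c where c: "\<And>x. x \<in> space E \<Longrightarrow> \<bar>f x\<bar> / V x \<le> c"
    using assms by (auto simp: wbounded_def bdd_above_def)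
  have "weighted 1 (max 0 c) f"
    unfolding weighted_def
  proof (intro conjI ballI)
    show "f \<in> borel_measurable E" using assms by (simp add: wbounded_def)
    fix y assume y: "y \<in> space E"
    have "\<bar>f y\<bar> \<le> c * V y" using c[OF y] V_pos[OF y] by (simp add: divide_le_eq)
    also have "\<dots> \<le> max 0 c * V y" using V_pos[OF y] by (intro mult_right_mono) auto
    finally show "\<bar>f y\<bar> \<le> max 0 c * V y ^ 1" by simp
  qed simp
  then show ?thesis by blast
qed

text \<open>Weak convergence is read off from the quantitative bound: its exponent is negative, so
  integrals of all test functions converge, and these determine weak convergence.\<close>

lemma central_limit:
  assumes "f \<in> wbounded E V"
  shows "\<exists>\<sigma>\<ge>0. (0 < \<sigma> \<or> degenerate_fluctuation B \<gamma> lam W f) \<and>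
    (\<forall>x\<in>space E. weak_conv_at_top (fluctuation_law B \<gamma> lam W f x) (mixed_gaussian_law B W \<sigma> x)) \<and>
    (\<exists>K>0. \<forall>t>0. \<forall>x\<in>space E. smooth_dist (fluctuation_law B \<gamma> lam W f x t) (mixed_gaussian_law B W \<sigma> x)
      \<le> K * exp (lam * (lam - 2 * \<rho>) / (2 * (lam + 2 * \<rho>)) * t) * mean_semigroup B 0 (Vstar V) x)"
proof -
  obtain c where f: "weighted 1 c f" using wbounded_weighted[OF assms] by blast
  let ?r = "lam * (lam - 2 * \<rho>) / (2 * (lam + 2 * \<rho>))"
  obtain v K where v: "0 \<le> v" "0 < v \<or> degenerate_fluctuation B \<gamma> lam W f" and K: "0 \<le> K"
    and le: "\<And>x F t. x \<in> space E \<Longrightarrow> F \<in> smooth_tests \<Longrightarrow> 0 \<le> t \<Longrightarrow>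
      \<bar>(LINT w|P x. F (fluctuation B \<gamma> lam W f t w)) - (LINT w|P x. gauss_smooth F 0 (v * W w))\<bar>
      \<le> K * exp (?r * t) * Vstar V x"
    using fluct_gaussian[OF f] by blast
  have dist: "\<bar>(LINT z|fluctuation_law B \<gamma> lam W f x t. F z) - (LINT z|mixed_gaussian_law B W (sqrt v) x. F z)\<bar>
      \<le> K * exp (?r * t) * Vstar V x" if "x \<in> space E" "F \<in> smooth_tests" "0 \<le> t" for x F t
    unfolding integral_mixed_gaussian_law(1)[OF that(1,2) v(1)] fluctuation_law(2)[OF that(1) weighted_measurable[OF f] that(3,2)]
    by (rule le[OF that])
  \<comment> \<open>A witness that the class of test functions is non-empty, as the supremum in the
    distance requires.\<close>
  have F0: "(\<lambda>_. 0) \<in> smooth_tests"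
    unfolding smooth_tests_def by (auto intro!: exI[of _ "\<lambda>_. 0"])
  have weak: "weak_conv_at_top (fluctuation_law B \<gamma> lam W f x) (mixed_gaussian_law B W (sqrt v) x)" if x: "x \<in> space E" for x
    unfolding weak_conv_at_top_def
  proof (intro allI impI)
    fix \<tau> :: "nat \<Rightarrow> real" assume \<tau>: "filterlim \<tau> at_top sequentially"
    have r: "?r < 0" using lam_pos rho_pos rate by (intro divide_neg_pos mult_pos_neg) auto
    have "filterlim (\<lambda>n. ?r * \<tau> n) at_bot sequentially"
      by (rule filterlim_tendsto_neg_mult_at_bot[OF tendsto_const r \<tau>])
    then have e0: "(\<lambda>n. exp (?r * \<tau> n)) \<longlonglongrightarrow> 0" by (rule filterlim_compose[OF exp_at_bot])
    have "eventually (\<lambda>n. 0 \<le> \<tau> n) sequentially" using \<tau> by (simp add: filterlim_at_top)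
    \<comment> \<open>The estimates hold for non-negative times, which the sequence may miss at its
      beginning.\<close>
    then obtain n0 where n0: "\<And>n. n0 \<le> n \<Longrightarrow> 0 \<le> \<tau> n" by (auto simp: eventually_sequentially)
    have "(\<lambda>n. K * exp (?r * \<tau> n) * Vstar V x) \<longlonglongrightarrow> K * 0 * Vstar V x"
      by (intro tendsto_mult tendsto_const e0)
    then have b0: "(\<lambda>n. K * exp (?r * \<tau> (n + n0)) * Vstar V x) \<longlonglongrightarrow> 0"
      using LIMSEQ_ignore_initial_segment by fastforce
    have "weak_conv_m (\<lambda>n. fluctuation_law B \<gamma> lam W f x (\<tau> (n + n0))) (mixed_gaussian_law B W (sqrt v) x)"
    proof (rule weak_conv_m_smooth_tests)
      show "real_distribution (fluctuation_law B \<gamma> lam W f x (\<tau> (n + n0)))" for n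
        using n0 by (intro fluctuation_law(1)[OF x weighted_measurable[OF f]]) simp
      show "real_distribution (mixed_gaussian_law B W (sqrt v) x)" by (rule integral_mixed_gaussian_law(2)[OF x F0 order_refl])
      fix F assume F: "F \<in> smooth_tests"
      have "(\<lambda>n. (LINT z|fluctuation_law B \<gamma> lam W f x (\<tau> (n + n0)). F z) - (LINT z|mixed_gaussian_law B W (sqrt v) x. F z)) \<longlonglongrightarrow> 0"
        by (rule Lim_null_comparison[OF _ b0]) (use dist[OF x F] n0 in simp)
      then show "(\<lambda>n. LINT z|fluctuation_law B \<gamma> lam W f x (\<tau> (n + n0)). F z) \<longlonglongrightarrow> (LINT z|mixed_gaussian_law B W (sqrt v) x. F z)"
        by (simp only: LIM_zero_iff)
    qed
    then show "weak_conv_m (\<lambda>n. fluctuation_law B \<gamma> lam W f x (\<tau> n)) (mixed_gaussian_law B W (sqrt v) x)"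
      unfolding weak_conv_m_def weak_conv_def
      using LIMSEQ_offset[of "\<lambda>n. cdf (fluctuation_law B \<gamma> lam W f x (\<tau> n)) _" n0] by blast
  qed
  \<comment> \<open>\<open>K\<close> may be 0, and \<open>K + 1\<close> supplies the strictly
    positive constant.\<close>
  have "smooth_dist (fluctuation_law B \<gamma> lam W f x t) (mixed_gaussian_law B W (sqrt v) x)
      \<le> (K + 1) * exp (?r * t) * mean_semigroup B 0 (Vstar V) x" if t: "0 < t" and x: "x \<in> space E" for t x
  proof -
    have V0: "0 \<le> Vstar V x" using Vstar_bounds(1)[of V x] V_pos[OF x] by linarith
    have "smooth_dist (fluctuation_law B \<gamma> lam W f x t) (mixed_gaussian_law B W (sqrt v) x) \<le> K * exp (?r * t) * Vstar V x"
      unfolding smooth_dist_def using F0 dist[OF x _ less_imp_le[OF t]] by (intro cSUP_least) auto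
    also have "\<dots> \<le> (K + 1) * exp (?r * t) * Vstar V x" using V0 by (intro mult_right_mono) auto
    also have "Vstar V x = mean_semigroup B 0 (Vstar V) x"
      by (rule semigroup_0[symmetric, OF x]) (simp add: Vstar_def[abs_def])
    finally show ?thesis .
  qed
  moreover have "0 < K + 1" using K by simp
  ultimately show ?thesis
    using v weak by (intro exI[of _ "sqrt v"]) auto
qed

end

theorem theorem2p3:
  fixes B :: "('x, 'u::countable, 'w) branching_model"
    and V h :: "'x \<Rightarrow> real"
    and \<gamma> :: "'x measure"
    and lam \<rho> :: real
    and \<kappa> :: nat
    and W :: "'w \<Rightarrow> real"
  assumes "branching_process B"
    and "V \<in> borel_measurable (trait_space B)"
    and "\<forall>x\<in>space (trait_space B). 0 < V x"
    and "4 \<le> \<kappa>"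
    and "assumption_moments B V \<kappa>"
    and "assumption_ergodic B V \<kappa> \<gamma> h lam \<rho>"
    and "lam < 2 * \<rho>"
    and "martingale_limit B h lam W"
  shows "\<forall>f\<in>wbounded (trait_space B) V. \<exists>\<sigma>\<ge>0.
           (0 < \<sigma> \<or> degenerate_fluctuation B \<gamma> lam W f) \<and>
           (\<forall>x\<in>space (trait_space B).
              weak_conv_at_top (fluctuation_law B \<gamma> lam W f x) (mixed_gaussian_law B W \<sigma> x)) \<and>
           (\<exists>K>0. \<forall>t>0. \<forall>x\<in>space (trait_space B).
              smooth_dist (fluctuation_law B \<gamma> lam W f x t) (mixed_gaussian_law B W \<sigma> x)
                \<le> K * exp (lam * (lam - 2 * \<rho>) / (2 * (lam + 2 * \<rho>)) * t)
                    * mean_semigroup B 0 (Vstar V) x)"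
proof -
  interpret limit_branching B V \<kappa> \<gamma> h lam \<rho> W
    using assms by unfold_locales auto
  show ?thesis using central_limit by blast
qed

end
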